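(* Let $d\ge3$, $\gamma\in(0,1)$, and let $u_p$ be the function $u_p(x)=|x|^{\lambda(p)}\big(v_2+g_p\big)(x/|x|)$ (with $u_p(0)=0$), where $p\mapsto(\lambda(p),g_p)$ is the smooth branch described in the context. There exists $\delta>0$ such that for every $2<p<2+\delta$ the function $u_p$ is $p$-harmonic on $\mathbb{R}^d$, belongs to $C^{1,\gamma}_{\rm loc}(\mathbb{R}^d)\cap C^\infty(\mathbb{R}^d\setminus\{0\})$, has $u_p(0)=0$ and $\nabla u_p(0)=0$, and satisfies $$\lim_{\varepsilon\to0}\frac{\mathcal{M}^V_\varepsilon u_p(0)-u_p(0)}{\varepsilon^2}=\lim_{\varepsilon\to0}\varepsilon^{-2}\mathcal{M}^V_\varepsilon u_p(0)=-\infty .$$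
   Context: For $1<p<\infty$, a function is $p$-harmonic if it is a (continuous) weak solution of $\operatorname{div}(|\nabla u|^{p-2}\nabla u)=0$. Variational mean value: for given $p>1$, $\mathcal{M}^V_\varepsilon u(x)\in\mathbb{R}$ is the unique minimizer $t\in\mathbb{R}$ of $t\mapsto\|u-t\|_{L^p(B_\varepsilon(x))}$, equivalently the unique $t$ with $\int_{B_\varepsilon(x)}|u(y)-t|^{p-2}(u(y)-t)\,dy=0$. In the theorem the exponent in $\mathcal{M}^V_\varepsilon u_p$ is the same $p$. The branch: let $\mathbb{S}^{d-1}\subset\mathbb{R}^d$ be the unit sphere with spherical gradient $\nabla_{\mathbb{S}}$, Hessian $D^2_{\mathbb{S}}$ and Laplacian $\Delta_{\mathbb{S}}$, and let $v_2(\omega)=\omega_d^2-\frac1d$. For $\lambda>0$ and $v\in C^{2}(\mathbb{S}^{d-1})$ with $|\nabla_{\mathbb{S}}v|^2+\lambda^2v^2>0$ everywhere, put $$\mathcal{A}_\lambda v=\frac{\nabla_{\mathbb{S}}v\cdot D^2_{\mathbb{S}}v\,\nabla_{\mathbb{S}}v+\lambda^2v|\nabla_{\mathbb{S}}v|^2}{|\nabla_{\mathbb{S}}v|^2+\lambda^2v^2},\qquad \mathcal{L}_p^\lambda v=\Delta_{\mathbb{S}}v+\lambda\big((p-1)\lambda+d-p\big)v+(p-2)\mathcal{A}_\lambda v .$$ Set $\Phi(p,\lambda,g)=\mathcal{L}_p^\lambda(v_2+g)$, defined for $(p,\lambda,g)$ in a neighborhood of $(2,2,0)$. Let $V_2$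 be the space of $h\in C^{2,\gamma}(\mathbb{S}^{d-1})$ that are axially symmetric ($h(R\omega)=h(\omega)$ for all $R\in O(d)$ with $Re_d=e_d$) and satisfy $\int_{\mathbb{S}^{d-1}}hv_2\,dS=0$. The branch consists of smooth mappings $\lambda:(2-\delta_0,2+\delta_0)\to\mathbb{R}$ and $g:(2-\delta_0,2+\delta_0)\to V_2$, $p\mapsto g_p$ (for some $\delta_0>0$), with $\lambda(2)=2$, $g_2=0$ and $\Phi(p,\lambda(p),g_p)=0$ for all $p$; such mappings exist and are unique for $p$ near $2$ (given by the Implicit Function Theorem at $(2,2,0)$). *)

theory Defs
  imports "HOL-Analysis.Analysis"
begin

section \<open>Classical smoothness on open sets\<close>

definition grad :: "('a::euclidean_space \<Rightarrow> real) \<Rightarrow> 'a \<Rightarrow> 'a"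
  where "grad f x = (\<Sum>i\<in>Basis. frechet_derivative f (at x) i *\<^sub>R i)"

text \<open>Meant for open \<open>S\<close>; for \<open>'a = real\<close> we have \<open>Basis = {1}\<close>, so this also covers
  \<open>C\<^sup>k\<close> curves.\<close>

primrec Ck_on :: "nat \<Rightarrow> 'a::euclidean_space set \<Rightarrow> ('a \<Rightarrow> 'b::real_normed_vector) \<Rightarrow> bool" where
  "Ck_on 0 S f \<longleftrightarrow> continuous_on S f"
| "Ck_on (Suc k) S f \<longleftrightarrow> (\<forall>x\<in>S. f differentiable (at x)) \<and>
     (\<forall>i\<in>Basis. Ck_on k S (\<lambda>x. frechet_derivative f (at x) i))"

definition Cinf_on :: "'a::euclidean_space set \<Rightarrow> ('a \<Rightarrow> 'b::real_normed_vector) \<Rightarrow> bool"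
  where "Cinf_on S f \<longleftrightarrow> (\<forall>k. Ck_on k S f)"

definition C1_holder_loc_on :: "real \<Rightarrow> 'a::euclidean_space set \<Rightarrow> ('a \<Rightarrow> real) \<Rightarrow> bool"
  where "C1_holder_loc_on \<gamma> S f \<longleftrightarrow> Ck_on 1 S f \<and>
    (\<forall>K. compact K \<and> K \<subseteq> S \<longrightarrow>
      (\<exists>C. \<forall>x\<in>K. \<forall>y\<in>K. norm (grad f x - grad f y) \<le> C * dist x y powr \<gamma>))"


section \<open>Weak solutions of the p-Laplace equation\<close>

definition test_function_on :: "'a::euclidean_space set \<Rightarrow> ('a \<Rightarrow> real) \<Rightarrow> bool"
  where "test_function_on S \<phi> \<longleftrightarrow> Cinf_on UNIV \<phi> \<and>
    compact (closure (support_on UNIV \<phi>)) \<and> closure (support_on UNIV \<phi>) \<subseteq> S"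

definition weak_gradient_on :: "'a::euclidean_space set \<Rightarrow> ('a \<Rightarrow> real) \<Rightarrow> ('a \<Rightarrow> 'a) \<Rightarrow> bool"
  where "weak_gradient_on S u G \<longleftrightarrow> (\<forall>\<phi>. test_function_on S \<phi> \<longrightarrow>
    (\<forall>i\<in>Basis. (LINT x:S|lborel. u x * (grad \<phi> x \<bullet> i)) = - (LINT x:S|lborel. (G x \<bullet> i) * \<phi> x)))"

definition Lp_loc_on :: "real \<Rightarrow> 'a::euclidean_space set \<Rightarrow> ('a \<Rightarrow> 'b::euclidean_space) \<Rightarrow> bool"
  where "Lp_loc_on p S f \<longleftrightarrow> set_borel_measurable lborel S f \<and>
    (\<forall>K. compact K \<and> K \<subseteq> S \<longrightarrow> set_integrable lborel K (\<lambda>x. norm (f x) powr p))"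

text \<open>A continuous \<open>u\<close> in \<open>W\<^sup>1\<^sup>,\<^sup>p\<close> locally, with weak gradient \<open>G\<close>. Where \<open>G x = 0\<close> the
  flux is \<open>0\<close> for every exponent, since \<open>0 powr a = 0\<close>.\<close>

definition p_harmonic_on :: "real \<Rightarrow> 'a::euclidean_space set \<Rightarrow> ('a \<Rightarrow> real) \<Rightarrow> bool"
  where "p_harmonic_on p S u \<longleftrightarrow> continuous_on S u \<and>
    (\<exists>G. Lp_loc_on p S G \<and> weak_gradient_on S u G \<and>
      (\<forall>\<phi>. test_function_on S \<phi> \<longrightarrow>
        (LINT x:S|lborel. norm (G x) powr (p - 2) * (G x \<bullet> grad \<phi> x)) = 0))"


section \<open>The variational mean value\<close>

definition Lp_norm_on :: "real \<Rightarrow> 'a::euclidean_space set \<Rightarrow> ('a \<Rightarrow> real) \<Rightarrow> real"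
  where "Lp_norm_on p S f = (LINT y:S|lborel. \<bar>f y\<bar> powr p) powr (1 / p)"

definition var_mean :: "real \<Rightarrow> real \<Rightarrow> ('a::euclidean_space \<Rightarrow> real) \<Rightarrow> 'a \<Rightarrow> real"
  where "var_mean p \<epsilon> u x =
    (THE t. is_arg_min (\<lambda>t. Lp_norm_on p (ball x \<epsilon>) (\<lambda>y. u y - t)) (\<lambda>_. True) t)"


section \<open>Calculus on the unit sphere\<close>

text \<open>A function on \<open>sphere 0 1\<close> is a function on the whole space of which only the values on the
  sphere matter. It is differentiated through its extension \<open>\<lambda>x. v (sgn x)\<close>, homogeneous of degree
  \<open>0\<close> (recall \<open>sgn x = x /\<^sub>R norm x\<close>). The gradient of this extension at a point of the sphere
  is tangential, and equals the spherical gradient.\<close>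

definition sph_grad :: "('a::euclidean_space \<Rightarrow> real) \<Rightarrow> 'a \<Rightarrow> 'a"
  where "sph_grad v \<omega> = grad (\<lambda>x. v (sgn x)) \<omega>"

text \<open>The covariant derivative of the tangent field \<open>sph_grad v\<close>: the tangential part of its ambient
  directional derivative. As an operator on the whole space it vanishes on the normal direction
  \<open>\<omega>\<close>, so that its trace is the trace over the tangent space.\<close>

definition sph_hess :: "('a::euclidean_space \<Rightarrow> real) \<Rightarrow> 'a \<Rightarrow> 'a \<Rightarrow> 'a"
  where "sph_hess v \<omega> \<xi> =
    (let \<eta> = frechet_derivative (\<lambda>x. sph_grad v (sgn x)) (at \<omega>) \<xi> in \<eta> - (\<eta> \<bullet> \<omega>) *\<^sub>R \<omega>)"

definition sph_laplacian :: "('a::euclidean_space \<Rightarrow> real) \<Rightarrow> 'a \<Rightarrow> real"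
  where "sph_laplacian v \<omega> = (\<Sum>i\<in>Basis. sph_hess v \<omega> i \<bullet> i)"

text \<open>The surface measure on the unit sphere, by polar coordinates: the measure of \<open>A\<close> is \<open>d\<close> times
  the volume of the cone \<open>{r\<omega>. 0 < r < 1, \<omega> \<in> A}\<close>.\<close>

definition sph_measure :: "'a::euclidean_space measure"
  where "sph_measure =
    scale_measure (of_nat DIM('a)) (distr (restrict_space lborel (ball 0 1 - {0})) borel sgn)"

definition sph_C2_holder :: "real \<Rightarrow> ('a::euclidean_space \<Rightarrow> real) \<Rightarrow> bool"
  where "sph_C2_holder \<gamma> v \<longleftrightarrow> Ck_on 2 (- {0}) (\<lambda>x. v (sgn x)) \<and>
    (\<exists>C. \<forall>\<omega>\<in>sphere 0 1. \<forall>\<omega>'\<in>sphere 0 1.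
      onorm (\<lambda>\<xi>. sph_hess v \<omega> \<xi> - sph_hess v \<omega>' \<xi>) \<le> C * dist \<omega> \<omega>' powr \<gamma>)"

text \<open>A norm of the Banach space of all \<open>v\<close> with \<open>sph_C2_holder \<gamma> v\<close>, for which all four suprema
  are finite; to be used for such \<open>v\<close> only.\<close>

definition sph_C2_holder_norm :: "real \<Rightarrow> ('a::euclidean_space \<Rightarrow> real) \<Rightarrow> real"
  where "sph_C2_holder_norm \<gamma> v =
    (SUP \<omega>\<in>sphere 0 1. \<bar>v \<omega>\<bar>) + (SUP \<omega>\<in>sphere 0 1. norm (sph_grad v \<omega>)) +
    (SUP \<omega>\<in>sphere 0 1. onorm (sph_hess v \<omega>)) +
    (SUP (\<omega>, \<omega>') \<in> {(\<omega>, \<omega>'). \<omega> \<in> sphere 0 1 \<and> \<omega>' \<in> sphere 0 1 \<and> \<omega> \<noteq> \<omega>'}.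
       onorm (\<lambda>\<xi>. sph_hess v \<omega> \<xi> - sph_hess v \<omega>' \<xi>) / dist \<omega> \<omega>' powr \<gamma>)"


section \<open>The branch\<close>

definition sph_A :: "real \<Rightarrow> ('a::euclidean_space \<Rightarrow> real) \<Rightarrow> 'a \<Rightarrow> real"
  where "sph_A lam v \<omega> =
    (sph_grad v \<omega> \<bullet> sph_hess v \<omega> (sph_grad v \<omega>) + lam\<^sup>2 * v \<omega> * (norm (sph_grad v \<omega>))\<^sup>2) /
    ((norm (sph_grad v \<omega>))\<^sup>2 + lam\<^sup>2 * (v \<omega>)\<^sup>2)"

definition sph_L :: "real \<Rightarrow> real \<Rightarrow> ('a::euclidean_space \<Rightarrow> real) \<Rightarrow> 'a \<Rightarrow> real"
  where "sph_L p lam v \<omega> =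
    sph_laplacian v \<omega> + lam * ((p - 1) * lam + real DIM('a) - p) * v \<omega> + (p - 2) * sph_A lam v \<omega>"

definition nondegenerate :: "real \<Rightarrow> ('a::euclidean_space \<Rightarrow> real) \<Rightarrow> bool"
  where "nondegenerate lam v \<longleftrightarrow>
    (\<forall>\<omega>\<in>sphere 0 1. (norm (sph_grad v \<omega>))\<^sup>2 + lam\<^sup>2 * (v \<omega>)\<^sup>2 > 0)"

text \<open>The unit vector \<open>e\<close> plays the role of the last standard basis vector.\<close>

definition v2 :: "'a::euclidean_space \<Rightarrow> 'a \<Rightarrow> real"
  where "v2 e \<omega> = (\<omega> \<bullet> e)\<^sup>2 - 1 / real DIM('a)"

definition Phi :: "'a::euclidean_space \<Rightarrow> real \<Rightarrow> real \<Rightarrow> ('a \<Rightarrow> real) \<Rightarrow> 'a \<Rightarrow> real"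
  where "Phi e p lam g = sph_L p lam (\<lambda>\<omega>. v2 e \<omega> + g \<omega>)"

definition axially_symmetric :: "'a::euclidean_space \<Rightarrow> ('a \<Rightarrow> real) \<Rightarrow> bool"
  where "axially_symmetric e h \<longleftrightarrow>
    (\<forall>R. orthogonal_transformation R \<and> R e = e \<longrightarrow> (\<forall>\<omega>\<in>sphere 0 1. h (R \<omega>) = h \<omega>))"

definition V2 :: "'a::euclidean_space \<Rightarrow> real \<Rightarrow> ('a \<Rightarrow> real) set"
  where "V2 e \<gamma> = {h. sph_C2_holder \<gamma> h \<and> axially_symmetric e h \<and>
    (LINT \<omega>|sph_measure. h \<omega> * v2 e \<omega>) = 0}"

text \<open>\<open>C\<^sup>\<infinity>\<close> curves in the normed space \<open>V2 e \<gamma>\<close>: \<open>D k\<close> is the derivative of order \<open>k\<close>, and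
  difference quotients converge in the norm of the space.\<close>

definition smooth_curve_V2 :: "'a::euclidean_space \<Rightarrow> real \<Rightarrow> real set \<Rightarrow> (real \<Rightarrow> 'a \<Rightarrow> real) \<Rightarrow> bool"
  where "smooth_curve_V2 e \<gamma> I g \<longleftrightarrow> (\<exists>D :: nat \<Rightarrow> real \<Rightarrow> 'a \<Rightarrow> real. D 0 = g \<and>
    (\<forall>k. \<forall>p\<in>I. D k p \<in> V2 e \<gamma> \<and>
      ((\<lambda>q. sph_C2_holder_norm \<gamma> (\<lambda>\<omega>. (D k q \<omega> - D k p \<omega>) / (q - p) - D (Suc k) p \<omega>)) \<longlongrightarrow> 0)
        (at p)))"

text \<open>The conditions \<open>lam p > 0\<close> and \<open>nondegenerate\<close> say that \<open>Phi\<close> is defined along the branch.\<close>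

definition smooth_branch ::
    "'a::euclidean_space \<Rightarrow> real \<Rightarrow> real \<Rightarrow> (real \<Rightarrow> real) \<Rightarrow> (real \<Rightarrow> 'a \<Rightarrow> real) \<Rightarrow> bool"
  where "smooth_branch e \<gamma> \<delta>\<^sub>0 lam g \<longleftrightarrow>
    Cinf_on {2 - \<delta>\<^sub>0<..<2 + \<delta>\<^sub>0} lam \<and> smooth_curve_V2 e \<gamma> {2 - \<delta>\<^sub>0<..<2 + \<delta>\<^sub>0} g \<and>
    lam 2 = 2 \<and> (\<forall>\<omega>\<in>sphere 0 1. g 2 \<omega> = 0) \<and>
    (\<forall>p\<in>{2 - \<delta>\<^sub>0<..<2 + \<delta>\<^sub>0}. lam p > 0 \<and> nondegenerate (lam p) (\<lambda>\<omega>. v2 e \<omega> + g p \<omega>) \<and>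
      (\<forall>\<omega>\<in>sphere 0 1. Phi e p (lam p) (g p) \<omega> = 0))"

text \<open>The value at \<open>0\<close> is \<open>0\<close>, since \<open>0 powr a = 0\<close>.\<close>

definition branch_fun ::
    "'a::euclidean_space \<Rightarrow> (real \<Rightarrow> real) \<Rightarrow> (real \<Rightarrow> 'a \<Rightarrow> real) \<Rightarrow> real \<Rightarrow> 'a \<Rightarrow> real"
  where "branch_fun e lam g p x = norm x powr lam p * (v2 e (sgn x) + g p (sgn x))"

end

theory Submission
  imports Defs
begin

text \<open>
  Away from the origin \<open>\<Phi> = 0\<close> is the \<open>p\<close>-Laplace equation for \<open>u\<^sub>p\<close>, and a cutoff
  removes the origin because \<open>\<lambda> > 1\<close>. Axial symmetry turns \<open>\<Phi> = 0\<close> into an ordinary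
  differential equation in the latitude with regular singular points at the poles, which gives smoothness.

  Testing \<open>\<Phi> = 0\<close> with \<open>1\<close> and \<open>v\<^sub>2\<close> over the sphere yields, with
  \<open>v\<^sub>p = v\<^sub>2 + g\<^sub>p\<close> and \<open>c\<^sub>p = \<lambda>((p - 1)\<lambda> + d - p)\<close>,
  \<open>c\<^sub>p \<integral>v\<^sub>p = - (p - 2) \<integral>\<A> v\<^sub>p\<close> and
  \<open>(c\<^sub>p - 2d) \<integral>v\<^sub>p v\<^sub>2 = - (p - 2) \<integral>v\<^sub>2 \<A> v\<^sub>p\<close>.
  To first order in \<open>p - 2\<close> the second identity gives \<open>\<lambda>(p) < 2\<close>, and the first one gives
  \<open>\<integral>|v\<^sub>p|\<^sup>p\<^sup>-\<^sup>2 v\<^sub>p < 0\<close>, by the entropy inequality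
  \<open>\<integral>v\<^sub>2 ln |v\<^sub>2| < (1 / 2d) \<integral>\<A> v\<^sub>2\<close>. Hence the mean
  \<open>m\<close> over the unit ball is negative, and by homogeneity the mean over the ball of radius \<open>\<epsilon>\<close> is
  \<open>\<epsilon>\<^sup>\<lambda> m\<close> with \<open>\<lambda> < 2\<close>.
\<close>

section \<open>Calculus of \<open>C\<^sup>k\<close> functions\<close>

text \<open>At p = 2 the exponent equals 2 and the integral of v2 vanishes, so neither lam < 2 nor m
  < 0 can be read off from the limit: both are first-order effects in p - 2. The branch is
  nevertheless never differentiated explicitly. The two tested identities carry a factor p - 2 of
  their own, so after division by it one only needs that \<open>g p\<close> tends to 0 together with
  its first and second spherical derivatives. The entropy inequality appears because (|v|^(p-2) - 1)
  v / (p-2) tends to v2 ln |v2|, while c tends to 2d. Spherical integrals are taken as integrals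
  over the unit ball with a weight |x|^a. Green's identity then rests on nothing but translation
  invariance of Lebesgue measure, and the choice a = lam (p-1), the degree of |u|^(p-2) u, makes the
  integral that decides the sign of m exactly of this type. Near a pole the equation is written in s
  = 1 - \<omega> \<bullet> e and not in the angle: s is smooth on the sphere, so smoothness of the
  profile up to s = 0 transfers to the sphere.\<close>

lemma Ck_on_cong:
  assumes "open S" "\<And>x. x \<in> S \<Longrightarrow> f x = h x" "Ck_on k S f"
  shows "Ck_on k S h"
  using assms(2,3)
proof (induction k arbitrary: f h)
  case 0
  then show ?case by (simp cong: continuous_on_cong)
next
  case (Suc k)
  have D: "(h has_derivative frechet_derivative f (at x)) (at x)" if "x \<in> S" for x
  proof (rule has_derivative_transform_within_open[OF _ \<open>open S\<close> that])
    show "(f has_derivative frechet_derivative f (at x)) (at x)"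
      using Suc.prems(2) that by (simp add: frechet_derivative_works)
  qed (use Suc.prems in auto)
  have E: "frechet_derivative h (at x) = frechet_derivative f (at x)" if "x \<in> S" for x
    using frechet_derivative_at[OF D[OF that]] by simp
  show ?case
    unfolding Ck_on.simps
  proof (intro conjI ballI)
    show "h differentiable at x" if "x \<in> S" for x
      using D[OF that] unfolding differentiable_def by blast
    fix i :: 'a assume "i \<in> Basis"
    then have "Ck_on k S (\<lambda>x. frechet_derivative f (at x) i)"
      using Suc.prems(2) by simp
    then show "Ck_on k S (\<lambda>x. frechet_derivative h (at x) i)"
      by (rule Suc.IH[rotated]) (simp add: E)
  qed
qed

lemma Ck_on_SucI:
  assumes "open S" "\<And>x. x \<in> S \<Longrightarrow> (f has_derivative f' x) (at x)"
    "\<And>i. i \<in> Basis \<Longrightarrow> Ck_on k S (\<lambda>x. f' x i)"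
  shows "Ck_on (Suc k) S f"
  unfolding Ck_on.simps
proof (intro conjI ballI)
  show "f differentiable at x" if "x \<in> S" for x
    using assms(2)[OF that] unfolding differentiable_def by blast
  show "Ck_on k S (\<lambda>x. frechet_derivative f (at x) i)" if "i \<in> Basis" for i
    using assms(3)[OF that]
    by (rule Ck_on_cong[OF assms(1), rotated]) (use frechet_derivative_at[OF assms(2)] in simp)
qed

lemma Ck_on_Suc_has_derivative:
  assumes "Ck_on (Suc k) S f" "x \<in> S"
  shows "(f has_derivative frechet_derivative f (at x)) (at x)"
  using assms by (simp add: frechet_derivative_works)

lemma Ck_on_mono: "Ck_on k T f \<Longrightarrow> S \<subseteq> T \<Longrightarrow> Ck_on k S f"
  by (induction k arbitrary: f) (auto intro: continuous_on_subset)

lemma Ck_on_Un: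
  "open S \<Longrightarrow> open T \<Longrightarrow> Ck_on k S f \<Longrightarrow> Ck_on k T f \<Longrightarrow> Ck_on k (S \<union> T) f"
  by (induction k arbitrary: f) (auto intro: continuous_on_open_Un)

lemma Ck_on_SucD: "Ck_on (Suc k) S f \<Longrightarrow> Ck_on k S f"
proof (induction k arbitrary: f)
  case 0
  then show ?case
    by (auto intro!: continuous_at_imp_continuous_on differentiable_imp_continuous_within)
next
  case (Suc k)
  have "Ck_on (Suc k) S (\<lambda>x. frechet_derivative f (at x) i)" if "i \<in> Basis" for i
    using Suc.prems that unfolding Ck_on.simps(2)[of "Suc k"] by blast
  then have "Ck_on k S (\<lambda>x. frechet_derivative f (at x) i)" if "i \<in> Basis" for i
    using Suc.IH that by blast
  moreover have "\<forall>x\<in>S. f differentiable at x"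
    using Suc.prems unfolding Ck_on.simps(2)[of "Suc k"] by blast
  ultimately show ?case by simp
qed

lemma Ck_on_le: "Ck_on k S f \<Longrightarrow> j \<le> k \<Longrightarrow> Ck_on j S f"
proof (induction k)
  case (Suc k)
  show ?case
  proof (cases "j = Suc k")
    case False
    then show ?thesis using Suc.IH[OF Ck_on_SucD[OF Suc.prems(1)]] Suc.prems(2) by linarith
  qed (use Suc.prems in blast)
qed simp

lemma Ck_on_const: "Ck_on k S (\<lambda>x. c)"
proof (induction k arbitrary: c)
  case (Suc k)
  have "frechet_derivative (\<lambda>x::'a. c) (at x) = (\<lambda>_. 0)" for x
    using frechet_derivative_at[OF has_derivative_const] by metis
  then show ?case using Suc by simp
qed simp

lemma Ck_on_bounded_linear_id:
  assumes "bounded_linear f" shows "Ck_on k S f"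
proof -
  have "Ck_on (Suc k) UNIV f" for k
    by (rule Ck_on_SucI[where f' = "\<lambda>_. f"])
       (use assms in \<open>auto intro: bounded_linear_imp_has_derivative Ck_on_const\<close>)
  then show ?thesis using Ck_on_SucD Ck_on_mono by blast
qed

lemma Ck_on_add:
  assumes "open S" "Ck_on k S f" "Ck_on k S h"
  shows "Ck_on k S (\<lambda>x. f x + h x)"
  using assms(2,3)
proof (induction k arbitrary: f h)
  case 0 then show ?case by (simp add: continuous_on_add)
next
  case (Suc k)
  show ?case
    by (rule Ck_on_SucI[OF assms(1), where f' = "\<lambda>x i. frechet_derivative f (at x) i + frechet_derivative h (at x) i"])
       (use Suc in \<open>auto intro!: has_derivative_add simp: frechet_derivative_works\<close>)
qed

lemma Ck_on_sum:
  assumes "open S" "\<And>j. j \<in> J \<Longrightarrow> Ck_on k S (f j)"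
  shows "Ck_on k S (\<lambda>x. \<Sum>j\<in>J. f j x)"
  using assms(2)
  by (induction J rule: infinite_finite_induct) (auto intro: Ck_on_const Ck_on_add[OF assms(1)])

lemma Ck_on_bilinear:
  assumes "bounded_bilinear B" "open S" "Ck_on k S f" "Ck_on k S h"
  shows "Ck_on k S (\<lambda>x. B (f x) (h x))"
  using assms(3,4)
proof (induction k arbitrary: f h)
  case 0 then show ?case using assms(1) by (simp add: bounded_bilinear.continuous_on)
next
  case (Suc k)
  show ?case
  proof (rule Ck_on_SucI[OF assms(2)])
    show "((\<lambda>x. B (f x) (h x)) has_derivative
        (\<lambda>i. B (f x) (frechet_derivative h (at x) i) + B (frechet_derivative f (at x) i) (h x))) (at x)"
      if "x \<in> S" for x
      using Suc.prems that
      by (intro bounded_bilinear.FDERIV[OF assms(1)]) (auto simp: frechet_derivative_works)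
    show "Ck_on k S (\<lambda>x. B (f x) (frechet_derivative h (at x) i) + B (frechet_derivative f (at x) i) (h x))"
      if "i \<in> Basis" for i
      using Suc.prems Ck_on_SucD[OF Suc.prems(1)] Ck_on_SucD[OF Suc.prems(2)] that
      by (intro Ck_on_add assms(2) Suc.IH) simp_all
  qed
qed

lemmas Ck_on_mult = Ck_on_bilinear[OF bounded_bilinear_mult]
lemmas Ck_on_scaleR = Ck_on_bilinear[OF bounded_bilinear_scaleR]
lemmas Ck_on_inner = Ck_on_bilinear[OF bounded_bilinear_inner]

lemma Ck_on_compose:
  fixes f :: "'b::euclidean_space \<Rightarrow> 'c::real_normed_vector" and h :: "'a::euclidean_space \<Rightarrow> 'b"
  assumes "open S" "Ck_on k T f" "Ck_on k S h" "h ` S \<subseteq> T"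
  shows "Ck_on k S (\<lambda>x. f (h x))"
  using assms(2,3)
proof (induction k arbitrary: f)
  case 0 then show ?case using assms(4) by (auto intro: continuous_on_compose2)
next
  case (Suc k)
  show ?case
  proof (rule Ck_on_SucI[OF assms(1)])
    fix x assume x: "x \<in> S"
    then have "h x \<in> T" using assms(4) by auto
    then show "((\<lambda>x. f (h x)) has_derivative
        (\<lambda>i. frechet_derivative f (at (h x)) (frechet_derivative h (at x) i))) (at x)"
      using Ck_on_Suc_has_derivative[OF Suc.prems(1)] Ck_on_Suc_has_derivative[OF Suc.prems(2) x]
      by (intro has_derivative_compose[of h _ x UNIV f]) auto
  next
    fix i :: 'a assume i: "i \<in> Basis"
    \<comment> \<open>\<open>Ck_on\<close> controls a derivative only in the directions of
      \<open>Basis\<close>, so the chain rule is expanded in coordinates before the induction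
      hypothesis can be used.\<close>
    have "frechet_derivative f (at (h x)) (frechet_derivative h (at x) i) =
        (\<Sum>j\<in>Basis. (frechet_derivative h (at x) i \<bullet> j) *\<^sub>R frechet_derivative f (at (h x)) j)"
      if "x \<in> S" for x
    proof -
      have "linear (frechet_derivative f (at (h x)))"
        using Suc.prems(1) that assms(4) by (intro linear_frechet_derivative) auto
      then show ?thesis
        by (subst euclidean_representation[symmetric, of "frechet_derivative h (at x) i"])
           (simp add: linear_sum linear_scale del: euclidean_representation)
    qed
    moreover have "Ck_on k S (\<lambda>x. \<Sum>j\<in>Basis. (frechet_derivative h (at x) i \<bullet> j) *\<^sub>R frechet_derivative f (at (h x)) j)"
      using Suc.prems i Ck_on_SucD[OF Suc.prems(2)]
      by (intro Ck_on_sum Ck_on_scaleR Ck_on_inner Ck_on_const Suc.IH assms(1)) auto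
    ultimately show "Ck_on k S (\<lambda>x. frechet_derivative f (at (h x)) (frechet_derivative h (at x) i))"
      by (rule_tac Ck_on_cong[OF assms(1)]) auto
  qed
qed

lemma Ck_on_id: "Ck_on k S (\<lambda>x. x)"
  by (rule Ck_on_bounded_linear_id) (rule bounded_linear_ident)

lemma Ck_on_powr: "Ck_on k {0<..} (\<lambda>x::real. x powr a)"
proof (induction k arbitrary: a)
  case 0 show ?case by (auto intro!: continuous_intros)
next
  case (Suc k)
  show ?case
  proof (rule Ck_on_SucI[where f' = "\<lambda>x h. a * x powr (a - 1) * h"])
    show "((\<lambda>x. x powr a) has_derivative (\<lambda>h. a * x powr (a - 1) * h)) (at x)" if "x \<in> {0<..}" for x
      using has_real_derivative_powr[of x a] that by (simp add: has_field_derivative_def)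
    show "Ck_on k {0<..} (\<lambda>x. a * x powr (a - 1) * i)" for i
      by (intro Ck_on_mult Ck_on_const Suc) auto
  qed simp
qed

lemma open_minus_0 [simp]: "open (- {0 :: 'a::{t1_space,zero}})"
  by (simp add: open_Compl)

lemma Ck_on_norm_powr: "Ck_on k (- {0}) (\<lambda>x::'a::euclidean_space. norm x powr a)"
proof -
  \<comment> \<open>Passing through \<open>x \<bullet> x\<close> reduces the claim to a polynomial
    followed by a power on the positive axis.\<close>
  have "Ck_on k (- {0::'a}) (\<lambda>x. (x \<bullet> x) powr (a / 2))"
    by (rule Ck_on_compose[OF _ Ck_on_powr]) (auto intro!: Ck_on_inner Ck_on_id)
  moreover have "(x \<bullet> x) powr (a / 2) = norm x powr a" if "x \<noteq> 0" for x :: 'a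
  proof -
    have "x \<bullet> x = norm x powr 2" using that by (simp add: dot_square_norm)
    then show ?thesis by (simp only: powr_powr) simp
  qed
  ultimately show ?thesis by (rule_tac Ck_on_cong) auto
qed

lemma Ck_on_sgn: "Ck_on k (- {0}) (sgn :: 'a::euclidean_space \<Rightarrow> 'a)"
proof -
  have "Ck_on k (- {0::'a}) (\<lambda>x. norm x powr -1 *\<^sub>R x)"
    by (intro Ck_on_scaleR Ck_on_norm_powr Ck_on_id) simp
  then show ?thesis
    by (rule Ck_on_cong[rotated 2]) (auto simp: sgn_div_norm powr_minus)
qed

lemma Ck_on_1I:
  assumes "open S" "\<And>x. x \<in> S \<Longrightarrow> (f has_derivative f' x) (at x)"
    "\<And>i. i \<in> Basis \<Longrightarrow> continuous_on S (\<lambda>x. f' x i)"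
  shows "Ck_on 1 S f"
  using Ck_on_SucI[of S f f' 0] assms by simp

lemma Ck_on_imp_continuous_on: "Ck_on k S f \<Longrightarrow> continuous_on S f"
  using Ck_on_le[of k S f 0] by simp

section \<open>Functions homogeneous of degree 0 and their radial multiples\<close>

lemma frechet_derivative_eq_grad:
  assumes "f differentiable (at x)"
  shows "frechet_derivative f (at x) = (\<lambda>h. grad f x \<bullet> h)"
proof
  fix h :: 'a
  have "linear (frechet_derivative f (at x))"
    using assms by (rule linear_frechet_derivative)
  then have "frechet_derivative f (at x) (\<Sum>i\<in>Basis. (h \<bullet> i) *\<^sub>R i) = (\<Sum>i\<in>Basis. (h \<bullet> i) *\<^sub>R frechet_derivative f (at x) i)"
    by (simp add: linear_sum linear_scale)
  then show "frechet_derivative f (at x) h = grad f x \<bullet> h"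
    by (simp only: euclidean_representation)
       (simp add: grad_def inner_sum_left inner_commute[of h] mult.commute)
qed

lemma has_derivative_grad:
  assumes "f differentiable (at x)"
  shows "(f has_derivative (\<lambda>h. grad f x \<bullet> h)) (at x)"
  using assms frechet_derivative_eq_grad[OF assms] by (simp add: frechet_derivative_works)

lemma grad_eqI:
  assumes "(f has_derivative (\<lambda>h. a \<bullet> h)) (at x)"
  shows "grad f x = a"
  unfolding grad_def frechet_derivative_at[OF assms, symmetric] by (rule euclidean_representation)

lemma Ck_on_grad:
  assumes "open S" "Ck_on (Suc k) S f"
  shows "Ck_on k S (grad f)"
proof -
  have "Ck_on k S (\<lambda>x. \<Sum>i\<in>Basis. frechet_derivative f (at x) i *\<^sub>R i)"
    using assms by (intro Ck_on_sum Ck_on_scaleR Ck_on_const) auto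
  then show ?thesis unfolding grad_def[abs_def] .
qed

lemma has_derivative_norm_sgn:
  fixes x :: "'a::real_inner"
  assumes "x \<noteq> 0"
  shows "(norm has_derivative (\<lambda>h. h \<bullet> sgn x)) (at x)"
  using has_derivative_norm[OF assms] .

lemma has_derivative_norm_powr:
  fixes x :: "'a::real_inner"
  assumes "x \<noteq> 0"
  shows "((\<lambda>x. norm x powr a) has_derivative (\<lambda>h. a * norm x powr (a - 2) * (x \<bullet> h))) (at x)"
proof -
  have "((\<lambda>x. norm x powr a) has_derivative (\<lambda>h. norm x powr a * (0 * ln (norm x) + (h \<bullet> sgn x) * a / norm x))) (at x)"
    using assms by (auto intro!: derivative_eq_intros has_derivative_norm_sgn)
  moreover have "norm x powr a * (0 * ln (norm x) + (h \<bullet> sgn x) * a / norm x) = a * norm x powr (a - 2) * (x \<bullet> h)" for h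
    using assms by (simp add: sgn_div_norm powr_diff inner_commute field_simps power2_eq_square)
  ultimately show ?thesis by simp
qed

lemma sgn_scaleR_pos: "c > 0 \<Longrightarrow> sgn (c *\<^sub>R x) = sgn (x :: 'a::real_normed_vector)"
  by (simp add: sgn_scaleR)

lemma sgn_sgn_vector [simp]: "sgn (sgn x) = sgn (x :: 'a::real_normed_vector)"
  by (cases "x = 0") (simp_all add: sgn_div_norm)

lemma norm_sgn_1: "x \<noteq> 0 \<Longrightarrow> norm (sgn x) = 1"
  by (simp add: norm_sgn)

lemma has_derivative_sgn:
  fixes x :: "'a::real_inner"
  assumes "x \<noteq> 0"
  shows "(sgn has_derivative (\<lambda>h. (h - (sgn x \<bullet> h) *\<^sub>R sgn x) /\<^sub>R norm x)) (at x)"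
proof -
  have "((\<lambda>x. inverse (norm x) *\<^sub>R x) has_derivative
      (\<lambda>h. inverse (norm x) *\<^sub>R h + (- (inverse (norm x) * (h \<bullet> sgn x) * inverse (norm x))) *\<^sub>R x)) (at x)"
    using assms by (auto intro!: derivative_eq_intros has_derivative_norm_sgn)
  moreover have "(\<lambda>x. inverse (norm x) *\<^sub>R x) = (sgn :: 'a \<Rightarrow> 'a)"
    by (auto simp: sgn_div_norm)
  moreover have "inverse (norm x) *\<^sub>R h + (- (inverse (norm x) * (h \<bullet> sgn x) * inverse (norm x))) *\<^sub>R x
      = (h - (sgn x \<bullet> h) *\<^sub>R sgn x) /\<^sub>R norm x" for h
    by (simp add: sgn_div_norm algebra_simps inner_commute)
  ultimately show ?thesis by simp
qed

text \<open>The function does not change under y -> y / \<open>norm x\<close>, and this dilation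
  moves x to \<open>sgn x\<close>. Hence all differentiation can be done on the unit sphere.\<close>

lemma has_derivative_hom0:
  fixes f :: "'a::real_normed_vector \<Rightarrow> 'b::real_normed_vector"
  assumes "((\<lambda>y. f (sgn y)) has_derivative D) (at (sgn x))" "x \<noteq> 0"
  shows "((\<lambda>y. f (sgn y)) has_derivative (\<lambda>h. D (h /\<^sub>R norm x))) (at x)"
proof -
  have "((\<lambda>y. f (sgn (y /\<^sub>R norm x))) has_derivative (\<lambda>h. D (h /\<^sub>R norm x))) (at x)"
    using assms(1) by (intro has_derivative_compose[of "\<lambda>y. y /\<^sub>R norm x" _ x UNIV "\<lambda>y. f (sgn y)" D])
      (auto intro!: derivative_eq_intros simp: sgn_div_norm)
  then show ?thesis using assms(2) by (simp add: sgn_scaleR_pos)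
qed

text \<open>The function is constant along the ray t -> (1 + t) x near t = 0.\<close>

lemma hom0_radial_derivative:
  fixes f :: "'a::real_normed_vector \<Rightarrow> 'b::real_normed_vector"
  assumes "((\<lambda>y. f (sgn y)) has_derivative D) (at x)"
  shows "D x = 0"
proof -
  have "((\<lambda>t::real. f (sgn ((1 + t) *\<^sub>R x))) has_derivative (\<lambda>t. D (t *\<^sub>R x))) (at 0)"
    by (rule has_derivative_compose[of "\<lambda>t. (1 + t) *\<^sub>R x" _ 0 UNIV "\<lambda>y. f (sgn y)" D])
       (use assms in \<open>auto intro!: derivative_eq_intros\<close>)
  then have "((\<lambda>t::real. f (sgn x)) has_derivative (\<lambda>t. D (t *\<^sub>R x))) (at 0)"
    by (rule has_derivative_transform_within_open[of _ _ _ _ "{-1<..}"]) (auto simp: sgn_scaleR_pos)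
  then have "(\<lambda>t::real. D (t *\<^sub>R x)) = (\<lambda>_. 0)"
    using has_derivative_const has_derivative_unique by blast
  from fun_cong[OF this, of 1] show ?thesis by simp
qed

locale sph_C2 =
  fixes v :: "'a::euclidean_space \<Rightarrow> real"
  assumes C2: "Ck_on 2 (- {0}) (\<lambda>x. v (sgn x))"
begin

text \<open>The gradient of the degree 0 extension of \<open>v\<close> has degree -1.
  \<open>W\<close> extends its values on the sphere with degree 0 instead, so the two differ by the
  factor \<open>norm x\<close>, and \<open>W\<close> can be differentiated by the same scaling
  argument as \<open>v\<close>.\<close>

definition "W x = sph_grad v (sgn x)"

definition "DW x = frechet_derivative W (at x)"

lemma differentiable_hom0: "x \<noteq> 0 \<Longrightarrow> (\<lambda>x. v (sgn x)) differentiable (at x)"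
  using C2 by (simp add: numeral_2_eq_2)

lemma has_derivative_v:
  assumes "x \<noteq> 0"
  shows "((\<lambda>x. v (sgn x)) has_derivative (\<lambda>h. W x \<bullet> h / norm x)) (at x)"
proof -
  have "sgn x \<noteq> 0" using assms by (simp add: sgn_zero_iff)
  from has_derivative_hom0[OF has_derivative_grad[OF differentiable_hom0[OF this]] assms]
  show ?thesis by (simp add: W_def sph_grad_def divide_inverse mult.commute)
qed

lemma grad_v: "x \<noteq> 0 \<Longrightarrow> grad (\<lambda>x. v (sgn x)) x = W x /\<^sub>R norm x"
  using has_derivative_v by (intro grad_eqI) (simp add: divide_inverse mult.commute)

lemma W_radial: "W x \<bullet> x = 0"
proof (cases "x = 0")
  case False
  then show ?thesis using hom0_radial_derivative[OF has_derivative_v[OF False]] by simp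
qed simp

lemma W_sgn: "W x \<bullet> sgn x = 0"
  using W_radial[of x] by (simp add: sgn_div_norm)

lemma W_hom: "c > 0 \<Longrightarrow> W (c *\<^sub>R x) = W x" "W (sgn x) = W x"
  by (auto simp: W_def sgn_scaleR_pos)

lemma Ck_on_W:
  assumes "Ck_on (Suc k) (- {0}) (\<lambda>x. v (sgn x))"
  shows "Ck_on k (- {0}) W"
proof -
  have "Ck_on k (- {0}) (\<lambda>x. norm x powr 1 *\<^sub>R grad (\<lambda>x. v (sgn x)) x)"
    using assms by (intro Ck_on_scaleR Ck_on_norm_powr Ck_on_grad) auto
  then show ?thesis
    by (rule Ck_on_cong[rotated 2]) (auto simp: grad_v)
qed

lemma C1_W: "Ck_on 1 (- {0}) W"
  using Ck_on_W[of 1] C2 by (simp add: numeral_2_eq_2)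

lemma C1_v: "Ck_on 1 (- {0}) (\<lambda>x. v (sgn x))"
  using Ck_on_SucD[of 1 "- {0}" "\<lambda>x. v (sgn x)"] C2 unfolding Suc_1 .

lemma has_derivative_W_self: "x \<noteq> 0 \<Longrightarrow> (W has_derivative DW x) (at x)"
  using C1_W unfolding DW_def by (simp add: frechet_derivative_works)

lemma has_derivative_W:
  assumes "x \<noteq> 0"
  shows "(W has_derivative (\<lambda>h. DW (sgn x) h /\<^sub>R norm x)) (at x)"
proof -
  have nz: "sgn x \<noteq> 0" using assms by (simp add: sgn_zero_iff)
  have eq: "(\<lambda>y. sph_grad v (sgn y)) = W" by (auto simp: W_def)
  have "linear (DW (sgn x))"
    using has_derivative_W_self[OF nz] has_derivative_linear by blast
  with has_derivative_hom0[of "sph_grad v" "DW (sgn x)" x] has_derivative_W_self[OF nz] assms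
  show ?thesis by (simp add: eq linear_scale)
qed

lemma DW_radial: "x \<noteq> 0 \<Longrightarrow> DW x x = 0"
  using hom0_radial_derivative[of "sph_grad v" "DW x" x] has_derivative_W_self[of x]
  by (simp add: W_def[abs_def])

lemma linear_DW: "x \<noteq> 0 \<Longrightarrow> linear (DW x)"
  using has_derivative_W_self has_derivative_linear by blast

lemma sph_hess_eq: "sph_hess v \<omega> h = DW \<omega> h - (DW \<omega> h \<bullet> \<omega>) *\<^sub>R \<omega>"
  by (simp add: sph_hess_def Let_def DW_def W_def[abs_def])

text \<open>The projection in \<open>sph_hess\<close> changes the trace by
  \<open>DW \<omega> \<omega> \<bullet> \<omega>\<close>, which is 0 because \<open>W\<close> is
  constant along rays.\<close>

lemma div_W:
  assumes "norm \<omega> = 1"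
  shows "(\<Sum>i\<in>Basis. DW \<omega> i \<bullet> i) = sph_laplacian v \<omega>"
proof -
  have nz: "\<omega> \<noteq> 0" using assms by auto
  have "(\<Sum>i\<in>Basis. (\<omega> \<bullet> i) * (DW \<omega> i \<bullet> \<omega>)) = DW \<omega> (\<Sum>i\<in>Basis. (\<omega> \<bullet> i) *\<^sub>R i) \<bullet> \<omega>"
    by (simp add: linear_sum[OF linear_DW[OF nz]] linear_scale[OF linear_DW[OF nz]] inner_sum_left del: euclidean_representation)
  also have "\<dots> = 0" using DW_radial[OF nz] by (simp add: euclidean_representation)
  finally show ?thesis
    by (simp add: sph_laplacian_def sph_hess_eq inner_diff_left sum_subtractf mult.commute)
qed

lemma W_hess_W: "norm \<omega> = 1 \<Longrightarrow> W \<omega> \<bullet> sph_hess v \<omega> h = W \<omega> \<bullet> DW \<omega> h"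
  using W_radial by (simp add: sph_hess_eq inner_diff_right)

text \<open>\<open>Z lam\<close> is the gradient of \<open>\<lambda>x. norm x powr lam * v (sgn x)\<close> on the unit sphere.\<close>

definition "Z lam x = (lam * v (sgn x)) *\<^sub>R sgn x + W x"

lemma Z_hom: "c > 0 \<Longrightarrow> Z lam (c *\<^sub>R x) = Z lam x" "Z lam (sgn x) = Z lam x"
  by (auto simp: Z_def W_hom sgn_scaleR_pos)

lemma C1_Z: "Ck_on 1 (- {0}) (Z lam)"
  unfolding Z_def[abs_def]
  by (intro Ck_on_add Ck_on_scaleR Ck_on_mult Ck_on_const C1_v C1_W Ck_on_sgn) auto

lemma norm_Z: "x \<noteq> 0 \<Longrightarrow> (norm (Z lam x))\<^sup>2 = (norm (W x))\<^sup>2 + lam\<^sup>2 * (v (sgn x))\<^sup>2"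
proof -
  assume "x \<noteq> 0"
  then have "sgn x \<bullet> sgn x = 1" by (simp add: dot_square_norm norm_sgn_1)
  moreover have "sgn x \<bullet> W x = 0" using W_sgn[of x] by (simp add: inner_commute)
  ultimately show ?thesis
    unfolding Z_def power2_norm_eq_inner by (simp add: inner_add_left inner_add_right W_sgn power2_eq_square)
qed

lemma has_derivative_radial_mult:
  assumes "x \<noteq> 0"
  shows "((\<lambda>x. norm x powr lam * v (sgn x)) has_derivative (\<lambda>h. (norm x powr (lam - 1) *\<^sub>R Z lam x) \<bullet> h)) (at x)"
proof -
  have "((\<lambda>x. norm x powr lam * v (sgn x)) has_derivative
     (\<lambda>h. norm x powr lam * (W x \<bullet> h / norm x) + lam * norm x powr (lam - 2) * (x \<bullet> h) * v (sgn x))) (at x)"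
    using assms by (intro has_derivative_mult has_derivative_norm_powr has_derivative_v)
  moreover have "norm x powr lam * (W x \<bullet> h / norm x) + lam * norm x powr (lam - 2) * (x \<bullet> h) * v (sgn x)
     = (norm x powr (lam - 1) *\<^sub>R Z lam x) \<bullet> h" for h
    using assms by (simp add: Z_def inner_add_left powr_diff sgn_div_norm field_simps power2_eq_square)
  ultimately show ?thesis by simp
qed

lemma grad_radial_mult:
  "x \<noteq> 0 \<Longrightarrow> grad (\<lambda>x. norm x powr lam * v (sgn x)) x = norm x powr (lam - 1) *\<^sub>R Z lam x"
  by (rule grad_eqI) (rule has_derivative_radial_mult)

text \<open>The field |grad u|^(p-2) grad u of the p-Laplace equation, with its degree of
  homogeneity split off; the remaining factor has degree 0 and is bounded.\<close>

definition "flux lam p x = norm x powr ((lam - 1) * (p - 1)) *\<^sub>R (norm (Z lam x) powr (p - 2) *\<^sub>R Z lam x)"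

lemma flux_grad:
  assumes "x \<noteq> 0" "p \<noteq> 1"
  shows "norm (grad (\<lambda>x. norm x powr lam * v (sgn x)) x) powr (p - 2) *\<^sub>R grad (\<lambda>x. norm x powr lam * v (sgn x)) x
    = flux lam p x"
proof -
  have "(lam - 1) * (p - 1) = (lam - 1) * (p - 2) + (lam - 1)" by (simp add: algebra_simps)
  then show ?thesis
    using assms unfolding grad_radial_mult[OF assms(1)] flux_def
    by (simp add: powr_mult powr_powr powr_add)
qed

lemma flux_C1:
  assumes "\<And>x. x \<noteq> 0 \<Longrightarrow> Z lam x \<noteq> 0"
  shows "Ck_on 1 (- {0}) (flux lam p)"
proof -
  have "Ck_on 1 (- {0}) (\<lambda>x. norm (Z lam x) powr (p - 2))"
  proof (rule Ck_on_compose[where T = "- {0}" and h = "Z lam" and f = "\<lambda>y. norm y powr (p - 2)"])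
    show "Z lam ` (- {0}) \<subseteq> - {0}" by (rule image_subsetI) (simp add: assms)
  qed (rule open_minus_0 Ck_on_norm_powr C1_Z)+
  then show ?thesis
    unfolding flux_def[abs_def]
    by (rule Ck_on_scaleR[OF open_minus_0 Ck_on_norm_powr Ck_on_scaleR[OF open_minus_0 _ C1_Z]])
qed

text \<open>This is where \<open>sph_L\<close> comes from. The trace of the derivative of
  \<open>Z\<close> gives the Laplacian and lam (d-1) v, the radial weight gives (lam-1)(p-1) lam v,
  and differentiating |Z|^(p-2) gives the term with \<open>sph_A\<close>, because Z \<bullet> DZ(Z)
  is |Z|^2 times \<open>sph_A\<close>.\<close>

lemma div_flux_unit:
  assumes "norm x = 1" "Z lam x \<noteq> 0"
  obtains D where "(flux lam p has_derivative D) (at x)"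
    "(\<Sum>i\<in>Basis. D i \<bullet> i) = norm (Z lam x) powr (p - 2) * sph_L p lam v x"
proof -
  have nz: "x \<noteq> 0" and sx: "sgn x = x" using assms by (auto simp: sgn_div_norm)
  \<comment> \<open>The terms are due to the derivatives of \<open>sgn\<close>, of \<open>v\<close>
    and of \<open>W\<close>; since \<open>norm x = 1\<close>, no powers of the norm appear.\<close>
  define DZ where "DZ h = (lam * v x) *\<^sub>R (h - (x \<bullet> h) *\<^sub>R x) + (lam * (W x \<bullet> h)) *\<^sub>R x + DW x h" for h
  have DZ: "(Z lam has_derivative DZ) (at x)"
    unfolding Z_def[abs_def] using nz
    by (rule_tac has_derivative_eq_rhs[OF has_derivative_add[OF has_derivative_scaleR[OF
            has_derivative_mult_right[OF has_derivative_v] has_derivative_sgn] has_derivative_W_self]])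
       (auto simp: DZ_def sx assms(1))
  define m where "m = (lam - 1) * (p - 1)"
  define N where "N = norm (Z lam x)"
  have Npos: "N > 0" using assms by (simp add: N_def)
  define Ds where "Ds h = m * (x \<bullet> h) * N powr (p - 2) + (p - 2) * N powr (p - 4) * (Z lam x \<bullet> DZ h)" for h
  define D where "D h = N powr (p - 2) *\<^sub>R DZ h + Ds h *\<^sub>R Z lam x" for h
  have "((\<lambda>x. norm x powr m * norm (Z lam x) powr (p - 2)) has_derivative
     (\<lambda>h. norm x powr m * ((p - 2) * norm (Z lam x) powr (p - 2 - 2) * (Z lam x \<bullet> DZ h))
       + m * norm x powr (m - 2) * (x \<bullet> h) * norm (Z lam x) powr (p - 2))) (at x)"
    using nz assms(2)
    by (intro has_derivative_mult has_derivative_norm_powr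
        has_derivative_compose[OF DZ has_derivative_norm_powr]) auto
  then have "((\<lambda>x. norm x powr m * norm (Z lam x) powr (p - 2)) has_derivative Ds) (at x)"
    by (rule has_derivative_eq_rhs) (auto simp: Ds_def[abs_def] assms(1) N_def algebra_simps)
  then have "((\<lambda>x. (norm x powr m * norm (Z lam x) powr (p - 2)) *\<^sub>R Z lam x) has_derivative D) (at x)"
    unfolding D_def[abs_def] N_def
    by (rule has_derivative_eq_rhs[OF has_derivative_scaleR[OF _ DZ]]) (simp add: assms(1))
  then have 1: "(flux lam p has_derivative D) (at x)"
    by (simp add: flux_def[abs_def] m_def)
  have linDZ: "linear DZ" using DZ has_derivative_linear by blast
  have linDs: "linear Ds"
    unfolding Ds_def[abs_def]
    by (rule linearI) (simp_all add: linear_add[OF linDZ] linear_scale[OF linDZ] algebra_simps inner_add_right)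
  \<comment> \<open>Summing a linear form against the coordinates of \<open>Z lam x\<close>
    evaluates it at \<open>Z lam x\<close>: the scalar factor contributes its derivative along the
    field.\<close>
  have "(\<Sum>i\<in>Basis. Ds i *\<^sub>R Z lam x \<bullet> i) = Ds (\<Sum>i\<in>Basis. (Z lam x \<bullet> i) *\<^sub>R i)"
    by (simp add: linear_sum[OF linDs] linear_scale[OF linDs] mult.commute del: euclidean_representation)
  then have s1: "(\<Sum>i\<in>Basis. Ds i *\<^sub>R Z lam x \<bullet> i) = Ds (Z lam x)"
    by (simp only: euclidean_representation)
  have Wx: "W x \<bullet> x = 0" "x \<bullet> W x = 0" using W_radial[of x] by (auto simp: inner_commute)
  have xx: "x \<bullet> x = 1" using assms(1) by (simp add: dot_square_norm)
  have s2: "(\<Sum>i\<in>Basis. DZ i \<bullet> i) = lam * v x * (real DIM('a) - 1) + sph_laplacian v x"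
  proof -
    have a: "(\<Sum>i\<in>Basis. (i - (x \<bullet> i) *\<^sub>R x) \<bullet> i) = real DIM('a) - 1"
      using xx by (simp add: inner_diff_left sum_subtractf inner_same_Basis euclidean_inner[of x x])
    have b: "(\<Sum>i\<in>Basis. (W x \<bullet> i) * (x \<bullet> i)) = 0"
      using Wx euclidean_inner[of "W x" x] by simp
    have "(\<Sum>i\<in>Basis. DZ i \<bullet> i) = lam * v x * (\<Sum>i\<in>Basis. (i - (x \<bullet> i) *\<^sub>R x) \<bullet> i)
        + lam * (\<Sum>i\<in>Basis. (W x \<bullet> i) * (x \<bullet> i)) + (\<Sum>i\<in>Basis. DW x i \<bullet> i)"
      by (simp add: DZ_def inner_add_left sum.distrib sum_distrib_left mult.assoc)
    then show ?thesis using a b div_W[OF assms(1)] by simp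
  qed
  have Zx: "x \<bullet> Z lam x = lam * v x" by (simp add: Z_def sx inner_add_right xx Wx)
  have DZZ: "Z lam x \<bullet> DZ (Z lam x) = lam\<^sup>2 * v x * (norm (W x))\<^sup>2 + W x \<bullet> sph_hess v x (W x)"
  proof -
    \<comment> \<open>\<open>Z\<close> is constant along rays, so only the tangential part
      \<open>W x\<close> of \<open>Z lam x\<close> contributes.\<close>
    have "DZ x = 0" using DW_radial[OF nz] by (simp add: DZ_def xx Wx)
    then have "DZ (Z lam x) = DZ (W x)"
      by (simp add: Z_def sx linear_add[OF linDZ] linear_scale[OF linDZ])
    moreover have "x \<bullet> DW x (W x) = - (norm (W x))\<^sup>2"
    proof -
      \<comment> \<open>The tangency \<open>W y \<bullet> y = 0\<close>, differentiated in the
        direction \<open>W x\<close>, produces the curvature term of the sphere.\<close>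
      have "((\<lambda>y. W y \<bullet> y) has_derivative (\<lambda>h. W x \<bullet> h + DW x h \<bullet> x)) (at x)"
        by (auto intro!: derivative_eq_intros has_derivative_W_self[OF nz])
      then have "((\<lambda>y. 0) has_derivative (\<lambda>h. W x \<bullet> h + DW x h \<bullet> x)) (at x)"
        by (simp add: W_radial)
      then have "(\<lambda>h. W x \<bullet> h + DW x h \<bullet> x) = (\<lambda>_. 0)"
        using has_derivative_const has_derivative_unique by blast
      from fun_cong[OF this, of "W x"] show ?thesis
        by (simp add: power2_norm_eq_inner inner_commute)
    qed
    moreover have "DZ (W x) = (lam * v x) *\<^sub>R W x + (lam * (W x \<bullet> W x)) *\<^sub>R x + DW x (W x)"
      by (simp add: DZ_def Wx)
    moreover have "W x \<bullet> W x = (norm (W x))\<^sup>2" by (rule dot_square_norm)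
    ultimately have "Z lam x \<bullet> DZ (Z lam x) = lam * v x * (lam * (norm (W x))\<^sup>2 - (norm (W x))\<^sup>2)
        + (lam * v x * (norm (W x))\<^sup>2 + W x \<bullet> DW x (W x))"
      using xx Wx by (simp add: Z_def sx inner_add_left inner_add_right algebra_simps del: power2_norm_eq_inner)
    then show ?thesis
      unfolding W_hess_W[OF assms(1)] by (simp add: algebra_simps power2_eq_square[of lam])
  qed
  have N2: "N\<^sup>2 = (norm (W x))\<^sup>2 + lam\<^sup>2 * (v x)\<^sup>2"
    using norm_Z[OF nz] by (simp add: N_def sx)
  have A: "Z lam x \<bullet> DZ (Z lam x) = N\<^sup>2 * sph_A lam v x"
    using Npos N2[symmetric] unfolding DZZ sph_A_def
    by (simp add: W_def[symmetric] W_def[of x, unfolded sx, symmetric] add.commute)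
  have Np: "N powr (p - 4) * N\<^sup>2 = N powr (p - 2)"
    using Npos by (simp add: powr_add[symmetric] flip: powr_numeral)
  have "(\<Sum>i\<in>Basis. D i \<bullet> i) = N powr (p - 2) * (\<Sum>i\<in>Basis. DZ i \<bullet> i) + Ds (Z lam x)"
    unfolding s1[symmetric] by (simp add: D_def inner_add_left sum.distrib sum_distrib_left)
  also have "\<dots> = N powr (p - 2) * (lam * v x * (real DIM('a) - 1) + sph_laplacian v x + m * (lam * v x) + (p - 2) * sph_A lam v x)"
    unfolding s2 Ds_def Zx A Np[symmetric] by (simp add: algebra_simps)
  also have "\<dots> = N powr (p - 2) * sph_L p lam v x"
    by (simp add: sph_L_def m_def algebra_simps power2_eq_square)
  finally show ?thesis using that[OF 1] by (simp add: N_def)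
qed

text \<open>Homogeneity of degree (lam-1)(p-1) carries the computation on the sphere to every other
  point off the origin.\<close>

lemma div_flux:
  assumes "x \<noteq> 0" "\<And>x. x \<noteq> 0 \<Longrightarrow> Z lam x \<noteq> 0" "\<And>\<omega>. norm \<omega> = 1 \<Longrightarrow> sph_L p lam v \<omega> = 0"
  shows "(\<Sum>i\<in>Basis. frechet_derivative (flux lam p) (at x) i \<bullet> i) = 0"
proof -
  define r where "r = norm x"
  have r: "r > 0" "norm (sgn x) = 1" "sgn x \<noteq> 0" using assms(1) by (auto simp: r_def norm_sgn sgn_zero_iff)
  obtain D where D: "(flux lam p has_derivative D) (at (sgn x))" "(\<Sum>i\<in>Basis. D i \<bullet> i) = 0"
    using div_flux_unit[OF r(2) assms(2)[OF r(3)], of p] assms(3)[OF r(2)] by auto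
  define m where "m = (lam - 1) * (p - 1)"
  have eq: "flux lam p y = r powr m *\<^sub>R flux lam p (y /\<^sub>R r)" for y
    using r Z_hom(1)[of "inverse r" lam y]
    by (simp add: flux_def m_def[symmetric] powr_mult powr_divide divide_inverse[symmetric] inverse_eq_divide)
  have "((\<lambda>y. flux lam p (y /\<^sub>R r)) has_derivative (\<lambda>h. D (h /\<^sub>R r))) (at x)"
    using D(1) r by (intro has_derivative_compose[of "\<lambda>y. y /\<^sub>R r" _ x UNIV "flux lam p" D])
      (auto intro!: derivative_eq_intros simp: sgn_div_norm r_def)
  then have "((\<lambda>y. r powr m *\<^sub>R flux lam p (y /\<^sub>R r)) has_derivative (\<lambda>h. r powr m *\<^sub>R D (h /\<^sub>R r))) (at x)"
    by (rule has_derivative_scaleR_right)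
  then have "(flux lam p has_derivative (\<lambda>h. r powr m *\<^sub>R D (h /\<^sub>R r))) (at x)"
    by (simp add: eq[symmetric])
  then have "frechet_derivative (flux lam p) (at x) = (\<lambda>h. r powr m *\<^sub>R D (h /\<^sub>R r))"
    by (rule frechet_derivative_at[symmetric])
  moreover have "linear D" using D(1) has_derivative_linear by blast
  ultimately have "(\<Sum>i\<in>Basis. frechet_derivative (flux lam p) (at x) i \<bullet> i) = r powr m * inverse r * (\<Sum>i\<in>Basis. D i \<bullet> i)"
    by (simp add: linear_scale sum_distrib_left mult.assoc)
  then show ?thesis using D(2) by simp
qed

end

section \<open>Integration by parts in the presence of a singular point\<close>

lemma integrable_continuous_bounded_support:
  fixes h :: "'a::euclidean_space \<Rightarrow> 'b::{banach, second_countable_topology}"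
  assumes "continuous_on UNIV h" "\<And>x. norm x \<ge> R \<Longrightarrow> h x = 0"
  shows "integrable lborel h"
proof -
  have "integrable lborel (\<lambda>x. indicator (cball 0 R) x *\<^sub>R h x)"
    by (rule borel_integrable_compact) (auto intro: continuous_on_subset[OF assms(1)])
  moreover have "indicator (cball 0 R) x *\<^sub>R h x = h x" for x
    using assms(2)[of x] by (auto simp: indicator_def)
  ultimately show ?thesis by simp
qed

lemma integral_lborel_translate:
  fixes h :: "'a::euclidean_space \<Rightarrow> 'b::{banach, second_countable_topology}"
  assumes "h \<in> borel_measurable borel"
  shows "(LINT x|lborel. h (c + x)) = (LINT x|lborel. h x)"
proof -
  have "(LINT x|lborel. h x) = (LINT x|distr lborel borel ((+) c). h x)"
    by (simp add: lborel_distr_plus)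
  also have "\<dots> = (LINT x|lborel. h (c + x))"
    using assms by (subst integral_distr) auto
  finally show ?thesis by simp
qed

text \<open>Differentiate \<open>s \<mapsto> \<integral>h(x + s i) dx\<close>, which is constant by translation invariance.\<close>

lemma integral_partial_derivative_eq_0:
  fixes h :: "'a::euclidean_space \<Rightarrow> real"
  assumes C1: "Ck_on 1 UNIV h" and supp: "\<And>x. norm x \<ge> R \<Longrightarrow> h x = 0" and i: "i \<in> Basis"
  shows "integrable lborel (\<lambda>x. frechet_derivative h (at x) i)"
    and "(LINT x|lborel. frechet_derivative h (at x) i) = 0"
proof -
  let ?f = "\<lambda>x. frechet_derivative h (at x) i"
  have D: "(h has_derivative frechet_derivative h (at x)) (at x)" for x
    using C1 by (simp add: frechet_derivative_works)
  have contf: "continuous_on UNIV ?f" using C1 i by simp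
  have conth: "continuous_on UNIV h" using C1 by (rule Ck_on_imp_continuous_on)
  have f0: "?f x = 0" if "norm x > R" for x
  proof -
    have "((\<lambda>_. 0) has_derivative (\<lambda>_. 0)) (at x)" by simp
    then have "(h has_derivative (\<lambda>_. 0)) (at x)"
      by (rule has_derivative_transform_within_open[of _ _ _ _ "{x. norm x > R}"])
         (use that supp in \<open>auto intro: open_Collect_less continuous_intros\<close>)
    then show ?thesis using frechet_derivative_at by metis
  qed
  have "compact (?f ` cball 0 R)"
    by (rule compact_continuous_image) (auto intro: continuous_on_subset[OF contf])
  then obtain M where "M > 0" "\<forall>y\<in>?f ` cball 0 R. norm y \<le> M"
    unfolding compact_eq_bounded_closed bounded_pos by blast
  then have M: "\<And>x. x \<in> cball 0 R \<Longrightarrow> \<bar>?f x\<bar> \<le> M" "M > 0"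
    by auto
  have M': "\<bar>?f x\<bar> \<le> M" for x
    using M f0[of x] by (cases "norm x > R") auto
  have int_f: "integrable lborel ?f"
    by (rule integrable_continuous_bounded_support[OF contf, of "R + 1"]) (use f0 in auto)
  then show "integrable lborel ?f" .
  have int_h: "integrable lborel h"
    by (rule integrable_continuous_bounded_support[OF conth supp])
  have mh: "h \<in> borel_measurable borel" using conth by (rule borel_measurable_continuous_onI)
  \<comment> \<open>Steps of length at most 1 keep the supports of all difference quotients in one
    ball of radius \<bar>R\<bar> + 1, where the constant M dominates them by the mean value
    theorem.\<close>
  define s where "s n = inverse (real (Suc n))" for n
  have s: "0 < s n" "s n \<le> 1" for n by (auto simp: s_def inverse_le_1_iff)
  have s0: "s \<longlonglongrightarrow> 0" unfolding s_def by (rule LIMSEQ_inverse_real_of_nat)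
  define q where "q n x = (h (s n *\<^sub>R i + x) - h x) / s n" for n x
  have line: "((\<lambda>t. h (t *\<^sub>R i + x)) has_real_derivative ?f (t *\<^sub>R i + x)) (at t)" for t x
  proof -
    have "((\<lambda>t. h (t *\<^sub>R i + x)) has_derivative (\<lambda>t'. frechet_derivative h (at (t *\<^sub>R i + x)) (t' *\<^sub>R i))) (at t)"
      by (rule has_derivative_compose[of "\<lambda>t. t *\<^sub>R i + x" _ t UNIV h, OF _ D])
         (auto intro!: derivative_eq_intros)
    moreover have "linear (frechet_derivative h (at (t *\<^sub>R i + x)))"
      using D has_derivative_linear by blast
    ultimately show ?thesis
      unfolding has_field_derivative_def by (simp add: linear_scale) (simp add: mult.commute[of _ "frechet_derivative h _ i"])
  qed
  have "(\<lambda>n. LINT x|lborel. q n x) \<longlonglongrightarrow> (LINT x|lborel. ?f x)"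
  proof (rule integral_dominated_convergence[where w = "\<lambda>x. M * indicator (cball 0 (\<bar>R\<bar> + 1)) x"])
    show "?f \<in> borel_measurable lborel" using int_f by auto
    show "q n \<in> borel_measurable lborel" for n
      unfolding q_def using mh by measurable
    show "integrable lborel (\<lambda>x. M * indicator (cball 0 (\<bar>R\<bar> + 1)) x :: real)"
      by (intro integrable_mult_right) (simp add: integrable_indicator_iff emeasure_bounded_finite[unfolded infinity_ennreal_def])
    have "(\<lambda>n. q n x) \<longlonglongrightarrow> ?f x" for x
    proof -
      have "((\<lambda>t. (h (t *\<^sub>R i + x) - h x) / t) \<longlongrightarrow> ?f x) (at 0)"
        using line[of x 0] by (simp add: has_field_derivative_iff)
      then show ?thesis
        unfolding q_def by (rule filterlim_compose) (use s(1) s0 in \<open>simp add: filterlim_at less_imp_neq[symmetric]\<close>)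
    qed
    then show "AE x in lborel. (\<lambda>n. q n x) \<longlonglongrightarrow> ?f x" by simp
    have "norm (q n x) \<le> M * indicator (cball 0 (\<bar>R\<bar> + 1)) x" for n x
    proof (cases "norm x \<le> \<bar>R\<bar> + 1")
      case True
      obtain z where "h (s n *\<^sub>R i + x) - h (0 *\<^sub>R i + x) = (s n - 0) * ?f (z *\<^sub>R i + x)"
        using MVT2[of 0 "s n" "\<lambda>t. h (t *\<^sub>R i + x)" "\<lambda>t. ?f (t *\<^sub>R i + x)"] line s by metis
      then have "q n x = ?f (z *\<^sub>R i + x)" using s(1)[of n] by (simp add: q_def)
      then show ?thesis using M' True by (simp add: indicator_def)
    next
      case False
      have "norm x \<le> norm (s n *\<^sub>R i + x) + norm (s n *\<^sub>R i)"
        using norm_diff_ineq[of x "s n *\<^sub>R i"] by (simp add: add.commute)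
      then have "norm (s n *\<^sub>R i + x) \<ge> R" using False s[of n] i by simp
      then show ?thesis using supp[of x] supp[of "s n *\<^sub>R i + x"] False by (simp add: q_def)
    qed
    then show "AE x in lborel. norm (q n x) \<le> M * indicator (cball 0 (\<bar>R\<bar> + 1)) x" for n by simp
  qed
  moreover have "(LINT x|lborel. q n x) = 0" for n
  proof -
    have "integrable lborel (\<lambda>x. h (s n *\<^sub>R i + x))"
    proof (rule integrable_continuous_bounded_support[where R = "R + 1"])
      show "continuous_on UNIV (\<lambda>x. h (s n *\<^sub>R i + x))"
        by (rule continuous_on_compose2[OF conth]) (auto intro!: continuous_intros)
      show "h (s n *\<^sub>R i + x) = 0" if "norm x \<ge> R + 1" for x
        using norm_diff_ineq[of x "s n *\<^sub>R i"] that s[of n] i by (intro supp) (simp add: add.commute)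
    qed
    then show ?thesis
      unfolding q_def using int_h integral_lborel_translate[OF mh, of "s n *\<^sub>R i"] by simp
  qed
  ultimately have "(\<lambda>n. 0) \<longlonglongrightarrow> (LINT x|lborel. ?f x)" by simp
  then show "(LINT x|lborel. ?f x) = 0" using LIMSEQ_unique tendsto_const by blast
qed

section \<open>The divergence theorem for fields that may be singular at the origin\<close>

definition divergence :: "('a::euclidean_space \<Rightarrow> 'a) \<Rightarrow> 'a \<Rightarrow> real"
  where "divergence X x = (\<Sum>i\<in>Basis. frechet_derivative X (at x) i \<bullet> i)"

lemma Ck_on_UNIV_vanish_near_0:
  fixes f :: "'a::euclidean_space \<Rightarrow> 'b::real_normed_vector"
  assumes "Ck_on k (- {0}) f" "\<epsilon> > 0" "\<And>x. norm x < \<epsilon> \<Longrightarrow> f x = 0"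
  shows "Ck_on k UNIV f"
proof -
  have "Ck_on k (ball 0 \<epsilon>) f"
    by (rule Ck_on_cong[OF _ _ Ck_on_const[of k _ 0]]) (use assms in auto)
  then have "Ck_on k (- {0} \<union> ball 0 \<epsilon>) f" using assms by (intro Ck_on_Un) auto
  moreover have "- {0} \<union> ball 0 \<epsilon> = (UNIV :: 'a set)" using assms(2) by auto
  ultimately show ?thesis by simp
qed

text \<open>Each product of \<eta> with a component of X vanishes near 0 and is therefore C1 on the
  whole space with compact support, so its partial derivatives integrate to 0.\<close>

lemma divergence_theorem_cutoff:
  fixes X :: "'a::euclidean_space \<Rightarrow> 'a" and \<eta> :: "'a \<Rightarrow> real"
  assumes X: "Ck_on 1 (- {0}) X" and \<eta>: "Ck_on 1 UNIV \<eta>"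
    and e: "\<epsilon> > 0" "\<And>x. norm x < \<epsilon> \<Longrightarrow> \<eta> x = 0" and R: "\<And>x. norm x \<ge> R \<Longrightarrow> \<eta> x = 0"
  shows "integrable lborel (\<lambda>x. \<eta> x * divergence X x + grad \<eta> x \<bullet> X x)"
    and "(LINT x|lborel. \<eta> x * divergence X x + grad \<eta> x \<bullet> X x) = 0"
proof -
  define h where "h i x = \<eta> x * (X x \<bullet> i)" for i x
  have C1: "Ck_on 1 UNIV (h i)" for i
  proof (rule Ck_on_UNIV_vanish_near_0[OF _ e(1)])
    show "Ck_on 1 (- {0}) (h i)"
      unfolding h_def[abs_def]
      by (intro Ck_on_mult Ck_on_inner Ck_on_const X Ck_on_mono[OF \<eta>]) auto
  qed (simp add: h_def e)
  have D\<eta>: "(\<eta> has_derivative (\<lambda>k. grad \<eta> x \<bullet> k)) (at x)" for x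
    using \<eta> by (intro has_derivative_grad) simp
  have g0: "grad \<eta> 0 = 0"
  proof (rule grad_eqI)
    have "((\<lambda>_. 0) has_derivative (\<lambda>_. 0)) (at (0::'a))" by simp
    then have "(\<eta> has_derivative (\<lambda>_. 0)) (at 0)"
      by (rule has_derivative_transform_within_open[of _ _ _ _ "ball 0 \<epsilon>"]) (use e in auto)
    then show "(\<eta> has_derivative (\<lambda>h. 0 \<bullet> h)) (at 0)" by simp
  qed
  have eq: "frechet_derivative (h i) (at x) i = \<eta> x * (frechet_derivative X (at x) i \<bullet> i) + (grad \<eta> x \<bullet> i) * (X x \<bullet> i)"
    if "i \<in> Basis" for i x
  proof (cases "x = 0")
    \<comment> \<open>X need not be differentiable at 0; whatever value
      \<open>frechet_derivative\<close> takes there is multiplied by \<eta> 0 = 0.\<close>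
    case True
    have "((\<lambda>_. 0) has_derivative (\<lambda>_. 0)) (at (0::'a))" by simp
    then have "(h i has_derivative (\<lambda>_. 0)) (at 0)"
      by (rule has_derivative_transform_within_open[of _ _ _ _ "ball 0 \<epsilon>"]) (use e in \<open>auto simp: h_def\<close>)
    then have "frechet_derivative (h i) (at 0) = (\<lambda>_. 0)" by (rule frechet_derivative_at[symmetric])
    then show ?thesis using True g0 e by simp
  next
    case False
    have "(X has_derivative frechet_derivative X (at x)) (at x)"
      using X False by (simp add: frechet_derivative_works)
    then have "(h i has_derivative (\<lambda>k. \<eta> x * (frechet_derivative X (at x) k \<bullet> i) + (grad \<eta> x \<bullet> k) * (X x \<bullet> i))) (at x)"
      unfolding h_def[abs_def] by (intro has_derivative_mult D\<eta> has_derivative_inner_left)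
    from frechet_derivative_at[OF this] show ?thesis by metis
  qed
  have sum: "(\<Sum>i\<in>Basis. frechet_derivative (h i) (at x) i) = \<eta> x * divergence X x + grad \<eta> x \<bullet> X x" for x
    unfolding divergence_def euclidean_inner[of "grad \<eta> x" "X x"] sum_distrib_left sum.distrib[symmetric]
    by (rule sum.cong) (simp_all add: eq)
  have *: "integrable lborel (\<lambda>x. frechet_derivative (h i) (at x) i)"
    "(LINT x|lborel. frechet_derivative (h i) (at x) i) = 0" if "i \<in> Basis" for i
    using integral_partial_derivative_eq_0[OF C1 _ that, of R i] R by (auto simp: h_def)
  have "integrable lborel (\<lambda>x. \<Sum>i\<in>Basis. frechet_derivative (h i) (at x) i)"
    by (intro Bochner_Integration.integrable_sum *)
  then show "integrable lborel (\<lambda>x. \<eta> x * divergence X x + grad \<eta> x \<bullet> X x)" by (simp add: sum)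
  have "(LINT x|lborel. (\<Sum>i\<in>Basis. frechet_derivative (h i) (at x) i)) = 0"
    by (subst Bochner_Integration.integral_sum) (simp_all add: *)
  then show "(LINT x|lborel. \<eta> x * divergence X x + grad \<eta> x \<bullet> X x) = 0" by (simp add: sum)
qed

section \<open>A C1 cutoff function and its radial versions\<close>

definition pos_square :: "real \<Rightarrow> real" where "pos_square s = (max 0 s)\<^sup>2"

lemma has_real_derivative_pos_square:
  "(pos_square has_real_derivative 2 * max 0 s) (at s)"
proof -
  consider "s < 0" | "s = 0" | "s > 0" by linarith
  then show ?thesis
  proof cases
    case 1
    have "((\<lambda>_. 0) has_real_derivative 0) (at s)" by simp
    then have "(pos_square has_real_derivative 0) (at s)"
      by (rule has_field_derivative_transform_within_open[of _ _ _ "{..<0}"])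
         (use 1 in \<open>auto simp: pos_square_def max_def\<close>)
    then show ?thesis using 1 by simp
  next
    case 2
    have "((\<lambda>t. pos_square t / t) \<longlongrightarrow> 0) (at 0)"
    proof (rule Lim_null_comparison[of _ "\<lambda>t. \<bar>t\<bar>"])
      show "\<forall>\<^sub>F t in at 0. norm (pos_square t / t) \<le> \<bar>t\<bar>"
        by (rule always_eventually) (auto simp: pos_square_def max_def power2_eq_square abs_mult)
    qed (auto intro!: tendsto_eq_intros)
    then show ?thesis using 2 by (simp add: has_field_derivative_iff pos_square_def)
  next
    case 3
    have "((\<lambda>t. t\<^sup>2) has_real_derivative 2 * s) (at s)" by (auto intro!: derivative_eq_intros)
    then have "(pos_square has_real_derivative 2 * s) (at s)"
      by (rule has_field_derivative_transform_within_open[of _ _ _ "{0<..}"])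
         (use 3 in \<open>auto simp: pos_square_def max_def\<close>)
    then show ?thesis using 3 by simp
  qed
qed

text \<open>A C1 transition from 0 on s \<le> 1 to 1 on s \<ge> 2, made of two truncated parabolas:
  the inner one starts at s = 1, the outer one saturates when s - 1 reaches 1.\<close>

definition cutoff :: "real \<Rightarrow> real" where "cutoff s = 1 - pos_square (1 - pos_square (s - 1))"

definition cutoff' :: "real \<Rightarrow> real"
  where "cutoff' s = 4 * max 0 (1 - pos_square (s - 1)) * max 0 (s - 1)"

lemma has_real_derivative_cutoff: "(cutoff has_real_derivative cutoff' s) (at s)"
proof -
  have "((\<lambda>s. pos_square (s - 1)) has_real_derivative 2 * max 0 (s - 1) * 1) (at s)"
    by (rule DERIV_chain2[OF has_real_derivative_pos_square]) (auto intro!: derivative_eq_intros)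
  then have "((\<lambda>s. pos_square (1 - pos_square (s - 1))) has_real_derivative
      2 * max 0 (1 - pos_square (s - 1)) * (- (2 * max 0 (s - 1)))) (at s)"
    by (intro DERIV_chain2[OF has_real_derivative_pos_square]) (auto intro!: derivative_eq_intros)
  then show ?thesis
    unfolding cutoff_def[abs_def] cutoff'_def
    by (auto intro!: derivative_eq_intros)
qed

lemma cutoff_0: "s \<le> 1 \<Longrightarrow> cutoff s = 0"
  and cutoff_1: "s \<ge> 2 \<Longrightarrow> cutoff s = 1"
  and cutoff_bounds: "0 \<le> cutoff s" "cutoff s \<le> 1"
proof -
  show "s \<le> 1 \<Longrightarrow> cutoff s = 0" by (simp add: cutoff_def pos_square_def)
  have "1 - pos_square (s - 1) \<le> 0" if "s \<ge> 2"
    using that one_le_power[of "s - 1" 2] by (simp add: pos_square_def)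
  then show "s \<ge> 2 \<Longrightarrow> cutoff s = 1" by (simp add: cutoff_def pos_square_def[of "1 - _"])
  have "pos_square t \<le> 1" if "t \<le> 1" for t
    using that power_le_one[of "max 0 t" 2] by (simp add: pos_square_def)
  then show "0 \<le> cutoff s" by (simp add: cutoff_def pos_square_def[of "s - 1"])
  show "cutoff s \<le> 1" by (simp add: cutoff_def pos_square_def)
qed

lemma cutoff'_bound: "\<bar>cutoff' s\<bar> \<le> 4" and cutoff'_0: "s \<ge> 2 \<Longrightarrow> cutoff' s = 0"
proof -
  have *: "1 - pos_square (s - 1) \<le> 0" if "s \<ge> 2"
    using that one_le_power[of "s - 1" 2] by (simp add: pos_square_def)
  then show "s \<ge> 2 \<Longrightarrow> cutoff' s = 0" by (simp add: cutoff'_def)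
  have "max 0 (1 - pos_square (s - 1)) * max 0 (s - 1) \<le> 1 * 1" if "s < 2"
    by (rule mult_mono) (use that in \<open>auto simp: pos_square_def\<close>)
  then show "\<bar>cutoff' s\<bar> \<le> 4"
    using \<open>s \<ge> 2 \<Longrightarrow> cutoff' s = 0\<close> by (cases "s < 2") (auto simp: cutoff'_def abs_mult)
qed

lemma continuous_on_pos_square [continuous_intros]:
  "continuous_on S f \<Longrightarrow> continuous_on S (\<lambda>x. pos_square (f x))"
  unfolding pos_square_def by (intro continuous_intros)

lemma Ck_on_cutoff: "Ck_on 1 UNIV cutoff"
proof (rule Ck_on_1I)
  show "(cutoff has_derivative (\<lambda>h. cutoff' s * h)) (at s)" for s
    using has_real_derivative_cutoff[of s] by (simp add: has_field_derivative_def)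
  show "continuous_on UNIV (\<lambda>s. cutoff' s * i)" for i
    unfolding cutoff'_def by (intro continuous_intros)
qed simp

text \<open>The argument is a function of \<open>x \<bullet> x\<close> and not of
  \<open>norm x\<close>, so that the cutoff is C1 at the origin as well. Its gradient is
  radial.\<close>

lemma radial_cutoff:
  fixes x :: "'a::euclidean_space"
  shows "Ck_on 1 UNIV (\<lambda>x::'a. cutoff (a + b * (x \<bullet> x)))"
    and "((\<lambda>x. cutoff (a + b * (x \<bullet> x))) has_derivative (\<lambda>h. (2 * b * cutoff' (a + b * (x \<bullet> x))) *\<^sub>R x \<bullet> h)) (at x)"
proof -
  show "Ck_on 1 UNIV (\<lambda>x::'a. cutoff (a + b * (x \<bullet> x)))"
    by (rule Ck_on_compose[where T = UNIV and f = cutoff, OF open_UNIV Ck_on_cutoff])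
       (intro Ck_on_add Ck_on_mult Ck_on_const Ck_on_inner Ck_on_id open_UNIV | simp)+
  have "((\<lambda>x. a + b * (x \<bullet> x)) has_derivative (\<lambda>h. 2 * b * (x \<bullet> h))) (at x)"
    by (auto intro!: derivative_eq_intros simp: inner_commute algebra_simps)
  from has_derivative_compose[OF this has_real_derivative_cutoff[of "a + b * (x \<bullet> x)", unfolded has_field_derivative_def]]
  show "((\<lambda>x. cutoff (a + b * (x \<bullet> x))) has_derivative (\<lambda>h. (2 * b * cutoff' (a + b * (x \<bullet> x))) *\<^sub>R x \<bullet> h)) (at x)"
    by (rule has_derivative_eq_rhs) (auto simp: algebra_simps)
qed

text \<open>The field is tangential, so it does not see the gradients of the radial cutoffs.\<close>

lemma integral_div_tangential:
  fixes X :: "'a::euclidean_space \<Rightarrow> 'a"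
  assumes X: "Ck_on 1 (- {0}) X" and tang: "\<And>x. X x \<bullet> x = 0"
    and f: "f \<in> borel_measurable borel" "\<And>x. x \<noteq> 0 \<Longrightarrow> norm x < 1 \<Longrightarrow> divergence X x = f x" "\<And>x. norm x < 1 \<Longrightarrow> \<bar>f x\<bar> \<le> C"
  shows "(LINT x:ball 0 1|lborel. f x) = 0"
proof -
  \<comment> \<open>The first factor removes \<open>x \<bullet> x \<le> 1 / n\<close>, the second
    one \<open>x \<bullet> x \<ge> 1 - 1 / n\<close>; both equal 1 in the limit at every other point
    of the open ball. For n = 0 the product is 0.\<close>
  define \<eta> where "\<eta> n x = cutoff (0 + real n * (x \<bullet> x)) * cutoff (real n + (- real n) * (x \<bullet> x))" for n and x :: 'a
  have \<eta>C: "Ck_on 1 UNIV (\<eta> n)" for n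
    unfolding \<eta>_def[abs_def] by (intro Ck_on_mult radial_cutoff open_UNIV)
  have grad: "grad (\<eta> n) x \<bullet> X x = 0" for n x
  proof -
    obtain c where "(\<eta> n has_derivative (\<lambda>h. c *\<^sub>R x \<bullet> h)) (at x)"
    proof
      show "(\<eta> n has_derivative (\<lambda>h. (cutoff (0 + real n * (x \<bullet> x)) * (2 * (- real n) * cutoff' (real n + (- real n) * (x \<bullet> x)))
        + (2 * real n * cutoff' (0 + real n * (x \<bullet> x))) * cutoff (real n + (- real n) * (x \<bullet> x))) *\<^sub>R x \<bullet> h)) (at x)"
        unfolding \<eta>_def[abs_def]
        by (rule has_derivative_eq_rhs[OF has_derivative_mult[OF radial_cutoff(2) radial_cutoff(2)]])
           (auto simp: algebra_simps)
    qed
    then have "grad (\<eta> n) x = c *\<^sub>R x" by (rule grad_eqI)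
    then show ?thesis using tang[of x] by (simp add: inner_commute)
  qed
  have z1: "\<eta> n x = 0" if "norm x \<ge> 1" for n x
  proof -
    have "x \<bullet> x \<ge> 1" using that by (simp add: dot_square_norm)
    then have "real n + - real n * (x \<bullet> x) \<le> 1"
      using mult_left_mono[of 1 "x \<bullet> x" "real n"] by simp
    then show ?thesis by (simp add: \<eta>_def cutoff_0)
  qed
  \<comment> \<open>The radius 1 / (1 + n) is smaller than necessary, but it is also meaningful for
    n = 0.\<close>
  have z2: "\<eta> n x = 0" if "norm x < 1 / (1 + real n)" for n x
  proof -
    have "norm x * norm x \<le> 1 / (1 + real n) * 1"
      using that order.strict_trans2[OF that, of 1] by (intro mult_mono) auto
    then have "real n * (x \<bullet> x) \<le> 1"
      by (simp add: dot_square_norm power2_eq_square field_simps)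
        (smt (verit) mult_nonneg_nonneg norm_ge_zero)
    then show ?thesis by (simp add: \<eta>_def cutoff_0)
  qed
  have "(LINT x|lborel. \<eta> n x * divergence X x + grad (\<eta> n) x \<bullet> X x) = 0" for n
    by (rule divergence_theorem_cutoff(2)[OF X \<eta>C, of "1 / (1 + real n)" n 1]) (use z1 z2 in auto)
  moreover have "\<eta> n x * divergence X x + grad (\<eta> n) x \<bullet> X x = \<eta> n x * f x" for n x
    using z1[of x n] z2[of 0 n] f(2)[of x] by (cases "x = 0"; cases "norm x < 1") (auto simp: grad)
  ultimately have int0: "(LINT x|lborel. \<eta> n x * f x) = 0" for n by simp
  \<comment> \<open>Every cutoff vanishes at the origin, so the limit is the integral over the
    punctured ball; the missing point is a null set.\<close>
  have "(\<lambda>n. LINT x|lborel. \<eta> n x * f x) \<longlonglongrightarrow> (LINT x|lborel. indicator (ball 0 1 - {0}) x * f x)"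
  proof (rule integral_dominated_convergence[where w = "\<lambda>x. \<bar>C\<bar> * indicator (ball 0 1) x"])
    show "(\<lambda>x. indicator (ball 0 1 - {0}) x * f x) \<in> borel_measurable lborel"
      using f(1) by (intro borel_measurable_times borel_measurable_indicator) auto
    have "\<eta> n \<in> borel_measurable borel" for n
      using Ck_on_imp_continuous_on[OF \<eta>C] by (rule borel_measurable_continuous_onI)
    then show "(\<lambda>x. \<eta> n x * f x) \<in> borel_measurable lborel" for n using f(1) by simp
    show "integrable lborel (\<lambda>x::'a. \<bar>C\<bar> * indicator (ball 0 1) x :: real)"
      by (intro integrable_mult_right) (simp add: integrable_indicator_iff emeasure_bounded_finite[unfolded infinity_ennreal_def])
    have "norm (\<eta> n x * f x) \<le> \<bar>C\<bar> * indicator (ball 0 1) x" for n x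
    proof (cases "norm x < 1")
      case True
      have "\<bar>\<eta> n x\<bar> \<le> 1" using mult_mono[OF cutoff_bounds(2) cutoff_bounds(2)] cutoff_bounds(1)
        by (auto simp: \<eta>_def abs_mult)
      then have "\<bar>\<eta> n x\<bar> * \<bar>f x\<bar> \<le> 1 * \<bar>C\<bar>" using f(3)[OF True] by (intro mult_mono) auto
      then show ?thesis using True by (simp add: abs_mult)
    qed (use z1 in auto)
    then show "AE x in lborel. norm (\<eta> n x * f x) \<le> \<bar>C\<bar> * indicator (ball 0 1) x" for n by simp
    have "(\<lambda>n. \<eta> n x * f x) \<longlonglongrightarrow> indicator (ball 0 1 - {0}) x * f x" for x
    proof (cases "x = 0 \<or> norm x \<ge> 1")
      case True
      then have "\<eta> n x = 0" for n using z1[of x n] by (auto simp: \<eta>_def cutoff_0)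
      then show ?thesis using True by auto
    next
      case False
      define y where "y = x \<bullet> x"
      have y: "0 < y" "y < 1" using False by (auto simp: y_def dot_square_norm power_less_one_iff)
      have "eventually (\<lambda>n. real n * y \<ge> 2 \<and> real n * (1 - y) \<ge> 2) sequentially"
      proof -
        have "filterlim (\<lambda>n. real n * c) at_top sequentially" if "c > 0" for c
          using that by (rule filterlim_at_top_mult_tendsto_pos[OF tendsto_const _ filterlim_real_sequentially])
        from this[of y] this[of "1 - y"] y show ?thesis
          by (intro eventually_conj) (auto simp: filterlim_at_top)
      qed
      then have "eventually (\<lambda>n. \<eta> n x * f x = f x) sequentially"
        by eventually_elim (auto simp: \<eta>_def y_def[symmetric] cutoff_1 algebra_simps)
      then show ?thesis using False by (simp add: tendsto_eventually)
    qed
    then show "AE x in lborel. (\<lambda>n. \<eta> n x * f x) \<longlonglongrightarrow> indicator (ball 0 1 - {0}) x * f x" by simp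
  qed
  then have "(LINT x|lborel. indicator (ball 0 1 - {0}) x * f x) = 0"
    using LIMSEQ_unique[OF _ tendsto_const[of 0]] by (simp add: int0)
  moreover have "(LINT x|lborel. indicator (ball 0 1 - {0}) x * f x) = (LINT x|lborel. indicator (ball 0 1) x * f x)"
  proof (rule integral_cong_AE)
    show "AE x in lborel. indicator (ball 0 1 - {0}) x * f x = indicator (ball 0 1) x * f x"
      using AE_lborel_singleton[of 0] by eventually_elim (auto simp: indicator_def)
  qed (use f(1) in \<open>auto intro!: borel_measurable_times borel_measurable_indicator\<close>)
  ultimately show ?thesis by (simp add: set_lebesgue_integral_def)
qed

section \<open>Homogeneous solutions are p-harmonic across the origin\<close>

lemma hom0_bounded:
  fixes f :: "'a::euclidean_space \<Rightarrow> 'b::real_normed_vector"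
  assumes "continuous_on (- {0}) f" "\<And>x. x \<noteq> 0 \<Longrightarrow> f (sgn x) = f x"
  obtains M where "M > 0" "\<And>x. x \<noteq> 0 \<Longrightarrow> norm (f x) \<le> M"
proof -
  have "compact (f ` sphere 0 1)"
    by (rule compact_continuous_image) (auto intro: continuous_on_subset[OF assms(1)])
  then obtain M where M: "M > 0" "\<forall>y\<in>f ` sphere 0 1. norm y \<le> M"
    using compact_imp_bounded bounded_pos by blast
  show ?thesis
  proof (rule that[OF M(1)])
    fix x :: 'a assume "x \<noteq> 0"
    then have "sgn x \<in> sphere 0 1" by (simp add: norm_sgn)
    then show "norm (f x) \<le> M" using M(2) assms(2)[OF \<open>x \<noteq> 0\<close>] by (metis imageI)
  qed
qed

text \<open>Nothing is known about f at 0. Continuity there comes from the bound M and from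
  \<open>0 powr a = 0\<close>.\<close>

lemma continuous_on_norm_powr_scaleR:
  fixes f :: "'a::euclidean_space \<Rightarrow> 'b::real_normed_vector"
  assumes "a > 0" "continuous_on (- {0}) f" "\<And>x. x \<noteq> 0 \<Longrightarrow> norm (f x) \<le> M"
  shows "continuous_on UNIV (\<lambda>x. norm x powr a *\<^sub>R f x)"
proof (intro continuous_at_imp_continuous_on ballI)
  fix x :: 'a
  show "isCont (\<lambda>x. norm x powr a *\<^sub>R f x) x"
  proof (cases "x = 0")
    case True
    have "((\<lambda>x::'a. norm x powr a * M) \<longlongrightarrow> 0 powr a * M) (at 0)"
      using assms(1) by (intro tendsto_intros tendsto_powr') (auto intro!: tendsto_eq_intros)
    moreover have "norm (norm x powr a *\<^sub>R f x) \<le> norm x powr a * M" if "x \<noteq> 0" for x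
      using mult_left_mono[OF assms(3)[OF that], of "norm x powr a"] by simp
    then have "\<forall>\<^sub>F x in at 0. norm (norm x powr a *\<^sub>R f x) \<le> norm x powr a * M"
      unfolding eventually_at_filter by (intro always_eventually) blast
    ultimately have "((\<lambda>x. norm x powr a *\<^sub>R f x) \<longlongrightarrow> 0) (at 0)"
      by (rule_tac Lim_null_comparison) (simp_all)
    then show ?thesis using True assms(1) by (simp add: isCont_def)
  next
    case False
    have "continuous_on (- {0}) (\<lambda>x. norm x powr a *\<^sub>R f x)"
      by (intro continuous_intros assms) auto
    then show ?thesis using False by (simp add: continuous_on_eq_continuous_at)
  qed
qed

section \<open>The weak formulation for homogeneous functions\<close>

lemma test_function_onE:
  assumes "test_function_on UNIV \<phi>"
  obtains R where "R > 0" "Ck_on 1 UNIV \<phi>" "\<And>x. norm x \<ge> R \<Longrightarrow> \<phi> x = 0" "\<And>x. norm x \<ge> R \<Longrightarrow> grad \<phi> x = 0"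
proof -
  have C1: "Ck_on 1 UNIV \<phi>" using assms by (simp only: test_function_on_def Cinf_on_def)
  have "bounded (support_on UNIV \<phi>)"
    using assms bounded_subset[OF compact_imp_bounded closure_subset] by (auto simp: test_function_on_def)
  then obtain R where R: "R > 0" "\<And>x. x \<in> support_on UNIV \<phi> \<Longrightarrow> norm x \<le> R"
    unfolding bounded_pos by blast
  have z: "\<phi> x = 0" if "norm x > R" for x using R(2)[of x] that by (auto simp: support_on_def)
  have gz: "grad \<phi> x = 0" if "norm x > R" for x
  proof (rule grad_eqI)
    have "((\<lambda>_. 0) has_derivative (\<lambda>_. 0)) (at x)" by simp
    then have "(\<phi> has_derivative (\<lambda>_. 0)) (at x)"
      by (rule has_derivative_transform_within_open[of _ _ _ _ "{x. norm x > R}"])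
         (use that z in \<open>auto intro: open_Collect_less continuous_intros\<close>)
    then show "(\<phi> has_derivative (\<lambda>h. 0 \<bullet> h)) (at x)" by simp
  qed
  show ?thesis
    by (rule that[of "R + 1"]) (use R C1 z gz in auto)
qed

context sph_C2
begin

lemma bounded_v: obtains M where "M > 0" "\<And>x. x \<noteq> 0 \<Longrightarrow> norm (v (sgn x)) \<le> M"
  using hom0_bounded[OF Ck_on_imp_continuous_on[OF C1_v]] by auto

lemma bounded_Z: obtains M where "M > 0" "\<And>x. x \<noteq> 0 \<Longrightarrow> norm (Z lam x) \<le> M"
  using hom0_bounded[OF Ck_on_imp_continuous_on[OF C1_Z]] Z_hom(2) by metis

text \<open>The function is O(|x|^lam), and lam > 1 makes this o(|x|).\<close>

lemma has_derivative_radial_mult_0: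
  assumes "lam > 1"
  shows "((\<lambda>x. norm x powr lam * v (sgn x)) has_derivative (\<lambda>h. 0)) (at 0)"
proof -
  obtain M where M: "M > 0" "\<And>x. x \<noteq> 0 \<Longrightarrow> norm (v (sgn x)) \<le> M" using bounded_v by blast
  have "((\<lambda>x::'a. norm x powr (lam - 1) * M) \<longlongrightarrow> 0 powr (lam - 1) * M) (at 0)"
    using assms by (intro tendsto_intros tendsto_powr') (auto intro!: tendsto_eq_intros)
  moreover have "norm ((norm x powr lam * v (sgn x)) / norm x) \<le> norm x powr (lam - 1) * M" if "x \<noteq> 0" for x
    using M(2)[OF that] M(1) that by (simp add: abs_mult powr_diff divide_right_mono mult_left_mono)
  then have "\<forall>\<^sub>F x in at 0. norm ((norm x powr lam * v (sgn x)) / norm x) \<le> norm x powr (lam - 1) * M"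
    unfolding eventually_at_filter by (intro always_eventually) blast
  ultimately have "((\<lambda>x. (norm x powr lam * v (sgn x)) / norm x) \<longlongrightarrow> 0) (at 0)"
    by (rule_tac Lim_null_comparison) simp_all
  then show ?thesis
    using assms tendsto_norm_zero[of "\<lambda>x. (norm x powr lam * v (sgn x)) / norm x" "at 0"]
    by (simp add: has_derivative_at abs_mult)
qed

lemma grad_radial_mult_all:
  assumes "lam > 1"
  shows "grad (\<lambda>x. norm x powr lam * v (sgn x)) = (\<lambda>x. norm x powr (lam - 1) *\<^sub>R Z lam x)"
proof
  fix x show "grad (\<lambda>x. norm x powr lam * v (sgn x)) x = norm x powr (lam - 1) *\<^sub>R Z lam x"
    by (cases "x = 0") (use assms grad_eqI[of _ 0 0] has_derivative_radial_mult_0 in \<open>auto simp: grad_radial_mult\<close>)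
qed

lemma continuous_grad:
  assumes "lam > 1"
  shows "continuous_on UNIV (\<lambda>x. norm x powr (lam - 1) *\<^sub>R Z lam x)"
proof -
  obtain M where "\<And>x. x \<noteq> 0 \<Longrightarrow> norm (Z lam x) \<le> M" using bounded_Z by blast
  then show ?thesis
    using assms Ck_on_imp_continuous_on[OF C1_Z] by (intro continuous_on_norm_powr_scaleR) auto
qed

lemma has_derivative_radial_mult_all:
  assumes "lam > 1"
  shows "((\<lambda>x. norm x powr lam * v (sgn x)) has_derivative (\<lambda>h. (norm x powr (lam - 1) *\<^sub>R Z lam x) \<bullet> h)) (at x)"
proof (cases "x = 0")
  case True
  then show ?thesis using assms has_derivative_radial_mult_0[OF assms] by simp
next
  case False
  then show ?thesis by (rule has_derivative_radial_mult)
qed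

lemma C1_radial_mult:
  assumes "lam > 1"
  shows "Ck_on 1 UNIV (\<lambda>x. norm x powr lam * v (sgn x))"
  by (rule Ck_on_1I[OF _ has_derivative_radial_mult_all[OF assms]])
     (use continuous_grad[OF assms] in \<open>auto intro!: continuous_on_inner continuous_on_const simp del: inner_scaleR_left\<close>)

lemma weak_gradient_radial_mult:
  assumes "lam > 1"
  shows "weak_gradient_on UNIV (\<lambda>x. norm x powr lam * v (sgn x)) (\<lambda>x. norm x powr (lam - 1) *\<^sub>R Z lam x)"
  unfolding weak_gradient_on_def
proof (intro allI impI ballI)
  fix \<phi> :: "'a \<Rightarrow> real" and i :: 'a assume \<phi>: "test_function_on UNIV \<phi>" and i: "i \<in> Basis"
  from \<phi> obtain R where R: "Ck_on 1 UNIV \<phi>" "\<And>x. norm x \<ge> R \<Longrightarrow> \<phi> x = 0" "\<And>x. norm x \<ge> R \<Longrightarrow> grad \<phi> x = 0"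
    by (rule test_function_onE) blast
  let ?u = "\<lambda>x. norm x powr lam * v (sgn x)" and ?G = "\<lambda>x. norm x powr (lam - 1) *\<^sub>R Z lam x"
  have cG: "continuous_on UNIV ?G" by (rule continuous_grad[OF assms])
  have cu: "continuous_on UNIV ?u" by (rule Ck_on_imp_continuous_on[OF C1_radial_mult[OF assms]])
  have cp: "continuous_on UNIV \<phi>" by (rule Ck_on_imp_continuous_on[OF R(1)])
  have cg: "continuous_on UNIV (grad \<phi>)"
    using Ck_on_grad[of UNIV 0 \<phi>] R(1) by simp
  have "frechet_derivative (\<lambda>x. ?u x * \<phi> x) (at x) i = ?u x * (grad \<phi> x \<bullet> i) + (?G x \<bullet> i) * \<phi> x" for x
  proof -
    have "\<phi> differentiable (at x)" using R(1) by simp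
    from fun_cong[OF frechet_derivative_at[OF has_derivative_mult[OF
      has_derivative_radial_mult_all[OF assms] has_derivative_grad[OF this]]], of i]
    show ?thesis by (rule sym)
  qed
  moreover have "(LINT x|lborel. frechet_derivative (\<lambda>x. ?u x * \<phi> x) (at x) i) = 0"
    by (rule integral_partial_derivative_eq_0(2)[OF Ck_on_mult[OF open_UNIV C1_radial_mult[OF assms] R(1)] _ i, of R])
       (simp add: R)
  ultimately have "(LINT x|lborel. ?u x * (grad \<phi> x \<bullet> i) + (?G x \<bullet> i) * \<phi> x) = 0" by simp
  moreover have "integrable lborel (\<lambda>x. ?u x * (grad \<phi> x \<bullet> i))"
    by (rule integrable_continuous_bounded_support[of _ R])
       (use R(3) in \<open>auto intro!: continuous_on_mult[OF cu] continuous_on_inner cg continuous_on_const\<close>)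
  moreover have "integrable lborel (\<lambda>x. (?G x \<bullet> i) * \<phi> x)"
    by (rule integrable_continuous_bounded_support[of _ R])
       (use R(2) in \<open>auto intro!: continuous_on_mult cp continuous_on_inner cG continuous_on_const simp del: inner_scaleR_left\<close>)
  ultimately have "(LINT x|lborel. ?u x * (grad \<phi> x \<bullet> i)) = - (LINT x|lborel. (?G x \<bullet> i) * \<phi> x)"
    by (subst (asm) Bochner_Integration.integral_add) auto
  then show "(LINT x:UNIV|lborel. ?u x * (grad \<phi> x \<bullet> i)) = - (LINT x:UNIV|lborel. (?G x \<bullet> i) * \<phi> x)"
    by (simp add: set_lebesgue_integral_def)
qed

text \<open>The test function is cut off near the origin. The gradient of the cutoff is O(n) and
  lives on a ball of radius O(1/n), while the flux stays bounded; the error is O(n^(1-d)), which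
  tends to 0 already for d = 2.\<close>

lemma flux_weakly_divergence_free:
  assumes lam: "lam > 1" and p: "p > 1" and dim: "DIM('a) \<ge> 2"
    and Z: "\<And>x. x \<noteq> 0 \<Longrightarrow> Z lam x \<noteq> 0" and L: "\<And>\<omega>. norm \<omega> = 1 \<Longrightarrow> sph_L p lam v \<omega> = 0"
    and \<phi>: "test_function_on UNIV \<phi>"
  shows "continuous_on UNIV (flux lam p)" "(LINT x|lborel. flux lam p x \<bullet> grad \<phi> x) = 0"
proof -
  let ?X = "flux lam p"
  have C1: "Ck_on 1 (- {0}) ?X" using Z by (rule flux_C1)
  obtain M where M: "\<And>x. x \<noteq> 0 \<Longrightarrow> norm (norm (Z lam x) powr (p - 2) *\<^sub>R Z lam x) \<le> M"
  proof (rule hom0_bounded[of "\<lambda>x. norm (Z lam x) powr (p - 2) *\<^sub>R Z lam x"])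
    show "continuous_on (- {0}) (\<lambda>x. norm (Z lam x) powr (p - 2) *\<^sub>R Z lam x)"
      using Z Ck_on_imp_continuous_on[OF C1_Z] by (intro continuous_intros) auto
  qed (auto simp: Z_hom)
  show cX: "continuous_on UNIV ?X"
    unfolding flux_def[abs_def]
  proof (rule continuous_on_norm_powr_scaleR[OF _ _ M])
    show "continuous_on (- {0}) (\<lambda>x. norm (Z lam x) powr (p - 2) *\<^sub>R Z lam x)"
      using Z Ck_on_imp_continuous_on[OF C1_Z] by (intro continuous_intros) auto
  qed (use lam p in auto)
  from \<phi> obtain R where R: "Ck_on 1 UNIV \<phi>" "\<And>x. norm x \<ge> R \<Longrightarrow> \<phi> x = 0" "\<And>x. norm x \<ge> R \<Longrightarrow> grad \<phi> x = 0"
    by (rule test_function_onE) blast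
  have cp: "continuous_on UNIV \<phi>" by (rule Ck_on_imp_continuous_on[OF R(1)])
  have cg: "continuous_on UNIV (grad \<phi>)"
    using Ck_on_grad[of UNIV 0 \<phi>] R(1) by simp
  \<comment> \<open>Zero for \<open>norm x\<close> up to 1 / (n+1), and one from sqrt 2 / (n+1)
    onwards.\<close>
  define \<kappa> where "\<kappa> n x = cutoff (0 + (real (Suc n))\<^sup>2 * (x \<bullet> x))" for n and x :: 'a
  define \<kappa>' where "\<kappa>' n x = (2 * (real (Suc n))\<^sup>2 * cutoff' (0 + (real (Suc n))\<^sup>2 * (x \<bullet> x))) *\<^sub>R x" for n and x :: 'a
  have D\<kappa>: "(\<kappa> n has_derivative (\<lambda>h. \<kappa>' n x \<bullet> h)) (at x)" for n x
    unfolding \<kappa>_def[abs_def] \<kappa>'_def by (rule radial_cutoff)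
  have C\<kappa>: "Ck_on 1 UNIV (\<kappa> n)" for n unfolding \<kappa>_def[abs_def] by (rule radial_cutoff)
  have c\<kappa>: "continuous_on UNIV (\<kappa> n)" for n by (rule Ck_on_imp_continuous_on[OF C\<kappa>])
  have c\<kappa>': "continuous_on UNIV (\<kappa>' n)" for n
    unfolding \<kappa>'_def[abs_def] cutoff'_def[abs_def] by (intro continuous_intros)
  define I1 where "I1 n x = \<kappa> n x * (?X x \<bullet> grad \<phi> x)" for n x
  define I2 where "I2 n x = \<phi> x * (\<kappa>' n x \<bullet> ?X x)" for n x
  have iI1: "integrable lborel (I1 n)" for n
    unfolding I1_def[abs_def]
    by (rule integrable_continuous_bounded_support[of _ R])
       (use R(3) in \<open>auto intro!: continuous_on_mult c\<kappa> continuous_on_inner cg cX\<close>)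
  have iI2: "integrable lborel (I2 n)" for n
    unfolding I2_def[abs_def]
    by (rule integrable_continuous_bounded_support[of _ R])
       (use R(2) in \<open>auto intro!: continuous_on_mult c\<kappa>' cp continuous_on_inner cg cX\<close>)
  have sum0: "(LINT x|lborel. I1 n x) = - (LINT x|lborel. I2 n x)" for n
  proof -
    have near: "\<kappa> n x * \<phi> x = 0" if "norm x < 1 / real (Suc n)" for x
    proof -
      have "(real (Suc n) * norm x)\<^sup>2 \<le> 1"
        using that by (intro power_le_one) (auto simp: field_simps)
      then show ?thesis by (simp add: \<kappa>_def cutoff_0 dot_square_norm power_mult_distrib)
    qed
    have "(LINT x|lborel. (\<kappa> n x * \<phi> x) * divergence ?X x + grad (\<lambda>x. \<kappa> n x * \<phi> x) x \<bullet> ?X x) = 0"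
      by (rule divergence_theorem_cutoff(2)[OF C1 Ck_on_mult[OF open_UNIV C\<kappa> R(1)], of "1 / real (Suc n)" n R])
         (use near R(2) in auto)
    moreover have "(\<kappa> n x * \<phi> x) * divergence ?X x + grad (\<lambda>x. \<kappa> n x * \<phi> x) x \<bullet> ?X x = I1 n x + I2 n x" for x
    proof -
      have "(\<kappa> n x * \<phi> x) * divergence ?X x = 0"
        using near[of 0] div_flux[OF _ Z L, of x] by (cases "x = 0") (auto simp: divergence_def)
      moreover have "grad (\<lambda>x. \<kappa> n x * \<phi> x) x = \<kappa> n x *\<^sub>R grad \<phi> x + \<phi> x *\<^sub>R \<kappa>' n x"
      proof (rule grad_eqI)
        have "\<phi> differentiable (at x)" using R(1) by simp
        from has_derivative_mult[OF D\<kappa> has_derivative_grad[OF this]]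
        show "((\<lambda>x. \<kappa> n x * \<phi> x) has_derivative (\<lambda>h. (\<kappa> n x *\<^sub>R grad \<phi> x + \<phi> x *\<^sub>R \<kappa>' n x) \<bullet> h)) (at x)"
          by (rule has_derivative_eq_rhs) (simp add: inner_add_left mult.commute)
      qed
      ultimately show ?thesis
        by (simp add: I1_def I2_def inner_add_left inner_commute[of "flux lam p x"])
    qed
    ultimately have "(LINT x|lborel. I1 n x + I2 n x) = 0" by simp
    then show ?thesis using iI1 iI2 by simp
  qed
  have bounded_on_cball: "\<exists>B>0. \<forall>x\<in>cball 0 r. norm (f x) \<le> B"
    if "continuous_on UNIV f" for f :: "'a \<Rightarrow> 'b::real_normed_vector" and r
  proof -
    have "compact (f ` cball 0 r)"
      by (rule compact_continuous_image) (auto intro: continuous_on_subset[OF that])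
    then show ?thesis using compact_imp_bounded[of "f ` cball 0 r"] unfolding bounded_pos by auto
  qed
  have "(\<lambda>n. LINT x|lborel. I1 n x) \<longlonglongrightarrow> (LINT x|lborel. ?X x \<bullet> grad \<phi> x)"
  proof (rule integral_dominated_convergence[where w = "\<lambda>x. \<bar>?X x \<bullet> grad \<phi> x\<bar>"])
    have "integrable lborel (\<lambda>x. ?X x \<bullet> grad \<phi> x)"
      by (rule integrable_continuous_bounded_support[of _ R])
         (use R(3) in \<open>auto intro!: continuous_on_inner cg cX\<close>)
    then show "integrable lborel (\<lambda>x. \<bar>?X x \<bullet> grad \<phi> x\<bar>)" "(\<lambda>x. ?X x \<bullet> grad \<phi> x) \<in> borel_measurable lborel"
      by auto
    show "I1 n \<in> borel_measurable lborel" for n using iI1 by auto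
    have "norm (I1 n x) \<le> 1 * \<bar>?X x \<bullet> grad \<phi> x\<bar>" for n x
      unfolding I1_def norm_mult by (intro mult_mono) (auto simp: \<kappa>_def cutoff_bounds)
    then show "AE x in lborel. norm (I1 n x) \<le> \<bar>?X x \<bullet> grad \<phi> x\<bar>" for n by simp
    have "(\<lambda>n. I1 n x) \<longlonglongrightarrow> ?X x \<bullet> grad \<phi> x" if "x \<noteq> 0" for x
    proof -
      define y where "y = x \<bullet> x"
      have y: "y > 0" using that by (simp add: y_def)
      have "filterlim (\<lambda>n. real n * y) at_top sequentially"
        using y by (intro filterlim_at_top_mult_tendsto_pos[OF tendsto_const _ filterlim_real_sequentially])
      then have "eventually (\<lambda>n. real n * y \<ge> 2) sequentially" by (simp add: filterlim_at_top)
      then have "eventually (\<lambda>n. I1 n x = ?X x \<bullet> grad \<phi> x) sequentially"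
      proof eventually_elim
        case (elim n)
        have "real n * y \<le> (real (Suc n))\<^sup>2 * y"
          using y by (intro mult_right_mono) (auto simp: power2_eq_square algebra_simps)
        then show ?case using elim by (simp add: I1_def \<kappa>_def y_def[symmetric] cutoff_1)
      qed
      then show ?thesis by (rule tendsto_eventually)
    qed
    then show "AE x in lborel. (\<lambda>n. I1 n x) \<longlonglongrightarrow> ?X x \<bullet> grad \<phi> x"
      using AE_lborel_singleton[of 0] by auto
  qed
  moreover have "(\<lambda>n. LINT x|lborel. I2 n x) \<longlonglongrightarrow> 0"
  proof -
    obtain B1 B2 where B: "B1 > 0" "\<forall>x\<in>cball 0 2. norm (\<phi> x) \<le> B1" "B2 > 0" "\<forall>x\<in>cball 0 2. norm (?X x) \<le> B2"
      using bounded_on_cball[OF cp, of 2] bounded_on_cball[OF cX, of 2] by blast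
    define V where "V = unit_ball_vol (real DIM('a))"
    have bnd: "\<bar>LINT x|lborel. I2 n x\<bar> \<le> B1 * (16 * B2) * V * 4 / real (Suc n)" if "n \<ge> 1" for n
    proof -
      define N where "N = real (Suc n)"
      \<comment> \<open>With n \<ge> 1 one has 2 / N \<le> 1, so that in the volume bound the
        exponent \<open>DIM('a)\<close> may be lowered to 2.\<close>
      have N: "N \<ge> 2" using that by (simp add: N_def)
      have pt: "\<bar>I2 n x\<bar> \<le> B1 * (16 * N * B2) * indicator (ball 0 (2 / N)) x" for x
      proof (cases "N\<^sup>2 * (x \<bullet> x) \<ge> 2")
        case True
        then have "\<kappa>' n x = 0"
          using cutoff'_0[of "0 + N\<^sup>2 * (x \<bullet> x)"] unfolding \<kappa>'_def N_def by simp
        then show ?thesis using B N by (simp add: I2_def)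
      next
        case False
        then have "(N * norm x)\<^sup>2 < 2\<^sup>2" by (simp add: dot_square_norm power_mult_distrib)
        then have Nx: "N * norm x < 2" by (rule power_less_imp_less_base) simp
        then have x: "x \<in> ball 0 (2 / N)" using N by (simp add: field_simps)
        have "norm x < 2"
          using Nx N mult_right_mono[of 1 N "norm x"] by simp
        then have x2: "x \<in> cball 0 2" by simp
        \<comment> \<open>The gradient has size 2 N^2 |cutoff'| |x|; on the support of
          \<open>cutoff'\<close> one of the factors N is absorbed by N |x| < 2.\<close>
        have "norm (\<kappa>' n x) = 2 * N * \<bar>cutoff' (0 + N\<^sup>2 * (x \<bullet> x))\<bar> * (N * norm x)"
          unfolding \<kappa>'_def N_def by (simp add: power2_eq_square abs_mult)
        also have "\<dots> \<le> 2 * N * 4 * 2"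
          using Nx N by (intro mult_mono cutoff'_bound) auto
        finally have "norm (\<kappa>' n x) \<le> 16 * N" by simp
        then have "\<bar>\<kappa>' n x \<bullet> ?X x\<bar> \<le> 16 * N * B2"
        proof -
          have "norm (\<kappa>' n x) * norm (?X x) \<le> 16 * N * B2"
            using \<open>norm (\<kappa>' n x) \<le> 16 * N\<close> bspec[OF B(4) x2] N by (intro mult_mono) auto
          then show ?thesis using Cauchy_Schwarz_ineq2[of "\<kappa>' n x" "?X x"] by linarith
        qed
        then have "\<bar>I2 n x\<bar> \<le> B1 * (16 * N * B2)"
          unfolding I2_def abs_mult using bspec[OF B(2) x2] B(1) by (intro mult_mono) auto
        then show ?thesis using x by simp
      qed
      have int: "integrable lborel (indicator (ball 0 (2 / N)) :: 'a \<Rightarrow> real)"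
        by (simp add: integrable_indicator_iff emeasure_bounded_finite[unfolded infinity_ennreal_def])
      have "\<bar>LINT x|lborel. I2 n x\<bar> \<le> (LINT x|lborel. \<bar>I2 n x\<bar>)" by (rule integral_abs_bound)
      also have "\<dots> \<le> (LINT x|lborel. B1 * (16 * N * B2) * indicator (ball 0 (2 / N)) (x :: 'a))"
        using iI2 int pt by (intro integral_mono) auto
      also have "\<dots> = B1 * (16 * N * B2) * measure lborel (ball (0 :: 'a) (2 / N))" by simp
      also have "measure lborel (ball (0 :: 'a) (2 / N)) = V * (2 / N) ^ DIM('a)"
        unfolding V_def using N by (intro content_ball) auto
      also have "B1 * (16 * N * B2) * (V * (2 / N) ^ DIM('a)) \<le> B1 * (16 * N * B2) * (V * (2 / N) ^ 2)"
        using B N dim by (intro mult_left_mono power_decreasing) (auto simp: V_def unit_ball_vol_nonneg)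
      also have "\<dots> = B1 * (16 * B2) * V * 4 / N" using N by (simp add: field_simps power2_eq_square)
      finally show ?thesis by (simp add: N_def)
    qed
    have "(\<lambda>n. B1 * (16 * B2) * V * 4 * inverse (real (Suc n))) \<longlonglongrightarrow> B1 * (16 * B2) * V * 4 * 0"
      by (intro tendsto_mult_left LIMSEQ_inverse_real_of_nat)
    then have lim0: "(\<lambda>n. B1 * (16 * B2) * V * 4 * inverse (real (Suc n))) \<longlonglongrightarrow> 0" by simp
    have "\<forall>\<^sub>F n in sequentially. norm (LINT x|lborel. I2 n x) \<le> B1 * (16 * B2) * V * 4 * inverse (real (Suc n))"
      using eventually_ge_at_top[of 1]
    proof eventually_elim
      case (elim n)
      from bnd[OF elim] show ?case by (simp only: real_norm_def divide_inverse)
    qed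
    then show ?thesis using lim0 by (rule Lim_null_comparison)
  qed
  then have "(\<lambda>n. LINT x|lborel. I1 n x) \<longlonglongrightarrow> 0"
    unfolding sum0 using tendsto_minus by fastforce
  ultimately show "(LINT x|lborel. ?X x \<bullet> grad \<phi> x) = 0" by (rule LIMSEQ_unique)
qed

lemma p_harmonic_radial_mult:
  assumes lam: "lam > 1" and p: "p > 1" and dim: "DIM('a) \<ge> 2"
    and Z: "\<And>x. x \<noteq> 0 \<Longrightarrow> Z lam x \<noteq> 0" and L: "\<And>\<omega>. norm \<omega> = 1 \<Longrightarrow> sph_L p lam v \<omega> = 0"
  shows "p_harmonic_on p UNIV (\<lambda>x. norm x powr lam * v (sgn x))"
  unfolding p_harmonic_on_def
proof (intro conjI exI[of _ "\<lambda>x. norm x powr (lam - 1) *\<^sub>R Z lam x"] allI impI)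
  let ?G = "\<lambda>x. norm x powr (lam - 1) *\<^sub>R Z lam x"
  have cG: "continuous_on UNIV ?G" by (rule continuous_grad[OF lam])
  show "continuous_on UNIV (\<lambda>x. norm x powr lam * v (sgn x))"
    by (rule Ck_on_imp_continuous_on[OF C1_radial_mult[OF lam]])
  show "weak_gradient_on UNIV (\<lambda>x. norm x powr lam * v (sgn x)) ?G"
    by (rule weak_gradient_radial_mult[OF lam])
  show "Lp_loc_on p UNIV ?G"
    unfolding Lp_loc_on_def
  proof (intro conjI allI impI)
    show "set_borel_measurable lborel UNIV ?G"
      using borel_measurable_continuous_onI[OF cG] by (simp add: set_borel_measurable_def)
    fix K :: "'a set" assume "compact K \<and> K \<subseteq> UNIV"
    then show "set_integrable lborel K (\<lambda>x. norm (?G x) powr p)"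
      unfolding set_integrable_def using p
      by (intro borel_integrable_compact continuous_on_powr' continuous_on_norm continuous_on_const
            continuous_on_subset[OF cG]) auto
  qed
  fix \<phi> :: "'a \<Rightarrow> real" assume \<phi>: "test_function_on UNIV \<phi>"
  have "norm (?G x) powr (p - 2) * (?G x \<bullet> grad \<phi> x) = flux lam p x \<bullet> grad \<phi> x" for x
  proof (cases "x = 0")
    case False
    have "norm (?G x) powr (p - 2) *\<^sub>R ?G x = flux lam p x"
      using flux_grad[OF False, of p lam] p by (simp add: grad_radial_mult[OF False])
    then show ?thesis by (metis inner_scaleR_left)
  qed (simp add: flux_def)
  then show "(LINT x:UNIV|lborel. norm (?G x) powr (p - 2) * (?G x \<bullet> grad \<phi> x)) = 0"
    using flux_weakly_divergence_free(2)[OF assms \<phi>] by (simp add: set_lebesgue_integral_def del: inner_scaleR_left norm_scaleR)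
qed

section \<open>Hoelder continuity of the gradient\<close>

text \<open>The field has degree a, so its derivative has degree a - 1; the constant is found on the
  compact unit sphere.\<close>

lemma norm_derivative_radial_power:
  obtains C where "C > 0" "\<And>x. x \<noteq> 0 \<Longrightarrow> \<exists>D. ((\<lambda>x. norm x powr a *\<^sub>R Z lam x) has_derivative D) (at x)
    \<and> onorm D \<le> C * norm x powr (a - 1)"
proof -
  obtain M where M: "M > 0" "\<And>x. x \<noteq> 0 \<Longrightarrow> norm (Z lam x) \<le> M" using bounded_Z by blast
  let ?D = "\<lambda>z. frechet_derivative (Z lam) (at z)"
  have D: "(Z lam has_derivative ?D z) (at z)" if "z \<noteq> 0" for z
    using C1_Z that by (simp add: frechet_derivative_works)
  have "continuous_on (- {0}) (\<lambda>z. \<Sum>i\<in>Basis. norm (?D z i))"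
    using C1_Z by (intro continuous_intros) simp
  then have "compact ((\<lambda>z. \<Sum>i\<in>Basis. norm (?D z i)) ` sphere 0 1)"
    by (intro compact_continuous_image) (auto intro: continuous_on_subset)
  then obtain B where B: "B > 0" "\<forall>y\<in>(\<lambda>z. \<Sum>i\<in>Basis. norm (?D z i)) ` sphere 0 1. norm y \<le> B"
    using compact_imp_bounded bounded_pos by blast
  have Bz: "norm (?D z h) \<le> B * norm h" if "norm z = 1" for z h
  proof -
    have "linear (?D z)" using D[of z] that has_derivative_linear by force
    then have "?D z (\<Sum>i\<in>Basis. (h \<bullet> i) *\<^sub>R i) = (\<Sum>i\<in>Basis. (h \<bullet> i) *\<^sub>R ?D z i)"
      by (simp add: linear_sum linear_scale)
    then have "norm (?D z h) = norm (\<Sum>i\<in>Basis. (h \<bullet> i) *\<^sub>R ?D z i)"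
      by (simp only: euclidean_representation)
    also have "\<dots> \<le> (\<Sum>i\<in>Basis. norm h * norm (?D z i))"
      by (rule order.trans[OF norm_sum]) (auto intro!: sum_mono mult_right_mono Basis_le_norm)
    also have "\<dots> = norm h * (\<Sum>i\<in>Basis. norm (?D z i))" by (simp add: sum_distrib_left)
    also have "\<dots> \<le> norm h * B"
    proof (rule mult_left_mono)
      have "norm (\<Sum>i\<in>Basis. norm (?D z i)) \<le> B" using B(2) that by (auto simp del: real_norm_def)
      then show "(\<Sum>i\<in>Basis. norm (?D z i)) \<le> B" by simp
    qed simp
    finally show ?thesis by (simp add: mult.commute)
  qed
  show ?thesis
  proof (rule that[of "B + \<bar>a\<bar> * M"])
    show "B + \<bar>a\<bar> * M > 0" using B M by (simp add: add_pos_nonneg)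
    fix x :: 'a assume x: "x \<noteq> 0"
    then have sx: "norm (sgn x) = 1" "sgn x \<noteq> 0" by (auto simp: norm_sgn sgn_zero_iff)
    have eq: "Z lam (sgn y) = Z lam y" for y by (rule Z_hom)
    have DZ: "(Z lam has_derivative (\<lambda>h. ?D (sgn x) (h /\<^sub>R norm x))) (at x)"
      using has_derivative_hom0[of "Z lam" "?D (sgn x)" x] D[OF sx(2)] x by (simp add: eq)
    let ?E = "\<lambda>h. norm x powr a *\<^sub>R ?D (sgn x) (h /\<^sub>R norm x) + (a * norm x powr (a - 2) * (x \<bullet> h)) *\<^sub>R Z lam x"
    have "((\<lambda>x. norm x powr a *\<^sub>R Z lam x) has_derivative ?E) (at x)"
      by (intro has_derivative_scaleR has_derivative_norm_powr x DZ)
    moreover have "onorm ?E \<le> (B + \<bar>a\<bar> * M) * norm x powr (a - 1)"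
    proof (rule onorm_bound)
      fix h
      have "norm (?E h) \<le> norm x powr a * (B * norm (h /\<^sub>R norm x)) + \<bar>a * norm x powr (a - 2) * (x \<bullet> h)\<bar> * M"
        using mult_left_mono[OF Bz[OF sx(1), of "h /\<^sub>R norm x"], of "norm x powr a"]
          mult_left_mono[OF M(2)[OF x], of "\<bar>a * norm x powr (a - 2) * (x \<bullet> h)\<bar>"]
        by (intro order.trans[OF norm_triangle_ineq] add_mono) (simp_all only: norm_scaleR abs_of_nonneg[OF powr_ge_zero] abs_ge_zero powr_ge_zero simp_thms)
      also have "\<bar>a * norm x powr (a - 2) * (x \<bullet> h)\<bar> * M \<le> \<bar>a\<bar> * norm x powr (a - 2) * (norm x * norm h) * M"
        using M(1) by (intro mult_right_mono) (auto simp: abs_mult intro!: mult_left_mono Cauchy_Schwarz_ineq2)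
      also have "norm x powr a * (B * norm (h /\<^sub>R norm x)) + \<bar>a\<bar> * norm x powr (a - 2) * (norm x * norm h) * M
         = (B + \<bar>a\<bar> * M) * norm x powr (a - 1) * norm h"
        using x by (simp add: powr_diff power2_eq_square field_simps)
      finally show "norm (?E h) \<le> (B + \<bar>a\<bar> * M) * norm x powr (a - 1) * norm h" by simp
    qed (use B M in auto)
    ultimately show "\<exists>D. ((\<lambda>x. norm x powr a *\<^sub>R Z lam x) has_derivative D) (at x)
      \<and> onorm D \<le> (B + \<bar>a\<bar> * M) * norm x powr (a - 1)" by blast
  qed
qed

text \<open>Let x be the point of larger norm. If the distance is at least half of
  \<open>norm x\<close>, the size of the field alone gives the bound. Otherwise the segment stays
  away from the origin, and the derivative bound applies with \<open>norm z\<close> at least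
  \<open>norm x / 2\<close>.\<close>

lemma holder_radial_power:
  assumes a: "0 < a" "a \<le> 1"
  obtains C where "C > 0" "\<And>x y. norm (norm x powr a *\<^sub>R Z lam x - norm y powr a *\<^sub>R Z lam y) \<le> C * dist x y powr a"
proof -
  let ?G = "\<lambda>x. norm x powr a *\<^sub>R Z lam x"
  obtain M where M: "M > 0" "\<And>x. x \<noteq> 0 \<Longrightarrow> norm (Z lam x) \<le> M" using bounded_Z by blast
  obtain C where C: "C > 0" "\<And>x. x \<noteq> 0 \<Longrightarrow> \<exists>D. (?G has_derivative D) (at x) \<and> onorm D \<le> C * norm x powr (a - 1)"
    by (rule norm_derivative_radial_power) blast
  have G: "norm (?G x) \<le> norm x powr a * M" for x
  proof (cases "x = 0")
    case False
    then show ?thesis using mult_left_mono[OF M(2)[OF False], of "norm x powr a"] by simp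
  qed simp
  have main: "norm (?G x - ?G y) \<le> (4 * M + C) * dist x y powr a" if yx: "norm y \<le> norm x" for x y
  proof (cases "dist x y < norm x / 2")
    case False
    have "norm (?G x - ?G y) \<le> norm x powr a * M + norm y powr a * M"
      using norm_triangle_ineq4[of "?G x" "?G y"] G[of x] G[of y] by linarith
    also have "norm y powr a \<le> norm x powr a" using yx a by (intro powr_mono2) auto
    then have "norm x powr a * M + norm y powr a * M \<le> 2 * M * norm x powr a"
      using M(1) by (simp add: mult.commute[of _ M])
    also have "norm x powr a \<le> (2 * dist x y) powr a" using False a by (intro powr_mono2) auto
    also have "(2 * dist x y) powr a = 2 powr a * dist x y powr a" by (simp add: powr_mult)
    also have "\<dots> \<le> 2 * dist x y powr a" using powr_mono[of a 1 2] a by (intro mult_right_mono) auto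
    finally have "norm (?G x - ?G y) \<le> 2 * M * (2 * dist x y powr a)" using M(1) by simp
    also have "\<dots> \<le> (4 * M + C) * dist x y powr a" using C(1) by (simp add: algebra_simps)
    finally show ?thesis .
  next
    case True
    define r where "r = norm x / 2"
    have r: "r > 0" "dist x y < r" using True le_less_trans[OF zero_le_dist True] by (auto simp: r_def)
    have nz: "norm z \<ge> r" if "z \<in> ball x r" for z
      using that norm_triangle_ineq2[of x z] by (simp add: dist_norm r_def)
    \<comment> \<open>The derivative bound only asserts existence at each point; the mean value
      inequality needs one derivative chosen for every z.\<close>
    define D where "D z = (SOME D. (?G has_derivative D) (at z) \<and> onorm D \<le> C * norm z powr (a - 1))" for z
    have D: "(?G has_derivative D z) (at z)" "onorm (D z) \<le> C * norm z powr (a - 1)" if "z \<in> ball x r" for z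
    proof -
      have "z \<noteq> 0" using nz[OF that] r(1) by auto
      from someI_ex[OF C(2)[OF this]] show "(?G has_derivative D z) (at z)" "onorm (D z) \<le> C * norm z powr (a - 1)"
        unfolding D_def by auto
    qed
    have "norm (?G x - ?G y) \<le> (C * r powr (a - 1)) * norm (x - y)"
    proof (rule differentiable_bound[of "ball x r"])
      fix z assume z: "z \<in> ball x r"
      show "(?G has_derivative D z) (at z within ball x r)"
        using D(1)[OF z] by (rule has_derivative_at_withinI)
      have "C * norm z powr (a - 1) \<le> C * r powr (a - 1)"
        using C(1) nz[OF z] a r by (intro mult_left_mono powr_mono2') auto
      then show "onorm (D z) \<le> C * r powr (a - 1)"
        using D(2)[OF z] by linarith
    qed (use r in auto)
    \<comment> \<open>Here a - 1 \<le> 0 and \<open>dist x y < r\<close>, so the negative power may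
      be moved from r to the distance.\<close>
    also have "r powr (a - 1) * norm (x - y) \<le> dist x y powr a"
    proof (cases "x = y")
      case False
      have "r powr (a - 1) \<le> dist x y powr (a - 1)"
        using r a False by (intro powr_mono2') auto
      then have "r powr (a - 1) * dist x y \<le> dist x y powr (a - 1) * dist x y" by (intro mult_right_mono) auto
      also have "\<dots> = dist x y powr a" using False by (simp add: powr_diff)
      finally show ?thesis by (simp add: dist_norm)
    qed simp
    then have "C * r powr (a - 1) * norm (x - y) \<le> C * dist x y powr a"
      using C(1) by (simp add: mult.assoc)
    also have "C * dist x y powr a \<le> (4 * M + C) * dist x y powr a" using M(1) by (intro mult_right_mono) auto
    finally show ?thesis .
  qed
  show ?thesis
  proof (rule that[of "4 * M + C"])
    show "norm (?G x - ?G y) \<le> (4 * M + C) * dist x y powr a" for x y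
      using main[of y x] main[of x y] by (cases "norm y \<le> norm x") (auto simp: norm_minus_commute dist_commute)
  qed (use M C in auto)
qed

text \<open>The gradient has the exponent lam - 1 globally; on a bounded set it may be lowered to
  \<gamma> at the price of a power of the diameter.\<close>

lemma C1_holder_radial_mult:
  assumes \<gamma>: "0 < \<gamma>" and lam: "\<gamma> \<le> lam - 1" "lam \<le> 2"
  shows "C1_holder_loc_on \<gamma> UNIV (\<lambda>x. norm x powr lam * v (sgn x))"
  unfolding C1_holder_loc_on_def
proof (intro conjI allI impI)
  have l1: "lam > 1" using assms by simp
  show "Ck_on 1 UNIV (\<lambda>x. norm x powr lam * v (sgn x))" by (rule C1_radial_mult[OF l1])
  fix K :: "'a set" assume "compact K \<and> K \<subseteq> UNIV"
  then have "bounded K" using compact_imp_bounded by blast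
  obtain C where C: "C > 0" "\<And>x y. norm (norm x powr (lam - 1) *\<^sub>R Z lam x - norm y powr (lam - 1) *\<^sub>R Z lam y) \<le> C * dist x y powr (lam - 1)"
    by (rule holder_radial_power[of "lam - 1"]) (use assms in auto)
  have "norm (norm x powr (lam - 1) *\<^sub>R Z lam x - norm y powr (lam - 1) *\<^sub>R Z lam y)
     \<le> (C * (diameter K + 1) powr (lam - 1 - \<gamma>)) * dist x y powr \<gamma>" if "x \<in> K" "y \<in> K" for x y
  proof -
    have "dist x y powr (lam - 1) = dist x y powr (lam - 1 - \<gamma>) * dist x y powr \<gamma>"
      by (simp flip: powr_add)
    also have "\<dots> \<le> (diameter K + 1) powr (lam - 1 - \<gamma>) * dist x y powr \<gamma>"
      using diameter_bounded_bound[OF \<open>bounded K\<close> that] lam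
      by (intro mult_right_mono powr_mono2) auto
    finally have "C * dist x y powr (lam - 1) \<le> C * ((diameter K + 1) powr (lam - 1 - \<gamma>) * dist x y powr \<gamma>)"
      using C(1) by simp
    then show ?thesis using C(2)[of x y] by (simp add: mult.assoc)
  qed
  then show "\<exists>C. \<forall>x\<in>K. \<forall>y\<in>K. norm (grad (\<lambda>x. norm x powr lam * v (sgn x)) x - grad (\<lambda>x. norm x powr lam * v (sgn x)) y) \<le> C * dist x y powr \<gamma>"
    unfolding grad_radial_mult_all[OF l1] by blast
qed

end

section \<open>Smoothness at the poles\<close>

text \<open>Derivatives are taken within I. A half-open interval can then contain the pole as its
  endpoint, where \<open>Ck_on\<close> would ask for a two-sided derivative.\<close>

primrec Ck_ivl :: "nat \<Rightarrow> real set \<Rightarrow> (real \<Rightarrow> real) \<Rightarrow> bool" where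
  "Ck_ivl 0 I f \<longleftrightarrow> continuous_on I f"
| "Ck_ivl (Suc k) I f \<longleftrightarrow> (\<exists>f'. (\<forall>s\<in>I. (f has_real_derivative f' s) (at s within I)) \<and> Ck_ivl k I f')"

lemma Ck_ivl_SucI: "(\<And>s. s \<in> I \<Longrightarrow> (f has_real_derivative f' s) (at s within I)) \<Longrightarrow> Ck_ivl k I f' \<Longrightarrow> Ck_ivl (Suc k) I f"
  by auto

lemma Ck_ivl_SucE:
  assumes "Ck_ivl (Suc k) I f"
  obtains f' where "\<And>s. s \<in> I \<Longrightarrow> (f has_real_derivative f' s) (at s within I)" "Ck_ivl k I f'"
  using assms by auto

lemma Ck_ivl_SucD: "Ck_ivl (Suc k) I f \<Longrightarrow> Ck_ivl k I f"
proof (induction k arbitrary: f)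
  case 0
  then obtain f' where "\<And>s. s \<in> I \<Longrightarrow> (f has_real_derivative f' s) (at s within I)" by (rule Ck_ivl_SucE) blast
  then show ?case by (auto simp: continuous_on_eq_continuous_within intro: DERIV_continuous)
next
  case (Suc k)
  from Suc.prems obtain f' where f': "\<And>s. s \<in> I \<Longrightarrow> (f has_real_derivative f' s) (at s within I)" "Ck_ivl (Suc k) I f'"
    by (rule Ck_ivl_SucE) blast
  show ?case by (rule Ck_ivl_SucI[OF f'(1) Suc.IH[OF f'(2)]])
qed

lemma Ck_ivl_continuous: "Ck_ivl k I f \<Longrightarrow> continuous_on I f"
  by (induction k) (use Ck_ivl_SucD in \<open>auto simp del: Ck_ivl.simps simp: Ck_ivl.simps(1)\<close>)

lemma Ck_ivl_const: "Ck_ivl k I (\<lambda>s. c)"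
  by (induction k arbitrary: c) (auto intro!: exI[of _ "\<lambda>_. 0"])

lemma Ck_ivl_id: "Ck_ivl k I (\<lambda>s. s)"
  by (cases k) (auto intro!: exI[of _ "\<lambda>_. 1"] Ck_ivl_const)

lemma Ck_ivl_add: "Ck_ivl k I f \<Longrightarrow> Ck_ivl k I h \<Longrightarrow> Ck_ivl k I (\<lambda>s. f s + h s)"
proof (induction k arbitrary: f h)
  case 0
  then show ?case by (simp add: continuous_on_add)
next
  case (Suc k)
  from Suc.prems(1) obtain f' where f': "\<And>s. s \<in> I \<Longrightarrow> (f has_real_derivative f' s) (at s within I)" "Ck_ivl k I f'"
    by (rule Ck_ivl_SucE) blast
  from Suc.prems(2) obtain h' where h': "\<And>s. s \<in> I \<Longrightarrow> (h has_real_derivative h' s) (at s within I)" "Ck_ivl k I h'"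
    by (rule Ck_ivl_SucE) blast
  show ?case
    by (rule Ck_ivl_SucI[OF DERIV_add[OF f'(1) h'(1)] Suc.IH[OF f'(2) h'(2)]])
qed

lemma Ck_ivl_mult: "Ck_ivl k I f \<Longrightarrow> Ck_ivl k I h \<Longrightarrow> Ck_ivl k I (\<lambda>s. f s * h s)"
proof (induction k arbitrary: f h)
  case 0
  then show ?case by (simp add: continuous_on_mult)
next
  case (Suc k)
  from Suc.prems(1) obtain f' where f': "\<And>s. s \<in> I \<Longrightarrow> (f has_real_derivative f' s) (at s within I)" "Ck_ivl k I f'"
    by (rule Ck_ivl_SucE) blast
  from Suc.prems(2) obtain h' where h': "\<And>s. s \<in> I \<Longrightarrow> (h has_real_derivative h' s) (at s within I)" "Ck_ivl k I h'"
    by (rule Ck_ivl_SucE) blast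
  show ?case
    by (rule Ck_ivl_SucI[OF DERIV_mult[OF f'(1) h'(1)] Ck_ivl_add[OF
        Suc.IH[OF f'(2) Ck_ivl_SucD[OF Suc.prems(2)]] Suc.IH[OF h'(2) Ck_ivl_SucD[OF Suc.prems(1)]]]])
qed

lemma Ck_ivl_minus: "Ck_ivl k I f \<Longrightarrow> Ck_ivl k I (\<lambda>s. - f s)"
  using Ck_ivl_mult[OF Ck_ivl_const[of k I "-1"]] by simp

lemma Ck_ivl_diff: "Ck_ivl k I f \<Longrightarrow> Ck_ivl k I h \<Longrightarrow> Ck_ivl k I (\<lambda>s. f s - h s)"
  using Ck_ivl_add[OF _ Ck_ivl_minus] by simp

lemma Ck_ivl_inverse:
  assumes "\<And>s. s \<in> I \<Longrightarrow> f s \<noteq> 0"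
  shows "Ck_ivl k I f \<Longrightarrow> Ck_ivl k I (\<lambda>s. inverse (f s))"
proof (induction k)
  case 0
  then show ?case using assms by (simp add: continuous_on_inverse)
next
  case (Suc k)
  from Suc.prems obtain f' where f': "\<And>s. s \<in> I \<Longrightarrow> (f has_real_derivative f' s) (at s within I)" "Ck_ivl k I f'"
    by (rule Ck_ivl_SucE) blast
  show ?case
    by (intro Ck_ivl_SucI[of I _ "\<lambda>s. - (inverse (f s) * f' s * inverse (f s))"] Ck_ivl_minus Ck_ivl_mult
        Suc.IH Ck_ivl_SucD[OF Suc.prems] f' DERIV_inverse' assms)
qed

lemma Ck_ivl_divide:
  assumes "\<And>s. s \<in> I \<Longrightarrow> h s \<noteq> 0" "Ck_ivl k I f" "Ck_ivl k I h"
  shows "Ck_ivl k I (\<lambda>s. f s / h s)"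
  unfolding divide_inverse by (intro Ck_ivl_mult Ck_ivl_inverse assms)

lemma Ck_ivl_power: "Ck_ivl k I f \<Longrightarrow> Ck_ivl k I (\<lambda>s. f s ^ n)"
  by (induction n) (auto intro: Ck_ivl_const Ck_ivl_mult)

lemmas Ck_ivl_intros = Ck_ivl_const Ck_ivl_id Ck_ivl_add Ck_ivl_mult Ck_ivl_minus Ck_ivl_diff Ck_ivl_power

text \<open>The inner function may attain an endpoint of I at an interior point of S, as 1 -
  \<open>sgn x \<bullet> e\<close> does at the pole. One-sided derivatives of f suffice there, since
  \<phi> never leaves I.\<close>

lemma Ck_on_compose_Ck_ivl:
  fixes \<phi> :: "'a::euclidean_space \<Rightarrow> real"
  assumes "open S" "\<And>j. Ck_on j S \<phi>" "\<phi> ` S \<subseteq> I" "Ck_ivl k I f"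
  shows "Ck_on k S (\<lambda>x. f (\<phi> x))"
  using assms(4)
proof (induction k arbitrary: f)
  case 0
  then show ?case using assms(2)[of 0] assms(3) by (auto intro: continuous_on_compose2)
next
  case (Suc k)
  from Suc.prems obtain f' where f': "\<And>s. s \<in> I \<Longrightarrow> (f has_real_derivative f' s) (at s within I)" "Ck_ivl k I f'"
    by (rule Ck_ivl_SucE) blast
  show ?case
  proof (rule Ck_on_SucI[OF assms(1), where f' = "\<lambda>x h. f' (\<phi> x) * frechet_derivative \<phi> (at x) h"])
    fix x assume x: "x \<in> S"
    have "(\<phi> has_derivative frechet_derivative \<phi> (at x)) (at x within S)"
      using Ck_on_Suc_has_derivative[OF assms(2) x] by (rule has_derivative_at_withinI)
    moreover have "(f has_derivative (*) (f' (\<phi> x))) (at (\<phi> x) within \<phi> ` S)"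
      using f'(1)[of "\<phi> x"] assms(3) x unfolding has_field_derivative_def by (auto intro: has_derivative_subset)
    ultimately show "((\<lambda>x. f (\<phi> x)) has_derivative (\<lambda>h. f' (\<phi> x) * frechet_derivative \<phi> (at x) h)) (at x)"
      using has_derivative_in_compose at_within_open[OF x assms(1)] by metis
  next
    show "Ck_on k S (\<lambda>x. f' (\<phi> x) * frechet_derivative \<phi> (at x) i)" if "i \<in> Basis" for i
      using assms(2)[of "Suc k"] that by (intro Ck_on_mult[OF assms(1)] Suc.IH f'(2)) simp
  qed
qed

section \<open>Linear equations with a regular singular point\<close>

lemma at_0_within_Ico: "b > 0 \<Longrightarrow> at (0::real) within {0..<b} = at_right 0"
  by (rule at_within_nhd[of _ "{..<b}"]) auto

lemma lhopital_powr_at_right_0: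
  fixes f :: "real \<Rightarrow> real"
  assumes "\<alpha> > 0" "b > 0" "(f \<longlongrightarrow> 0) (at_right 0)"
    "\<And>s. 0 < s \<Longrightarrow> s < b \<Longrightarrow> (f has_real_derivative f' s) (at s)"
    "((\<lambda>s. f' s / (\<alpha> * s powr (\<alpha> - 1))) \<longlongrightarrow> l) (at_right 0)"
  shows "((\<lambda>s. f s / s powr \<alpha>) \<longlongrightarrow> l) (at_right 0)"
proof (rule lhopital_right_0[OF assms(3) _ _ _ _ _ assms(5)])
  have ev: "eventually (\<lambda>s. 0 < s \<and> s < b) (at_right (0::real))"
    using assms(2) by (auto simp: eventually_at_right_field)
  have "((\<lambda>s::real. s powr \<alpha>) \<longlongrightarrow> 0 powr \<alpha>) (at_right 0)"
    using assms(1) by (intro tendsto_powr' tendsto_intros) (auto simp: eventually_at_filter)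
  then show "((\<lambda>s::real. s powr \<alpha>) \<longlongrightarrow> 0) (at_right 0)" using assms(1) by simp
  show "\<forall>\<^sub>F x in at_right 0. x powr \<alpha> \<noteq> 0" "\<forall>\<^sub>F x in at_right 0. \<alpha> * x powr (\<alpha> - 1) \<noteq> 0"
    using ev by (eventually_elim, use assms(1) in simp)+
  show "\<forall>\<^sub>F x in at_right 0. (f has_real_derivative f' x) (at x)"
    using ev by eventually_elim (use assms(4) in simp)
  show "\<forall>\<^sub>F x in at_right 0. ((\<lambda>s. s powr \<alpha>) has_real_derivative \<alpha> * x powr (\<alpha> - 1)) (at x)"
    using ev by eventually_elim (use has_real_derivative_powr in simp)
qed

text \<open>With the integrating factor s^\<beta> the equation becomes a formula for a derivative,
  and L'Hopital's rule determines first the value and then the derivative of P at 0. Continuity of P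
  excludes the singular solution s^(-\<beta>).\<close>

lemma regular_singular_C1:
  fixes b :: real
  defines "I \<equiv> {0..<b}"
  assumes b: "b > 0" and \<beta>: "\<beta> > 0" and contP: "continuous_on I P"
    and P': "\<And>s. 0 < s \<Longrightarrow> s < b \<Longrightarrow> (P has_real_derivative P' s) (at s)"
    and ode: "\<And>s. 0 < s \<Longrightarrow> s < b \<Longrightarrow> s * P' s + \<beta> * P s = G s + s * K s"
    and G: "\<And>s. s \<in> I \<Longrightarrow> (G has_real_derivative G' s) (at s within I)"
    and contK: "continuous_on I K"
  shows "\<exists>Q. (\<forall>s\<in>I. (P has_real_derivative Q s) (at s within I)) \<and> continuous_on I Q \<and>
    (\<forall>s. 0 < s \<longrightarrow> s < b \<longrightarrow> Q s = P' s)"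
proof -
  have at0: "at 0 within I = at_right 0" unfolding I_def by (rule at_0_within_Ico[OF b])
  have at_pos: "at s within I = at s" if "0 < s" "s < b" for s
    by (rule at_within_open_subset[of s "{0<..<b}"]) (use that in \<open>auto simp: I_def\<close>)
  have ev: "eventually (\<lambda>s. 0 < s \<and> s < b) (at_right (0::real))"
    using b by (auto simp: eventually_at_right_field)
  have contG: "continuous_on I G"
    using G by (auto simp: continuous_on_eq_continuous_within intro: DERIV_continuous)
  have lim: "(f \<longlongrightarrow> f 0) (at_right 0)" if "continuous_on I f" for f :: "real \<Rightarrow> real"
  proof -
    have "0 \<in> I" using b by (simp add: I_def)
    then show ?thesis using that at0 unfolding continuous_on_def by metis
  qed
  note limP = lim[OF contP] and limG = lim[OF contG] and limK = lim[OF contK]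
  have lim0: "((\<lambda>s::real. s powr \<alpha>) \<longlongrightarrow> 0) (at_right 0)" if "\<alpha> > 0" for \<alpha>
  proof -
    have "((\<lambda>s::real. s powr \<alpha>) \<longlongrightarrow> 0 powr \<alpha>) (at_right 0)"
      using that by (intro tendsto_powr' tendsto_intros) (auto simp: eventually_at_filter)
    then show ?thesis using that by simp
  qed
  \<comment> \<open>The constant c is left free: c = 0 identifies P 0, and afterwards c = P 0 gives
    the difference quotient at 0.\<close>
  have powD: "((\<lambda>s. s powr \<beta> * (P s - c)) has_real_derivative s powr (\<beta> - 1) * (G s + s * K s - \<beta> * c)) (at s)"
    if "0 < s" "s < b" for s c
  proof -
    have "((\<lambda>s. s powr \<beta> * (P s - c)) has_real_derivative (\<beta> * s powr (\<beta> - 1)) * (P s - c) + (P' s - 0) * s powr \<beta>) (at s)"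
      by (intro DERIV_mult DERIV_diff P' DERIV_const has_real_derivative_powr that)
    moreover have "s powr \<beta> = s * s powr (\<beta> - 1)" using that by (simp add: powr_diff)
    then have "(\<beta> * s powr (\<beta> - 1)) * (P s - c) + (P' s - 0) * s powr \<beta>
        = s powr (\<beta> - 1) * ((s * P' s + \<beta> * P s) - \<beta> * c)" by (simp add: algebra_simps)
    ultimately show ?thesis using ode[OF that] by simp
  qed
  have P0: "\<beta> * P 0 = G 0"
  proof -
    have "((\<lambda>s. (s powr \<beta> * (P s - 0)) / s powr \<beta>) \<longlongrightarrow> G 0 / \<beta>) (at_right 0)"
    proof (rule lhopital_powr_at_right_0[OF \<beta> b _ powD])
      show "((\<lambda>s. s powr \<beta> * (P s - 0)) \<longlongrightarrow> 0) (at_right 0)"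
        using tendsto_mult[OF lim0[OF \<beta>] limP] by simp
      have "((\<lambda>s. (G s + s * K s) / \<beta>) \<longlongrightarrow> (G 0 + 0 * K 0) / \<beta>) (at_right 0)"
        by (intro tendsto_intros limG limK) (use \<beta> in auto)
      then have "((\<lambda>s. (G s + s * K s) / \<beta>) \<longlongrightarrow> G 0 / \<beta>) (at_right 0)" by simp
      then show "((\<lambda>s. s powr (\<beta> - 1) * (G s + s * K s - \<beta> * 0) / (\<beta> * s powr (\<beta> - 1))) \<longlongrightarrow> G 0 / \<beta>) (at_right 0)"
      proof (rule tendsto_cong[THEN iffD1, rotated])
        show "\<forall>\<^sub>F s in at_right 0. (G s + s * K s) / \<beta> = s powr (\<beta> - 1) * (G s + s * K s - \<beta> * 0) / (\<beta> * s powr (\<beta> - 1))"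
          using ev by eventually_elim simp
      qed
    qed
    moreover have "((\<lambda>s. (s powr \<beta> * (P s - 0)) / s powr \<beta>) \<longlongrightarrow> P 0) (at_right 0)"
      by (rule tendsto_cong[THEN iffD1, OF _ limP]) (use ev in eventually_elim, simp)
    ultimately have "G 0 / \<beta> = P 0" by (rule tendsto_unique[OF trivial_limit_at_right_real])
    then show ?thesis using \<beta> by (simp add: field_simps)
  qed
  have limG': "((\<lambda>s. (G s - G 0) / s) \<longlongrightarrow> G' 0) (at_right 0)"
    using G[of 0] b at0 by (simp add: has_field_derivative_iff I_def)
  \<comment> \<open>The value forced by the terms of first order in s: (\<beta> + 1) Q0 = G' 0 + K
    0.\<close>
  define Q0 where "Q0 = (G' 0 + K 0) / (\<beta> + 1)"
  have limQ: "((\<lambda>s. (P s - P 0) / s) \<longlongrightarrow> Q0) (at_right 0)"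
  proof -
    have "((\<lambda>s. (s powr \<beta> * (P s - P 0)) / s powr (\<beta> + 1)) \<longlongrightarrow> Q0) (at_right 0)"
    proof (rule lhopital_powr_at_right_0[OF _ b _ powD])
      show "((\<lambda>s. s powr \<beta> * (P s - P 0)) \<longlongrightarrow> 0) (at_right 0)"
        using tendsto_mult[OF lim0[OF \<beta>] tendsto_diff[OF limP tendsto_const[of "P 0"]]] by simp
      have "((\<lambda>s. ((G s - G 0) / s + K s) / (\<beta> + 1)) \<longlongrightarrow> Q0) (at_right 0)"
        unfolding Q0_def by (intro tendsto_intros limG' limK) (use \<beta> in auto)
      then show "((\<lambda>s. s powr (\<beta> - 1) * (G s + s * K s - \<beta> * P 0) / ((\<beta> + 1) * s powr (\<beta> + 1 - 1))) \<longlongrightarrow> Q0) (at_right 0)"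
      proof (rule tendsto_cong[THEN iffD1, rotated])
        show "\<forall>\<^sub>F s in at_right 0. ((G s - G 0) / s + K s) / (\<beta> + 1)
           = s powr (\<beta> - 1) * (G s + s * K s - \<beta> * P 0) / ((\<beta> + 1) * s powr (\<beta> + 1 - 1))"
          using ev
        proof eventually_elim
          case (elim s)
          define w where "w = s powr (\<beta> - 1)"
          have "w > 0" "s powr (\<beta> + 1 - 1) = s * w" using elim by (auto simp: w_def powr_diff)
          moreover have "((G s - G 0) / s + K s) / (\<beta> + 1) = (w * (G s + s * K s - G 0)) / (w * (s * (\<beta> + 1)))"
            using elim \<open>w > 0\<close> by (subst mult_divide_mult_cancel_left) (auto simp: field_simps)
          ultimately show ?case using P0 unfolding w_def[symmetric] by (simp add: mult_ac)
        qed
      qed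
    qed (use \<beta> in auto)
    then show ?thesis
    proof (rule tendsto_cong[THEN iffD1, rotated])
      show "\<forall>\<^sub>F s in at_right 0. s powr \<beta> * (P s - P 0) / s powr (\<beta> + 1) = (P s - P 0) / s"
        using ev by eventually_elim (simp add: powr_add)
    qed
  qed
  define Q where "Q s = (if s = 0 then Q0 else P' s)" for s
  have Q_eq: "Q s = (G s + s * K s - \<beta> * P s) / s" if "0 < s" "s < b" for s
    using ode[OF that] that by (simp add: Q_def field_simps)
  have deriv: "(P has_real_derivative Q s) (at s within I)" if "s \<in> I" for s
  proof (cases "s = 0")
    case True
    then show ?thesis using limQ by (simp add: has_field_derivative_iff at0 Q_def)
  next
    case False
    then show ?thesis using that P'[of s] at_pos[of s] by (simp add: I_def Q_def)
  qed
  have "continuous_on I Q"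
    unfolding continuous_on_def
  proof
    fix s assume s: "s \<in> I"
    show "(Q \<longlongrightarrow> Q s) (at s within I)"
    proof (cases "s = 0")
      case True
      \<comment> \<open>For s > 0 the equation, with \<beta> P 0 = G 0 subtracted, writes P' through
        difference quotients whose limits are known.\<close>
      have "((\<lambda>s. (G s - G 0) / s + K s - \<beta> * ((P s - P 0) / s)) \<longlongrightarrow> G' 0 + K 0 - \<beta> * Q0) (at_right 0)"
        by (intro tendsto_intros limG' limK limQ)
      moreover have "G' 0 + K 0 - \<beta> * Q0 = Q0" using \<beta> by (simp add: Q0_def field_simps)
      moreover have "\<forall>\<^sub>F s in at_right 0. (G s - G 0) / s + K s - \<beta> * ((P s - P 0) / s) = Q s"
        using ev
      proof eventually_elim
        case (elim s)
        have "(G s - G 0) / s + K s - \<beta> * ((P s - P 0) / s) = (G s + s * K s - \<beta> * P s + (\<beta> * P 0 - G 0)) / s"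
          using elim by (simp add: divide_simps) (simp add: algebra_simps)
        then show ?case using P0 Q_eq[of s] elim by simp
      qed
      ultimately have "(Q \<longlongrightarrow> Q0) (at_right 0)"
        using tendsto_cong by force
      then show ?thesis using True by (simp add: at0 Q_def)
    next
      case False
      have "continuous_on {0<..<b} (\<lambda>s. (G s + s * K s - \<beta> * P s) / s)"
        by (intro continuous_intros continuous_on_subset[OF contP] continuous_on_subset[OF contG]
            continuous_on_subset[OF contK]) (auto simp: I_def)
      then have "continuous_on {0<..<b} Q"
        by (rule continuous_on_eq) (use Q_eq in auto)
      moreover have "s \<in> {0<..<b}" using False s by (auto simp: I_def)
      ultimately have "(Q \<longlongrightarrow> Q s) (at s)"
        by (simp add: continuous_on_eq_continuous_at isCont_def)
      then show ?thesis using False s at_pos[of s] by (simp add: I_def)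
    qed
  qed
  with deriv show ?thesis by (intro exI[of _ Q]) (auto simp: Q_def)
qed

text \<open>At the regular singular point \<open>s = 0\<close> the derivative \<open>P'\<close> solves an equation of the same
  form with \<open>\<beta> + 1\<close> in place of \<open>\<beta>\<close>. One derivative is gained each time.\<close>

lemma regular_singular_gain:
  fixes b :: real
  defines "I \<equiv> {0..<b}"
  assumes b: "b > 0"
  assumes "\<beta> > 0" "continuous_on I P"
    "\<And>s. 0 < s \<Longrightarrow> s < b \<Longrightarrow> (P has_real_derivative P' s) (at s)"
    "\<And>s. 0 < s \<Longrightarrow> s < b \<Longrightarrow> s * P' s + \<beta> * P s = G s + s * K s"
    "Ck_ivl (Suc k) I G" "Ck_ivl k I K"
  shows "Ck_ivl (Suc k) I P"
  using assms(3-)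
proof (induction k arbitrary: \<beta> P P' G K)
  case (0 \<beta> P P' G K)
  from 0(5) obtain G' where G': "\<And>s. s \<in> I \<Longrightarrow> (G has_real_derivative G' s) (at s within I)"
    by (rule Ck_ivl_SucE) blast
  from regular_singular_C1[of b \<beta> P P' G K G', folded I_def, OF b 0(1-4) G' Ck_ivl_continuous[OF 0(6)]]
  show ?case by auto
next
  case (Suc k \<beta> P P' G K)
  from Suc.prems(5) obtain G' where G': "\<And>s. s \<in> I \<Longrightarrow> (G has_real_derivative G' s) (at s within I)" "Ck_ivl (Suc k) I G'"
    by (rule Ck_ivl_SucE) blast
  from Suc.prems(6) obtain K' where K': "\<And>s. s \<in> I \<Longrightarrow> (K has_real_derivative K' s) (at s within I)" "Ck_ivl k I K'"
    by (rule Ck_ivl_SucE) blast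
  obtain Q where Q: "\<And>s. s \<in> I \<Longrightarrow> (P has_real_derivative Q s) (at s within I)" "continuous_on I Q"
    "\<And>s. 0 < s \<Longrightarrow> s < b \<Longrightarrow> Q s = P' s"
    using regular_singular_C1[of b \<beta> P P' G K G', folded I_def, OF b Suc.prems(1-4) G'(1) Ck_ivl_continuous[OF Suc.prems(6)]]
    by blast
  have at_pos: "at s within I = at s" if "0 < s" "s < b" for s
    by (rule at_within_open_subset[of s "{0<..<b}"]) (use that in \<open>auto simp: I_def\<close>)
  \<comment> \<open>The quotient rule for Q = (G + s K - \<beta> P) / s, which is the equation
    solved for P'.\<close>
  define Q' where "Q' s = ((G' s + (K s + s * K' s) - \<beta> * P' s) * s - (G s + s * K s - \<beta> * P s)) / (s * s)" for s
  have "Ck_ivl (Suc k) I Q"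
  \<comment> \<open>Differentiating s Q + \<beta> P = G + s K gives s Q' + (\<beta> + 1) Q = (G' +
    K) + s K'. The new pair of data has lost one derivative, as the induction hypothesis
    expects.\<close>
  proof (rule Suc.IH[of "\<beta> + 1" Q Q' "\<lambda>s. G' s + K s" K'])
    fix s :: real assume s: "0 < s" "s < b"
    then have sI: "s \<in> I" by (simp add: I_def)
    have G1: "(G has_real_derivative G' s) (at s)" and K1: "(K has_real_derivative K' s) (at s)"
      using G'(1)[OF sI] K'(1)[OF sI] at_pos[OF s] by auto
    have "((\<lambda>s. (G s + s * K s - \<beta> * P s) / s) has_real_derivative Q' s) (at s)"
      unfolding Q'_def using s
      by (auto intro!: derivative_eq_intros G1 K1 Suc.prems(3) simp: algebra_simps)
    then show "(Q has_real_derivative Q' s) (at s)"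
    proof (rule has_field_derivative_transform_within_open[of _ _ _ "{0<..<b}"])
      show "(G x + x * K x - \<beta> * P x) / x = Q x" if "x \<in> {0<..<b}" for x
        using Suc.prems(4)[of x] Q(3)[of x] that by (simp add: field_simps)
    qed (use s in auto)
    have "s * Q' s = (G' s + (K s + s * K' s) - \<beta> * P' s) - (G s + s * K s - \<beta> * P s) / s"
      unfolding Q'_def using s by (simp add: field_simps)
    moreover have "(G s + s * K s - \<beta> * P s) / s = P' s"
      using Suc.prems(4)[OF s] s by (simp add: field_simps)
    ultimately show "s * Q' s + (\<beta> + 1) * Q s = (G' s + K s) + s * K' s"
      using Q(3)[OF s] by (simp add: algebra_simps)
  qed (use Suc.prems(1) Q(2) G'(2) K'(2) Suc.prems(6) in \<open>auto intro!: Ck_ivl_add simp del: Ck_ivl.simps\<close>)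
  then show ?case using Q(1) by (intro Ck_ivl_SucI[of I P Q])
qed

text \<open>F is the profile in s = 1 - \<omega> \<bullet> e and P its derivative. Solved for P',
  the nonlinear equation has the form s P' + \<beta> P = -(c/2) F + s K with \<beta> = (d-1)/2,
  where K depends smoothly on s, F and P. If P is C^k, then so is K, F is C^(k+1), and the regular
  singular equation makes P itself C^(k+1). The coefficient A of P' stays positive because p - 2 >
  -1.\<close>

lemma axial_ode_smooth:
  fixes F P P' :: "real \<Rightarrow> real" and lam p c d :: real
  defines "I \<equiv> {0..<2}"
  defines "N \<equiv> \<lambda>s. s * (2 - s) * (P s)\<^sup>2 + lam\<^sup>2 * (F s)\<^sup>2"
  assumes p: "p > 1" and d: "d > 1"
    and F: "\<And>s. s \<in> I \<Longrightarrow> (F has_real_derivative P s) (at s within I)" and P: "continuous_on I P"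
    and P': "\<And>s. 0 < s \<Longrightarrow> s < 2 \<Longrightarrow> (P has_real_derivative P' s) (at s)"
    and N: "\<And>s. s \<in> I \<Longrightarrow> N s > 0"
    and ode: "\<And>s. 0 < s \<Longrightarrow> s < 2 \<Longrightarrow> P' s * (s * (2 - s)) + (d - 1) * (1 - s) * P s + c * F s
      + (p - 2) * (s * (2 - s) * (P s)\<^sup>2 * (P' s * (s * (2 - s)) + (1 - s) * P s + lam\<^sup>2 * F s) / N s) = 0"
  shows "Ck_ivl k I F"
proof -
  define q where "q = p - 2"
  \<comment> \<open>\<open>s * R s\<close> is the share of the tangential gradient in N and lies
    between 0 and 1.\<close>
  define R where "R s = (2 - s) * (P s)\<^sup>2 / N s" for s
  define A where "A s = 1 + q * (s * R s)" for s
  define \<beta> where "\<beta> = (d - 1) / 2"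
  \<comment> \<open>What remains on the right after multiplication by (2 - s) A, once \<beta> P and
    -(c/2) F are split off and one factor s is cancelled. The part singular at s = 0 is only \<beta>
    P + (c/2) F, since (d-1)(1-s) - \<beta> (2-s) = -\<beta> s.\<close>
  define num where "num s = P s * (\<beta> + \<beta> * (2 - s) * q * R s) - q * R s * ((1 - s) * P s + lam\<^sup>2 * F s)
    - (c / 2 * F s) * (1 - (2 - s) * q * R s)" for s
  define K where "K s = num s / ((2 - s) * A s)" for s
  have R: "0 \<le> s * R s" "s * R s \<le> 1" if "s \<in> I" for s
  proof -
    show "0 \<le> s * R s" unfolding R_def using that N[OF that] by (auto simp: I_def)
    have "s * R s = s * (2 - s) * (P s)\<^sup>2 / N s" by (simp add: R_def)
    also have "\<dots> \<le> 1" using N[OF that] by (simp add: N_def)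
    finally show "s * R s \<le> 1" .
  qed
  have A: "A s > 0" if "s \<in> I" for s
  proof (cases "q \<ge> 0")
    case True
    then show ?thesis using R[OF that] by (simp add: A_def add_pos_nonneg)
  next
    case False
    then have "q * (s * R s) \<ge> q * 1" using R(2)[OF that] by (intro mult_left_mono_neg) auto
    then show ?thesis using p by (simp add: A_def q_def)
  qed
  have eq: "s * P' s + \<beta> * P s = - (c / 2) * F s + s * K s" if s: "0 < s" "s < 2" for s
  proof -
    have sI: "s \<in> I" using s by (simp add: I_def)
    let ?D = "(2 - s) * A s"
    have D: "?D \<noteq> 0" using A[OF sI] s by simp
    have KD: "K s * ?D = num s" using D by (simp add: K_def)
    have "P' s * (s * (2 - s)) + (d - 1) * (1 - s) * P s + c * F s
      + q * ((s * R s) * (P' s * (s * (2 - s)) + (1 - s) * P s + lam\<^sup>2 * F s)) = 0"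
      using ode[OF s] by (simp add: R_def q_def mult_ac)
    then have "s * P' s * ?D = - ((d - 1) * (1 - s) * P s + c * F s + q * (s * R s) * ((1 - s) * P s + lam\<^sup>2 * F s))"
      unfolding A_def by (simp add: algebra_simps)
    then have "(s * P' s + \<beta> * P s) * ?D = - ((d - 1) * (1 - s) * P s + c * F s + q * (s * R s) * ((1 - s) * P s + lam\<^sup>2 * F s))
       + \<beta> * P s * ((2 - s) * (1 + q * (s * R s)))"
      unfolding distrib_right by (simp add: A_def)
    also have "\<dots> = - (c / 2) * F s * ((2 - s) * (1 + q * (s * R s))) + s * num s"
      unfolding num_def \<beta>_def by (simp add: field_simps)
    also have "\<dots> = (- (c / 2) * F s + s * K s) * ?D"
      unfolding distrib_right KD[symmetric] A_def by (simp add: mult.assoc)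
    finally show ?thesis using D by simp
  qed
  have contF: "continuous_on I F"
    using F by (auto simp: continuous_on_eq_continuous_within intro: DERIV_continuous)
  have CkP: "Ck_ivl k I P" for k
  proof (induction k)
    case 0
    then show ?case using P by simp
  next
    case (Suc k)
    have CF: "Ck_ivl (Suc k) I F" using F Suc by (rule Ck_ivl_SucI)
    note CF' = Ck_ivl_SucD[OF CF]
    have CN: "Ck_ivl k I N" unfolding N_def by (intro Ck_ivl_intros Suc CF')
    have CR: "Ck_ivl k I R" unfolding R_def
      by (rule Ck_ivl_divide) (use N in \<open>force intro!: Ck_ivl_intros Suc CN\<close>)+
    have "Ck_ivl k I K"
      unfolding K_def
    proof (rule Ck_ivl_divide)
      show "(2 - s) * A s \<noteq> 0" if "s \<in> I" for s using A[OF that] that by (auto simp: I_def)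
      show "Ck_ivl k I num"
        unfolding num_def by (intro Ck_ivl_intros CR Suc CF')
      show "Ck_ivl k I (\<lambda>s. (2 - s) * A s)"
        unfolding A_def by (intro Ck_ivl_intros CR)
    qed
    moreover have "Ck_ivl (Suc k) I (\<lambda>s. - (c / 2) * F s)"
      by (intro Ck_ivl_mult Ck_ivl_const CF)
    ultimately show ?case
      using regular_singular_gain[of 2 \<beta> P P' "\<lambda>s. - (c / 2) * F s" K k, folded I_def] d P P' eq
      by (simp add: \<beta>_def del: Ck_ivl.simps)
  qed
  show ?thesis by (rule Ck_ivl_SucD[OF Ck_ivl_SucI[OF F CkP]])
qed

text \<open>The reflection in the hyperplane orthogonal to \<omega> - \<omega>' fixes e and sends
  \<omega> to \<omega>'.\<close>

lemma axially_symmetric_eq: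
  fixes e :: "'a::euclidean_space"
  assumes "axially_symmetric e v" "norm \<omega> = 1" "norm \<omega>' = 1" "\<omega> \<bullet> e = \<omega>' \<bullet> e"
  shows "v \<omega> = v \<omega>'"
proof (cases "\<omega> = \<omega>'")
  case False
  define w where "w = \<omega> - \<omega>'"
  define R where "R x = x - (2 * (x \<bullet> w) / (w \<bullet> w)) *\<^sub>R w" for x
  have w: "w \<bullet> w \<noteq> 0" using False by (simp add: w_def)
  have we: "e \<bullet> w = 0" using assms(4) by (simp add: w_def inner_diff_right inner_commute)
  have "orthogonal_transformation R"
    unfolding orthogonal_transformation_def
  proof (intro conjI allI)
    show "linear R" unfolding R_def by (rule linearI) (simp_all add: inner_add_left algebra_simps add_divide_distrib)
    show "R x \<bullet> R y = x \<bullet> y" for x y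
      using w unfolding R_def by (simp add: inner_diff_left inner_diff_right inner_commute field_simps)
  qed
  moreover have "R e = e" by (simp add: R_def we)
  moreover have "R \<omega> = \<omega>'"
  proof -
    have "\<omega> \<bullet> \<omega> = 1" "\<omega>' \<bullet> \<omega>' = 1" using assms(2,3) by (auto simp: dot_square_norm)
    then have "w \<bullet> w = 2 * (\<omega> \<bullet> w)"
      unfolding w_def inner_diff_left inner_diff_right by (simp add: inner_commute)
    then have "2 * (\<omega> \<bullet> w) / (w \<bullet> w) = 1" using w by simp
    then show ?thesis by (simp only: R_def scaleR_one) (simp add: w_def)
  qed
  ultimately show ?thesis using assms(1,2) unfolding axially_symmetric_def by force
qed simp

context sph_C2
begin

text \<open>By axial symmetry v is a function F of 1 - \<omega> \<bullet> e, read off on one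
  meridian. Smoothness of F up to the endpoint s = 0 gives smoothness of v at the pole e. What has
  to be supplied by hand is that F' extends continuously to s = 0 and that the equation does not
  degenerate there.\<close>

lemma smooth_away_from_antipole:
  assumes e: "norm e = 1" and b: "norm b = 1" and eb: "e \<bullet> b = 0" and ax: "axially_symmetric e v"
    and Z: "\<And>x. x \<noteq> 0 \<Longrightarrow> Z lam x \<noteq> 0" and L: "\<And>\<omega>. norm \<omega> = 1 \<Longrightarrow> sph_L p lam v \<omega> = 0" and p: "p > 1"
    and dim: "DIM('a) \<ge> 2"
  shows "Ck_on k {x. x \<noteq> 0 \<and> sgn x \<bullet> e > -1} (\<lambda>x. v (sgn x))"
proof -
  \<comment> \<open>The meridian from e through b, parametrised by s = 1 - \<omega> \<bullet> e; the
    square root is the length of the component orthogonal to e.\<close>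
  define c where "c s = (1 - s) *\<^sub>R e + sqrt (s * (2 - s)) *\<^sub>R b" for s
  define F where "F s = v (c s)" for s
  have ee: "e \<bullet> e = 1" "b \<bullet> b = 1" "b \<bullet> e = 0" using e b eb by (auto simp: dot_square_norm inner_commute)
  have c_e: "c s \<bullet> e = 1 - s" for s by (simp add: c_def inner_add_left ee)
  have c_b: "c s \<bullet> b = sqrt (s * (2 - s))" for s by (simp add: c_def inner_add_left ee eb)
  have c_norm: "norm (c s) = 1" if "0 \<le> s" "s \<le> 2" for s
  proof -
    have "(norm (c s))\<^sup>2 = (1 - s)\<^sup>2 + (sqrt (s * (2 - s)))\<^sup>2"
      unfolding power2_norm_eq_inner c_def by (simp add: inner_add_left inner_add_right ee eb power2_eq_square)
    also have "(sqrt (s * (2 - s)))\<^sup>2 = s * (2 - s)" using that by simp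
    also have "(1 - s)\<^sup>2 + s * (2 - s) = 1" by (simp add: power2_eq_square algebra_simps)
    finally show ?thesis by (simp add: power2_eq_1_iff) (smt (verit) norm_ge_zero)
  qed
  have c_sgn: "sgn (c s) = c s" "c s \<noteq> 0" if "0 \<le> s" "s \<le> 2" for s
    using c_norm[OF that] by (auto simp: sgn_div_norm)
  have abs_e: "\<bar>\<omega> \<bullet> e\<bar> \<le> 1" if "norm \<omega> = 1" for \<omega>
    using Cauchy_Schwarz_ineq2[of \<omega> e] e that by simp
  have v_F: "v \<omega> = F (1 - \<omega> \<bullet> e)" if "norm \<omega> = 1" for \<omega>
  proof -
    have "0 \<le> 1 - \<omega> \<bullet> e" "1 - \<omega> \<bullet> e \<le> 2" using abs_e[OF that] by auto
    from c_norm[OF this] show ?thesis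
      unfolding F_def by (intro axially_symmetric_eq[OF ax that]) (auto simp: c_e)
  qed
  have F_v: "F s = v (sgn (c s))" if "0 \<le> s" "s \<le> 2" for s using c_sgn[OF that] by (simp add: F_def)
  have CkF: "Ck_on 2 {0<..<2} F"
  proof (rule Ck_on_cong)
    have "Ck_on 2 {0<..<2::real} (\<lambda>s. (s * (2 + - s)) powr (1 / 2))"
    proof (rule Ck_on_compose[where T = "{0<..}" and f = "\<lambda>x. x powr (1 / 2)"])
      show "Ck_on 2 {0<..<2} (\<lambda>s::real. s * (2 + - s))"
        by (intro Ck_on_mult Ck_on_add Ck_on_const Ck_on_id Ck_on_bounded_linear_id)
           (auto intro!: bounded_linear_minus bounded_linear_ident)
    qed (auto intro: Ck_on_powr)
    then have "Ck_on 2 {0<..<2::real} (\<lambda>s. (1 + - s) *\<^sub>R e + ((s * (2 + - s)) powr (1 / 2)) *\<^sub>R b)"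
      by (intro Ck_on_add[OF _ Ck_on_scaleR[OF _ Ck_on_add[OF _ Ck_on_const Ck_on_bounded_linear_id] Ck_on_const]
            Ck_on_scaleR[OF _ _ Ck_on_const]])
         (auto intro!: bounded_linear_minus bounded_linear_ident)
    then have "Ck_on 2 {0<..<2} c"
      by (rule Ck_on_cong[rotated 2]) (auto simp: c_def powr_half_sqrt)
    moreover have "c ` {0<..<2} \<subseteq> - {0}" using c_sgn(2) by (intro image_subsetI) simp
    ultimately show "Ck_on 2 {0<..<2} (\<lambda>s. v (sgn (c s)))"
      by (rule Ck_on_compose[where T = "- {0}" and h = c and f = "\<lambda>x. v (sgn x)", OF _ C2, rotated]) simp
  qed (use F_v in auto)
  define P where "P s = frechet_derivative F (at s) 1" for s
  define P' where "P' s = frechet_derivative P (at s) 1" for s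
  have DF: "(F has_real_derivative P s) (at s)" and DP: "(P has_real_derivative P' s) (at s)" if "0 < s" "s < 2" for s
  proof -
    have real_deriv: "(f has_real_derivative frechet_derivative f (at s) 1) (at s)"
      if "f differentiable (at s)" for f :: "real \<Rightarrow> real"
    proof -
      have D: "(f has_derivative frechet_derivative f (at s)) (at s)" using that by (simp add: frechet_derivative_works)
      have "frechet_derivative f (at s) = (*) (frechet_derivative f (at s) 1)"
      proof (rule ext)
        fix r :: real
        have "frechet_derivative f (at s) (r *\<^sub>R 1) = r *\<^sub>R frechet_derivative f (at s) 1"
          by (rule linear_scale[OF has_derivative_linear[OF D]])
        then show "frechet_derivative f (at s) r = frechet_derivative f (at s) 1 * r"
          by (simp only: real_scaleR_def mult_1_right mult.commute[of r "frechet_derivative f (at s) 1"])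
      qed
      then show ?thesis unfolding has_field_derivative_def by (rule has_derivative_eq_rhs[OF D])
    qed
    have "Ck_on (Suc 1) {0<..<2} F" using CkF by (simp add: numeral_2_eq_2)
    then have "F differentiable (at s)" "P differentiable (at s)"
      unfolding P_def[abs_def] using that by auto
    then show "(F has_real_derivative P s) (at s)" "(P has_real_derivative P' s) (at s)"
      using real_deriv by (auto simp: P_def P'_def)
  qed
  define S' where "S' = {x. x \<noteq> 0 \<and> \<bar>sgn x \<bullet> e\<bar> < 1}"
  have cont_sgn: "continuous_on (- {0}) (\<lambda>x::'a. sgn x \<bullet> e)"
    by (intro continuous_intros) auto
  have open_S': "open S'"
  proof -
    have "open (- {0} \<inter> (\<lambda>x. \<bar>sgn x \<bullet> e\<bar>) -` {..<1})"
      by (intro continuous_open_preimage continuous_on_rabs cont_sgn) auto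
    moreover have "S' = - {0} \<inter> (\<lambda>x. \<bar>sgn x \<bullet> e\<bar>) -` {..<1}" by (auto simp: S'_def)
    ultimately show ?thesis by simp
  qed
  \<comment> \<open>The tangential part of e, that is, the spherical gradient of \<omega> \<bullet>
    e; its squared length at \<open>c s\<close> is s (2 - s).\<close>
  define \<epsilon> where "\<epsilon> x = e - (sgn x \<bullet> e) *\<^sub>R sgn x" for x
  have D\<phi>: "((\<lambda>x. 1 - sgn x \<bullet> e) has_derivative (\<lambda>h. - (\<epsilon> x \<bullet> h) / norm x)) (at x)" if "x \<noteq> 0" for x
    by (rule has_derivative_eq_rhs[OF has_derivative_diff[OF has_derivative_const
          has_derivative_inner_left[OF has_derivative_sgn[OF that]]]])
       (auto simp: \<epsilon>_def inner_diff_left divide_inverse inner_commute algebra_simps)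
  have W_eq: "W x = - P (1 - sgn x \<bullet> e) *\<^sub>R \<epsilon> x" if "x \<in> S'" for x
  proof -
    have x: "x \<noteq> 0" "0 < 1 - sgn x \<bullet> e" "1 - sgn x \<bullet> e < 2" using that by (auto simp: S'_def)
    have "((\<lambda>x. F (1 - sgn x \<bullet> e)) has_derivative (\<lambda>h. P (1 - sgn x \<bullet> e) * (- (\<epsilon> x \<bullet> h) / norm x))) (at x)"
      using has_derivative_compose[OF D\<phi>[OF x(1)] DF[OF x(2,3), unfolded has_field_derivative_def]] .
    then have "((\<lambda>x. v (sgn x)) has_derivative (\<lambda>h. P (1 - sgn x \<bullet> e) * (- (\<epsilon> x \<bullet> h) / norm x))) (at x)"
      by (rule has_derivative_transform_within_open[OF _ open_S' that]) (use v_F in \<open>auto simp: S'_def norm_sgn\<close>)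
    then have eq: "(\<lambda>h. P (1 - sgn x \<bullet> e) * (- (\<epsilon> x \<bullet> h) / norm x)) = (\<lambda>h. W x \<bullet> h / norm x)"
      using has_derivative_v[OF x(1)] by (rule has_derivative_unique)
    have "W x \<bullet> h = (- P (1 - sgn x \<bullet> e) *\<^sub>R \<epsilon> x) \<bullet> h" for h
      using fun_cong[OF eq, of h] x(1) by (simp add: field_simps)
    then show ?thesis by (metis vector_eq_ldot inner_commute)
  qed
  have DW_eq: "DW (c s) h = (P' s * (\<epsilon> (c s) \<bullet> h)) *\<^sub>R \<epsilon> (c s)
      + P s *\<^sub>R ((\<epsilon> (c s) \<bullet> h) *\<^sub>R c s + (1 - s) *\<^sub>R (h - (c s \<bullet> h) *\<^sub>R c s))" if s: "0 < s" "s < 2" for s h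
  proof -
    let ?x = "c s"
    have c_e': "e \<bullet> c s = 1 - s" using c_e[of s] by (simp add: inner_commute)
    have x: "?x \<in> S'" "?x \<noteq> 0" "sgn ?x = ?x" "norm ?x = 1"
      using c_sgn[of s] c_norm[of s] s by (auto simp: S'_def c_e)
    have DP': "(P has_derivative (*) (P' s)) (at (1 - sgn ?x \<bullet> e))"
      using DP[OF s] x(3) by (simp add: has_field_derivative_def c_e)
    have 1: "((\<lambda>x. P (1 - sgn x \<bullet> e)) has_derivative (\<lambda>h. P' s * (- (\<epsilon> ?x \<bullet> h) / norm ?x))) (at ?x)"
      using has_derivative_compose[OF D\<phi>[OF x(2)] DP'] .
    have 2: "(\<epsilon> has_derivative (\<lambda>h. - ((\<epsilon> ?x \<bullet> h) *\<^sub>R ?x + (1 - s) *\<^sub>R (h - (?x \<bullet> h) *\<^sub>R ?x)))) (at ?x)"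
      unfolding \<epsilon>_def[abs_def]
      by (rule has_derivative_eq_rhs[OF has_derivative_diff[OF has_derivative_const has_derivative_scaleR[OF
            has_derivative_inner_left[OF has_derivative_sgn[OF x(2)]] has_derivative_sgn[OF x(2)]]]])
         (auto simp: x(3,4) c_e' \<epsilon>_def inner_diff_left inner_commute[of _ e] algebra_simps)
    have "((\<lambda>x. - P (1 - sgn x \<bullet> e) *\<^sub>R \<epsilon> x) has_derivative (\<lambda>h. (P' s * (\<epsilon> ?x \<bullet> h)) *\<^sub>R \<epsilon> ?x
      + P s *\<^sub>R ((\<epsilon> ?x \<bullet> h) *\<^sub>R ?x + (1 - s) *\<^sub>R (h - (?x \<bullet> h) *\<^sub>R ?x)))) (at ?x)"
      by (rule has_derivative_eq_rhs[OF has_derivative_scaleR[OF has_derivative_minus[OF 1] 2]])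
         (auto simp: x(3,4) c_e algebra_simps)
    then have "(W has_derivative (\<lambda>h. (P' s * (\<epsilon> ?x \<bullet> h)) *\<^sub>R \<epsilon> ?x
      + P s *\<^sub>R ((\<epsilon> ?x \<bullet> h) *\<^sub>R ?x + (1 - s) *\<^sub>R (h - (?x \<bullet> h) *\<^sub>R ?x)))) (at ?x)"
      by (rule has_derivative_transform_within_open[OF _ open_S' x(1)]) (simp add: W_eq)
    from has_derivative_unique[OF has_derivative_W_self[OF x(2)] this] show ?thesis by metis
  qed
  have W_c: "W (c s) = - P s *\<^sub>R \<epsilon> (c s)" "\<epsilon> (c s) = e - (1 - s) *\<^sub>R c s"
    "\<epsilon> (c s) \<bullet> c s = 0" "\<epsilon> (c s) \<bullet> \<epsilon> (c s) = s * (2 - s)" "c s \<bullet> c s = 1" if s: "0 < s" "s < 2" for s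
  proof -
    have x: "c s \<in> S'" "sgn (c s) = c s" "norm (c s) = 1"
      using c_sgn[of s] c_norm[of s] s by (auto simp: S'_def c_e)
    show "W (c s) = - P s *\<^sub>R \<epsilon> (c s)" using W_eq[OF x(1)] x(2) by (simp add: c_e)
    show eps: "\<epsilon> (c s) = e - (1 - s) *\<^sub>R c s" using x(2) by (simp add: \<epsilon>_def c_e)
    show cc: "c s \<bullet> c s = 1" using x(3) by (simp add: dot_square_norm)
    have ec: "e \<bullet> c s = 1 - s" using c_e[of s] by (simp add: inner_commute)
    show "\<epsilon> (c s) \<bullet> c s = 0" unfolding eps by (simp add: inner_diff_left ec cc)
    show "\<epsilon> (c s) \<bullet> \<epsilon> (c s) = s * (2 - s)" unfolding eps
      by (simp add: inner_diff_left inner_diff_right ec cc c_e ee algebra_simps)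
  qed
  define N where "N s = s * (2 - s) * (P s)\<^sup>2 + lam\<^sup>2 * (F s)\<^sup>2" for s
  have W2: "(norm (W (c s)))\<^sup>2 = s * (2 - s) * (P s)\<^sup>2" if "0 < s" "s < 2" for s
    unfolding W_c(1)[OF that] power2_norm_eq_inner by (simp add: W_c(4)[OF that] power2_eq_square)
  \<comment> \<open>The equation \<open>L\<close> at the point \<open>c s\<close>. There
    \<open>W\<close> is - P times \<epsilon>, and the Laplacian and \<open>sph_A\<close> reduce to P
    and P'.\<close>
  have ode: "P' s * (s * (2 - s)) + (real DIM('a) - 1) * (1 - s) * P s + lam * ((p - 1) * lam + real DIM('a) - p) * F s
      + (p - 2) * (s * (2 - s) * (P s)\<^sup>2 * (P' s * (s * (2 - s)) + (1 - s) * P s + lam\<^sup>2 * F s) / N s) = 0"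
    if s: "0 < s" "s < 2" for s
  proof -
    let ?x = "c s" and ?\<sigma> = "s * (2 - s)"
    have nx: "norm ?x = 1" and sx: "sgn ?x = ?x" using c_norm c_sgn s by auto
    have lap: "sph_laplacian v ?x = P' s * ?\<sigma> + (real DIM('a) - 1) * (1 - s) * P s"
    proof -
      have a: "(\<Sum>i\<in>Basis. (i - (?x \<bullet> i) *\<^sub>R ?x) \<bullet> i) = real DIM('a) - 1"
        using W_c(5)[OF s] by (simp add: inner_diff_left sum_subtractf inner_same_Basis euclidean_inner[of ?x ?x])
      have f: "(\<Sum>i\<in>Basis. (\<epsilon> ?x \<bullet> i) * (\<epsilon> ?x \<bullet> i)) = ?\<sigma>" "(\<Sum>i\<in>Basis. (\<epsilon> ?x \<bullet> i) * (?x \<bullet> i)) = 0"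
        using W_c(3,4)[OF s] euclidean_inner[of "\<epsilon> ?x" "\<epsilon> ?x"] euclidean_inner[of "\<epsilon> ?x" ?x] by auto
      have "(\<Sum>i\<in>Basis. DW ?x i \<bullet> i) = P' s * (\<Sum>i\<in>Basis. (\<epsilon> ?x \<bullet> i) * (\<epsilon> ?x \<bullet> i))
          + P s * ((\<Sum>i\<in>Basis. (\<epsilon> ?x \<bullet> i) * (?x \<bullet> i)) + (1 - s) * (\<Sum>i\<in>Basis. (i - (?x \<bullet> i) *\<^sub>R ?x) \<bullet> i))"
        unfolding DW_eq[OF s] by (simp add: inner_add_left sum.distrib sum_distrib_left mult.assoc distrib_left)
      then show ?thesis using div_W[OF nx] a f by simp
    qed
    have w: "\<epsilon> ?x \<bullet> W ?x = - P s * ?\<sigma>" "?x \<bullet> W ?x = 0" "W ?x \<bullet> ?x = 0" "W ?x \<bullet> \<epsilon> ?x = - P s * ?\<sigma>"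
      "W ?x \<bullet> W ?x = P s * P s * ?\<sigma>"
      unfolding W_c(1)[OF s] using W_c(3,4)[OF s]
      by (simp_all add: inner_commute[of "c s"] del: mult_minus_left)
    have "W ?x \<bullet> DW ?x (W ?x) = P' s * (P s * ?\<sigma>) * (P s * ?\<sigma>) + P s * ((1 - s) * (P s * P s * ?\<sigma>))"
      unfolding DW_eq[OF s] inner_add_right inner_scaleR_right inner_diff_right w by simp
    then have num: "W ?x \<bullet> sph_hess v ?x (W ?x) + lam\<^sup>2 * F s * (norm (W ?x))\<^sup>2
      = ?\<sigma> * (P s)\<^sup>2 * (P' s * ?\<sigma> + (1 - s) * P s + lam\<^sup>2 * F s)"
      unfolding W_hess_W[OF nx] W2[OF s] by (simp add: algebra_simps power2_eq_square)
    have sgW: "sph_grad v ?x = W ?x" using W_def[of ?x] sx by simp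
    have A: "sph_A lam v ?x = ?\<sigma> * (P s)\<^sup>2 * (P' s * ?\<sigma> + (1 - s) * P s + lam\<^sup>2 * F s) / N s"
      using num unfolding sph_A_def sgW F_def[symmetric] W2[OF s] N_def by simp
    show ?thesis using L[OF nx] unfolding sph_L_def lap A by (simp add: F_def)
  qed
  define \<kappa> where "\<kappa> = DW e b \<bullet> b"
  have e0: "e \<noteq> 0" "sgn e = e" using e by (auto simp: sgn_div_norm)
  have We_b: "W e \<bullet> b = 0"
  proof -
    \<comment> \<open>The direction b and its opposite are exchanged by a symmetry that fixes e, so
      the derivative of v at the pole along b equals its own negative.\<close>
    have even: "v (sgn (e + (- t) *\<^sub>R b)) = v (sgn (e + t *\<^sub>R b))" for t
    proof (rule axially_symmetric_eq[OF ax])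
      have n: "norm (e + t *\<^sub>R b) = sqrt (1 + t\<^sup>2)" for t
        by (simp add: norm_eq_sqrt_inner inner_add_left inner_add_right ee eb power2_eq_square)
      have nz: "e + t *\<^sub>R b \<noteq> 0" for t using n[of t] by (smt (verit) norm_zero real_sqrt_gt_zero zero_le_power2)
      show "norm (sgn (e + (- t) *\<^sub>R b)) = 1" "norm (sgn (e + t *\<^sub>R b)) = 1"
        using nz[of t] nz[of "- t"] by (simp_all add: norm_sgn)
      show "sgn (e + (- t) *\<^sub>R b) \<bullet> e = sgn (e + t *\<^sub>R b) \<bullet> e"
        using n[of t] n[of "- t"] by (simp add: sgn_div_norm inner_diff_left inner_add_left ee)
    qed
    have D: "((\<lambda>x. v (sgn x)) has_derivative (\<lambda>h. W e \<bullet> h)) (at (e + r *\<^sub>R b))" if "r = 0" for r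
      using has_derivative_v[OF e0(1)] e that by simp
    have h: "((\<lambda>t. v (sgn (e + (r * t) *\<^sub>R b))) has_derivative (\<lambda>t. W e \<bullet> ((r * t) *\<^sub>R b))) (at 0)" for r :: real
      by (rule has_derivative_compose[of "\<lambda>t. e + (r * t) *\<^sub>R b" _ 0 UNIV "\<lambda>x. v (sgn x)"])
         (use D[of "r * 0"] in \<open>auto intro!: derivative_eq_intros\<close>)
    have "(\<lambda>t. v (sgn (e + (-1 * t) *\<^sub>R b))) = (\<lambda>t. v (sgn (e + (1 * t) *\<^sub>R b)))"
      using even by simp
    with h[of "-1"] h[of 1] have "(\<lambda>t. W e \<bullet> ((-1 * t) *\<^sub>R b)) = (\<lambda>t. W e \<bullet> ((1 * t) *\<^sub>R b))"
      using has_derivative_unique by metis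
    from fun_cong[OF this, of 1] show ?thesis by simp
  qed
  \<comment> \<open>On the meridian \<open>W \<bullet> b\<close> equals P (1 - s) sqrt (s (2 - s)),
    a quantity that vanishes at the pole. So the limit of P is the derivative of \<open>W\<close> at
    e, taken along b in the direction b.\<close>
  have limP: "(P \<longlongrightarrow> \<kappa>) (at_right 0)"
  proof -
    define k where "k t = W (e + t *\<^sub>R b) \<bullet> b" for t
    have "((\<lambda>t. e + t *\<^sub>R b) has_derivative (\<lambda>t. t *\<^sub>R b)) (at 0)"
      by (auto intro!: derivative_eq_intros)
    moreover have "(W has_derivative DW e) (at (e + 0 *\<^sub>R b))" using has_derivative_W_self[OF e0(1)] by simp
    ultimately have "(k has_derivative (\<lambda>t. DW e (t *\<^sub>R b) \<bullet> b)) (at 0)"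
      unfolding k_def[abs_def] by (intro has_derivative_inner_left has_derivative_compose[of "\<lambda>t. e + t *\<^sub>R b" _ 0 UNIV W])
    then have "(k has_real_derivative \<kappa>) (at 0)"
      using linear_scale[OF linear_DW[OF e0(1)]] by (simp add: has_field_derivative_def \<kappa>_def mult.commute[of _ "DW e b \<bullet> b"])
    then have lk: "((\<lambda>t. k t / t) \<longlongrightarrow> \<kappa>) (at 0)"
      using We_b by (simp add: has_field_derivative_iff k_def)
    \<comment> \<open>The tangent of the polar angle: e + \<tau> b lies on the ray through
      \<open>c s\<close>, and \<open>W\<close> is constant on that ray.\<close>
    define \<tau> where "\<tau> s = sqrt (s * (2 - s)) / (1 - s)" for s
    have ev: "eventually (\<lambda>s. 0 < s \<and> s < 1) (at_right (0::real))"
      by (auto simp: eventually_at_right_field intro!: exI[of _ 1])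
    have "(\<tau> \<longlongrightarrow> sqrt (0 * (2 - 0)) / (1 - 0)) (at_right 0)"
      unfolding \<tau>_def[abs_def] by (intro tendsto_intros) auto
    then have "filterlim \<tau> (at 0) (at_right 0)"
      unfolding filterlim_at
    proof (intro conjI)
      show "\<forall>\<^sub>F x in at_right 0. \<tau> x \<in> UNIV \<and> \<tau> x \<noteq> 0" using ev by eventually_elim (simp add: \<tau>_def)
    qed simp
    with lk have "((\<lambda>s. k (\<tau> s) / \<tau> s) \<longlongrightarrow> \<kappa>) (at_right 0)" by (rule filterlim_compose)
    then have "((\<lambda>s. (k (\<tau> s) / \<tau> s) / (1 - s)\<^sup>2) \<longlongrightarrow> \<kappa> / (1 - 0)\<^sup>2) (at_right 0)"
      by (intro tendsto_intros) auto
    then have l: "((\<lambda>s. (k (\<tau> s) / \<tau> s) / (1 - s)\<^sup>2) \<longlongrightarrow> \<kappa>) (at_right 0)" by simp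
    have "\<forall>\<^sub>F s in at_right 0. (k (\<tau> s) / \<tau> s) / (1 - s)\<^sup>2 = P s"
      using ev
    proof eventually_elim
      case (elim s)
      then have s: "0 < s" "s < 2" by auto
      define r where "r = sqrt (s * (2 - s))"
      have r: "r > 0" using s by (simp add: r_def)
      have "(1 - s) * \<tau> s = sqrt (s * (2 - s))" using elim by (simp add: \<tau>_def)
      then have "(1 - s) *\<^sub>R (e + \<tau> s *\<^sub>R b) = c s" by (simp add: c_def scaleR_add_right)
      then have "W (e + \<tau> s *\<^sub>R b) = W (c s)" using W_hom(1)[of "1 - s" "e + \<tau> s *\<^sub>R b"] elim by simp
      then have "k (\<tau> s) = P s * (1 - s) * r"
        unfolding k_def W_c(1)[OF s] W_c(2)[OF s] by (simp add: inner_diff_left eb c_b r_def)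
      then show ?case using elim r by (simp add: \<tau>_def r_def[symmetric] power2_eq_square)
    qed
    from tendsto_cong[OF this] l show ?thesis by simp
  qed
  define P0 where "P0 s = (if s = 0 then \<kappa> else P s)" for s
  have at_pos: "at s within {0..<2} = at s" if "0 < s" "s < 2" for s :: real
    by (rule at_within_open_subset[of s "{0<..<2}"]) (use that in auto)
  have cont_c: "continuous_on UNIV c" unfolding c_def by (intro continuous_intros)
  have lim_c: "(c \<longlongrightarrow> e) (at_right 0)"
  proof -
    have "(c \<longlongrightarrow> c 0) (at 0)" using cont_c by (simp add: continuous_on_eq_continuous_at isCont_def)
    then show ?thesis by (auto simp: c_def intro: tendsto_within_subset)
  qed
  have ev2: "eventually (\<lambda>s. 0 < s \<and> s < 2) (at_right (0::real))"
    by (auto simp: eventually_at_right_field intro!: exI[of _ 2])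
  have F0: "F 0 = v e" by (simp add: F_def c_def)
  have limF: "(F \<longlongrightarrow> F 0) (at_right 0)"
  proof -
    have "((\<lambda>x. v (sgn x)) \<longlongrightarrow> v (sgn e)) (at e)"
      using Ck_on_imp_continuous_on[OF C2] e0(1) by (simp add: continuous_on_eq_continuous_at isCont_def)
    then have "((\<lambda>s. v (sgn (c s))) \<longlongrightarrow> v (sgn e)) (at_right 0)"
      using lim_c by (rule isCont_tendsto_compose[unfolded isCont_def])
    moreover have "\<forall>\<^sub>F s in at_right 0. v (sgn (c s)) = F s"
      using ev2 by eventually_elim (simp add: F_v)
    ultimately show ?thesis using tendsto_cong F0 e0(2) by force
  qed
  have DF0: "(F has_real_derivative P0 s) (at s within {0..<2})" if "s \<in> {0..<2}" for s
  proof (cases "s = 0")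
    case True
    have "((\<lambda>s. (F s - F 0) / s powr 1) \<longlongrightarrow> \<kappa>) (at_right 0)"
    proof (rule lhopital_powr_at_right_0[of 1 2 _ P])
      show "((\<lambda>s. F s - F 0) \<longlongrightarrow> 0) (at_right 0)" using tendsto_diff[OF limF tendsto_const[of "F 0"]] by simp
      show "((\<lambda>s. F s - F 0) has_real_derivative P s) (at s)" if "0 < s" "s < 2" for s
        using DERIV_diff[OF DF[OF that] DERIV_const[of "F 0"]] by simp
      show "((\<lambda>s. P s / (1 * s powr (1 - 1))) \<longlongrightarrow> \<kappa>) (at_right 0)"
      proof (rule tendsto_cong[THEN iffD1, OF _ limP])
        show "\<forall>\<^sub>F s in at_right 0. P s = P s / (1 * s powr (1 - 1))" using ev2 by eventually_elim simp
      qed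
    qed auto
    moreover have "\<forall>\<^sub>F s in at_right 0. (F s - F 0) / s powr 1 = (F s - F 0) / s"
      using ev2 by eventually_elim simp
    ultimately have "((\<lambda>s. (F s - F 0) / s) \<longlongrightarrow> \<kappa>) (at_right 0)"
      by (rule tendsto_cong[THEN iffD1, rotated])
    then show ?thesis using True by (simp add: has_field_derivative_iff at_0_within_Ico P0_def)
  next
    case False
    then show ?thesis using that DF[of s] at_pos[of s] by (simp add: P0_def)
  qed
  have DP0: "(P0 has_real_derivative P' s) (at s)" if "0 < s" "s < 2" for s
    by (rule has_field_derivative_transform_within_open[OF DP[OF that], of "{0<..}"]) (use that in \<open>auto simp: P0_def\<close>)
  have contP0: "continuous_on {0..<2} P0"
    unfolding continuous_on_def
  proof
    fix s :: real assume s: "s \<in> {0..<2}"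
    show "(P0 \<longlongrightarrow> P0 s) (at s within {0..<2})"
    proof (cases "s = 0")
      case True
      have "\<forall>\<^sub>F s in at_right 0. P s = P0 s" using ev2 by eventually_elim (simp add: P0_def)
      then have "(P0 \<longlongrightarrow> \<kappa>) (at_right 0)" using limP by (rule tendsto_cong[THEN iffD1])
      then show ?thesis using True by (simp add: at_0_within_Ico P0_def)
    next
      case False
      then have s': "0 < s" "s < 2" using s by auto
      have "isCont P0 s" using DP0[OF s'] by (rule DERIV_isCont)
      then show ?thesis using at_pos[OF s'] by (simp add: isCont_def)
    qed
  qed
  \<comment> \<open>The squared length s (2 - s) P^2 tends to 0, as P has a limit. Then
    \<open>Z lam e \<noteq> 0\<close> forces lam v(e) \<noteq> 0, the nondegeneracy needed at s =
    0.\<close>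
  have We: "W e = 0"
  proof -
    have "isCont W e"
      using Ck_on_imp_continuous_on[OF C1_W] e0(1) by (simp add: continuous_on_eq_continuous_at)
    then have "((\<lambda>s. W (c s)) \<longlongrightarrow> W e) (at_right 0)" using lim_c by (rule isCont_tendsto_compose)
    then have "((\<lambda>s. (norm (W (c s)))\<^sup>2) \<longlongrightarrow> (norm (W e))\<^sup>2) (at_right 0)" by (intro tendsto_intros)
    moreover have "((\<lambda>s. (norm (W (c s)))\<^sup>2) \<longlongrightarrow> 0) (at_right 0)"
    proof (rule tendsto_cong[THEN iffD1])
      show "\<forall>\<^sub>F s in at_right 0. s * (2 - s) * (P s)\<^sup>2 = (norm (W (c s)))\<^sup>2"
        using ev2 by eventually_elim (simp add: W2)
      have "((\<lambda>s. s * (2 - s) * (P s)\<^sup>2) \<longlongrightarrow> 0 * (2 - 0) * \<kappa>\<^sup>2) (at_right 0)"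
        by (intro tendsto_intros limP)
      then show "((\<lambda>s. s * (2 - s) * (P s)\<^sup>2) \<longlongrightarrow> 0) (at_right 0)" by simp
    qed
    ultimately have "(norm (W e))\<^sup>2 = 0" by (rule tendsto_unique[OF trivial_limit_at_right_real])
    then show ?thesis by simp
  qed
  have Npos: "s * (2 - s) * (P0 s)\<^sup>2 + lam\<^sup>2 * (F s)\<^sup>2 > 0" if "s \<in> {0..<2}" for s
  proof (cases "s = 0")
    case True
    have "0 < (norm (Z lam e))\<^sup>2" using Z[OF e0(1)] by simp
    then show ?thesis using norm_Z[OF e0(1), of lam] True We e0(2) F0 by simp
  next
    case False
    then have s: "0 < s" "s < 2" using that by auto
    have "0 < (norm (Z lam (c s)))\<^sup>2" using Z c_sgn(2)[of s] s by simp
    also have "(norm (Z lam (c s)))\<^sup>2 = s * (2 - s) * (P s)\<^sup>2 + lam\<^sup>2 * (F s)\<^sup>2"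
      using norm_Z[of "c s" lam] c_sgn[of s] s W2[OF s] by (simp add: F_def)
    finally show ?thesis using False by (simp add: P0_def)
  qed
  have smooth: "Ck_ivl k {0..<2} F"
  proof (rule axial_ode_smooth[OF p _ DF0 contP0 DP0 Npos])
    show "1 < real DIM('a)" using dim by simp
    show "P' s * (s * (2 - s)) + (real DIM('a) - 1) * (1 - s) * P0 s + lam * ((p - 1) * lam + real DIM('a) - p) * F s
      + (p - 2) * (s * (2 - s) * (P0 s)\<^sup>2 * (P' s * (s * (2 - s)) + (1 - s) * P0 s + lam\<^sup>2 * F s) /
        (s * (2 - s) * (P0 s)\<^sup>2 + lam\<^sup>2 * (F s)\<^sup>2)) = 0" if "0 < s" "s < 2" for s
      using ode[OF that] that by (simp add: P0_def N_def)
  qed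
  let ?S = "{x. x \<noteq> 0 \<and> sgn x \<bullet> e > -1}"
  have open_S: "open ?S"
  proof -
    have "open (- {0} \<inter> (\<lambda>x. sgn x \<bullet> e) -` {-1<..})"
      by (intro continuous_open_preimage cont_sgn) auto
    moreover have "?S = - {0} \<inter> (\<lambda>x. sgn x \<bullet> e) -` {-1<..}" by auto
    ultimately show ?thesis by simp
  qed
  have "Ck_on k ?S (\<lambda>x. F (1 + (-1) * (sgn x \<bullet> e)))"
  proof (rule Ck_on_compose_Ck_ivl[OF open_S _ _ smooth])
    show "Ck_on j ?S (\<lambda>x. 1 + (-1) * (sgn x \<bullet> e))" for j
      by (intro Ck_on_add Ck_on_mult Ck_on_const Ck_on_inner open_S Ck_on_mono[OF Ck_on_sgn]) auto
    show "(\<lambda>x. 1 + (-1) * (sgn x \<bullet> e)) ` ?S \<subseteq> {0..<2}"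
      using abs_e by (force simp: norm_sgn abs_le_iff)
  qed
  then show ?thesis
    by (rule Ck_on_cong[OF open_S, rotated]) (use v_F in \<open>auto simp: norm_sgn\<close>)
qed

end

section \<open>Variational means of homogeneous functions\<close>

lemma has_real_derivative_abs_powr:
  fixes p :: real
  assumes p: "p > 1"
  shows "((\<lambda>a. \<bar>a\<bar> powr p) has_real_derivative p * (\<bar>a\<bar> powr (p - 2) * a)) (at a)"
proof -
  consider "a > 0" | "a = 0" | "a < 0" by linarith
  then show ?thesis
  proof cases
    case 1
    have "((\<lambda>a. a powr p) has_real_derivative p * a powr (p - 1)) (at a)"
      using 1 by (rule has_real_derivative_powr)
    then have "((\<lambda>a. \<bar>a\<bar> powr p) has_real_derivative p * a powr (p - 1)) (at a)"
      by (rule has_field_derivative_transform_within_open[of _ _ _ "{0<..}"]) (use 1 in auto)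
    moreover have "a powr (p - 1) = \<bar>a\<bar> powr (p - 2) * a" using 1 by (simp add: powr_diff power2_eq_square)
    ultimately show ?thesis by simp
  next
    case 2
    have "((\<lambda>h::real. \<bar>h\<bar> powr (p - 1)) \<longlongrightarrow> \<bar>0\<bar> powr (p - 1)) (at 0)"
      using p by (intro tendsto_powr' tendsto_intros) auto
    moreover have "\<bar>h\<bar> powr (p - 1) = norm (\<bar>h\<bar> powr p / h)" for h :: real
      by (cases "h = 0") (simp_all add: abs_divide powr_diff)
    ultimately have "((\<lambda>h. norm (\<bar>h\<bar> powr p / h)) \<longlongrightarrow> 0) (at (0::real))" by simp
    then have "((\<lambda>h. \<bar>h\<bar> powr p / h) \<longlongrightarrow> 0) (at 0)"
      by (rule tendsto_norm_zero_cancel)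
    then show ?thesis using 2 by (simp add: has_field_derivative_iff)
  next
    case 3
    have "((\<lambda>a. (- a) powr p) has_real_derivative p * (- a) powr (p - 1) * -1) (at a)"
      using 3 by (intro DERIV_chain2[of "\<lambda>a. a powr p"] has_real_derivative_powr) (auto intro!: derivative_eq_intros)
    then have "((\<lambda>a. \<bar>a\<bar> powr p) has_real_derivative p * (- a) powr (p - 1) * -1) (at a)"
      by (rule has_field_derivative_transform_within_open[of _ _ _ "{..<0}"]) (use 3 in auto)
    moreover have "(- a) powr (p - 1) = - (\<bar>a\<bar> powr (p - 2) * a)" using 3 by (simp add: powr_diff power2_eq_square)
    ultimately show ?thesis by simp
  qed
qed

lemma strict_mono_signed_powr:
  fixes p :: real
  assumes p: "p > 1" and ab: "a < b"
  shows "\<bar>a\<bar> powr (p - 2) * a < \<bar>b\<bar> powr (p - 2) * b"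
proof -
  have eq: "\<bar>x\<bar> powr (p - 2) * x = sgn x * \<bar>x\<bar> powr (p - 1)" for x :: real
    by (cases "x = 0") (simp_all add: powr_diff power2_eq_square sgn_if abs_if)
  consider "a \<ge> 0" | "a < 0" "b > 0" | "b \<le> 0" using ab by linarith
  then show ?thesis
  proof cases
    case 1
    then show ?thesis using ab p powr_less_mono2[of "p - 1" a b]
      unfolding eq by (cases "a = 0") simp_all
  next
    case 2
    then have "sgn a * \<bar>a\<bar> powr (p - 1) < 0" "0 < sgn b * \<bar>b\<bar> powr (p - 1)" by simp_all
    then show ?thesis unfolding eq by linarith
  next
    case 3
    then show ?thesis using ab p powr_less_mono2[of "p - 1" "- b" "- a"]
      unfolding eq by (cases "b = 0") simp_all
  qed
qed

text \<open>Strict convexity in tangent form: the derivative is strictly increasing, and the mean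
  value theorem compares it with the secant.\<close>

lemma abs_powr_above_tangent:
  fixes p :: real
  assumes p: "p > 1" and ab: "a \<noteq> b"
  shows "\<bar>b\<bar> powr p > \<bar>a\<bar> powr p + p * (\<bar>a\<bar> powr (p - 2) * a) * (b - a)"
proof (cases "a < b")
  case True
  obtain z where z: "a < z" "z < b" "\<bar>b\<bar> powr p - \<bar>a\<bar> powr p = (b - a) * (p * (\<bar>z\<bar> powr (p - 2) * z))"
    using MVT2[OF True, of "\<lambda>a. \<bar>a\<bar> powr p" "\<lambda>a. p * (\<bar>a\<bar> powr (p - 2) * a)"] has_real_derivative_abs_powr[OF p] by blast
  have "p * (\<bar>a\<bar> powr (p - 2) * a) * (b - a) < p * (\<bar>z\<bar> powr (p - 2) * z) * (b - a)"
    using strict_mono_signed_powr[OF p z(1)] p True by (intro mult_strict_right_mono mult_strict_left_mono) auto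
  then show ?thesis using z(3) by (simp add: mult.commute)
next
  case False
  then have ba: "b < a" using ab by simp
  obtain z where z: "b < z" "z < a" "\<bar>a\<bar> powr p - \<bar>b\<bar> powr p = (a - b) * (p * (\<bar>z\<bar> powr (p - 2) * z))"
    using MVT2[OF ba, of "\<lambda>a. \<bar>a\<bar> powr p" "\<lambda>a. p * (\<bar>a\<bar> powr (p - 2) * a)"] has_real_derivative_abs_powr[OF p] by blast
  have "p * (\<bar>z\<bar> powr (p - 2) * z) * (a - b) < p * (\<bar>a\<bar> powr (p - 2) * a) * (a - b)"
    using strict_mono_signed_powr[OF p z(2)] p ba by (intro mult_strict_right_mono mult_strict_left_mono) auto
  then show ?thesis using z(3) by (simp add: algebra_simps)
qed

lemma continuous_signed_powr:
  fixes p :: real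
  assumes "p > 2"
  shows "continuous_on UNIV (\<lambda>a::real. \<bar>a\<bar> powr (p - 2) * a)"
  using assms by (intro continuous_intros continuous_on_powr') auto

text \<open>Since u is bounded, f is only evaluated on a compact interval as long as the shift stays
  bounded; its maximum there dominates.\<close>

lemma (in finite_measure) continuous_integral_translate:
  fixes f :: "real \<Rightarrow> real"
  assumes f: "continuous_on UNIV f" and u: "u \<in> borel_measurable M" "\<And>x. x \<in> space M \<Longrightarrow> \<bar>u x\<bar> \<le> K"
  shows "integrable M (\<lambda>x. f (u x - t))" "isCont (\<lambda>t. LINT x|M. f (u x - t)) t"
proof -
  have mf: "f \<in> borel_measurable borel" using f by (rule borel_measurable_continuous_onI)
  have mfu: "(\<lambda>x. f (u x - t)) \<in> borel_measurable M" for t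
    by (intro measurable_compose[OF _ mf] borel_measurable_diff u(1) borel_measurable_const)
  have bnd: "\<exists>B\<ge>0. \<forall>s x. \<bar>s\<bar> \<le> T \<longrightarrow> x \<in> space M \<longrightarrow> \<bar>f (u x - s)\<bar> \<le> B" for T
  proof -
    have "compact (f ` {- (K + T)..K + T})"
      by (rule compact_continuous_image) (auto intro: continuous_on_subset[OF f])
    then obtain B where B: "B > 0" "\<forall>y\<in>f ` {- (K + T)..K + T}. norm y \<le> B"
      using compact_imp_bounded bounded_pos by blast
    have "\<bar>f (u x - s)\<bar> \<le> B" if "\<bar>s\<bar> \<le> T" "x \<in> space M" for s x
    proof -
      have "u x - s \<in> {- (K + T)..K + T}" using u(2)[OF that(2)] that(1) by auto
      then show ?thesis using B(2) by auto
    qed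
    then show ?thesis using B(1) by (intro exI[of _ B]) auto
  qed
  show "integrable M (\<lambda>x. f (u x - t))"
  proof -
    obtain B where "\<forall>s x. \<bar>s\<bar> \<le> \<bar>t\<bar> \<longrightarrow> x \<in> space M \<longrightarrow> \<bar>f (u x - s)\<bar> \<le> B" using bnd by blast
    then show ?thesis by (intro integrable_const_bound[of _ B] mfu) auto
  qed
  show "isCont (\<lambda>t. LINT x|M. f (u x - t)) t"
    unfolding continuous_at_sequentially
  proof (intro allI impI)
    fix s assume s: "s \<longlonglongrightarrow> t"
    then obtain T where T: "\<And>n. \<bar>s n\<bar> \<le> T" using convergent_imp_Bseq[OF convergentI[OF s]] by (auto simp: Bseq_def)
    obtain B where B: "\<forall>s x. \<bar>s\<bar> \<le> T \<longrightarrow> x \<in> space M \<longrightarrow> \<bar>f (u x - s)\<bar> \<le> B" using bnd by blast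
    have "(\<lambda>n. LINT x|M. f (u x - s n)) \<longlonglongrightarrow> (LINT x|M. f (u x - t))"
    proof (rule integral_dominated_convergence[where w = "\<lambda>_. B"])
      have "(\<lambda>n. f (u x - s n)) \<longlonglongrightarrow> f (u x - t)" for x
      proof -
        have "isCont f (u x - t)" using f by (simp add: continuous_on_eq_continuous_at)
        then show ?thesis by (rule isCont_tendsto_compose) (intro tendsto_intros s)
      qed
      then show "AE x in M. (\<lambda>n. f (u x - s n)) \<longlonglongrightarrow> f (u x - t)" by simp
      show "AE x in M. norm (f (u x - s n)) \<le> B" for n using B T by auto
    qed (use mfu in auto)
    then show "((\<lambda>t. LINT x|M. f (u x - t)) \<circ> s) \<longlonglongrightarrow> (LINT x|M. f (u x - t))"
      by (simp add: o_def)
  qed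
qed

text \<open>Convexity settles all three claims. The sign of the minimiser is read off from \<Psi> at
  0: J has slope - p \<Psi> there, and \<Psi> 0 < 0 means that J decreases towards the left.\<close>

lemma (in finite_measure) unique_variational_mean:
  fixes p K :: real
  assumes p: "p > 2" and u: "u \<in> borel_measurable M" "\<And>x. x \<in> space M \<Longrightarrow> \<bar>u x\<bar> \<le> K"
    and pos: "emeasure M (space M) \<noteq> 0" and K: "K \<ge> 0"
    and neg: "(LINT x|M. \<bar>u x\<bar> powr (p - 2) * u x) < 0"
  defines "J \<equiv> \<lambda>t. LINT x|M. \<bar>u x - t\<bar> powr p"
  obtains m where "m < 0" "\<And>t. J m \<le> J t" "\<And>s. (\<And>t. J s \<le> J t) \<Longrightarrow> s = m"
proof -
  define \<psi> where "\<psi> a = \<bar>a\<bar> powr (p - 2) * a" for a :: real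
  define \<Psi> where "\<Psi> t = (LINT x|M. \<psi> (u x - t))" for t
  have p1: "p > 1" using p by simp
  have c1: "continuous_on UNIV (\<lambda>a::real. \<bar>a\<bar> powr p)"
    using p by (intro continuous_on_powr' continuous_intros) auto
  have c2: "continuous_on UNIV \<psi>" unfolding \<psi>_def using continuous_signed_powr[OF p] .
  note iJ = continuous_integral_translate(1)[OF c1 u] and cJ = continuous_integral_translate(2)[OF c1 u, folded J_def]
  note iP = continuous_integral_translate(1)[OF c2 u] and cP = continuous_integral_translate(2)[OF c2 u, folded \<Psi>_def]
  have tang: "\<bar>b\<bar> powr p \<ge> \<bar>a\<bar> powr p + p * \<psi> a * (b - a)" for a b :: real
    using abs_powr_above_tangent[OF p1, of a b] by (cases "a = b") (auto simp: \<psi>_def)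
  have J_ge: "J s \<ge> J t + p * (t - s) * \<Psi> t" for s t
  proof -
    have "J t + p * (t - s) * \<Psi> t = (LINT x|M. \<bar>u x - t\<bar> powr p + p * (t - s) * \<psi> (u x - t))"
      unfolding J_def \<Psi>_def using iJ[of t] iP[of t] by simp
    also have "\<dots> \<le> J s"
      unfolding J_def
    proof (rule integral_mono)
      show "\<bar>u x - t\<bar> powr p + p * (t - s) * \<psi> (u x - t) \<le> \<bar>u x - s\<bar> powr p" for x
        using tang[of "u x - t" "u x - s"] by (simp add: mult_ac)
    qed (use iJ iP in auto)
    finally show ?thesis .
  qed
  \<comment> \<open>Beyond 2K every \<bar>u x - t\<bar> is at least \<bar>u x\<bar>, so no value
    there is below J 0 and the search is confined to a compact interval.\<close>
  have "\<exists>m\<in>{-(2*K)..2*K}. \<forall>t\<in>{-(2*K)..2*K}. J m \<le> J t"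
    using K cJ by (intro continuous_attains_inf) (auto intro!: continuous_at_imp_continuous_on)
  then obtain m where m: "\<And>t. t \<in> {-(2*K)..2*K} \<Longrightarrow> J m \<le> J t" by blast
  have J0: "J 0 \<le> J t" if "t \<notin> {-(2*K)..2*K}" for t
    unfolding J_def
  proof (rule integral_mono[OF iJ iJ])
    fix x assume "x \<in> space M"
    then have "\<bar>u x\<bar> \<le> \<bar>u x - t\<bar>" using u(2)[of x] that by auto
    then show "\<bar>u x - 0\<bar> powr p \<le> \<bar>u x - t\<bar> powr p" using p by (simp add: powr_mono2)
  qed
  have min: "J m \<le> J t" for t
    using m[of t] m[of 0] J0[of t] K by (cases "t \<in> {-(2*K)..2*K}") auto
  have uniq: "s = m" if s: "\<And>t. J s \<le> J t" for s
  proof (rule ccontr)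
    assume "s \<noteq> m"
    \<comment> \<open>Two minimisers would make the midpoint strictly better: the tangent
      inequalities at u - z, taken towards u - s and u - m, add up with cancelling linear
      terms.\<close>
    define z where "z = (s + m) / 2"
    have "(LINT x|M. 2 * \<bar>u x - z\<bar> powr p) < (LINT x|M. \<bar>u x - s\<bar> powr p + \<bar>u x - m\<bar> powr p)"
    proof (rule integral_less_AE_space)
      have "2 * \<bar>u x - z\<bar> powr p < \<bar>u x - s\<bar> powr p + \<bar>u x - m\<bar> powr p" for x
        using abs_powr_above_tangent[OF p1, of "u x - z" "u x - s"]
          abs_powr_above_tangent[OF p1, of "u x - z" "u x - m"] \<open>s \<noteq> m\<close>
        by (simp add: z_def field_simps)
      then show "AE x in M. 2 * \<bar>u x - z\<bar> powr p < \<bar>u x - s\<bar> powr p + \<bar>u x - m\<bar> powr p" by simp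
    qed (use iJ pos in auto)
    then have "2 * J z < J s + J m" unfolding J_def using iJ by simp
    then show False using s[of z] min[of z] by simp
  qed
  have Psi0: "\<Psi> 0 < 0" using neg by (simp add: \<Psi>_def \<psi>_def)
  have "eventually (\<lambda>t. \<Psi> t < 0) (at 0)"
    using cP[of 0] Psi0 by (intro order_tendstoD(2)[of _ "\<Psi> 0"]) (auto simp: isCont_def)
  then obtain \<delta> where \<delta>: "\<delta> > 0" "\<And>t. t \<noteq> 0 \<Longrightarrow> dist t 0 < \<delta> \<Longrightarrow> \<Psi> t < 0"
    unfolding eventually_at by blast
  \<comment> \<open>A slightly negative competitor with J t < J 0. No m \<ge> 0 can match it,
    because the tangent inequality at 0 gives J m \<ge> J 0.\<close>
  define t where "t = - (\<delta> / 2)"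
  have "\<Psi> t < 0" "t < 0" using \<delta> by (auto simp: t_def)
  then have "p * (t - 0) * \<Psi> t > 0" using p by (intro mult_neg_neg mult_pos_neg) auto
  then have Jt: "J t < J 0" using J_ge[of t 0] by simp
  have "m < 0"
  proof (rule ccontr)
    assume "\<not> m < 0"
    then have "p * (0 - m) * \<Psi> 0 \<ge> 0" using p Psi0 by (intro mult_nonpos_nonpos) (auto simp: mult_nonneg_nonpos)
    then have "J m \<ge> J 0" using J_ge[of 0 m] by simp
    then show False using Jt min[of t] by simp
  qed
  then show ?thesis using that min uniq by blast
qed

section \<open>Scaling of variational means\<close>

lemma lborel_integral_scale:
  fixes h :: "'a::euclidean_space \<Rightarrow> real"
  assumes "h \<in> borel_measurable borel" "c > 0"
  shows "(LINT x|lborel. h x) = c ^ DIM('a) * (LINT x|lborel. h (c *\<^sub>R x))"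
proof -
  have "(LINT x|lborel. h x) = (LINT x|density (distr lborel borel (\<lambda>x. 0 + c *\<^sub>R x)) (\<lambda>_. ennreal (\<bar>c\<bar> ^ DIM('a))). h x)"
    using lborel_affine[of c "0::'a"] assms(2) by simp
  also have "\<dots> = (LINT x|distr lborel borel (\<lambda>x. 0 + c *\<^sub>R x). \<bar>c\<bar> ^ DIM('a) *\<^sub>R h x)"
    using assms by (intro integral_density) auto
  also have "\<dots> = (LINT x|lborel. \<bar>c\<bar> ^ DIM('a) *\<^sub>R h (0 + c *\<^sub>R x))"
    using assms by (intro integral_distr) auto
  finally show ?thesis using assms(2) by simp
qed

text \<open>The substitution y = \<epsilon> x turns the norm over the ball of radius \<epsilon> into
  a positive constant times the one over the unit ball, with t divided by \<epsilon>^lam. Minimisers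
  scale accordingly.\<close>

lemma var_mean_homogeneous:
  fixes u :: "'a::euclidean_space \<Rightarrow> real"
  assumes p: "p > 2" and u: "u \<in> borel_measurable borel" "\<And>x. norm x < 1 \<Longrightarrow> \<bar>u x\<bar> \<le> K"
    and hom: "\<And>c x. c > 0 \<Longrightarrow> u (c *\<^sub>R x) = c powr lam * u x"
    and neg: "(LINT x:ball 0 1|lborel. \<bar>u x\<bar> powr (p - 2) * u x) < 0"
  obtains m where "m < 0" "\<And>\<epsilon>. \<epsilon> > 0 \<Longrightarrow> var_mean p \<epsilon> u 0 = \<epsilon> powr lam * m"
proof -
  let ?M = "restrict_space lborel (ball (0::'a) 1)"
  have set_int: "(LINT x:ball 0 1|lborel. f x) = (LINT x|?M. f x)" for f :: "'a \<Rightarrow> real"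
    unfolding set_lebesgue_integral_def by (subst integral_restrict_space) auto
  have em: "emeasure ?M (space ?M) = emeasure lborel (ball (0::'a) 1)"
    by (simp add: space_restrict_space emeasure_restrict_space)
  interpret finite_measure ?M
  proof (rule finite_measureI)
    show "emeasure ?M (space ?M) \<noteq> \<infinity>"
      unfolding em using emeasure_bounded_finite[of "ball (0::'a) 1"] by simp
  qed
  have pos: "emeasure ?M (space ?M) \<noteq> 0"
    unfolding em by (simp add: emeasure_ball unit_ball_vol_pos[THEN less_imp_neq, symmetric])
  have K: "K \<ge> 0" using u(2)[of 0] by simp
  define J where "J t = (LINT x|?M. \<bar>u x - t\<bar> powr p)" for t
  have "u \<in> borel_measurable ?M" using u(1) by (simp add: measurable_restrict_space1)
  moreover have "\<bar>u x\<bar> \<le> K" if "x \<in> space ?M" for x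
    using u(2)[of x] that by (simp add: space_restrict_space)
  ultimately obtain m where m: "m < 0" "\<And>t. J m \<le> J t" "\<And>s. (\<And>t. J s \<le> J t) \<Longrightarrow> s = m"
    using unique_variational_mean[OF p _ _ pos K neg[unfolded set_int], folded J_def] by blast
  have J_nonneg: "J t \<ge> 0" for t unfolding J_def by (rule integral_nonneg_AE) simp
  have J_mono: "J s powr (1 / p) \<le> J t powr (1 / p) \<longleftrightarrow> J s \<le> J t" for s t
    using powr_mono2[of "1 / p" "J s" "J t"] powr_less_mono2[of "1 / p" "J t" "J s"] J_nonneg[of s] J_nonneg[of t] p
    by (auto simp: not_le[symmetric])
  show ?thesis
  proof (rule that[OF m(1)])
    fix \<epsilon> :: real assume e: "\<epsilon> > 0"
    define a where "a = \<epsilon> powr lam"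
    have a: "a > 0" using e by (simp add: a_def)
    define C where "C = (\<epsilon> ^ DIM('a) * a powr p) powr (1 / p)"
    have C: "C > 0" using e a by (simp add: C_def)
    have norm: "Lp_norm_on p (ball 0 \<epsilon>) (\<lambda>y. u y - t) = C * J (t / a) powr (1 / p)" for t
    proof -
      have "(LINT y:ball 0 \<epsilon>|lborel. \<bar>u y - t\<bar> powr p)
        = \<epsilon> ^ DIM('a) * (LINT y|lborel. indicator (ball 0 \<epsilon>) (\<epsilon> *\<^sub>R y) *\<^sub>R \<bar>u (\<epsilon> *\<^sub>R y) - t\<bar> powr p)"
        unfolding set_lebesgue_integral_def using u(1) e
        by (intro lborel_integral_scale) (auto intro!: borel_measurable_times borel_measurable_indicator
            powr_real_measurable borel_measurable_abs borel_measurable_diff)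
      also have "(LINT y|lborel. indicator (ball 0 \<epsilon>) (\<epsilon> *\<^sub>R y) *\<^sub>R \<bar>u (\<epsilon> *\<^sub>R y) - t\<bar> powr p)
        = (LINT y|lborel. a powr p * (indicator (ball 0 1) y *\<^sub>R \<bar>u y - t / a\<bar> powr p))"
      proof (rule Bochner_Integration.integral_cong)
        fix y :: 'a
        have "u (\<epsilon> *\<^sub>R y) - t = a * (u y - t / a)"
          using a hom[OF e] by (simp add: a_def[symmetric] right_diff_distrib)
        then have "\<bar>u (\<epsilon> *\<^sub>R y) - t\<bar> = a * \<bar>u y - t / a\<bar>" using a by (simp add: abs_mult)
        then have "\<bar>u (\<epsilon> *\<^sub>R y) - t\<bar> powr p = a powr p * \<bar>u y - t / a\<bar> powr p" using a by (simp add: powr_mult)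
        moreover have "indicator (ball 0 \<epsilon>) (\<epsilon> *\<^sub>R y) = (indicator (ball 0 1) y :: real)"
          using e by (auto simp: indicator_def)
        ultimately show "indicator (ball 0 \<epsilon>) (\<epsilon> *\<^sub>R y) *\<^sub>R \<bar>u (\<epsilon> *\<^sub>R y) - t\<bar> powr p
          = a powr p * (indicator (ball 0 1) y *\<^sub>R \<bar>u y - t / a\<bar> powr p)" by simp
      qed simp
      also have "\<dots> = a powr p * J (t / a)"
        unfolding J_def set_int[symmetric] set_lebesgue_integral_def by simp
      finally show ?thesis
        unfolding Lp_norm_on_def C_def using e a J_nonneg by (simp add: powr_mult)
    qed
    have iff: "is_arg_min (\<lambda>t. Lp_norm_on p (ball 0 \<epsilon>) (\<lambda>y. u y - t)) (\<lambda>_. True) t \<longleftrightarrow> t = a * m" for t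
    proof -
      have "is_arg_min (\<lambda>t. Lp_norm_on p (ball 0 \<epsilon>) (\<lambda>y. u y - t)) (\<lambda>_. True) t \<longleftrightarrow> (\<forall>s. J (t / a) \<le> J (s / a))"
        using C by (simp add: is_arg_min_linorder norm J_mono)
      also have "\<dots> \<longleftrightarrow> (\<forall>s. J (t / a) \<le> J s)"
      proof
        assume *: "\<forall>s. J (t / a) \<le> J (s / a)"
        show "\<forall>s. J (t / a) \<le> J s"
        proof
          fix s show "J (t / a) \<le> J s" using *[rule_format, of "s * a"] a by simp
        qed
      qed simp
      also have "\<dots> \<longleftrightarrow> t / a = m" using m by metis
      also have "\<dots> \<longleftrightarrow> t = a * m" using a by (auto simp: field_simps)
      finally show ?thesis .
    qed
    show "var_mean p \<epsilon> u 0 = \<epsilon> powr lam * m"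
      unfolding var_mean_def iff a_def[symmetric] by simp
  qed
qed

section \<open>A one-dimensional entropy inequality\<close>

text \<open>This is - ln r \<le> 1 / r at r = sqrt \<bar>x\<bar>. The square root supplies a bound
  that tends to 0 where the logarithm is singular.\<close>

lemma abs_mult_ln_le:
  fixes x :: real
  assumes "\<bar>x\<bar> \<le> 1"
  shows "\<bar>x * ln \<bar>x\<bar>\<bar> \<le> 2 * sqrt \<bar>x\<bar>"
proof (cases "x = 0")
  case False
  define r where "r = sqrt \<bar>x\<bar>"
  have r: "r > 0" "\<bar>x\<bar> = r * r" "r \<le> 1" using False assms by (auto simp: r_def)
  have "- ln r \<le> 1 / r" using ln_le_minus_one[of "1 / r"] r(1) by (simp add: ln_div)
  moreover have "ln r \<le> 0" using r by simp
  ultimately have "\<bar>ln r\<bar> \<le> 1 / r" by simp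
  then have "\<bar>ln (r * r)\<bar> \<le> 2 / r" using r(1) by (simp add: ln_mult)
  then have "r * r * \<bar>ln (r * r)\<bar> \<le> r * r * (2 / r)" using r(1) by (intro mult_left_mono) auto
  then show ?thesis using r by (simp add: abs_mult r_def[symmetric])
qed simp

lemma continuous_on_mult_ln_abs: "continuous_on UNIV (\<lambda>x::real. x * ln \<bar>x\<bar>)"
proof (intro continuous_at_imp_continuous_on ballI)
  fix x :: real
  show "isCont (\<lambda>x. x * ln \<bar>x\<bar>) x"
  proof (cases "x = 0")
    case True
    have "((\<lambda>x::real. 2 * sqrt \<bar>x\<bar>) \<longlongrightarrow> 2 * sqrt \<bar>0\<bar>) (at 0)" by (intro tendsto_intros)
    then have l: "((\<lambda>x::real. 2 * sqrt \<bar>x\<bar>) \<longlongrightarrow> 0) (at 0)" by simp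
    have "\<forall>\<^sub>F x in at 0. \<bar>x\<bar> \<le> (1::real)"
      unfolding eventually_at by (intro exI[of _ 1]) auto
    then have "\<forall>\<^sub>F x in at 0. norm (x * ln \<bar>x\<bar>) \<le> 2 * sqrt \<bar>x\<bar>"
    proof eventually_elim
      case (elim x)
      then show ?case using abs_mult_ln_le[of x] by simp
    qed
    from Lim_null_comparison[OF this l] show ?thesis using True by (simp add: isCont_def)
  next
    case False
    then show ?thesis by (intro continuous_intros) auto
  qed
qed

text \<open>The logarithmic derivative of the quotient of the two sides has the sign of
  \<open>2 n r - n - n r\<^sup>2 \<le> 0\<close>.\<close>

lemma power_mult_power_less:
  fixes r :: real
  assumes n: "n \<ge> 2" and r: "0 < r" "r < 1"
  shows "r ^ (n - 1) * (real n + r) ^ (n + 1) < (1 + real n * r) ^ (n + 1)"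
proof -
  define N where "N = real n"
  have N: "N \<ge> 2" using n by (simp add: N_def)
  have pos: "0 < N + r" "0 < 1 + N * r" using N r by (auto simp: add_pos_pos)
  define h where "h r = (N + 1) * ln (1 + N * r) - (N - 1) * ln r - (N + 1) * ln (N + r)" for r
  \<comment> \<open>h is the logarithm of the quotient of the two sides and h 1 = 0, so it suffices
    that h decreases.\<close>
  have "h r > h 1"
  proof (rule DERIV_neg_imp_decreasing_open[OF r(2)])
    fix x assume x: "r < x" "x < 1"
    have x0: "x > 0" using x r by simp
    have p: "1 + N * x > 0" "N + x > 0" using N x0 by (auto simp: add_pos_pos)
    have D: "(h has_real_derivative (N + 1) * (N / (1 + N * x)) - (N - 1) * (1 / x) - (N + 1) * (1 / (N + x))) (at x)"
      unfolding h_def using p x0 by (auto intro!: derivative_eq_intros)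
    have "(N + 1) * (N / (1 + N * x)) - (N - 1) * (1 / x) - (N + 1) * (1 / (N + x))
      = - ((N - 1) * N * (1 - x)\<^sup>2) / (x * (1 + N * x) * (N + x))"
      using p x0 by (simp add: divide_simps) (simp add: algebra_simps power2_eq_square)
    also have "\<dots> < 0"
      using p x0 x N by (intro divide_neg_pos) auto
    finally show "\<exists>y. (h has_real_derivative y) (at x) \<and> y < 0" using D by metis
  next
    show "continuous_on {r..1} h"
      unfolding h_def using r N by (intro continuous_intros) (auto simp: add_pos_pos intro!: less_imp_neq[symmetric])
  qed
  then have "(N - 1) * ln r + (N + 1) * ln (N + r) < (N + 1) * ln (1 + N * r)" by (simp add: h_def add.commute)
  moreover have "ln (r ^ (n - 1) * (N + r) ^ (n + 1)) = ln (r ^ (n - 1)) + ln ((N + r) ^ (n + 1))"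
    using pos r by (subst ln_mult) auto
  moreover have "ln (r ^ (n - 1)) = (N - 1) * ln r"
    unfolding ln_realpow using n by (simp add: N_def of_nat_diff)
  moreover have "ln ((N + r) ^ (n + 1)) = (N + 1) * ln (N + r)"
    unfolding ln_realpow by (simp add: N_def)
  moreover have "ln ((1 + N * r) ^ (n + 1)) = (N + 1) * ln (1 + N * r)"
    unfolding ln_realpow by (simp add: N_def)
  ultimately have "ln (r ^ (n - 1) * (N + r) ^ (n + 1)) < ln ((1 + N * r) ^ (n + 1))" by simp
  then show ?thesis
    using r N by (subst (asm) ln_less_cancel_iff) (auto simp: N_def add_pos_pos)
qed

lemma cos_arctan_squared: "(cos (arctan x))\<^sup>2 = 1 / (1 + x\<^sup>2)"
  and sin_arctan_squared: "(sin (arctan x))\<^sup>2 = x\<^sup>2 / (1 + x\<^sup>2)"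
  by (simp_all add: cos_arctan sin_arctan power_divide add_nonneg_nonneg)

text \<open>Both sides are values of cos \<theta> sin^n \<theta>. Their squares are rational in r =
  s^2, and the comparison of these is \<open>power_mult_power_less\<close>. It gives D > 0 in the
  integration by parts below.\<close>

lemma arctan_profile_less:
  fixes s :: real
  assumes n: "n \<ge> 2" and s: "0 < s" "s < 1"
  defines "m \<equiv> sqrt (real n)"
  shows "cos (arctan (m * s)) * sin (arctan (m * s)) ^ n < sin (arctan (s / m)) * cos (arctan (s / m)) ^ n"
proof -
  have m: "m > 0" "m * m = real n" using n by (auto simp: m_def)
  define r where "r = s\<^sup>2"
  have r: "0 < r" "r < 1" using s by (auto simp: r_def power_less_one_iff)
  define N where "N = real n"
  have N: "N \<ge> 2" using n by (simp add: N_def)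
  have w: "1 + (m * s)\<^sup>2 = 1 + N * r" "(m * s)\<^sup>2 = N * r"
    using m by (auto simp: power_mult_distrib r_def N_def power2_eq_square)
  have w': "1 + (s / m)\<^sup>2 = (N + r) / N" "(s / m)\<^sup>2 = r / N"
    using m N by (auto simp: power_divide r_def N_def power2_eq_square field_simps)
  let ?A = "cos (arctan (m * s)) * sin (arctan (m * s)) ^ n"
  let ?B = "sin (arctan (s / m)) * cos (arctan (s / m)) ^ n"
  have "?A\<^sup>2 = (cos (arctan (m * s)))\<^sup>2 * ((sin (arctan (m * s)))\<^sup>2) ^ n"
    by (simp add: power_mult_distrib power_mult[symmetric] mult.commute)
  also have "\<dots> = (1 / (1 + N * r)) * (N * r / (1 + N * r)) ^ n"
    by (simp only: cos_arctan_squared sin_arctan_squared w)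
  also have "\<dots> = N ^ n * r ^ n / (1 + N * r) ^ (n + 1)"
    by (simp add: power_divide power_mult_distrib)
  finally have A: "?A\<^sup>2 = N ^ n * r ^ n / (1 + N * r) ^ (n + 1)" .
  have "?B\<^sup>2 = (sin (arctan (s / m)))\<^sup>2 * ((cos (arctan (s / m)))\<^sup>2) ^ n"
    by (simp add: power_mult_distrib power_mult[symmetric] mult.commute)
  also have "\<dots> = ((r / N) / ((N + r) / N)) * (1 / ((N + r) / N)) ^ n"
    by (simp only: cos_arctan_squared sin_arctan_squared w'(1)) (simp only: w'(2))
  also have "\<dots> = r * N ^ n / (N + r) ^ (n + 1)"
    using N r by (simp add: power_divide)
  finally have B: "?B\<^sup>2 = r * N ^ n / (N + r) ^ (n + 1)" .
  have "N ^ n * r ^ n * (N + r) ^ (n + 1) = (r * N ^ n) * (r ^ (n - 1) * (N + r) ^ (n + 1))"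
    using n by (simp add: power_eq_if[of r n])
  also have "\<dots> < (r * N ^ n) * (1 + N * r) ^ (n + 1)"
    using power_mult_power_less[OF n r] N r by (intro mult_strict_left_mono) (auto simp: N_def)
  finally have "?A\<^sup>2 < ?B\<^sup>2"
    unfolding A B using N r
    by (subst pos_divide_less_eq, simp add: add_pos_pos, subst times_divide_eq_left, subst pos_less_divide_eq)
       (auto simp: add_pos_pos)
  moreover have "?B \<ge> 0" using s m by (simp add: sin_arctan cos_arctan)
  ultimately show ?thesis by (rule power_less_imp_less_base)
qed

text \<open>The two latitudes \<open>\<theta>1 s\<close> and \<open>\<theta>2 s\<close> are those where the logarithm has the same value \<open>G s\<close>;
  \<open>y\<close> has opposite signs there and \<open>T' = y sin\<^sup>n\<^sup>-\<^sup>1\<close>. Hence the integral of \<open>g\<close> equals that of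
  \<open>- G D'\<close> over \<open>{0..1}\<close>, and integration by parts turns it into that of \<open>G' D > 0\<close>.\<close>

lemma log_profile_integral_pos:
  fixes n :: nat
  assumes n: "n \<ge> 2"
  defines "N \<equiv> real n"
  defines "y \<equiv> \<lambda>\<theta>::real. (N + 1) * (cos \<theta>)\<^sup>2 - 1"
  defines "g \<equiv> \<lambda>\<theta>. (y \<theta> * (ln (1 + (N\<^sup>2 - 1) * (cos \<theta>)\<^sup>2) / 2) - y \<theta> * ln \<bar>y \<theta>\<bar>) * sin \<theta> ^ (n - 1)"
  shows "continuous_on UNIV g" "integral {0..pi/2} g > 0"
proof -
  have N: "N \<ge> 2" using n by (simp add: N_def)
  have N2: "N\<^sup>2 - 1 \<ge> 0" using N one_le_power[of N 2] by simp
  have pos: "1 + (N\<^sup>2 - 1) * z > 0" if "z \<ge> 0" for z using N2 that by (simp add: add_pos_nonneg)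
  have cy: "continuous_on UNIV y" unfolding y_def by (intro continuous_intros)
  show cont: "continuous_on UNIV g"
    unfolding g_def using pos
    by (intro continuous_intros cy continuous_on_compose2[OF continuous_on_mult_ln_abs cy])
       (auto simp: less_imp_neq[symmetric])
  \<comment> \<open>The zero of y in the first quadrant has squared cosine 1 / (N + 1), hence
    tangent sqrt N.\<close>
  define m where "m = sqrt N"
  have m: "m > 0" "m\<^sup>2 = N" using N by (auto simp: m_def)
  define T where "T \<theta> = cos \<theta> * sin \<theta> ^ n" for \<theta> :: real
  have DT: "(T has_real_derivative y \<theta> * sin \<theta> ^ (n - 1)) (at \<theta>)" for \<theta>
  proof -
    have "(T has_real_derivative (- sin \<theta>) * sin \<theta> ^ n + (N * sin \<theta> ^ (n - 1) * cos \<theta>) * cos \<theta>) (at \<theta>)"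
      unfolding T_def N_def by (auto intro!: derivative_eq_intros)
    moreover have "(- sin \<theta>) * sin \<theta> ^ n + (N * sin \<theta> ^ (n - 1) * cos \<theta>) * cos \<theta> = y \<theta> * sin \<theta> ^ (n - 1)"
    proof -
      have "sin \<theta> ^ n = sin \<theta> * sin \<theta> ^ (n - 1)" using n by (simp add: power_eq_if)
      then have "(- sin \<theta>) * sin \<theta> ^ n + (N * sin \<theta> ^ (n - 1) * cos \<theta>) * cos \<theta>
        = (N * (cos \<theta>)\<^sup>2 - (sin \<theta>)\<^sup>2) * sin \<theta> ^ (n - 1)"
        by (simp add: algebra_simps power2_eq_square)
      also have "N * (cos \<theta>)\<^sup>2 - (sin \<theta>)\<^sup>2 = y \<theta>" by (simp add: y_def sin_squared_eq algebra_simps)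
      finally show ?thesis .
    qed
    ultimately show ?thesis by simp
  qed
  \<comment> \<open>As s runs from 0 to 1, \<theta>1 descends from pi/2 and \<theta>2 rises from 0,
    until both meet at the zero \<open>arctan m\<close> of y.\<close>
  define \<theta>1 \<theta>2 where "\<theta>1 s = pi / 2 - arctan (s / m)" and "\<theta>2 s = arctan (m * s)" for s
  define \<theta>1' \<theta>2' where "\<theta>1' s = - (1 / m) / (1 + (s / m)\<^sup>2)" and "\<theta>2' s = m / (1 + (m * s)\<^sup>2)" for s
  have D\<theta>: "(\<theta>1 has_real_derivative \<theta>1' s) (at s)" "(\<theta>2 has_real_derivative \<theta>2' s) (at s)" for s
    unfolding \<theta>1_def \<theta>2_def \<theta>1'_def \<theta>2'_def
    by (rule DERIV_cong[OF DERIV_diff[OF DERIV_const DERIV_chain2[OF DERIV_arctan DERIV_cdivide[OF DERIV_ident]]]],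
        simp add: divide_inverse mult.commute)
       (rule DERIV_cong[OF DERIV_chain2[OF DERIV_arctan DERIV_cmult[OF DERIV_ident]]], simp add: divide_inverse mult.commute)
  define D where "D s = T (\<theta>1 s) - T (\<theta>2 s)" for s
  define D' where "D' s = y (\<theta>1 s) * sin (\<theta>1 s) ^ (n - 1) * \<theta>1' s - y (\<theta>2 s) * sin (\<theta>2 s) ^ (n - 1) * \<theta>2' s" for s
  have DD: "(D has_real_derivative D' s) (at s)" for s
    unfolding D_def D'_def by (intro DERIV_diff DERIV_chain2[OF DT] D\<theta>)
  have Dpos: "D s > 0" if "0 < s" "s < 1" for s
    using arctan_profile_less[OF n that] by (simp add: D_def T_def \<theta>1_def \<theta>2_def m_def N_def cos_diff sin_diff)
  have D0: "D 0 = 0" using n by (simp add: D_def T_def \<theta>1_def \<theta>2_def power_0_left)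
  have \<theta>_1: "\<theta>1 1 = \<theta>2 1"
  proof -
    have "arctan (1 / m) = pi / 2 - arctan m"
      using arctan_inverse[OF m(1)] by (simp only: inverse_eq_divide)
    then show ?thesis by (simp add: \<theta>1_def \<theta>2_def inverse_eq_divide)
  qed
  then have D1: "D 1 = 0" by (simp add: D_def)
  \<comment> \<open>The common value of \<open>ln (1 + (N\<^sup>2 - 1) * (cos \<theta>)\<^sup>2) / 2
    - ln \<bar>y \<theta>\<bar>\<close> at both latitudes. It increases, and blows up at s = 1,
    where y vanishes.\<close>
  define G where "G s = (ln (N + s\<^sup>2) + ln (1 + N * s\<^sup>2) - ln N) / 2 - ln (1 - s\<^sup>2)" for s
  define G' where "G' s = s / (N + s\<^sup>2) + N * s / (1 + N * s\<^sup>2) + 2 * s / (1 - s\<^sup>2)" for s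
  have s2: "s\<^sup>2 < 1" if "0 \<le> s" "s < 1" for s :: real using that by (simp add: power_less_one_iff)
  have ps: "N + s\<^sup>2 > 0" "1 + N * s\<^sup>2 > 0" for s :: real
    using N by (auto intro!: add_pos_nonneg)
  have DG: "(G has_real_derivative G' s) (at s)" if "0 \<le> s" "s < 1" for s
    unfolding G_def G'_def using s2[OF that] ps[of s]
    by (auto intro!: derivative_eq_intros simp: divide_simps)
  have G'pos: "G' s > 0" if "0 < s" "s < 1" for s
    unfolding G'_def using s2[of s] ps[of s] N that by (auto intro!: add_pos_pos divide_pos_pos mult_pos_pos)
  have g_eq: "g \<theta> = y \<theta> * sin \<theta> ^ (n - 1) * (ln (1 + (N\<^sup>2 - 1) * (cos \<theta>)\<^sup>2) / 2 - ln \<bar>y \<theta>\<bar>)" for \<theta>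
    by (simp add: g_def algebra_simps)
  have g2: "g (\<theta>2 s) = y (\<theta>2 s) * sin (\<theta>2 s) ^ (n - 1) * G s" if s: "0 \<le> s" "s < 1" for s
  proof -
    have z: "(cos (\<theta>2 s))\<^sup>2 = 1 / (1 + N * s\<^sup>2)"
      by (simp add: \<theta>2_def cos_arctan_squared power_mult_distrib m)
    have "1 + (N\<^sup>2 - 1) * (cos (\<theta>2 s))\<^sup>2 = N * (N + s\<^sup>2) / (1 + N * s\<^sup>2)"
      unfolding z using ps[of s] by (simp add: field_simps power2_eq_square)
    moreover have "y (\<theta>2 s) = N * (1 - s\<^sup>2) / (1 + N * s\<^sup>2)"
      unfolding y_def z using ps[of s] by (simp add: field_simps)
    moreover have "ln (N * (N + s\<^sup>2) / (1 + N * s\<^sup>2)) = ln N + ln (N + s\<^sup>2) - ln (1 + N * s\<^sup>2)"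
      using N ps[of s] by (simp add: ln_mult ln_div)
    moreover have "\<bar>N * (1 - s\<^sup>2) / (1 + N * s\<^sup>2)\<bar> = N * (1 - s\<^sup>2) / (1 + N * s\<^sup>2)"
      using N ps[of s] s2[OF s] by (simp add: abs_mult)
    moreover have "ln (N * (1 - s\<^sup>2) / (1 + N * s\<^sup>2)) = ln N + ln (1 - s\<^sup>2) - ln (1 + N * s\<^sup>2)"
      using N ps[of s] s2[OF s] by (simp add: ln_mult ln_div)
    ultimately have "ln (1 + (N\<^sup>2 - 1) * (cos (\<theta>2 s))\<^sup>2) / 2 - ln \<bar>y (\<theta>2 s)\<bar> = G s"
      by (simp only: G_def) (simp add: field_simps)
    then show ?thesis by (simp add: g_eq)
  qed
  have g1: "g (\<theta>1 s) = y (\<theta>1 s) * sin (\<theta>1 s) ^ (n - 1) * G s" if s: "0 \<le> s" "s < 1" for s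
  proof -
    have z: "(cos (\<theta>1 s))\<^sup>2 = s\<^sup>2 / (N + s\<^sup>2)"
      using m N by (simp add: \<theta>1_def cos_diff sin_arctan_squared power_divide) (simp add: field_simps)
    have "1 + (N\<^sup>2 - 1) * (cos (\<theta>1 s))\<^sup>2 = N * (1 + N * s\<^sup>2) / (N + s\<^sup>2)"
      unfolding z using ps[of s] by (simp add: field_simps power2_eq_square)
    moreover have "y (\<theta>1 s) = - (N * (1 - s\<^sup>2) / (N + s\<^sup>2))"
      unfolding y_def z using ps[of s] by (simp add: field_simps)
    moreover have "ln (N * (1 + N * s\<^sup>2) / (N + s\<^sup>2)) = ln N + ln (1 + N * s\<^sup>2) - ln (N + s\<^sup>2)"
      using N ps[of s] by (simp add: ln_mult ln_div)
    moreover have "\<bar>- (N * (1 - s\<^sup>2) / (N + s\<^sup>2))\<bar> = N * (1 - s\<^sup>2) / (N + s\<^sup>2)"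
      using N ps[of s] s2[OF s] by (simp add: abs_mult)
    moreover have "ln (N * (1 - s\<^sup>2) / (N + s\<^sup>2)) = ln N + ln (1 - s\<^sup>2) - ln (N + s\<^sup>2)"
      using N ps[of s] s2[OF s] by (simp add: ln_mult ln_div)
    ultimately have "ln (1 + (N\<^sup>2 - 1) * (cos (\<theta>1 s))\<^sup>2) / 2 - ln \<bar>y (\<theta>1 s)\<bar> = G s"
      by (simp only: G_def) (simp add: field_simps)
    then show ?thesis by (simp add: g_eq)
  qed
  define A where "A x = integral {0..x} g" for x
  have DA: "(A has_real_derivative g x) (at x within {0..pi/2})" if "x \<in> {0..pi/2}" for x
    unfolding A_def[abs_def]
    by (rule integral_has_real_derivative[OF continuous_on_subset[OF cont] that]) simp
  have contA: "continuous_on {0..pi/2} A"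
    unfolding continuous_on_eq_continuous_within by (intro ballI) (rule DERIV_continuous, rule DA)
  have ran: "\<theta>1 s \<in> {0..pi/2}" "\<theta>2 s \<in> {0..pi/2}" if "0 \<le> s" for s
  proof -
    have "arctan (s / m) \<ge> 0" "arctan (m * s) \<ge> 0" using m that by auto
    then show "\<theta>1 s \<in> {0..pi/2}" "\<theta>2 s \<in> {0..pi/2}"
      using arctan_bounded[of "s / m"] arctan_bounded[of "m * s"] by (auto simp: \<theta>1_def \<theta>2_def)
  qed
  have ran': "\<theta>1 s \<in> {0<..<pi/2}" "\<theta>2 s \<in> {0<..<pi/2}" if "0 < s" for s
  proof -
    have "arctan (s / m) > 0" "arctan (m * s) > 0" using m that by auto
    then show "\<theta>1 s \<in> {0<..<pi/2}" "\<theta>2 s \<in> {0<..<pi/2}"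
      using arctan_bounded[of "s / m"] arctan_bounded[of "m * s"] by (auto simp: \<theta>1_def \<theta>2_def)
  qed
  \<comment> \<open>The integral of g over the part of [0, pi/2] not strictly between \<theta>2 s
    and \<theta>1 s; at s = 1 this is the whole interval.\<close>
  define U where "U s = A (\<theta>2 s) + (A (pi/2) - A (\<theta>1 s))" for s
  have cont\<theta>: "continuous_on X \<theta>1" "continuous_on X \<theta>2" for X
    using D\<theta> DERIV_isCont by (blast intro: continuous_at_imp_continuous_on)+
  have contU: "continuous_on {0..1} U"
  proof -
    have "\<theta>1 ` {0..1} \<subseteq> {0..pi/2}" "\<theta>2 ` {0..1} \<subseteq> {0..pi/2}"
      by (intro image_subsetI ran; simp)+
    then have "continuous_on {0..1} (\<lambda>s. A (\<theta>1 s))" "continuous_on {0..1} (\<lambda>s. A (\<theta>2 s))"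
      by (blast intro: continuous_on_compose2[OF contA cont\<theta>(1)] continuous_on_compose2[OF contA cont\<theta>(2)])+
    then show ?thesis
      unfolding U_def by (intro continuous_on_add continuous_on_diff continuous_on_const)
  qed
  have contD: "continuous_on X D" for X
    using DD DERIV_isCont by (blast intro: continuous_at_imp_continuous_on)
  \<comment> \<open>Adding the boundary term G D to U builds the integration by parts into one
    function, whose derivative G' D is positive.\<close>
  define Y where "Y s = U s + G s * D s" for s
  have DY: "(Y has_real_derivative G' s * D s) (at s)" if s: "0 < s" "s < 1" for s
  proof -
    have DA': "(A has_real_derivative g x) (at x)" if "x \<in> {0<..<pi/2}" for x
    proof -
      have "at x within {0..pi/2} = at x"
        by (rule at_within_open_subset[OF that]) auto
      then show ?thesis using DA[of x] that by auto
    qed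
    have "(U has_real_derivative g (\<theta>2 s) * \<theta>2' s + (0 - g (\<theta>1 s) * \<theta>1' s)) (at s)"
      unfolding U_def by (intro DERIV_add DERIV_diff DERIV_const DERIV_chain2[OF DA'] D\<theta> ran' s)
    then have "(U has_real_derivative - (G s * D' s)) (at s)"
      using s by (simp add: g1 g2 D'_def algebra_simps)
    from DERIV_add[OF this DERIV_mult[OF DG DD]] s
    show ?thesis unfolding Y_def[abs_def] by (simp add: mult.commute)
  qed
  have Y0: "Y 0 = 0" by (simp add: Y_def D0 U_def \<theta>1_def \<theta>2_def A_def)
  have contY: "continuous_on {0..s} Y" if "s < 1" for s
    unfolding Y_def using that
    by (intro continuous_intros continuous_on_subset[OF contU] contD continuous_at_imp_continuous_on)
       (auto intro!: DERIV_isCont[OF DG])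
  have incr: "Y a < Y b" if "0 \<le> a" "a < b" "b < 1" for a b
  proof (rule DERIV_pos_imp_increasing_open[OF that(2)])
    fix x assume "a < x" "x < b"
    then have x: "0 < x" "x < 1" using that by auto
    then show "\<exists>y. (Y has_real_derivative y) (at x) \<and> 0 < y"
      using DY[OF x] G'pos[OF x] Dpos[OF x] by (intro exI[of _ "G' x * D x"]) simp
  qed (use that in \<open>auto intro: continuous_on_subset[OF contY[OF that(3)]]\<close>)
  \<comment> \<open>G has only a logarithmic singularity at s = 1, while D vanishes there to first
    order, so the boundary term disappears in the limit.\<close>
  have limY: "(Y \<longlongrightarrow> A (pi/2)) (at_left 1)"
  proof -
    have ev: "eventually (\<lambda>s. 0 < s \<and> s < (1::real)) (at_left 1)"
      by (auto simp: eventually_at_left_field intro!: exI[of _ 0])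
    have "(U \<longlongrightarrow> U 1) (at 1 within {0..1})" using contU by (simp add: continuous_on_def)
    then have limU: "(U \<longlongrightarrow> A (pi/2)) (at_left 1)"
      by (simp add: at_within_Icc_at_left U_def \<theta>_1)
    have "((\<lambda>s. (D s - D 1) / (s - 1)) \<longlongrightarrow> D' 1) (at 1)"
      using DD[of 1] by (simp add: has_field_derivative_iff)
    then have limD: "((\<lambda>s. D s / (s - 1)) \<longlongrightarrow> D' 1) (at_left 1)"
      using D1 by (auto intro: tendsto_within_subset)
    have "((\<lambda>s. (1 - s) * ln \<bar>1 - s\<bar>) \<longlongrightarrow> (1 - 1) * ln \<bar>1 - (1::real)\<bar>) (at_left 1)"
    proof (rule isCont_tendsto_compose[of "1 - 1" "\<lambda>x. x * ln \<bar>x\<bar>"])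
      show "isCont (\<lambda>x::real. x * ln \<bar>x\<bar>) (1 - 1)"
        using continuous_on_mult_ln_abs by (simp add: continuous_on_eq_continuous_at)
    qed (intro tendsto_intros)
    then have limL: "((\<lambda>s. (1 - s) * ln \<bar>1 - s\<bar>) \<longlongrightarrow> 0) (at_left (1::real))" by simp
    have "((\<lambda>s. (s - 1) * ((ln (N + s\<^sup>2) + ln (1 + N * s\<^sup>2) - ln N) / 2 - ln (1 + s)) + (1 - s) * ln \<bar>1 - s\<bar>)
      \<longlongrightarrow> (1 - 1) * ((ln (N + 1\<^sup>2) + ln (1 + N * 1\<^sup>2) - ln N) / 2 - ln (1 + 1)) + 0) (at_left 1)"
      using ps[of 1] by (intro tendsto_intros limL) auto
    then have limG: "((\<lambda>s. (s - 1) * ((ln (N + s\<^sup>2) + ln (1 + N * s\<^sup>2) - ln N) / 2 - ln (1 + s)) + (1 - s) * ln \<bar>1 - s\<bar>) \<longlongrightarrow> 0) (at_left 1)"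
      by simp
    have eqG: "\<forall>\<^sub>F s in at_left 1. (s - 1) * ((ln (N + s\<^sup>2) + ln (1 + N * s\<^sup>2) - ln N) / 2 - ln (1 + s)) + (1 - s) * ln \<bar>1 - s\<bar> = (s - 1) * G s"
      using ev
    proof eventually_elim
      case (elim s)
      have "1 - s\<^sup>2 = (1 - s) * (1 + s)" by (simp add: power2_eq_square algebra_simps)
      then have "ln (1 - s\<^sup>2) = ln (1 - s) + ln (1 + s)" using elim by (simp add: ln_mult)
      then show ?case using elim by (simp add: G_def algebra_simps)
    qed
    have "((\<lambda>s. (s - 1) * G s) \<longlongrightarrow> 0) (at_left 1)"
      using eqG limG by (rule tendsto_cong[THEN iffD1])
    from tendsto_mult[OF limD this]
    have l: "((\<lambda>s. D s / (s - 1) * ((s - 1) * G s)) \<longlongrightarrow> 0) (at_left 1)" by simp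
    have "\<forall>\<^sub>F s in at_left 1. D s / (s - 1) * ((s - 1) * G s) = G s * D s"
      using ev by eventually_elim simp
    then have "((\<lambda>s. G s * D s) \<longlongrightarrow> 0) (at_left 1)" using l by (rule tendsto_cong[THEN iffD1])
    from tendsto_add[OF limU this] show ?thesis by (simp add: Y_def[abs_def])
  qed
  \<comment> \<open>The limit alone would only preserve a weak inequality; comparison with the fixed
    value at 1/2 keeps it strict.\<close>
  have "0 < Y (1/2)" using incr[of 0 "1/2"] Y0 by simp
  also have "Y (1/2) \<le> A (pi/2)"
  proof (rule tendsto_lowerbound[OF limY])
    have "\<forall>\<^sub>F s in at_left 1. 1/2 < s \<and> s < (1::real)"
      by (auto simp: eventually_at_left_field intro!: exI[of _ "1/2"])
    then show "\<forall>\<^sub>F s in at_left 1. Y (1/2) \<le> Y s"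
      by eventually_elim (use incr[of "1/2"] in \<open>simp add: less_imp_le\<close>)
  qed simp
  finally show "integral {0..pi/2} g > 0" by (simp add: A_def)
qed

text \<open>\<open>sph_A 2\<close> of v2 is 2 B at z = cos^2 \<theta>, with N = d - 1. The product
  of cos \<theta> sin^n \<theta> with half the logarithm of 1 + (N^2 - 1) z vanishes at both ends;
  integrating its derivative replaces B by y times that half logarithm, and what is left is minus
  the integral of g.\<close>

lemma entropy_integral_neg:
  fixes n :: nat
  assumes n: "n \<ge> 2"
  defines "N \<equiv> real n"
  defines "y \<equiv> \<lambda>\<theta>::real. (N + 1) * (cos \<theta>)\<^sup>2 - 1"
  defines "B \<equiv> \<lambda>z. (N\<^sup>2 - 1) * z * (1 - z) / (1 + (N\<^sup>2 - 1) * z)"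
  shows "integral {0..pi/2} (\<lambda>\<theta>. (y \<theta> * ln \<bar>y \<theta>\<bar> - B ((cos \<theta>)\<^sup>2)) * sin \<theta> ^ (n - 1)) < 0"
proof -
  define g where "g \<theta> = (y \<theta> * (ln (1 + (N\<^sup>2 - 1) * (cos \<theta>)\<^sup>2) / 2) - y \<theta> * ln \<bar>y \<theta>\<bar>) * sin \<theta> ^ (n - 1)" for \<theta>
  have g: "continuous_on UNIV g" "integral {0..pi/2} g > 0"
    using log_profile_integral_pos[OF n] unfolding g_def[abs_def] y_def N_def by simp_all
  have N: "N \<ge> 2" using n by (simp add: N_def)
  have N2: "N\<^sup>2 - 1 \<ge> 0" using N one_le_power[of N 2] by simp
  have pos: "1 + (N\<^sup>2 - 1) * z > 0" if "z \<ge> 0" for z using N2 that by (simp add: add_pos_nonneg)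
  define H where "H \<theta> = cos \<theta> * sin \<theta> ^ n * (ln (1 + (N\<^sup>2 - 1) * (cos \<theta>)\<^sup>2) / 2)" for \<theta>
  define H' where "H' \<theta> = (y \<theta> * (ln (1 + (N\<^sup>2 - 1) * (cos \<theta>)\<^sup>2) / 2) - B ((cos \<theta>)\<^sup>2)) * sin \<theta> ^ (n - 1)" for \<theta>
  have DH: "(H has_real_derivative H' \<theta>) (at \<theta>)" for \<theta>
  proof -
    define L where "L = ln (1 + (N\<^sup>2 - 1) * (cos \<theta>)\<^sup>2) / 2"
    define Q where "Q = 1 + (N\<^sup>2 - 1) * (cos \<theta>)\<^sup>2"
    have Q: "Q > 0" using pos[of "(cos \<theta>)\<^sup>2"] by (simp add: Q_def)
    have sn: "sin \<theta> ^ n = sin \<theta> * sin \<theta> ^ (n - 1)" using n by (simp add: power_eq_if)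
    have "((\<lambda>\<theta>. ln (1 + (N\<^sup>2 - 1) * (cos \<theta>)\<^sup>2) / 2) has_real_derivative
      - ((N\<^sup>2 - 1) * cos \<theta> * sin \<theta>) / Q) (at \<theta>)"
      using Q unfolding Q_def by (auto intro!: derivative_eq_intros simp: field_simps)
    moreover have "((\<lambda>\<theta>. cos \<theta> * sin \<theta> ^ n) has_real_derivative
      (- sin \<theta>) * sin \<theta> ^ n + (N * sin \<theta> ^ (n - 1) * cos \<theta>) * cos \<theta>) (at \<theta>)"
      unfolding N_def by (auto intro!: derivative_eq_intros)
    ultimately have D: "(H has_real_derivative ((- sin \<theta>) * sin \<theta> ^ n + (N * sin \<theta> ^ (n - 1) * cos \<theta>) * cos \<theta>) * L
      + (- ((N\<^sup>2 - 1) * cos \<theta> * sin \<theta>) / Q) * (cos \<theta> * sin \<theta> ^ n)) (at \<theta>)"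
      unfolding H_def[abs_def] L_def by (rule_tac DERIV_mult)
    have e1: "((- sin \<theta>) * sin \<theta> ^ n + (N * sin \<theta> ^ (n - 1) * cos \<theta>) * cos \<theta>) * L = y \<theta> * L * sin \<theta> ^ (n - 1)"
    proof -
      have "(- sin \<theta>) * sin \<theta> ^ n + (N * sin \<theta> ^ (n - 1) * cos \<theta>) * cos \<theta>
        = (N * (cos \<theta>)\<^sup>2 - (sin \<theta>)\<^sup>2) * sin \<theta> ^ (n - 1)"
        unfolding sn by (simp add: algebra_simps power2_eq_square)
      also have "N * (cos \<theta>)\<^sup>2 - (sin \<theta>)\<^sup>2 = y \<theta>" by (simp add: y_def sin_squared_eq algebra_simps)
      finally show ?thesis by (simp add: mult_ac)
    qed
    have e2: "(- ((N\<^sup>2 - 1) * cos \<theta> * sin \<theta>) / Q) * (cos \<theta> * sin \<theta> ^ n) = - (B ((cos \<theta>)\<^sup>2)) * sin \<theta> ^ (n - 1)"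
    proof -
      have "1 - (cos \<theta>)\<^sup>2 = sin \<theta> * sin \<theta>" using sin_squared_eq[of \<theta>] by (simp add: power2_eq_square)
      then have "B ((cos \<theta>)\<^sup>2) = (N\<^sup>2 - 1) * (cos \<theta> * cos \<theta>) * (sin \<theta> * sin \<theta>) / Q"
        by (simp add: B_def Q_def power2_eq_square[of "cos \<theta>"])
      then show ?thesis unfolding sn by (simp add: mult_ac)
    qed
    show ?thesis
      by (rule DERIV_cong[OF D]) (unfold e1 e2, simp add: H'_def L_def left_diff_distrib)
  qed
  have "(H' has_integral H (pi/2) - H 0) {0..pi/2}"
    by (rule fundamental_theorem_of_calculus)
       (use DH in \<open>auto simp: has_real_derivative_iff_has_vector_derivative[symmetric] intro: has_field_derivative_at_within\<close>)
  moreover have "H (pi/2) - H 0 = 0" using n by (simp add: H_def power_0_left)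
  ultimately have 1: "(H' has_integral 0) {0..pi/2}" by simp
  have "(g has_integral integral {0..pi/2} g) {0..pi/2}"
    using g(1) by (intro integrable_integral integrable_continuous_interval) (auto intro: continuous_on_subset)
  from has_integral_diff[OF 1 this]
  have "((\<lambda>\<theta>. H' \<theta> - g \<theta>) has_integral - integral {0..pi/2} g) {0..pi/2}" by simp
  moreover have "H' \<theta> - g \<theta> = (y \<theta> * ln \<bar>y \<theta>\<bar> - B ((cos \<theta>)\<^sup>2)) * sin \<theta> ^ (n - 1)" for \<theta>
    by (simp add: H'_def g_def algebra_simps)
  ultimately show ?thesis using g(2) by (simp add: integral_unique)
qed

section \<open>Integrals over the sphere\<close>

definition sph_continuous :: "('a::euclidean_space \<Rightarrow> real) \<Rightarrow> bool"
  where "sph_continuous h \<longleftrightarrow> continuous_on (- {0}) (\<lambda>x. h (sgn x))"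

text \<open>Up to the factor 1 / (a + d), the integral of h over the unit sphere. At x = 0, where
  \<open>sgn x\<close> is not a point of the sphere, the weight \<open>0 powr a\<close> is
  0.\<close>

definition sph_int :: "real \<Rightarrow> ('a::euclidean_space \<Rightarrow> real) \<Rightarrow> real"
  where "sph_int a h = (LINT x:ball 0 1|lborel. norm x powr a * h (sgn x))"

lemma sph_continuous_intros [intro]:
  "sph_continuous (\<lambda>_. c)"
  "sph_continuous f \<Longrightarrow> sph_continuous h \<Longrightarrow> sph_continuous (\<lambda>\<omega>. f \<omega> + h \<omega>)"
  "sph_continuous f \<Longrightarrow> sph_continuous h \<Longrightarrow> sph_continuous (\<lambda>\<omega>. f \<omega> - h \<omega>)"
  "sph_continuous f \<Longrightarrow> sph_continuous h \<Longrightarrow> sph_continuous (\<lambda>\<omega>. f \<omega> * h \<omega>)"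
  unfolding sph_continuous_def by (auto intro!: continuous_intros)

lemma sph_continuous_bounded:
  assumes "sph_continuous h"
  obtains C where "C > 0" "\<And>\<omega>. norm \<omega> = 1 \<Longrightarrow> \<bar>h \<omega>\<bar> \<le> C"
proof -
  obtain M where M: "M > 0" "\<And>x. x \<noteq> 0 \<Longrightarrow> norm (h (sgn x)) \<le> M"
    by (rule hom0_bounded[OF assms[unfolded sph_continuous_def]]) auto
  show ?thesis
  proof (rule that[OF M(1)])
    fix \<omega> :: 'a assume "norm \<omega> = 1"
    then have "\<omega> \<noteq> 0" "sgn \<omega> = \<omega>" by (auto simp: sgn_div_norm)
    then show "\<bar>h \<omega>\<bar> \<le> M" using M(2)[of \<omega>] by simp
  qed
qed

lemma borel_measurable_off_0:
  fixes f :: "'a::euclidean_space \<Rightarrow> real"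
  assumes "continuous_on (- {0}) f"
  shows "f \<in> borel_measurable borel"
proof -
  have "(\<lambda>x. indicator (- {0}) x *\<^sub>R f x) \<in> borel_measurable borel"
    by (rule borel_measurable_continuous_on_indicator) (use assms in auto)
  then have "(\<lambda>x. indicator (- {0}) x *\<^sub>R f x + indicator {0} x * f 0) \<in> borel_measurable borel"
    by (intro borel_measurable_add borel_measurable_times borel_measurable_indicator) auto
  moreover have "(\<lambda>x. indicator (- {0}) x *\<^sub>R f x + indicator {0} x * f 0) = f"
    by (auto simp: indicator_def)
  ultimately show ?thesis by simp
qed

lemma borel_measurable_sph_continuous:
  "sph_continuous h \<Longrightarrow> (\<lambda>x. norm x powr a * h (sgn x)) \<in> borel_measurable borel"
  unfolding sph_continuous_def
  by (intro borel_measurable_off_0 continuous_intros) auto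

lemma integrable_sph_int:
  fixes h :: "'a::euclidean_space \<Rightarrow> real"
  assumes h: "sph_continuous h" and a: "a > 0"
  shows "integrable lborel (\<lambda>x. indicator (ball 0 1) x *\<^sub>R (norm x powr a * h (sgn x)))"
proof -
  obtain C where C: "C > 0" "\<And>\<omega>. norm \<omega> = 1 \<Longrightarrow> \<bar>h \<omega>\<bar> \<le> C" using sph_continuous_bounded[OF h] by blast
  show ?thesis
  proof (rule Bochner_Integration.integrable_bound)
    show "integrable lborel (\<lambda>x::'a. C * indicator (ball 0 1) x :: real)"
      by (intro integrable_mult_right) (simp add: integrable_indicator_iff emeasure_bounded_finite[unfolded infinity_ennreal_def])
    show "(\<lambda>x. indicator (ball 0 1) x *\<^sub>R (norm x powr a * h (sgn x))) \<in> borel_measurable lborel"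
      using borel_measurable_sph_continuous[OF h, of a] by (intro borel_measurable_scaleR borel_measurable_indicator) auto
    have "norm (indicator (ball 0 1) x *\<^sub>R (norm x powr a * h (sgn x))) \<le> norm (C * indicator (ball 0 1) x)" for x
    proof (cases "x = 0 \<or> norm x \<ge> 1")
      case True
      then show ?thesis using a by auto
    next
      case False
      then have "norm x powr a \<le> 1" using powr_mono2[of a "norm x" 1] a by simp
      moreover have "\<bar>h (sgn x)\<bar> \<le> C" using C(2)[of "sgn x"] False by (simp add: norm_sgn)
      ultimately have "norm x powr a * \<bar>h (sgn x)\<bar> \<le> 1 * C" by (intro mult_mono) auto
      then show ?thesis using False C(1) by (simp add: abs_mult)
    qed
    then show "AE x in lborel. norm (indicator (ball 0 1) x *\<^sub>R (norm x powr a * h (sgn x))) \<le> norm (C * indicator (ball 0 1) x)"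
      by simp
  qed
qed

lemma sph_int_linear:
  assumes "sph_continuous f" "sph_continuous h" "a > 0"
  shows "sph_int a (\<lambda>\<omega>. c * f \<omega> + c' * h \<omega>) = c * sph_int a f + c' * sph_int a h"
proof -
  have "sph_int a (\<lambda>\<omega>. c * f \<omega> + c' * h \<omega>) = (LINT x|lborel.
     c * (indicator (ball 0 1) x *\<^sub>R (norm x powr a * f (sgn x))) + c' * (indicator (ball 0 1) x *\<^sub>R (norm x powr a * h (sgn x))))"
    unfolding sph_int_def set_lebesgue_integral_def by (rule Bochner_Integration.integral_cong) (auto simp: algebra_simps)
  also have "\<dots> = c * sph_int a f + c' * sph_int a h"
    unfolding sph_int_def set_lebesgue_integral_def
    using integrable_sph_int[OF assms(1,3)] integrable_sph_int[OF assms(2,3)]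
    by (subst Bochner_Integration.integral_add) (simp_all only: integrable_mult_right integral_mult_right_zero)
  finally show ?thesis .
qed

lemma sph_int_cong:
  fixes f :: "'a::euclidean_space \<Rightarrow> real"
  assumes "a > 0" "\<And>\<omega>. norm \<omega> = 1 \<Longrightarrow> f \<omega> = h \<omega>"
  shows "sph_int a f = sph_int a h"
  unfolding sph_int_def set_lebesgue_integral_def
proof (rule Bochner_Integration.integral_cong)
  fix x :: 'a
  have "norm x powr a * f (sgn x) = norm x powr a * h (sgn x)"
    using assms by (cases "x = 0") (simp_all add: norm_sgn)
  then show "indicator (ball 0 1) x *\<^sub>R (norm x powr a * f (sgn x)) = indicator (ball 0 1) x *\<^sub>R (norm x powr a * h (sgn x))"
    by simp
qed simp

lemma sph_int_mono:
  fixes f :: "'a::euclidean_space \<Rightarrow> real"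
  assumes "sph_continuous f" "sph_continuous h" "a > 0" "\<And>\<omega>. norm \<omega> = 1 \<Longrightarrow> f \<omega> \<le> h \<omega>"
  shows "sph_int a f \<le> sph_int a h"
  unfolding sph_int_def set_lebesgue_integral_def
proof (rule integral_mono[OF integrable_sph_int[OF assms(1,3)] integrable_sph_int[OF assms(2,3)]])
  fix x :: 'a
  have "norm x powr a * f (sgn x) \<le> norm x powr a * h (sgn x)"
    using assms by (cases "x = 0") (simp_all add: norm_sgn mult_left_mono)
  then show "indicator (ball 0 1) x *\<^sub>R (norm x powr a * f (sgn x)) \<le> indicator (ball 0 1) x *\<^sub>R (norm x powr a * h (sgn x))"
    by (simp add: mult_left_mono)
qed

lemma sph_int_1_pos: "a > 0 \<Longrightarrow> sph_int a (\<lambda>_::'a::euclidean_space. 1) > 0"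
proof -
  assume a: "a > 0"
  let ?f = "\<lambda>x::'a. indicator (ball 0 1) x *\<^sub>R (norm x powr a * 1) :: real"
  have int: "integrable lborel ?f"
    using integrable_sph_int[of "\<lambda>_::'a. 1" a] a by auto
  have nn: "AE x in lborel. 0 \<le> ?f x" by simp
  have "(LINT x|lborel. ?f x) \<noteq> 0"
  proof
    assume "(LINT x|lborel. ?f x) = 0"
    then have "AE x in lborel. ?f x = 0"
      using integral_nonneg_eq_0_iff_AE[OF int nn] by simp
    then have "AE x in lborel. x \<notin> ball (0::'a) 1"
      using AE_lborel_singleton[of "0::'a"] by eventually_elim (auto simp: indicator_def split: if_splits)
    then have "emeasure lborel (ball (0::'a) 1) = 0"
      by (subst (asm) AE_iff_null_sets[symmetric]) (auto simp: null_sets_def)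
    then show False by (simp add: emeasure_ball unit_ball_vol_pos[THEN less_imp_neq, symmetric])
  qed
  moreover have "(LINT x|lborel. ?f x) \<ge> 0" by (rule integral_nonneg_AE[OF nn])
  ultimately have "(LINT x|lborel. ?f x) > 0" by linarith
  then show ?thesis by (simp add: sph_int_def set_lebesgue_integral_def)
qed

section \<open>Green's identity, zonal functions and their moments\<close>

lemma (in sph_C2) sph_continuous_v: "sph_continuous v"
  unfolding sph_continuous_def by (rule Ck_on_imp_continuous_on[OF C1_v])

lemma (in sph_C2) continuous_on_W_sgn: "continuous_on (- {0}) (\<lambda>x. W (sgn x))"
  unfolding W_hom(2) by (rule Ck_on_imp_continuous_on[OF C1_W])

lemma (in sph_C2) continuous_on_DW_sgn:
  assumes "i \<in> Basis" shows "continuous_on (- {0}) (\<lambda>x. DW (sgn x) i)"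
proof -
  have "continuous_on (- {0}) (\<lambda>x. DW x i)" using C1_W assms by (simp add: DW_def)
  then show ?thesis
    by (rule continuous_on_compose2[OF _ Ck_on_imp_continuous_on[OF Ck_on_sgn]]) (auto simp: sgn_zero_iff)
qed

lemma (in sph_C2) sph_continuous_laplacian: "sph_continuous (sph_laplacian v)"
  unfolding sph_continuous_def
proof (rule continuous_on_eq)
  show "continuous_on (- {0}) (\<lambda>x. \<Sum>i\<in>Basis. DW (sgn x) i \<bullet> i)"
    by (intro continuous_intros continuous_on_DW_sgn)
  show "(\<Sum>i\<in>Basis. DW (sgn x) i \<bullet> i) = sph_laplacian v (sgn x)" if "x \<in> - {0}" for x
    using that by (intro div_W) (simp add: norm_sgn)
qed

text \<open>The tangential field |x|^(a+1) (f W_h - h W_f) has divergence |x|^a (f \<Delta>h - h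
  \<Delta>f): the two products of gradients cancel, and the radial weight does not see a tangential
  field. The exponent a + 1 compensates the degree -1 of a derivative.\<close>

lemma sph_int_green:
  fixes f h :: "'a::euclidean_space \<Rightarrow> real"
  assumes "sph_C2 f" "sph_C2 h" and a: "a > 0"
  shows "sph_int a (\<lambda>\<omega>. f \<omega> * sph_laplacian h \<omega> - h \<omega> * sph_laplacian f \<omega>) = 0"
proof -
  interpret f: sph_C2 f by fact
  interpret h: sph_C2 h by fact
  let ?k = "\<lambda>\<omega>. f \<omega> * sph_laplacian h \<omega> - h \<omega> * sph_laplacian f \<omega>"
  have k: "sph_continuous ?k"
    by (intro sph_continuous_intros f.sph_continuous_v h.sph_continuous_v f.sph_continuous_laplacian h.sph_continuous_laplacian)
  obtain C where C: "C > 0" "\<And>\<omega>. norm \<omega> = 1 \<Longrightarrow> \<bar>?k \<omega>\<bar> \<le> C" using sph_continuous_bounded[OF k] by blast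
  define Y where "Y x = f (sgn x) *\<^sub>R h.W x - h (sgn x) *\<^sub>R f.W x" for x
  define X where "X x = norm x powr (a + 1) *\<^sub>R Y x" for x
  have Yx: "Y x \<bullet> x = 0" for x by (simp add: Y_def inner_diff_left f.W_radial h.W_radial)
  have "Ck_on 1 (- {0}) (\<lambda>x. f (sgn x) *\<^sub>R h.W x + (-1) *\<^sub>R h (sgn x) *\<^sub>R f.W x)"
    by (intro Ck_on_add Ck_on_scaleR[OF _ Ck_on_const] Ck_on_scaleR[OF _ f.C1_v h.C1_W] Ck_on_scaleR[OF _ h.C1_v f.C1_W]) auto
  then have CY: "Ck_on 1 (- {0}) Y" by (simp add: Y_def[abs_def])
  have CX: "Ck_on 1 (- {0}) X"
    unfolding X_def[abs_def] by (rule Ck_on_scaleR[OF open_minus_0 Ck_on_norm_powr CY])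
  have div: "divergence X x = norm x powr a * ?k (sgn x)" if x: "x \<noteq> 0" for x
  proof -
    let ?DY = "\<lambda>k. (f (sgn x) *\<^sub>R (h.DW (sgn x) k /\<^sub>R norm x) + (f.W x \<bullet> k / norm x) *\<^sub>R h.W x)
      - (h (sgn x) *\<^sub>R (f.DW (sgn x) k /\<^sub>R norm x) + (h.W x \<bullet> k / norm x) *\<^sub>R f.W x)"
    have DY: "(Y has_derivative ?DY) (at x)"
      unfolding Y_def[abs_def]
      by (intro has_derivative_diff has_derivative_scaleR f.has_derivative_v h.has_derivative_v
          f.has_derivative_W h.has_derivative_W x)
    have DX: "(X has_derivative (\<lambda>k. norm x powr (a + 1) *\<^sub>R ?DY k + ((a + 1) * norm x powr (a + 1 - 2) * (x \<bullet> k)) *\<^sub>R Y x)) (at x)"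
      unfolding X_def[abs_def] by (intro has_derivative_scaleR has_derivative_norm_powr DY x)
    have sx: "norm (sgn x) = 1" using x by (simp add: norm_sgn)
    have s1: "(\<Sum>i\<in>Basis. ?DY i \<bullet> i) = ?k (sgn x) / norm x"
    proof -
      have "(\<Sum>i\<in>Basis. ?DY i \<bullet> i) = (f (sgn x) / norm x) * (\<Sum>i\<in>Basis. h.DW (sgn x) i \<bullet> i) + (\<Sum>i\<in>Basis. (f.W x \<bullet> i) * (h.W x \<bullet> i)) / norm x
        - ((h (sgn x) / norm x) * (\<Sum>i\<in>Basis. f.DW (sgn x) i \<bullet> i) + (\<Sum>i\<in>Basis. (h.W x \<bullet> i) * (f.W x \<bullet> i)) / norm x)"
        by (simp add: inner_diff_left inner_add_left sum.distrib sum_subtractf sum_distrib_left sum_divide_distrib divide_inverse mult_ac)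
      also have "\<dots> = ?k (sgn x) / norm x"
        unfolding f.div_W[OF sx] h.div_W[OF sx] by (simp add: mult.commute diff_divide_distrib)
      finally show ?thesis .
    qed
    have s2: "(\<Sum>i\<in>Basis. (x \<bullet> i) * (Y x \<bullet> i)) = 0" using Yx[of x] euclidean_inner[of x "Y x"] by (simp add: inner_commute)
    have "divergence X x = norm x powr (a + 1) * (\<Sum>i\<in>Basis. ?DY i \<bullet> i) + (a + 1) * norm x powr (a + 1 - 2) * (\<Sum>i\<in>Basis. (x \<bullet> i) * (Y x \<bullet> i))"
      unfolding divergence_def frechet_derivative_at[OF DX, symmetric]
      by (simp only: inner_add_left inner_scaleR_left sum.distrib sum_distrib_left mult.assoc)
    also have "\<dots> = norm x powr a * ?k (sgn x)"
      unfolding s1 s2 using x by (simp add: powr_add)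
    finally show ?thesis .
  qed
  have "(LINT x:ball 0 1|lborel. norm x powr a * ?k (sgn x)) = 0"
  proof (rule integral_div_tangential[OF CX _ borel_measurable_sph_continuous[OF k] div, of C])
    show "X x \<bullet> x = 0" for x by (simp add: X_def Yx)
    fix x :: 'a assume x: "norm x < 1"
    show "\<bar>norm x powr a * ?k (sgn x)\<bar> \<le> C"
    proof (cases "x = 0")
      case False
      have "norm x powr a \<le> 1" using powr_mono2[of a "norm x" 1] a x by simp
      moreover have "\<bar>?k (sgn x)\<bar> \<le> C" using C(2)[of "sgn x"] False by (simp add: norm_sgn)
      ultimately have "norm x powr a * \<bar>?k (sgn x)\<bar> \<le> 1 * C" by (intro mult_mono) auto
      then show ?thesis by (simp add: abs_mult)
    qed (use a C in simp)
  qed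
  then show ?thesis by (simp add: sph_int_def)
qed

text \<open>Put t = \<omega> \<bullet> e. The gradient of t is the tangential part of e, of squared
  length 1 - t^2, and its spherical Hessian is - t times the identity on the tangent space. The
  chain rule does the rest.\<close>

lemma zonal:
  fixes e :: "'a::euclidean_space"
  assumes f: "\<And>t. (f has_real_derivative f1 t) (at t)" "\<And>t. (f1 has_real_derivative f2 t) (at t)" "continuous_on UNIV f2"
    and e: "norm e = 1"
  defines "v \<equiv> \<lambda>\<omega>. f (\<omega> \<bullet> e)"
  shows "sph_C2 v"
    and "norm \<omega> = 1 \<Longrightarrow> sph_grad v \<omega> = f1 (\<omega> \<bullet> e) *\<^sub>R (e - (\<omega> \<bullet> e) *\<^sub>R \<omega>)"
    and "norm \<omega> = 1 \<Longrightarrow> sph_laplacian v \<omega> = f2 (\<omega> \<bullet> e) * (1 - (\<omega> \<bullet> e)\<^sup>2) - (real DIM('a) - 1) * (\<omega> \<bullet> e) * f1 (\<omega> \<bullet> e)"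
    and "norm \<omega> = 1 \<Longrightarrow> sph_grad v \<omega> \<bullet> sph_hess v \<omega> (sph_grad v \<omega>)
      = (f1 (\<omega> \<bullet> e))\<^sup>2 * (1 - (\<omega> \<bullet> e)\<^sup>2) * (f2 (\<omega> \<bullet> e) * (1 - (\<omega> \<bullet> e)\<^sup>2) - (\<omega> \<bullet> e) * f1 (\<omega> \<bullet> e))"
proof -
  define \<tau> where "\<tau> x = sgn x \<bullet> e" for x
  define \<epsilon> where "\<epsilon> x = e - \<tau> x *\<^sub>R sgn x" for x
  have D\<tau>: "(\<tau> has_derivative (\<lambda>h. \<epsilon> x \<bullet> h / norm x)) (at x)" if "x \<noteq> 0" for x
    unfolding \<tau>_def[abs_def]
    by (rule has_derivative_eq_rhs[OF has_derivative_inner_left[OF has_derivative_sgn[OF that]]])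
       (auto simp: \<epsilon>_def \<tau>_def inner_diff_left divide_inverse inner_commute algebra_simps)
  have Ck1: "Ck_on (Suc (Suc 0)) UNIV f"
  proof (rule Ck_on_SucI)
    show "(f has_derivative (\<lambda>h. f1 t * h)) (at t)" for t using f(1)[of t] by (simp add: has_field_derivative_def)
    show "Ck_on (Suc 0) UNIV (\<lambda>t. f1 t * i)" for i
    proof (rule Ck_on_SucI)
      show "((\<lambda>t. f1 t * i) has_derivative (\<lambda>h. (f2 t * h) * i)) (at t)" for t
        using f(2)[of t] by (intro has_derivative_mult_left) (simp add: has_field_derivative_def)
      show "Ck_on 0 UNIV (\<lambda>t. f2 t * j * i)" for j using f(3) by (simp add: continuous_intros)
    qed simp
  qed simp
  have "Ck_on (Suc (Suc 0)) (- {0}) \<tau>"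
    unfolding \<tau>_def[abs_def] by (intro Ck_on_inner Ck_on_sgn Ck_on_const open_minus_0)
  then have "Ck_on (Suc (Suc 0)) (- {0}) (\<lambda>x. f (\<tau> x))"
    by (rule Ck_on_compose[OF open_minus_0 Ck1]) simp
  then show C2: "sph_C2 v"
    by (simp only: sph_C2_def v_def \<tau>_def numeral_2_eq_2)
  interpret sph_C2 v by (rule C2)
  have W_eq: "W x = f1 (\<tau> x) *\<^sub>R \<epsilon> x" if x: "x \<noteq> 0" for x
  proof -
    have "((\<lambda>x. v (sgn x)) has_derivative (\<lambda>h. f1 (\<tau> x) * (\<epsilon> x \<bullet> h / norm x))) (at x)"
      using has_derivative_compose[OF D\<tau>[OF x] f(1)[of "\<tau> x", unfolded has_field_derivative_def]]
      by (simp add: v_def \<tau>_def)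
    from has_derivative_unique[OF has_derivative_v[OF x] this]
    have eq: "(\<lambda>h. W x \<bullet> h / norm x) = (\<lambda>h. f1 (\<tau> x) * (\<epsilon> x \<bullet> h / norm x))" .
    have "W x \<bullet> h = (f1 (\<tau> x) *\<^sub>R \<epsilon> x) \<bullet> h" for h
      using fun_cong[OF eq, of h] x by (simp add: field_simps)
    then show ?thesis by (metis vector_eq_ldot inner_commute)
  qed
  assume nw: "norm \<omega> = 1"
  let ?t = "\<omega> \<bullet> e"
  have w: "\<omega> \<noteq> 0" "sgn \<omega> = \<omega>" "\<tau> \<omega> = ?t" "\<epsilon> \<omega> = e - ?t *\<^sub>R \<omega>" "\<omega> \<bullet> \<omega> = 1" "e \<bullet> e = 1"
    using nw e by (auto simp: sgn_div_norm \<tau>_def \<epsilon>_def dot_square_norm)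
  have sgW: "sph_grad v \<omega> = W \<omega>" using W_def[of \<omega>] w(2) by simp
  show "sph_grad v \<omega> = f1 ?t *\<^sub>R (e - ?t *\<^sub>R \<omega>)" using W_eq[OF w(1)] sgW w by simp
  have we: "\<epsilon> \<omega> \<bullet> \<omega> = 0" "\<omega> \<bullet> \<epsilon> \<omega> = 0" "\<epsilon> \<omega> \<bullet> \<epsilon> \<omega> = 1 - ?t\<^sup>2"
    unfolding w(4) inner_diff_left inner_diff_right inner_scaleR_left inner_scaleR_right w(5,6)
    by (simp_all add: inner_commute[of e \<omega>] power2_eq_square)
  have DW_eq: "DW \<omega> h = (f2 ?t * (\<epsilon> \<omega> \<bullet> h)) *\<^sub>R \<epsilon> \<omega> - f1 ?t *\<^sub>R ((\<epsilon> \<omega> \<bullet> h) *\<^sub>R \<omega> + ?t *\<^sub>R (h - (\<omega> \<bullet> h) *\<^sub>R \<omega>))" for h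
  proof -
    have 1: "((\<lambda>x. f1 (\<tau> x)) has_derivative (\<lambda>h. f2 ?t * (\<epsilon> \<omega> \<bullet> h))) (at \<omega>)"
      using has_derivative_compose[OF D\<tau>[OF w(1)] f(2)[of "\<tau> \<omega>", unfolded has_field_derivative_def]]
      by (simp add: nw w(3))
    have 2: "(\<epsilon> has_derivative (\<lambda>h. - ((\<epsilon> \<omega> \<bullet> h) *\<^sub>R \<omega> + ?t *\<^sub>R (h - (\<omega> \<bullet> h) *\<^sub>R \<omega>)))) (at \<omega>)"
      unfolding \<epsilon>_def[abs_def]
      by (rule has_derivative_eq_rhs[OF has_derivative_diff[OF has_derivative_const has_derivative_scaleR[OF
            D\<tau>[OF w(1)] has_derivative_sgn[OF w(1)]]]])
         (auto simp: w(2,3) nw \<epsilon>_def algebra_simps)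
    have "((\<lambda>x. f1 (\<tau> x) *\<^sub>R \<epsilon> x) has_derivative (\<lambda>h. (f2 ?t * (\<epsilon> \<omega> \<bullet> h)) *\<^sub>R \<epsilon> \<omega>
      - f1 ?t *\<^sub>R ((\<epsilon> \<omega> \<bullet> h) *\<^sub>R \<omega> + ?t *\<^sub>R (h - (\<omega> \<bullet> h) *\<^sub>R \<omega>)))) (at \<omega>)"
      by (rule has_derivative_eq_rhs[OF has_derivative_scaleR[OF 1 2]]) (auto simp: w(3) algebra_simps)
    then have "(W has_derivative (\<lambda>h. (f2 ?t * (\<epsilon> \<omega> \<bullet> h)) *\<^sub>R \<epsilon> \<omega>
      - f1 ?t *\<^sub>R ((\<epsilon> \<omega> \<bullet> h) *\<^sub>R \<omega> + ?t *\<^sub>R (h - (\<omega> \<bullet> h) *\<^sub>R \<omega>)))) (at \<omega>)"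
      by (rule has_derivative_transform_within_open[of _ _ _ _ "- {0}"]) (use w W_eq in auto)
    from has_derivative_unique[OF has_derivative_W_self[OF w(1)] this] show ?thesis by metis
  qed
  show "sph_laplacian v \<omega> = f2 ?t * (1 - ?t\<^sup>2) - (real DIM('a) - 1) * ?t * f1 ?t"
  proof -
    have a: "(\<Sum>i\<in>Basis. (i - (\<omega> \<bullet> i) *\<^sub>R \<omega>) \<bullet> i) = real DIM('a) - 1"
      using w(5) by (simp add: inner_diff_left sum_subtractf inner_same_Basis euclidean_inner[of \<omega> \<omega>])
    have f: "(\<Sum>i\<in>Basis. (\<epsilon> \<omega> \<bullet> i) * (\<epsilon> \<omega> \<bullet> i)) = 1 - ?t\<^sup>2" "(\<Sum>i\<in>Basis. (\<epsilon> \<omega> \<bullet> i) * (\<omega> \<bullet> i)) = 0"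
      using we euclidean_inner[of "\<epsilon> \<omega>" "\<epsilon> \<omega>"] euclidean_inner[of "\<epsilon> \<omega>" \<omega>] by auto
    have "(\<Sum>i\<in>Basis. DW \<omega> i \<bullet> i) = f2 ?t * (\<Sum>i\<in>Basis. (\<epsilon> \<omega> \<bullet> i) * (\<epsilon> \<omega> \<bullet> i))
        - f1 ?t * ((\<Sum>i\<in>Basis. (\<epsilon> \<omega> \<bullet> i) * (\<omega> \<bullet> i)) + ?t * (\<Sum>i\<in>Basis. (i - (\<omega> \<bullet> i) *\<^sub>R \<omega>) \<bullet> i))"
      unfolding DW_eq by (simp add: inner_add_left inner_diff_left[of "_ *\<^sub>R \<epsilon> \<omega>"] sum.distrib sum_subtractf sum_distrib_left mult.assoc distrib_left)
    then show ?thesis unfolding div_W[OF nw] a f by (simp add: algebra_simps)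
  qed
  have ww: "\<epsilon> \<omega> \<bullet> W \<omega> = f1 ?t * (1 - ?t\<^sup>2)" "\<omega> \<bullet> W \<omega> = 0" "W \<omega> \<bullet> \<omega> = 0" "W \<omega> \<bullet> \<epsilon> \<omega> = f1 ?t * (1 - ?t\<^sup>2)"
      "W \<omega> \<bullet> W \<omega> = f1 ?t * f1 ?t * (1 - ?t\<^sup>2)"
    unfolding W_eq[OF w(1)] w(3) by (simp_all add: we del: mult_minus_left)
  show "sph_grad v \<omega> \<bullet> sph_hess v \<omega> (sph_grad v \<omega>) = (f1 ?t)\<^sup>2 * (1 - ?t\<^sup>2) * (f2 ?t * (1 - ?t\<^sup>2) - ?t * f1 ?t)"
    unfolding sgW W_hess_W[OF nw] DW_eq inner_diff_right inner_add_right inner_scaleR_right ww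
    by (simp add: algebra_simps power2_eq_square)
qed

text \<open>Green's identity for t^(2j+2) against 1: the Laplacian of this power is (2j+2) ((2j+1)
  t^(2j) - (2j+d) t^(2j+2)).\<close>

lemma sph_int_moment:
  fixes e :: "'a::euclidean_space"
  assumes e: "norm e = 1" and a: "a > 0"
  shows "(2 * real j + 1) * sph_int a (\<lambda>\<omega>. ((\<omega> \<bullet> e)\<^sup>2) ^ j) = (2 * real j + real DIM('a)) * sph_int a (\<lambda>\<omega>. ((\<omega> \<bullet> e)\<^sup>2) ^ Suc j)"
proof -
  let ?f = "\<lambda>\<omega>. (\<omega> \<bullet> e) ^ (2 * j + 2)"
  have D: "((\<lambda>t. t ^ (2 * j + 2)) has_real_derivative (2 * real j + 2) * t ^ (2 * j + 1)) (at t)"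
    "((\<lambda>t. (2 * real j + 2) * t ^ (2 * j + 1)) has_real_derivative (2 * real j + 2) * (2 * real j + 1) * t ^ (2 * j)) (at t)" for t :: real
    by (rule DERIV_cong[OF DERIV_pow], simp) (rule DERIV_cong[OF DERIV_cmult[OF DERIV_pow]], simp)
  have cont: "continuous_on UNIV (\<lambda>t. (2 * real j + 2) * (2 * real j + 1) * t ^ (2 * j))"
    by (intro continuous_intros)
  note z = zonal[of "\<lambda>t. t ^ (2 * j + 2)" "\<lambda>t. (2 * real j + 2) * t ^ (2 * j + 1)"
      "\<lambda>t. (2 * real j + 2) * (2 * real j + 1) * t ^ (2 * j)", OF D cont e]
  note z1 = zonal[of "\<lambda>_. 1" "\<lambda>_. 0" "\<lambda>_. 0", OF _ _ _ e, simplified]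
  have sc: "sph_continuous (\<lambda>\<omega>. ((\<omega> \<bullet> e)\<^sup>2) ^ k)" for k
    unfolding sph_continuous_def by (intro continuous_intros) auto
  have "sph_int a (\<lambda>\<omega>. 1 * sph_laplacian ?f \<omega> - ?f \<omega> * sph_laplacian (\<lambda>_. 1) \<omega>) = 0"
    by (rule sph_int_green[OF z1(1) z(1) a])
  also have "sph_int a (\<lambda>\<omega>. 1 * sph_laplacian ?f \<omega> - ?f \<omega> * sph_laplacian (\<lambda>_. 1) \<omega>)
    = sph_int a (\<lambda>\<omega>. ((2 * real j + 2) * (2 * real j + 1)) * ((\<omega> \<bullet> e)\<^sup>2) ^ j
        + (- ((2 * real j + 2) * (2 * real j + real DIM('a)))) * ((\<omega> \<bullet> e)\<^sup>2) ^ Suc j)"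
  proof (rule sph_int_cong[OF a])
    fix \<omega> :: 'a assume w: "norm \<omega> = 1"
    show "1 * sph_laplacian ?f \<omega> - ?f \<omega> * sph_laplacian (\<lambda>_. 1) \<omega>
      = ((2 * real j + 2) * (2 * real j + 1)) * ((\<omega> \<bullet> e)\<^sup>2) ^ j
        + (- ((2 * real j + 2) * (2 * real j + real DIM('a)))) * ((\<omega> \<bullet> e)\<^sup>2) ^ Suc j"
    proof -
      define t P where "t = \<omega> \<bullet> e" and "P = (t\<^sup>2) ^ j"
      have "t ^ (2 * j) = P" "t ^ (2 * j + 1) = t * P" "t * t = t\<^sup>2"
        by (simp_all add: P_def power_mult power2_eq_square)
      then show ?thesis
        unfolding z(3)[OF w] z1(3)[OF w] t_def[symmetric] power_Suc P_def[symmetric]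
        by (simp add: algebra_simps power2_eq_square)
    qed
  qed
  finally have "((2 * real j + 2) * (2 * real j + 1)) * sph_int a (\<lambda>\<omega>. ((\<omega> \<bullet> e)\<^sup>2) ^ j)
        + (- ((2 * real j + 2) * (2 * real j + real DIM('a)))) * sph_int a (\<lambda>\<omega>. ((\<omega> \<bullet> e)\<^sup>2) ^ Suc j) = 0"
    by (simp only: sph_int_linear[OF sc sc a])
  then have "(2 * real j + 2) * ((2 * real j + 1) * sph_int a (\<lambda>\<omega>. ((\<omega> \<bullet> e)\<^sup>2) ^ j)
        - (2 * real j + real DIM('a)) * sph_int a (\<lambda>\<omega>. ((\<omega> \<bullet> e)\<^sup>2) ^ Suc j)) = 0"
  proof -
    have gen: "u * b * X + (- (u * c)) * Y = u * (b * X - c * Y)" for u b c X Y :: real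
      by (simp add: algebra_simps)
    assume "((2 * real j + 2) * (2 * real j + 1)) * sph_int a (\<lambda>\<omega>. ((\<omega> \<bullet> e)\<^sup>2) ^ j)
        + (- ((2 * real j + 2) * (2 * real j + real DIM('a)))) * sph_int a (\<lambda>\<omega>. ((\<omega> \<bullet> e)\<^sup>2) ^ Suc j) = 0"
    then show ?thesis unfolding gen .
  qed
  moreover have "2 * real j + 2 \<noteq> 0" by linarith
  ultimately show ?thesis unfolding mult_eq_0_iff by simp
qed

text \<open>The derivative of cos^(2j+1) sin^n integrates to 0, as the product vanishes at both
  ends. For n = d - 1 this is the recursion of the moments on the sphere.\<close>

lemma cos_sin_moment:
  fixes n j :: nat
  assumes n: "n \<ge> 1"
  shows "(2 * real j + 1) * integral {0..pi/2} (\<lambda>\<theta>. ((cos \<theta>)\<^sup>2) ^ j * sin \<theta> ^ (n - 1))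
    = (2 * real j + real n + 1) * integral {0..pi/2} (\<lambda>\<theta>. ((cos \<theta>)\<^sup>2) ^ Suc j * sin \<theta> ^ (n - 1))"
proof -
  let ?c = "\<lambda>j \<theta>::real. ((cos \<theta>)\<^sup>2) ^ j * sin \<theta> ^ (n - 1)"
  define H where "H \<theta> = cos \<theta> ^ (2 * j + 1) * sin \<theta> ^ n" for \<theta> :: real
  have D: "(H has_real_derivative (2 * real j + real n + 1) * ?c (Suc j) \<theta> - (2 * real j + 1) * ?c j \<theta>) (at \<theta>)" for \<theta>
  proof -
    have sn: "sin \<theta> ^ n = sin \<theta> * sin \<theta> ^ (n - 1)" using n by (simp add: power_eq_if)
    have ss: "sin \<theta> * sin \<theta> = 1 - (cos \<theta>)\<^sup>2" using sin_squared_eq[of \<theta>] by (simp add: power2_eq_square)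
    have HD: "(H has_real_derivative ((2 * real j + 1) * cos \<theta> ^ (2 * j) * (- sin \<theta>)) * sin \<theta> ^ n
      + (real n * sin \<theta> ^ (n - 1) * cos \<theta>) * cos \<theta> ^ (2 * j + 1)) (at \<theta>)"
      unfolding H_def[abs_def]
      by (rule DERIV_cong[OF DERIV_mult[OF DERIV_chain2[OF DERIV_pow DERIV_cos] DERIV_chain2[OF DERIV_pow DERIV_sin]]]) simp
    have "((2 * real j + 1) * cos \<theta> ^ (2 * j) * (- sin \<theta>)) * sin \<theta> ^ n
      + (real n * sin \<theta> ^ (n - 1) * cos \<theta>) * cos \<theta> ^ (2 * j + 1)
      = - ((2 * real j + 1) * cos \<theta> ^ (2 * j) * (sin \<theta> * sin \<theta>) * sin \<theta> ^ (n - 1))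
      + real n * sin \<theta> ^ (n - 1) * cos \<theta> ^ (2 * j + 2)"
      unfolding sn by (simp add: mult_ac)
    also have "\<dots> = (2 * real j + real n + 1) * ?c (Suc j) \<theta> - (2 * real j + 1) * ?c j \<theta>"
    proof -
      define P where "P = ((cos \<theta>)\<^sup>2) ^ j"
      have "cos \<theta> ^ (2 * j) = P" "cos \<theta> ^ (2 * j + 2) = (cos \<theta>)\<^sup>2 * P"
        by (simp_all add: P_def power_mult power2_eq_square)
      then show ?thesis unfolding ss power_Suc P_def[symmetric] by (simp add: algebra_simps power2_eq_square)
    qed
    finally show ?thesis by (rule DERIV_cong[OF HD])
  qed
  have int: "(\<lambda>\<theta>. k * ?c i \<theta>) integrable_on {0..pi/2}" for i k
    by (intro integrable_continuous_interval continuous_intros)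
  have "((\<lambda>\<theta>. (2 * real j + real n + 1) * ?c (Suc j) \<theta> - (2 * real j + 1) * ?c j \<theta>) has_integral H (pi/2) - H 0) {0..pi/2}"
    by (rule fundamental_theorem_of_calculus)
       (use D in \<open>auto simp: has_real_derivative_iff_has_vector_derivative[symmetric] intro: has_field_derivative_at_within\<close>)
  moreover have "H (pi/2) - H 0 = 0" using n by (simp add: H_def power_0_left)
  ultimately have "integral {0..pi/2} (\<lambda>\<theta>. (2 * real j + real n + 1) * ?c (Suc j) \<theta> - (2 * real j + 1) * ?c j \<theta>) = 0"
    by (simp only: integral_unique)
  then show ?thesis
    by (subst (asm) Henstock_Kurzweil_Integration.integral_diff[OF int int]) simp
qed

text \<open>Both sides satisfy the same recursion on the moments of \<open>(\<omega> \<bullet> e)\<^sup>2\<close>, and polynomials are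
  dense in the continuous functions on \<open>[0, 1]\<close>.\<close>

lemma sph_int_slice:
  fixes e :: "'a::euclidean_space" and h :: "real \<Rightarrow> real"
  assumes e: "norm e = 1" and a: "a > 0" and dim: "DIM('a) \<ge> 2" and h: "continuous_on {0..1} h"
  defines "k \<equiv> DIM('a) - 2"
  shows "sph_int a (\<lambda>\<omega>. h ((\<omega> \<bullet> e)\<^sup>2)) * integral {0..pi/2} (\<lambda>\<theta>. sin \<theta> ^ k)
    = sph_int a (\<lambda>_::'a. 1) * integral {0..pi/2} (\<lambda>\<theta>. h ((cos \<theta>)\<^sup>2) * sin \<theta> ^ k)"
proof -
  define E1 where "E1 = sph_int a (\<lambda>_::'a. 1)"
  define I0 where "I0 = integral {0..pi/2} (\<lambda>\<theta>. sin \<theta> ^ k)"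
  define E where "E h = sph_int a (\<lambda>\<omega>. h ((\<omega> \<bullet> e)\<^sup>2))" for h
  define J where "J h = integral {0..pi/2} (\<lambda>\<theta>. h ((cos \<theta>)\<^sup>2) * sin \<theta> ^ k)" for h
  have t2: "(sgn x \<bullet> e)\<^sup>2 \<in> {0..1}" for x
  proof -
    have "norm (sgn x) \<le> 1" by (simp add: norm_sgn)
    then have "\<bar>sgn x \<bullet> e\<bar> \<le> 1" using Cauchy_Schwarz_ineq2[of "sgn x" e] e by simp
    then show ?thesis by (simp add: abs_square_le_1)
  qed
  have sc: "sph_continuous (\<lambda>\<omega>. h ((\<omega> \<bullet> e)\<^sup>2))" if "continuous_on {0..1} h" for h
    unfolding sph_continuous_def
    by (rule continuous_on_compose2[OF that]) (use t2 in \<open>auto intro!: continuous_intros\<close>)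
  have cc: "continuous_on S (\<lambda>\<theta>. h ((cos \<theta>)\<^sup>2) * sin \<theta> ^ k)" if "continuous_on {0..1} h" for h and S :: "real set"
    by (intro continuous_intros continuous_on_compose2[OF that]) (auto simp: abs_square_le_1)
  have intJ: "(\<lambda>\<theta>. h ((cos \<theta>)\<^sup>2) * sin \<theta> ^ k) integrable_on {0..pi/2}" if "continuous_on {0..1} h" for h
    by (intro integrable_continuous_interval cc that)
  have E_lin: "E (\<lambda>z. c * f z + c' * h z) = c * E f + c' * E h" if "continuous_on {0..1} f" "continuous_on {0..1} h" for c c' f h
    unfolding E_def by (rule sph_int_linear[OF sc[OF that(1)] sc[OF that(2)] a])
  have J_lin: "J (\<lambda>z. c * f z + c' * h z) = c * J f + c' * J h" if "continuous_on {0..1} f" "continuous_on {0..1} h" for c c' f h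
  proof -
    have "((\<lambda>\<theta>. c * (f ((cos \<theta>)\<^sup>2) * sin \<theta> ^ k) + c' * (h ((cos \<theta>)\<^sup>2) * sin \<theta> ^ k)) has_integral c * J f + c' * J h) {0..pi/2}"
      unfolding J_def by (intro has_integral_add has_integral_mult_right integrable_integral intJ that)
    then show ?thesis unfolding J_def by (intro integral_unique) (simp add: algebra_simps)
  qed
  \<comment> \<open>Each functional is multiplied by the value of the other one at 1, so the common
    recursion starts from an equality without any division.\<close>
  have mom: "E (\<lambda>z. z ^ j) * I0 = E1 * J (\<lambda>z. z ^ j)" for j
  proof (induction j)
    case 0
    then show ?case by (simp add: E_def J_def E1_def I0_def)
  next
    case (Suc j)
    have kn: "k = (DIM('a) - 1) - 1" using dim by (simp add: k_def)
    have pos: "2 * real j + real DIM('a) > 0" using dim by simp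
    have "(2 * real j + 1) * E (\<lambda>z. z ^ j) = (2 * real j + real DIM('a)) * E (\<lambda>z. z ^ Suc j)"
      unfolding E_def by (rule sph_int_moment[OF e a])
    moreover have "(2 * real j + 1) * J (\<lambda>z. z ^ j) = (2 * real j + real DIM('a)) * J (\<lambda>z. z ^ Suc j)"
      unfolding J_def kn using cos_sin_moment[of "DIM('a) - 1" j] dim by (simp add: of_nat_diff)
    ultimately have "(2 * real j + real DIM('a)) * (E (\<lambda>z. z ^ Suc j) * I0) = (2 * real j + real DIM('a)) * (E1 * J (\<lambda>z. z ^ Suc j))"
      using Suc by (metis mult.assoc mult.left_commute)
    then show ?case using pos by simp
  qed
  have poly: "E p * I0 = E1 * J p" if rp: "real_polynomial_function p" for p
  proof -
    obtain c n where p: "p = (\<lambda>x. \<Sum>i\<le>n. c i * x ^ i)" using rp unfolding real_polynomial_function_iff_sum by blast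
    have lin: "E (\<lambda>z. u * f z + w * h z) * I0 = E1 * J (\<lambda>z. u * f z + w * h z)"
      if "continuous_on {0..1} f" "continuous_on {0..1} h" "E f * I0 = E1 * J f" "E h * I0 = E1 * J h" for u w f h
    proof -
      have "(u * E f + w * E h) * I0 = u * (E f * I0) + w * (E h * I0)" by (simp add: algebra_simps)
      also have "\<dots> = E1 * (u * J f + w * J h)" unfolding that(3,4) by (simp add: algebra_simps)
      finally show ?thesis unfolding E_lin[OF that(1,2)] J_lin[OF that(1,2)] .
    qed
    have cm: "continuous_on {0..1} (\<lambda>x::real. x ^ m)" for m by (intro continuous_intros)
    have "E (\<lambda>x. \<Sum>i\<le>m. c i * x ^ i) * I0 = E1 * J (\<lambda>x. \<Sum>i\<le>m. c i * x ^ i)" for m :: nat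
    proof (induction m)
      case 0
      show ?case using lin[OF cm cm mom mom, of "c 0" 0 0 0] by simp
    next
      case (Suc m)
      have "continuous_on {0..1} (\<lambda>x. \<Sum>i\<le>m. c i * x ^ i)" by (intro continuous_intros)
      from lin[OF this cm Suc mom, of 1 "c (Suc m)" "Suc m"] show ?case by (simp add: add.commute)
    qed
    then show ?thesis by (simp add: p)
  qed
  have E1: "E1 > 0" unfolding E1_def by (rule sph_int_1_pos[OF a])
  have sinpos: "sin \<theta> ^ k \<ge> 0" if "\<theta> \<in> {0..pi/2}" for \<theta> using that by (auto intro!: zero_le_power sin_ge_zero)
  have I0: "I0 \<ge> 0" unfolding I0_def by (rule integral_nonneg) (auto intro!: integrable_continuous_interval continuous_intros sinpos)
  have E_mono: "E f \<le> E h" if "continuous_on {0..1} f" "continuous_on {0..1} h" "\<And>z. z \<in> {0..1} \<Longrightarrow> f z \<le> h z" for f h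
    unfolding E_def
  proof (rule sph_int_mono[OF sc[OF that(1)] sc[OF that(2)] a that(3)])
    fix \<omega> :: 'a assume "norm \<omega> = 1"
    then have "sgn \<omega> = \<omega>" by (simp add: sgn_div_norm)
    then show "(\<omega> \<bullet> e)\<^sup>2 \<in> {0..1}" using t2[of \<omega>] by simp
  qed
  have J_mono: "J f \<le> J h" if "continuous_on {0..1} f" "continuous_on {0..1} h" "\<And>z. z \<in> {0..1} \<Longrightarrow> f z \<le> h z" for f h
    unfolding J_def
    by (rule integral_le[OF intJ[OF that(1)] intJ[OF that(2)]]) (auto intro!: mult_right_mono that(3) sinpos simp: abs_square_le_1)
  \<comment> \<open>Both functionals are linear and monotone, so a uniform error \<epsilon> in h
    changes them by at most \<epsilon> times their values at 1.\<close>
  have close: "\<bar>E h * I0 - E1 * J h\<bar> \<le> \<epsilon> * (2 * E1 * I0)" if "\<epsilon> > 0" for \<epsilon>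
  proof -
    obtain p where p: "real_polynomial_function p" "\<And>z. z \<in> {0..1} \<Longrightarrow> \<bar>h z - p z\<bar> < \<epsilon>"
      using Stone_Weierstrass_real_polynomial_function[of "{0..1}" h \<epsilon>] h \<open>\<epsilon> > 0\<close> by auto
    have cp: "continuous_on {0..1} p"
      using continuous_real_polymonial_function[OF p(1)] by (simp add: continuous_at_imp_continuous_on)
    have c1: "continuous_on {0..1} (\<lambda>z::real. 1::real)" by (rule continuous_on_const)
    have c2: "continuous_on {0..1} (\<lambda>z. 1 * p z + c * 1)" for c by (intro continuous_intros cp)
    have E1': "E (\<lambda>_. 1) = E1" "J (\<lambda>_. 1) = I0" by (simp_all add: E_def E1_def J_def I0_def)
    have "E (\<lambda>z. 1 * p z + (-\<epsilon>) * 1) \<le> E h" "E h \<le> E (\<lambda>z. 1 * p z + \<epsilon> * 1)"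
      "J (\<lambda>z. 1 * p z + (-\<epsilon>) * 1) \<le> J h" "J h \<le> J (\<lambda>z. 1 * p z + \<epsilon> * 1)"
      using p(2) by (intro E_mono J_mono c2 h; fastforce simp: abs_less_iff intro: less_imp_le)+
    then have *: "\<bar>E h - E p\<bar> \<le> \<epsilon> * E1" "\<bar>J h - J p\<bar> \<le> \<epsilon> * I0"
      unfolding E_lin[OF cp c1] J_lin[OF cp c1] E1' by auto
    have "E h * I0 - E1 * J h = (E h - E p) * I0 - E1 * (J h - J p)"
      using poly[OF p(1)] by (simp add: algebra_simps)
    then have "\<bar>E h * I0 - E1 * J h\<bar> \<le> \<bar>E h - E p\<bar> * I0 + E1 * \<bar>J h - J p\<bar>"
      using abs_triangle_ineq4[of "(E h - E p) * I0" "E1 * (J h - J p)"] E1 I0 by (simp add: abs_mult)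
    also have "\<dots> \<le> (\<epsilon> * E1) * I0 + E1 * (\<epsilon> * I0)"
      using * E1 I0 by (intro add_mono mult_right_mono mult_left_mono) auto
    finally show ?thesis by (simp add: mult_ac)
  qed
  have "E h * I0 - E1 * J h = 0"
  proof (rule ccontr)
    assume ne: "E h * I0 - E1 * J h \<noteq> 0"
    define \<delta> where "\<delta> = \<bar>E h * I0 - E1 * J h\<bar>"
    have \<delta>: "\<delta> > 0" using ne by (simp add: \<delta>_def)
    have c: "2 * E1 * I0 \<ge> 0" using E1 I0 by simp
    define \<epsilon> where "\<epsilon> = \<delta> / (2 * E1 * I0 + 1) / 2"
    have e: "\<epsilon> > 0" using \<delta> c by (simp add: \<epsilon>_def)
    have "\<epsilon> * (2 * E1 * I0) \<le> \<epsilon> * (2 * E1 * I0 + 1)" using e by simp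
    also have "\<dots> = \<delta> / 2" using c by (simp add: \<epsilon>_def field_simps)
    finally show False using close[OF e] \<delta> by (simp add: \<delta>_def)
  qed
  then show ?thesis unfolding E_def J_def E1_def I0_def by simp
qed

lemma integral_sin_power_pos: "integral {0..pi/2} (\<lambda>\<theta>. sin \<theta> ^ k) > (0::real)"
proof -
  have c: "continuous_on {0..pi/2} (\<lambda>\<theta>::real. sin \<theta> ^ k)" by (intro continuous_intros)
  have nn: "sin \<theta> ^ k \<ge> 0" if "\<theta> \<in> {0..pi/2}" for \<theta> :: real using that by (auto intro!: zero_le_power sin_ge_zero)
  have "integral {0..pi/2} (\<lambda>\<theta>::real. sin \<theta> ^ k) \<noteq> 0"
  proof
    assume "integral {0..pi/2} (\<lambda>\<theta>::real. sin \<theta> ^ k) = 0"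
    then have "\<forall>\<theta>\<in>{0..pi/2}. sin \<theta> ^ k = (0::real)"
      using integral_eq_0_iff[OF c _ nn] by simp
    from bspec[OF this, of "pi/2"] show False by simp
  qed
  moreover have "integral {0..pi/2} (\<lambda>\<theta>::real. sin \<theta> ^ k) \<ge> 0"
    by (rule integral_nonneg[OF integrable_continuous_interval[OF c] nn])
  ultimately show ?thesis by linarith
qed

section \<open>The spherical harmonic \<open>v2\<close>: the two integral inequalities\<close>

context
  fixes e :: "'a::euclidean_space"
  assumes e: "norm e = 1" and dim: "DIM('a) \<ge> 3"
begin

text \<open>v2 is a spherical harmonic of degree 2, whence the eigenvalue 2d. In
  \<open>sph_A\<close> numerator and denominator share the factor 4 / d^2.\<close>

lemma zonal_v2:
  shows "sph_C2 (v2 e)"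
    and "norm \<omega> = 1 \<Longrightarrow> sph_laplacian (v2 e) \<omega> = - 2 * real DIM('a) * v2 e \<omega>"
    and "norm \<omega> = 1 \<Longrightarrow> sph_A 2 (v2 e) \<omega> = 2 * ((real DIM('a) - 1)\<^sup>2 - 1) * (\<omega> \<bullet> e)\<^sup>2 * (1 - (\<omega> \<bullet> e)\<^sup>2)
      / (1 + ((real DIM('a) - 1)\<^sup>2 - 1) * (\<omega> \<bullet> e)\<^sup>2)"
proof -
  define d where "d = real DIM('a)"
  have d: "d \<ge> 3" using dim by (simp add: d_def)
  have D: "((\<lambda>t. t\<^sup>2 - 1 / d) has_real_derivative 2 * t) (at t)" "((\<lambda>t. 2 * t) has_real_derivative 2) (at t)" for t :: real
    by (auto intro!: derivative_eq_intros)
  note z = zonal[of "\<lambda>t. t\<^sup>2 - 1 / d" "\<lambda>t. 2 * t" "\<lambda>_. 2", OF D continuous_on_const e, folded d_def]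
  have v2_eq: "v2 e = (\<lambda>\<omega>. (\<omega> \<bullet> e)\<^sup>2 - 1 / d)" by (auto simp: v2_def d_def)
  show "sph_C2 (v2 e)" using z(1) by (simp add: v2_eq)
  assume w: "norm \<omega> = 1"
  define z where "z = (\<omega> \<bullet> e)\<^sup>2"
  have zt: "\<omega> \<bullet> e * (\<omega> \<bullet> e) = z" by (simp add: z_def power2_eq_square)
  show "sph_laplacian (v2 e) \<omega> = - 2 * real DIM('a) * v2 e \<omega>"
  proof -
    have "(d - 1) * (\<omega> \<bullet> e) * (2 * (\<omega> \<bullet> e)) = 2 * (d - 1) * z" by (simp add: z_def power2_eq_square)
    then show ?thesis
      unfolding v2_eq z(3)[OF w] d_def[symmetric] z_def[symmetric] using d by (simp add: field_simps)
  qed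
  have e1: "e \<bullet> e = 1" "\<omega> \<bullet> \<omega> = 1" using e w by (auto simp: dot_square_norm)
  have g2: "(norm (sph_grad (v2 e) \<omega>))\<^sup>2 = 4 * z * (1 - z)"
    unfolding v2_eq z(2)[OF w] power2_norm_eq_inner inner_scaleR_left inner_scaleR_right inner_diff_left inner_diff_right e1
    by (simp add: inner_commute[of e \<omega>] z_def algebra_simps power2_eq_square)
  have gh: "sph_grad (v2 e) \<omega> \<bullet> sph_hess (v2 e) \<omega> (sph_grad (v2 e) \<omega>) = 4 * z * (1 - z) * (2 - 4 * z)"
    unfolding v2_eq z(4)[OF w] by (simp add: z_def algebra_simps power2_eq_square)
  have z01: "z \<ge> 0" "z \<le> 1"
    using Cauchy_Schwarz_ineq2[of \<omega> e] e w by (auto simp: z_def abs_square_le_1)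
  let ?D = "(d - 1)\<^sup>2 - 1"
  have D0: "?D \<ge> 0" using d one_le_power[of "d - 1" 2] by simp
  have v: "v2 e \<omega> = z - 1 / d" by (simp add: v2_eq z_def)
  have num: "4 * z * (1 - z) * (2 - 4 * z) + 2\<^sup>2 * (z - 1 / d) * (4 * z * (1 - z)) = 4 / d\<^sup>2 * (2 * ?D * z * (1 - z))"
    using d by (simp add: field_simps power2_eq_square)
  have den: "4 * z * (1 - z) + 2\<^sup>2 * (z - 1 / d)\<^sup>2 = 4 / d\<^sup>2 * (1 + ?D * z)"
    using d by (simp add: field_simps power2_eq_square)
  have "sph_A 2 (v2 e) \<omega> = (4 / d\<^sup>2 * (2 * ?D * z * (1 - z))) / (4 / d\<^sup>2 * (1 + ?D * z))"
    unfolding sph_A_def gh g2 v num den ..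
  also have "\<dots> = 2 * ?D * z * (1 - z) / (1 + ?D * z)"
    using d by (subst mult_divide_mult_cancel_left) auto
  finally show "sph_A 2 (v2 e) \<omega> = 2 * ((real DIM('a) - 1)\<^sup>2 - 1) * (\<omega> \<bullet> e)\<^sup>2 * (1 - (\<omega> \<bullet> e)\<^sup>2)
      / (1 + ((real DIM('a) - 1)\<^sup>2 - 1) * (\<omega> \<bullet> e)\<^sup>2)" by (simp add: d_def z_def)
qed

lemma sph_int_v2_0: "a > 0 \<Longrightarrow> sph_int a (v2 e) = 0"
proof -
  assume a: "a > 0"
  have d: "real DIM('a) > 0" by simp
  have sc: "sph_continuous (\<lambda>\<omega>. ((\<omega> \<bullet> e)\<^sup>2) ^ k)" for k
    unfolding sph_continuous_def by (intro continuous_intros) auto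
  have "sph_int a (v2 e) = sph_int a (\<lambda>\<omega>. 1 * ((\<omega> \<bullet> e)\<^sup>2) ^ Suc 0 + (- 1 / real DIM('a)) * ((\<omega> \<bullet> e)\<^sup>2) ^ 0)"
    by (simp add: v2_def[abs_def])
  also have "\<dots> = 0"
    unfolding sph_int_linear[OF sc sc a] using sph_int_moment[OF e a, of 0] d by (simp add: field_simps)
  finally show ?thesis .
qed

lemma sph_int_v2_sq_pos: "a > 0 \<Longrightarrow> sph_int a (\<lambda>\<omega>. v2 e \<omega> * v2 e \<omega>) > 0"
proof -
  assume a: "a > 0"
  define d where "d = real DIM('a)"
  have d: "d \<ge> 3" using dim by (simp add: d_def)
  have sc: "sph_continuous (\<lambda>\<omega>. ((\<omega> \<bullet> e)\<^sup>2) ^ k)" for k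
    unfolding sph_continuous_def by (intro continuous_intros) auto
  define m where "m k = sph_int a (\<lambda>\<omega>. ((\<omega> \<bullet> e)\<^sup>2) ^ k)" for k
  have m: "m 0 > 0" "m 0 = d * m 1" "3 * m 1 = (2 + d) * m 2"
    using sph_int_1_pos[OF a, where 'a = 'a] sph_int_moment[OF e a, of 0] sph_int_moment[OF e a, of 1]
    by (simp_all add: m_def d_def numeral_2_eq_2 add.commute)
  have "sph_int a (\<lambda>\<omega>. v2 e \<omega> * v2 e \<omega>) = sph_int a (\<lambda>\<omega>. 1 * ((\<omega> \<bullet> e)\<^sup>2) ^ 2 + 1 * ((-2 / d) * ((\<omega> \<bullet> e)\<^sup>2) ^ 1 + (1 / d\<^sup>2) * ((\<omega> \<bullet> e)\<^sup>2) ^ 0))"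
    by (rule arg_cong[where f = "sph_int a"]) (use d in \<open>auto simp: v2_def d_def[symmetric] fun_eq_iff field_simps power2_eq_square\<close>)
  also have "\<dots> = 1 * m 2 + 1 * ((-2 / d) * m 1 + (1 / d\<^sup>2) * m 0)"
  proof -
    have "sph_continuous (\<lambda>\<omega>. (-2 / d) * ((\<omega> \<bullet> e)\<^sup>2) ^ 1 + (1 / d\<^sup>2) * ((\<omega> \<bullet> e)\<^sup>2) ^ 0)"
      by (intro sph_continuous_intros sc)
    from sph_int_linear[OF sc this a, of 1 2 1] show ?thesis
      unfolding sph_int_linear[OF sc sc a] m_def .
  qed
  also have "\<dots> = m 1 * (3 / (2 + d) - 1 / d)"
  proof -
    have "m 2 = m 1 * (3 / (2 + d))" "(1 / d\<^sup>2) * m 0 = m 1 * (1 / d)"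
      using m d by (simp_all add: field_simps power2_eq_square)
    then show ?thesis by (simp only:) (simp add: algebra_simps)
  qed
  also have "\<dots> > 0"
  proof (rule mult_pos_pos)
    show "m 1 > 0" using m d by (simp add: zero_less_mult_iff)
    have "3 / (3 * d) < 3 / (2 + d)" by (rule divide_strict_left_mono) (use d in auto)
    then show "3 / (2 + d) - 1 / d > 0" by simp
  qed
  finally show ?thesis .
qed

lemma sph_continuous_v2: "sph_continuous (v2 e)"
  by (rule sph_C2.sph_continuous_v[OF zonal_v2(1)])

text \<open>This is the inequality behind lam < 2. With z = (\<omega> \<bullet> e)^2 and D = (d-1)^2
  - 1 one has A + 2 v2 = 2(d-2)/d + 2(d-1) v2 / (1 + D z). After multiplication by v2 the constant
  integrates to 0, and the other term is at least 2/(d-1) v2^2, because 1 + D z \<le>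
  (d-1)^2.\<close>

lemma sph_int_A_v2_bound:
  assumes a: "a > 0" and A: "sph_continuous (sph_A 2 (v2 e))"
  shows "sph_int a (\<lambda>\<omega>. sph_A 2 (v2 e) \<omega> * v2 e \<omega>) + 2 * sph_int a (\<lambda>\<omega>. v2 e \<omega> * v2 e \<omega>) > 0"
proof -
  define d where "d = real DIM('a)"
  have d: "d \<ge> 3" using dim by (simp add: d_def)
  let ?v = "v2 e" and ?D = "(d - 1)\<^sup>2 - 1"
  have D0: "?D \<ge> 0" using d one_le_power[of "d - 1" 2] by simp
  note sc = sph_continuous_intros sph_continuous_v2 A
  have "2 / (d - 1) * sph_int a (\<lambda>\<omega>. ?v \<omega> * ?v \<omega>) + 2 * (d - 2) / d * sph_int a ?v
     \<le> 1 * sph_int a (\<lambda>\<omega>. sph_A 2 ?v \<omega> * ?v \<omega>) + 2 * sph_int a (\<lambda>\<omega>. ?v \<omega> * ?v \<omega>)"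
    unfolding sph_int_linear[OF sc(4)[OF sc(5,5)] sc(5) a, symmetric]
      sph_int_linear[OF sc(4)[OF sc(6,5)] sc(4)[OF sc(5,5)] a, symmetric]
  proof (rule sph_int_mono[OF _ _ a])
    fix \<omega> :: 'a assume w: "norm \<omega> = 1"
    define z where "z = (\<omega> \<bullet> e)\<^sup>2"
    have z01: "z \<ge> 0" "z \<le> 1"
      using Cauchy_Schwarz_ineq2[of \<omega> e] e w by (auto simp: z_def abs_square_le_1)
    have v: "?v \<omega> = z - 1 / d" by (simp add: v2_def d_def z_def)
    have p: "1 + ?D * z > 0" using D0 z01 by (simp add: add_pos_nonneg)
    define D Q where "D = ?D" and "Q = 1 + D * z"
    have A: "sph_A 2 ?v \<omega> = 2 * D * z * (1 - z) / Q"
      using zonal_v2(3)[OF w] by (simp add: d_def z_def D_def Q_def)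
    have Q: "Q > 0" using p by (simp add: Q_def D_def)
    have key: "2 * D * z * (1 - z) * d + 2 * (d * z - 1) * Q = 2 * (d - 2) * Q + 2 * (d - 1) * (d * z - 1)"
      unfolding Q_def D_def by (simp add: algebra_simps power2_eq_square)
    have "sph_A 2 ?v \<omega> + 2 * ?v \<omega> = (2 * D * z * (1 - z) * d + 2 * (d * z - 1) * Q) / (d * Q)"
      unfolding A v using Q d by (simp add: field_simps)
    also have "\<dots> = 2 * (d - 2) / d + 2 * (d - 1) * ?v \<omega> / Q"
      unfolding key v using Q d by (simp add: field_simps)
    finally have "sph_A 2 ?v \<omega> + 2 * ?v \<omega> = 2 * (d - 2) / d + 2 * (d - 1) * ?v \<omega> / (1 + ?D * z)"
      by (simp add: Q_def D_def)
    note Aeq = this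
    have "1 * (sph_A 2 ?v \<omega> * ?v \<omega>) + 2 * (?v \<omega> * ?v \<omega>) = (sph_A 2 ?v \<omega> + 2 * ?v \<omega>) * ?v \<omega>"
      by (simp add: distrib_right)
    also have "\<dots> = 2 * (d - 2) / d * ?v \<omega> + 2 * (d - 1) / (1 + ?D * z) * (?v \<omega> * ?v \<omega>)"
      unfolding Aeq distrib_right by simp
    finally have "1 * (sph_A 2 ?v \<omega> * ?v \<omega>) + 2 * (?v \<omega> * ?v \<omega>) = 2 * (d - 2) / d * ?v \<omega> + 2 * (d - 1) / (1 + ?D * z) * (?v \<omega> * ?v \<omega>)" .
    moreover have "2 / (d - 1) \<le> 2 * (d - 1) / (1 + ?D * z)"
    proof -
      have "1 + ?D * z \<le> (d - 1)\<^sup>2" using mult_left_mono[OF z01(2) D0] by simp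
      from mult_left_mono[OF this, of 2] have "2 * (1 + ?D * z) \<le> 2 * (d - 1) * (d - 1)"
        unfolding power2_eq_square[of "d - 1"] by (simp only: mult.assoc)
      then show ?thesis using p d by (simp add: divide_simps)
    qed
    then have "2 / (d - 1) * (?v \<omega> * ?v \<omega>) \<le> 2 * (d - 1) / (1 + ?D * z) * (?v \<omega> * ?v \<omega>)"
      by (intro mult_right_mono) auto
    ultimately show "2 / (d - 1) * (?v \<omega> * ?v \<omega>) + 2 * (d - 2) / d * ?v \<omega> \<le> 1 * (sph_A 2 ?v \<omega> * ?v \<omega>) + 2 * (?v \<omega> * ?v \<omega>)"
      by linarith
  qed (intro sc)+
  moreover have "2 / (d - 1) * sph_int a (\<lambda>\<omega>. ?v \<omega> * ?v \<omega>) > 0"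
    using sph_int_v2_sq_pos[OF a] d by simp
  ultimately show ?thesis using sph_int_v2_0[OF a] by simp
qed

text \<open>Slicing leads to the one-dimensional inequality with y = d v2. The factor d inside the
  logarithm adds ln d times the integral of y, which is 0 by the moment recursion.\<close>

lemma sph_int_entropy_bound:
  assumes a: "a > 0" and A: "sph_continuous (sph_A 2 (v2 e))"
  shows "sph_int a (\<lambda>\<omega>. v2 e \<omega> * ln \<bar>v2 e \<omega>\<bar>) - sph_int a (sph_A 2 (v2 e)) / (2 * real DIM('a)) < 0"
    and "sph_continuous (\<lambda>\<omega>. v2 e \<omega> * ln \<bar>v2 e \<omega>\<bar>)"
proof -
  define n where "n = DIM('a) - 1"
  define N where "N = real n"
  define d where "d = real DIM('a)"
  have d: "d \<ge> 3" "N = d - 1" "n \<ge> 2" using dim by (auto simp: d_def N_def n_def of_nat_diff)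
  have N2: "N\<^sup>2 - 1 \<ge> 0" using d one_le_power[of N 2] by simp
  define B where "B z = (N\<^sup>2 - 1) * z * (1 - z) / (1 + (N\<^sup>2 - 1) * z)" for z
  define h where "h z = (z - 1 / d) * ln \<bar>z - 1 / d\<bar> - B z / d" for z
  have pos: "1 + (N\<^sup>2 - 1) * z > 0" if "z \<ge> 0" for z using N2 that by (simp add: add_pos_nonneg)
  have ch: "continuous_on {0..1} h"
    unfolding h_def B_def using d pos
    by (intro continuous_intros continuous_on_compose2[OF continuous_on_mult_ln_abs, of _ "\<lambda>z. z - 1 / d"]) (force simp: less_imp_neq[symmetric])+
  show scl: "sph_continuous (\<lambda>\<omega>. v2 e \<omega> * ln \<bar>v2 e \<omega>\<bar>)"
    using sph_continuous_v2 unfolding sph_continuous_def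
    by (intro continuous_on_compose2[OF continuous_on_mult_ln_abs]) auto
  have "sph_int a (\<lambda>\<omega>. h ((\<omega> \<bullet> e)\<^sup>2)) = sph_int a (\<lambda>\<omega>. 1 * (v2 e \<omega> * ln \<bar>v2 e \<omega>\<bar>) + (- 1 / (2 * d)) * sph_A 2 (v2 e) \<omega>)"
  proof (rule sph_int_cong[OF a])
    fix \<omega> :: 'a assume w: "norm \<omega> = 1"
    have "sph_A 2 (v2 e) \<omega> = 2 * B ((\<omega> \<bullet> e)\<^sup>2)"
      unfolding zonal_v2(3)[OF w] B_def d(2) d_def by simp
    then show "h ((\<omega> \<bullet> e)\<^sup>2) = 1 * (v2 e \<omega> * ln \<bar>v2 e \<omega>\<bar>) + (- 1 / (2 * d)) * sph_A 2 (v2 e) \<omega>"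
      by (simp add: h_def v2_def d_def)
  qed
  also have "\<dots> = 1 * sph_int a (\<lambda>\<omega>. v2 e \<omega> * ln \<bar>v2 e \<omega>\<bar>) + (- 1 / (2 * d)) * sph_int a (sph_A 2 (v2 e))"
    by (rule sph_int_linear[OF scl A a])
  finally have eq: "sph_int a (\<lambda>\<omega>. h ((\<omega> \<bullet> e)\<^sup>2)) = sph_int a (\<lambda>\<omega>. v2 e \<omega> * ln \<bar>v2 e \<omega>\<bar>) - sph_int a (sph_A 2 (v2 e)) / (2 * real DIM('a))"
    by (simp add: d_def)
  define y where "y \<theta> = (N + 1) * (cos \<theta>)\<^sup>2 - 1" for \<theta> :: real
  let ?J = "\<lambda>f. integral {0..pi/2} (\<lambda>\<theta>. f \<theta> * sin \<theta> ^ (n - 1))"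
  have ent: "?J (\<lambda>\<theta>. y \<theta> * ln \<bar>y \<theta>\<bar> - B ((cos \<theta>)\<^sup>2)) < 0"
    using entropy_integral_neg[OF d(3)] unfolding y_def B_def N_def by simp
  have cB: "continuous_on S (\<lambda>\<theta>. B ((cos \<theta>)\<^sup>2))" for S
    unfolding B_def using pos by (intro continuous_intros) (auto simp: less_imp_neq[symmetric])
  have cy: "continuous_on S y" for S unfolding y_def by (intro continuous_intros)
  have cyl: "continuous_on S (\<lambda>\<theta>. y \<theta> * ln \<bar>y \<theta>\<bar>)" for S
    by (rule continuous_on_compose2[OF continuous_on_mult_ln_abs cy]) auto
  have "?J y = 0"
  proof -
    have "((\<lambda>\<theta>. (N + 1) * (((cos \<theta>)\<^sup>2) ^ Suc 0 * sin \<theta> ^ (n - 1)) - 1 * (((cos \<theta>)\<^sup>2) ^ 0 * sin \<theta> ^ (n - 1))) has_integral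
      (N + 1) * ?J (\<lambda>\<theta>. ((cos \<theta>)\<^sup>2) ^ Suc 0) - 1 * ?J (\<lambda>\<theta>. ((cos \<theta>)\<^sup>2) ^ 0)) {0..pi/2}"
      by (intro has_integral_diff has_integral_mult_right integrable_integral integrable_continuous_interval continuous_intros)
    moreover have "(N + 1) * ?J (\<lambda>\<theta>. ((cos \<theta>)\<^sup>2) ^ Suc 0) - 1 * ?J (\<lambda>\<theta>. ((cos \<theta>)\<^sup>2) ^ 0) = 0"
      using cos_sin_moment[of n 0] d(3) by (simp add: N_def)
    ultimately show ?thesis by (intro integral_unique) (simp add: y_def algebra_simps)
  qed
  have int1: "((\<lambda>\<theta>. (y \<theta> * ln \<bar>y \<theta>\<bar> - B ((cos \<theta>)\<^sup>2)) * sin \<theta> ^ (n - 1)) has_integral ?J (\<lambda>\<theta>. y \<theta> * ln \<bar>y \<theta>\<bar> - B ((cos \<theta>)\<^sup>2))) {0..pi/2}"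
    by (intro integrable_integral integrable_continuous_interval continuous_intros cyl cB)
  have int2: "((\<lambda>\<theta>. y \<theta> * sin \<theta> ^ (n - 1)) has_integral ?J y) {0..pi/2}"
    by (intro integrable_integral integrable_continuous_interval continuous_intros cy)
  have "((\<lambda>\<theta>. (1 / d) * ((y \<theta> * ln \<bar>y \<theta>\<bar> - B ((cos \<theta>)\<^sup>2)) * sin \<theta> ^ (n - 1)) - (ln d / d) * (y \<theta> * sin \<theta> ^ (n - 1))) has_integral
      (1 / d) * ?J (\<lambda>\<theta>. y \<theta> * ln \<bar>y \<theta>\<bar> - B ((cos \<theta>)\<^sup>2)) - (ln d / d) * ?J y) {0..pi/2}"
    by (intro has_integral_diff has_integral_mult_right int1 int2)
  moreover have "(1 / d) * ((y \<theta> * ln \<bar>y \<theta>\<bar> - B ((cos \<theta>)\<^sup>2)) * sin \<theta> ^ (n - 1)) - (ln d / d) * (y \<theta> * sin \<theta> ^ (n - 1))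
    = h ((cos \<theta>)\<^sup>2) * sin \<theta> ^ (n - 1)" for \<theta>
  proof -
    have yd: "(cos \<theta>)\<^sup>2 - 1 / d = y \<theta> / d" using d by (simp add: y_def field_simps)
    have "(y \<theta> / d) * ln \<bar>y \<theta> / d\<bar> = (1 / d) * (y \<theta> * ln \<bar>y \<theta>\<bar>) - (ln d / d) * y \<theta>"
    proof (cases "y \<theta> = 0")
      case False
      have "\<bar>y \<theta> / d\<bar> = \<bar>y \<theta>\<bar> / d" using d by (simp add: abs_divide)
      then have "ln \<bar>y \<theta> / d\<bar> = ln \<bar>y \<theta>\<bar> - ln d" using d False by (simp add: ln_div)
      then show ?thesis by (simp add: right_diff_distrib)
    qed simp
    then show ?thesis unfolding h_def yd by (simp only:) (simp add: algebra_simps diff_divide_distrib)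
  qed
  ultimately have Jh: "?J (\<lambda>\<theta>. h ((cos \<theta>)\<^sup>2)) < 0"
    using ent d \<open>?J y = 0\<close> by (simp add: integral_unique divide_neg_pos)
  have k: "DIM('a) - 2 = n - 1" using dim by (simp add: n_def)
  have "sph_int a (\<lambda>\<omega>. h ((\<omega> \<bullet> e)\<^sup>2)) * integral {0..pi/2} (\<lambda>\<theta>. sin \<theta> ^ (n - 1)) = sph_int a (\<lambda>_::'a. 1) * ?J (\<lambda>\<theta>. h ((cos \<theta>)\<^sup>2))"
    using sph_int_slice[OF e a _ ch] dim unfolding k by simp
  also have "\<dots> < 0" using Jh sph_int_1_pos[OF a, where 'a = 'a] by (intro mult_pos_neg)
  finally show "sph_int a (\<lambda>\<omega>. v2 e \<omega> * ln \<bar>v2 e \<omega>\<bar>) - sph_int a (sph_A 2 (v2 e)) / (2 * real DIM('a)) < 0"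
    unfolding eq[symmetric] using integral_sin_power_pos[of "n - 1"] by (simp add: mult_less_0_iff)
qed

end

section \<open>The branch as p tends to 2 from above\<close>

lemma sph_C2_holderD: "sph_C2_holder \<gamma> v \<Longrightarrow> sph_C2 v"
  by (simp add: sph_C2_holder_def sph_C2_def)

lemma sgn_unit: "norm x = 1 \<Longrightarrow> sgn x = (x :: 'a::real_normed_vector)" "norm x = 1 \<Longrightarrow> x \<noteq> 0"
  by (auto simp: sgn_div_norm)

context sph_C2
begin

lemma sph_grad_eq_W: "norm \<omega> = 1 \<Longrightarrow> sph_grad v \<omega> = W \<omega>"
  by (simp add: W_def sgn_unit)

lemma hess_bounded: obtains B where "B > 0" "\<And>\<omega> h. norm \<omega> = 1 \<Longrightarrow> norm (sph_hess v \<omega> h) \<le> B * norm h"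
proof -
  have "sph_continuous (\<lambda>\<omega>. \<Sum>i\<in>Basis. norm (DW \<omega> i))"
    unfolding sph_continuous_def by (intro continuous_intros continuous_on_DW_sgn)
  then obtain C where C: "C > 0" "\<And>\<omega>. norm \<omega> = 1 \<Longrightarrow> \<bar>\<Sum>i\<in>Basis. norm (DW \<omega> i)\<bar> \<le> C"
    using sph_continuous_bounded by blast
  have "norm (sph_hess v \<omega> h) \<le> 2 * C * norm h" if w: "norm \<omega> = 1" for \<omega> h
  proof -
    have lin: "linear (DW \<omega>)" by (rule linear_DW[OF sgn_unit(2)[OF w]])
    have "DW \<omega> (\<Sum>i\<in>Basis. (h \<bullet> i) *\<^sub>R i) = (\<Sum>i\<in>Basis. (h \<bullet> i) *\<^sub>R DW \<omega> i)"
      by (simp add: linear_sum[OF lin] linear_scale[OF lin])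
    then have "norm (DW \<omega> h) = norm (\<Sum>i\<in>Basis. (h \<bullet> i) *\<^sub>R DW \<omega> i)"
      by (simp only: euclidean_representation)
    also have "\<dots> \<le> (\<Sum>i\<in>Basis. norm h * norm (DW \<omega> i))"
      by (rule order.trans[OF norm_sum]) (auto intro!: sum_mono mult_right_mono Basis_le_norm)
    also have "\<dots> = norm h * (\<Sum>i\<in>Basis. norm (DW \<omega> i))" by (simp add: sum_distrib_left)
    also have "\<dots> \<le> norm h * C" using C(2)[OF w] by (intro mult_left_mono) auto
    finally have D: "norm (DW \<omega> h) \<le> C * norm h" by (simp add: mult.commute)
    have "norm ((DW \<omega> h \<bullet> \<omega>) *\<^sub>R \<omega>) \<le> norm (DW \<omega> h)"
      using Cauchy_Schwarz_ineq2[of "DW \<omega> h" \<omega>] w by simp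
    then have "norm (sph_hess v \<omega> h) \<le> norm (DW \<omega> h) + norm (DW \<omega> h)"
      unfolding sph_hess_eq using norm_triangle_ineq4[of "DW \<omega> h" "(DW \<omega> h \<bullet> \<omega>) *\<^sub>R \<omega>"] by linarith
    then show ?thesis using D by linarith
  qed
  then show ?thesis using that[of "2 * C"] C(1) by simp
qed

lemma bounded_linear_hess: "norm \<omega> = 1 \<Longrightarrow> bounded_linear (sph_hess v \<omega>)"
proof -
  assume w: "norm \<omega> = 1"
  have lin: "linear (DW \<omega>)" by (rule linear_DW[OF sgn_unit(2)[OF w]])
  have "linear (sph_hess v \<omega>)"
    by (rule linearI) (simp_all add: sph_hess_eq linear_add[OF lin] linear_scale[OF lin] inner_add_left algebra_simps)
  then show ?thesis by (simp add: linear_conv_bounded_linear)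
qed

lemma sph_continuous_sph_A:
  assumes "\<And>\<omega>. norm \<omega> = 1 \<Longrightarrow> (norm (sph_grad v \<omega>))\<^sup>2 + lam\<^sup>2 * (v \<omega>)\<^sup>2 > 0"
  shows "sph_continuous (sph_A lam v)"
  unfolding sph_continuous_def
proof (rule continuous_on_eq)
  have cW: "continuous_on (- {0}) W" by (rule Ck_on_imp_continuous_on[OF C1_W])
  have cv: "continuous_on (- {0}) (\<lambda>x. v (sgn x))" by (rule Ck_on_imp_continuous_on[OF C1_v])
  \<comment> \<open>Continuity of \<open>DW\<close> is available only direction by direction in
    \<open>Basis\<close>, so \<open>DW\<close> applied to \<open>W\<close> is expanded in
    coordinates.\<close>
  show "continuous_on (- {0}) (\<lambda>x. (W x \<bullet> (\<Sum>i\<in>Basis. (W x \<bullet> i) *\<^sub>R DW (sgn x) i) + lam\<^sup>2 * v (sgn x) * (norm (W x))\<^sup>2) /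
      ((norm (W x))\<^sup>2 + lam\<^sup>2 * (v (sgn x))\<^sup>2))"
  proof (intro continuous_intros cW cv continuous_on_DW_sgn ballI)
    fix x :: 'a assume "x \<in> - {0}"
    then have w: "norm (sgn x) = 1" by (simp add: norm_sgn)
    show "(norm (W x))\<^sup>2 + lam\<^sup>2 * (v (sgn x))\<^sup>2 \<noteq> 0"
      using assms[OF w] sph_grad_eq_W[OF w] W_hom(2)[of x] by simp
  qed
  fix x :: 'a assume "x \<in> - {0}"
  then have w: "norm (sgn x) = 1" by (simp add: norm_sgn)
  have lin: "linear (DW (sgn x))" by (rule linear_DW[OF sgn_unit(2)[OF w]])
  have "DW (sgn x) (\<Sum>i\<in>Basis. (W x \<bullet> i) *\<^sub>R i) = (\<Sum>i\<in>Basis. (W x \<bullet> i) *\<^sub>R DW (sgn x) i)"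
    by (simp add: linear_sum[OF lin] linear_scale[OF lin])
  then have "(\<Sum>i\<in>Basis. (W x \<bullet> i) *\<^sub>R DW (sgn x) i) = DW (sgn x) (W x)"
    by (simp only: euclidean_representation)
  moreover have "W (sgn x) \<bullet> sph_hess v (sgn x) (W x) = W (sgn x) \<bullet> DW (sgn x) (W x)" by (rule W_hess_W[OF w])
  ultimately show "(W x \<bullet> (\<Sum>i\<in>Basis. (W x \<bullet> i) *\<^sub>R DW (sgn x) i) + lam\<^sup>2 * v (sgn x) * (norm (W x))\<^sup>2) /
      ((norm (W x))\<^sup>2 + lam\<^sup>2 * (v (sgn x))\<^sup>2) = sph_A lam v (sgn x)"
    by (simp add: sph_A_def sph_grad_eq_W[OF w] W_hom(2))
qed

end

text \<open>The denominator contains the squared gradient that the numerator carries as a factor. So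
  the bound does not depend on how small the denominator is and holds uniformly along the
  branch.\<close>

lemma abs_sph_A_le:
  assumes pos: "(norm (sph_grad v \<omega>))\<^sup>2 + lam\<^sup>2 * (v \<omega>)\<^sup>2 > 0"
    and B: "B \<ge> 0" "\<And>h. norm (sph_hess v \<omega> h) \<le> B * norm h"
  shows "\<bar>sph_A lam v \<omega>\<bar> \<le> B + lam\<^sup>2 * \<bar>v \<omega>\<bar>"
proof -
  let ?G = "sph_grad v \<omega>"
  have "\<bar>?G \<bullet> sph_hess v \<omega> ?G\<bar> \<le> norm ?G * (B * norm ?G)"
    by (rule order.trans[OF Cauchy_Schwarz_ineq2 mult_left_mono[OF B(2)]]) simp
  then have "\<bar>?G \<bullet> sph_hess v \<omega> ?G + lam\<^sup>2 * v \<omega> * (norm ?G)\<^sup>2\<bar> \<le> (B + lam\<^sup>2 * \<bar>v \<omega>\<bar>) * (norm ?G)\<^sup>2"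
    using abs_triangle_ineq[of "?G \<bullet> sph_hess v \<omega> ?G" "lam\<^sup>2 * v \<omega> * (norm ?G)\<^sup>2"]
    by (simp add: abs_mult algebra_simps power2_eq_square[of "norm _"])
  also have "\<dots> \<le> (B + lam\<^sup>2 * \<bar>v \<omega>\<bar>) * ((norm ?G)\<^sup>2 + lam\<^sup>2 * (v \<omega>)\<^sup>2)"
    using B(1) by (intro mult_left_mono) auto
  finally show ?thesis
    unfolding sph_A_def abs_divide using pos by (simp add: pos_divide_le_eq)
qed

section \<open>Pointwise consequences of smoothness of the curve \<open>g\<close>\<close>

lemma sph_C2_lincomb:
  fixes f h :: "'a::euclidean_space \<Rightarrow> real" and a b :: real
  assumes f: "sph_C2 f" and h: "sph_C2 h"
  defines "k \<equiv> \<lambda>\<omega>. a * f \<omega> + b * h \<omega>"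
  shows "sph_C2 k"
    and "norm \<omega> = 1 \<Longrightarrow> sph_grad k \<omega> = a *\<^sub>R sph_grad f \<omega> + b *\<^sub>R sph_grad h \<omega>"
    and "norm \<omega> = 1 \<Longrightarrow> sph_hess k \<omega> \<xi> = a *\<^sub>R sph_hess f \<omega> \<xi> + b *\<^sub>R sph_hess h \<omega> \<xi>"
proof -
  interpret f: sph_C2 f by fact
  interpret h: sph_C2 h by fact
  have "Ck_on 2 (- {0}) (\<lambda>x. a * f (sgn x) + b * h (sgn x))"
    by (intro Ck_on_add Ck_on_mult[OF _ Ck_on_const] f.C2 h.C2) auto
  then show "sph_C2 k" by (simp add: sph_C2_def k_def)
  then interpret k: sph_C2 k .
  have Wk: "k.W x = a *\<^sub>R f.W x + b *\<^sub>R h.W x" if "x \<noteq> 0" for x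
  proof -
    have "((\<lambda>x. k (sgn x)) has_derivative (\<lambda>y. a * (f.W x \<bullet> y / norm x) + b * (h.W x \<bullet> y / norm x))) (at x)"
      unfolding k_def by (intro has_derivative_add has_derivative_mult_right f.has_derivative_v h.has_derivative_v that)
    from has_derivative_unique[OF k.has_derivative_v[OF that] this]
    have "k.W x \<bullet> y / norm x = a * (f.W x \<bullet> y / norm x) + b * (h.W x \<bullet> y / norm x)" for y by (rule fun_cong)
    then have "k.W x \<bullet> y = (a *\<^sub>R f.W x + b *\<^sub>R h.W x) \<bullet> y" for y
      using that by (simp add: inner_add_left field_simps)
    then show ?thesis by (metis vector_eq_ldot inner_commute)
  qed
  assume w: "norm \<omega> = 1"
  note w0 = sgn_unit(2)[OF w]
  show "sph_grad k \<omega> = a *\<^sub>R sph_grad f \<omega> + b *\<^sub>R sph_grad h \<omega>"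
    unfolding k.sph_grad_eq_W[OF w] f.sph_grad_eq_W[OF w] h.sph_grad_eq_W[OF w] by (rule Wk[OF w0])
  have "((\<lambda>x. a *\<^sub>R f.W x + b *\<^sub>R h.W x) has_derivative (\<lambda>y. a *\<^sub>R f.DW \<omega> y + b *\<^sub>R h.DW \<omega> y)) (at \<omega>)"
    by (intro has_derivative_add has_derivative_scaleR_right f.has_derivative_W_self h.has_derivative_W_self w0)
  then have "(k.W has_derivative (\<lambda>y. a *\<^sub>R f.DW \<omega> y + b *\<^sub>R h.DW \<omega> y)) (at \<omega>)"
    by (rule has_derivative_transform_within_open[of _ _ _ _ "- {0}"]) (use w0 Wk in auto)
  from has_derivative_unique[OF k.has_derivative_W_self[OF w0] this]
  have "k.DW \<omega> \<xi> = a *\<^sub>R f.DW \<omega> \<xi> + b *\<^sub>R h.DW \<omega> \<xi>" by (rule fun_cong)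
  then show "sph_hess k \<omega> \<xi> = a *\<^sub>R sph_hess f \<omega> \<xi> + b *\<^sub>R sph_hess h \<omega> \<xi>"
    unfolding k.sph_hess_eq f.sph_hess_eq h.sph_hess_eq by (simp add: inner_add_left algebra_simps)
qed

lemma sph_C2_holder_lincomb:
  fixes f h :: "'a::euclidean_space \<Rightarrow> real"
  assumes f: "sph_C2_holder \<gamma> f" and h: "sph_C2_holder \<gamma> h"
  shows "sph_C2_holder \<gamma> (\<lambda>\<omega>. a * f \<omega> + b * h \<omega>)"
proof -
  note fC = sph_C2_holderD[OF f] and hC = sph_C2_holderD[OF h]
  obtain Cf Ch where C: "\<forall>\<omega>\<in>sphere 0 1. \<forall>\<omega>'\<in>sphere 0 1. onorm (\<lambda>\<xi>. sph_hess f \<omega> \<xi> - sph_hess f \<omega>' \<xi>) \<le> Cf * dist \<omega> \<omega>' powr \<gamma>"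
    "\<forall>\<omega>\<in>sphere 0 1. \<forall>\<omega>'\<in>sphere 0 1. onorm (\<lambda>\<xi>. sph_hess h \<omega> \<xi> - sph_hess h \<omega>' \<xi>) \<le> Ch * dist \<omega> \<omega>' powr \<gamma>"
    using f h unfolding sph_C2_holder_def by auto
  have "onorm (\<lambda>\<xi>. sph_hess (\<lambda>\<omega>. a * f \<omega> + b * h \<omega>) \<omega> \<xi> - sph_hess (\<lambda>\<omega>. a * f \<omega> + b * h \<omega>) \<omega>' \<xi>)
      \<le> (\<bar>a\<bar> * Cf + \<bar>b\<bar> * Ch) * dist \<omega> \<omega>' powr \<gamma>" if w: "norm \<omega> = 1" "norm \<omega>' = 1" for \<omega> \<omega>' :: 'a
  proof -
    let ?F = "\<lambda>\<xi>. sph_hess f \<omega> \<xi> - sph_hess f \<omega>' \<xi>" and ?H = "\<lambda>\<xi>. sph_hess h \<omega> \<xi> - sph_hess h \<omega>' \<xi>"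
    have bF: "bounded_linear ?F" and bH: "bounded_linear ?H"
      using sph_C2.bounded_linear_hess[OF fC] sph_C2.bounded_linear_hess[OF hC] w by (auto intro: bounded_linear_sub)
    have eq: "(\<lambda>\<xi>. sph_hess (\<lambda>\<omega>. a * f \<omega> + b * h \<omega>) \<omega> \<xi> - sph_hess (\<lambda>\<omega>. a * f \<omega> + b * h \<omega>) \<omega>' \<xi>)
      = (\<lambda>\<xi>. a *\<^sub>R ?F \<xi> + b *\<^sub>R ?H \<xi>)"
      unfolding sph_C2_lincomb(3)[OF fC hC w(1)] sph_C2_lincomb(3)[OF fC hC w(2)] by (simp add: algebra_simps)
    have "onorm (\<lambda>\<xi>. a *\<^sub>R ?F \<xi> + b *\<^sub>R ?H \<xi>) \<le> onorm (\<lambda>\<xi>. a *\<^sub>R ?F \<xi>) + onorm (\<lambda>\<xi>. b *\<^sub>R ?H \<xi>)"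
      by (intro onorm_triangle bounded_linear_const_scaleR bF bH)
    also have "\<dots> = \<bar>a\<bar> * onorm ?F + \<bar>b\<bar> * onorm ?H" by (simp add: onorm_scaleR[OF bF] onorm_scaleR[OF bH])
    also have "\<dots> \<le> \<bar>a\<bar> * (Cf * dist \<omega> \<omega>' powr \<gamma>) + \<bar>b\<bar> * (Ch * dist \<omega> \<omega>' powr \<gamma>)"
      using C w by (intro add_mono mult_left_mono) auto
    finally show ?thesis unfolding eq by (simp add: algebra_simps)
  qed
  moreover have "Ck_on 2 (- {0}) (\<lambda>x. a * f (sgn x) + b * h (sgn x))"
    using sph_C2_lincomb(1)[OF fC hC] by (simp add: sph_C2_def)
  ultimately show ?thesis unfolding sph_C2_holder_def by (auto intro!: exI[of _ "\<bar>a\<bar> * Cf + \<bar>b\<bar> * Ch"])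
qed

lemma sph_C2_holder_norm_bounds:
  fixes v :: "'a::euclidean_space \<Rightarrow> real"
  assumes v: "sph_C2_holder \<gamma> v" and w: "norm \<omega> = 1"
  shows "\<bar>v \<omega>\<bar> \<le> sph_C2_holder_norm \<gamma> v" "norm (sph_grad v \<omega>) \<le> sph_C2_holder_norm \<gamma> v"
    "norm (sph_hess v \<omega> \<xi>) \<le> sph_C2_holder_norm \<gamma> v * norm \<xi>"
proof -
  interpret sph_C2 v by (rule sph_C2_holderD[OF v])
  let ?S = "sphere (0::'a) 1" and ?T = "{(\<omega>, \<omega>'). \<omega> \<in> sphere (0::'a) 1 \<and> \<omega>' \<in> sphere (0::'a) 1 \<and> \<omega> \<noteq> \<omega>'}"
  let ?q = "\<lambda>(\<omega>, \<omega>'). onorm (\<lambda>\<xi>. sph_hess v \<omega> \<xi> - sph_hess v \<omega>' \<xi>) / dist \<omega> \<omega>' powr \<gamma>"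
  obtain C1 where C1: "\<And>\<omega>. norm \<omega> = 1 \<Longrightarrow> \<bar>v \<omega>\<bar> \<le> C1" using sph_continuous_bounded[OF sph_continuous_v] by blast
  have "sph_continuous (\<lambda>\<omega>. norm (W \<omega>))"
    unfolding sph_continuous_def by (intro continuous_intros continuous_on_W_sgn)
  then obtain C2 where C2: "\<And>\<omega>. norm \<omega> = 1 \<Longrightarrow> \<bar>norm (W \<omega>)\<bar> \<le> C2" using sph_continuous_bounded by blast
  obtain C3 where C3: "\<And>\<omega> h. norm \<omega> = 1 \<Longrightarrow> norm (sph_hess v \<omega> h) \<le> C3 * norm h" "C3 > 0" by (rule hess_bounded) blast
  obtain C4 where C4: "\<forall>\<omega>\<in>?S. \<forall>\<omega>'\<in>?S. onorm (\<lambda>\<xi>. sph_hess v \<omega> \<xi> - sph_hess v \<omega>' \<xi>) \<le> C4 * dist \<omega> \<omega>' powr \<gamma>"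
    using v unfolding sph_C2_holder_def by blast
  have b1: "bdd_above ((\<lambda>\<omega>. \<bar>v \<omega>\<bar>) ` ?S)" by (rule bdd_aboveI2[of _ _ C1]) (simp add: C1)
  have b2: "bdd_above ((\<lambda>\<omega>. norm (sph_grad v \<omega>)) ` ?S)"
    by (rule bdd_aboveI2[of _ _ C2]) (use C2 sph_grad_eq_W in auto)
  have b3: "bdd_above ((\<lambda>\<omega>. onorm (sph_hess v \<omega>)) ` ?S)"
    by (rule bdd_aboveI2[of _ _ C3]) (use C3 in \<open>auto intro!: onorm_bound\<close>)
  have b4: "bdd_above (?q ` ?T)"
  proof (rule bdd_aboveI2[of _ _ C4])
    fix x assume "x \<in> ?T"
    then obtain \<omega> \<omega>' where x: "x = (\<omega>, \<omega>')" "\<omega> \<in> ?S" "\<omega>' \<in> ?S" "\<omega> \<noteq> \<omega>'" by blast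
    then have "dist \<omega> \<omega>' powr \<gamma> > 0" by simp
    then show "?q x \<le> C4" using C4 x by (simp add: pos_divide_le_eq)
  qed
  \<comment> \<open>The antipodal pair shows that the last supremum is taken over a nonempty set,
    hence is nonnegative; then each of the other suprema is bounded by the norm.\<close>
  have wS: "\<omega> \<in> ?S" "- \<omega> \<in> ?S" "\<omega> \<noteq> - \<omega>" using w by (auto simp: eq_neg_iff_add_eq_0 simp flip: scaleR_2)
  then have wT: "(\<omega>, - \<omega>) \<in> ?T" by simp
  have s1: "\<bar>v \<omega>\<bar> \<le> (SUP \<omega>\<in>?S. \<bar>v \<omega>\<bar>)" by (rule cSUP_upper[OF wS(1) b1])
  have s2: "norm (sph_grad v \<omega>) \<le> (SUP \<omega>\<in>?S. norm (sph_grad v \<omega>))" by (rule cSUP_upper[OF wS(1) b2])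
  have s3: "onorm (sph_hess v \<omega>) \<le> (SUP \<omega>\<in>?S. onorm (sph_hess v \<omega>))" by (rule cSUP_upper[OF wS(1) b3])
  have s4: "?q (\<omega>, - \<omega>) \<le> Sup (?q ` ?T)" by (rule cSUP_upper[OF wT b4])
  have bl: "bounded_linear (sph_hess v \<omega>)" "bounded_linear (sph_hess v (- \<omega>))"
    using bounded_linear_hess w by auto
  have "0 \<le> ?q (\<omega>, - \<omega>)"
    using onorm_pos_le[OF bounded_linear_sub[OF bl]] by simp
  then have p4: "0 \<le> Sup (?q ` ?T)" using s4 by linarith
  have p3: "0 \<le> onorm (sph_hess v \<omega>)" by (rule onorm_pos_le[OF bl(1)])
  have N: "sph_C2_holder_norm \<gamma> v = (SUP \<omega>\<in>?S. \<bar>v \<omega>\<bar>) + (SUP \<omega>\<in>?S. norm (sph_grad v \<omega>)) +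
    (SUP \<omega>\<in>?S. onorm (sph_hess v \<omega>)) + Sup (?q ` ?T)"
    by (simp add: sph_C2_holder_norm_def)
  note nn = abs_ge_zero[of "v \<omega>"] norm_ge_zero[of "sph_grad v \<omega>"]
  show "\<bar>v \<omega>\<bar> \<le> sph_C2_holder_norm \<gamma> v" "norm (sph_grad v \<omega>) \<le> sph_C2_holder_norm \<gamma> v"
    unfolding N using s1 s2 s3 p4 p3 nn by linarith+
  have "onorm (sph_hess v \<omega>) \<le> sph_C2_holder_norm \<gamma> v" unfolding N using s1 s2 s3 p4 p3 nn by linarith
  then have "onorm (sph_hess v \<omega>) * norm \<xi> \<le> sph_C2_holder_norm \<gamma> v * norm \<xi>" by (rule mult_right_mono) simp
  then show "norm (sph_hess v \<omega> \<xi>) \<le> sph_C2_holder_norm \<gamma> v * norm \<xi>"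
    using onorm[OF bl(1), of \<xi>] by linarith
qed

text \<open>\<open>g 2\<close> is known to vanish on the sphere only. That is enough, since all
  spherical derivatives go through the extension by \<open>sgn\<close>.\<close>

lemma sph_C2_vanishing:
  assumes "\<And>\<omega>. norm \<omega> = 1 \<Longrightarrow> v \<omega> = 0" and w: "norm \<omega> = 1"
  shows "sph_grad v \<omega> = 0" "sph_hess v \<omega> \<xi> = 0"
proof -
  have g: "sph_grad v \<omega>' = 0" if "norm \<omega>' = 1" for \<omega>'
    unfolding sph_grad_def
  proof (rule grad_eqI)
    have "((\<lambda>_. 0) has_derivative (\<lambda>_. 0)) (at \<omega>')" by simp
    then have "((\<lambda>x. v (sgn x)) has_derivative (\<lambda>_. 0)) (at \<omega>')"
      by (rule has_derivative_transform_within_open[of _ _ _ _ "- {0}"])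
         (use that assms(1) sgn_unit in \<open>auto simp: norm_sgn\<close>)
    then show "((\<lambda>x. v (sgn x)) has_derivative (\<lambda>h. 0 \<bullet> h)) (at \<omega>')" by simp
  qed
  show "sph_grad v \<omega> = 0" by (rule g[OF w])
  have "((\<lambda>_. 0) has_derivative (\<lambda>_. 0)) (at \<omega>)" by simp
  then have "((\<lambda>x. sph_grad v (sgn x)) has_derivative (\<lambda>_. 0)) (at \<omega>)"
    by (rule has_derivative_transform_within_open[of _ _ _ _ "- {0}"])
       (use w g sgn_unit in \<open>auto simp: norm_sgn\<close>)
  from frechet_derivative_at[OF this, symmetric] show "sph_hess v \<omega> \<xi> = 0" by (simp add: sph_hess_def)
qed

lemma norm_le_of_diff_quotient:
  fixes x y :: "'b::real_normed_vector" and q :: real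
  assumes q: "q \<noteq> 0" and "norm ((1 / q) *\<^sub>R x - y) \<le> B" "norm y \<le> c * B"
  shows "norm x \<le> (c + 1) * \<bar>q\<bar> * B"
proof -
  have "norm ((1 / q) *\<^sub>R x) \<le> norm ((1 / q) *\<^sub>R x - y) + norm y"
    using norm_triangle_ineq[of "(1 / q) *\<^sub>R x - y" y] by simp
  then have "norm x / \<bar>q\<bar> \<le> (c + 1) * B" using assms by (simp add: algebra_simps)
  then show ?thesis using q by (simp add: pos_divide_le_eq mult_ac)
qed

text \<open>Only the first derivative of the curve is used: near p0 the difference quotient lies
  within distance 1 of it in norm, and the norm controls values, gradients and Hessians at every
  point.\<close>

lemma smooth_curve_V2_linear_bound:
  fixes e :: "'a::euclidean_space"
  assumes g: "smooth_curve_V2 e \<gamma> I g" and I: "p0 \<in> I" "open I" and g0: "\<And>\<omega>. norm \<omega> = 1 \<Longrightarrow> g p0 \<omega> = 0"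
  obtains C where "C > 0" "\<forall>\<^sub>F p in at p0. p \<in> I \<and> sph_C2_holder \<gamma> (g p) \<and> axially_symmetric e (g p) \<and>
    (\<forall>\<omega>. norm \<omega> = 1 \<longrightarrow> \<bar>g p \<omega>\<bar> \<le> C * \<bar>p - p0\<bar> \<and> norm (sph_grad (g p) \<omega>) \<le> C * \<bar>p - p0\<bar> \<and>
      (\<forall>\<xi>. norm (sph_hess (g p) \<omega> \<xi>) \<le> C * \<bar>p - p0\<bar> * norm \<xi>))"
proof -
  from g obtain D where D: "D 0 = g" "\<And>k p. p \<in> I \<Longrightarrow> D k p \<in> V2 e \<gamma>"
    "\<And>k p. p \<in> I \<Longrightarrow> ((\<lambda>q. sph_C2_holder_norm \<gamma> (\<lambda>\<omega>. (D k q \<omega> - D k p \<omega>) / (q - p) - D (Suc k) p \<omega>)) \<longlongrightarrow> 0) (at p)"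
    unfolding smooth_curve_V2_def by blast
  have H: "sph_C2_holder \<gamma> (g p)" "axially_symmetric e (g p)" if "p \<in> I" for p
    using D(2)[OF that, of 0] D(1) by (auto simp: V2_def)
  define G where "G = D 1 p0"
  have G: "sph_C2_holder \<gamma> G" using D(2)[OF I(1), of 1] by (simp add: V2_def G_def)
  define r where "r q \<omega> = (g q \<omega> - g p0 \<omega>) / (q - p0) - G \<omega>" for q \<omega>
  have "((\<lambda>q. sph_C2_holder_norm \<gamma> (r q)) \<longlongrightarrow> 0) (at p0)"
    using D(3)[OF I(1), of 0] unfolding r_def G_def D(1) by simp
  then have "\<forall>\<^sub>F q in at p0. sph_C2_holder_norm \<gamma> (r q) < 1" by (rule order_tendstoD) simp
  moreover have "\<forall>\<^sub>F q in at p0. q \<in> I" using eventually_at_in_open'[OF I(2,1)] by (auto elim: eventually_mono)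
  moreover have "\<forall>\<^sub>F q in at p0. q \<noteq> p0" by (simp add: eventually_at_filter)
  ultimately have ev: "\<forall>\<^sub>F q in at p0. sph_C2_holder_norm \<gamma> (r q) < 1 \<and> q \<in> I \<and> q \<noteq> p0"
    by eventually_elim simp
  \<comment> \<open>The norm of the derivative plus the distance 1; the absolute value makes C
    positive without an appeal to nonnegativity of the norm.\<close>
  define C where "C = \<bar>sph_C2_holder_norm \<gamma> G\<bar> + 1"
  show ?thesis
  proof (rule that[of C])
    show "C > 0" by (simp add: C_def)
    show "\<forall>\<^sub>F p in at p0. p \<in> I \<and> sph_C2_holder \<gamma> (g p) \<and> axially_symmetric e (g p) \<and>
    (\<forall>\<omega>. norm \<omega> = 1 \<longrightarrow> \<bar>g p \<omega>\<bar> \<le> C * \<bar>p - p0\<bar> \<and> norm (sph_grad (g p) \<omega>) \<le> C * \<bar>p - p0\<bar> \<and>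
      (\<forall>\<xi>. norm (sph_hess (g p) \<omega> \<xi>) \<le> C * \<bar>p - p0\<bar> * norm \<xi>))"
      using ev
    proof eventually_elim
      case (elim q)
      then have q: "q \<in> I" "q - p0 \<noteq> 0" "sph_C2_holder_norm \<gamma> (r q) < 1" by auto
      define s where "s = 1 / (q - p0)"
      define d where "d \<omega> = s * g q \<omega> + (- s) * g p0 \<omega>" for \<omega>
      have Hd: "sph_C2_holder \<gamma> d" unfolding d_def[abs_def] by (rule sph_C2_holder_lincomb[OF H(1)[OF q(1)] H(1)[OF I(1)]])
      have r_eq: "r q = (\<lambda>\<omega>. 1 * d \<omega> + (-1) * G \<omega>)"
        by (auto simp: r_def d_def s_def fun_eq_iff diff_divide_distrib)
      have Hr: "sph_C2_holder \<gamma> (r q)" unfolding r_eq by (rule sph_C2_holder_lincomb[OF Hd G])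
      have sq: "inverse s = q - p0" "s \<noteq> 0" using q(2) by (auto simp: s_def)
      note key = norm_le_of_diff_quotient[OF q(2), where c = "C - 1", folded s_def, unfolded diff_add_cancel]
      have Gb: "\<bar>G \<omega>\<bar> \<le> C - 1" "norm (sph_grad G \<omega>) \<le> C - 1" "norm (sph_hess G \<omega> \<xi>) \<le> (C - 1) * norm \<xi>" if w: "norm \<omega> = 1" for \<omega> \<xi>
      proof -
        have le: "sph_C2_holder_norm \<gamma> G \<le> C - 1" by (simp add: C_def)
        show "\<bar>G \<omega>\<bar> \<le> C - 1" "norm (sph_grad G \<omega>) \<le> C - 1" using sph_C2_holder_norm_bounds[OF G w] le by (blast intro: order.trans)+
        show "norm (sph_hess G \<omega> \<xi>) \<le> (C - 1) * norm \<xi>"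
          using sph_C2_holder_norm_bounds(3)[OF G w, of \<xi>] mult_right_mono[OF le, of "norm \<xi>"] by simp
      qed
      have rb: "\<bar>r q \<omega>\<bar> \<le> 1" "norm (sph_grad (r q) \<omega>) \<le> 1" "norm (sph_hess (r q) \<omega> \<xi>) \<le> 1 * norm \<xi>" if w: "norm \<omega> = 1" for \<omega> \<xi>
      proof -
        have le: "sph_C2_holder_norm \<gamma> (r q) \<le> 1" using q(3) by simp
        show "\<bar>r q \<omega>\<bar> \<le> 1" "norm (sph_grad (r q) \<omega>) \<le> 1" using sph_C2_holder_norm_bounds[OF Hr w] le by (blast intro: order.trans)+
        show "norm (sph_hess (r q) \<omega> \<xi>) \<le> 1 * norm \<xi>"
          using sph_C2_holder_norm_bounds(3)[OF Hr w, of \<xi>] mult_right_mono[OF le, of "norm \<xi>"] by simp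
      qed
      note Hq = sph_C2_holderD[OF H(1)[OF q(1)]] and H0 = sph_C2_holderD[OF H(1)[OF I(1)]]
      have "\<bar>g q \<omega>\<bar> \<le> C * \<bar>q - p0\<bar> \<and> norm (sph_grad (g q) \<omega>) \<le> C * \<bar>q - p0\<bar> \<and>
        (\<forall>\<xi>. norm (sph_hess (g q) \<omega> \<xi>) \<le> C * \<bar>q - p0\<bar> * norm \<xi>)" if w: "norm \<omega> = 1" for \<omega>
      proof (intro conjI allI)
        have "r q \<omega> = s * g q \<omega> - G \<omega>" unfolding r_eq d_def using g0[OF w] by simp
        then show "\<bar>g q \<omega>\<bar> \<le> C * \<bar>q - p0\<bar>"
          using key[where x = "g q \<omega>" and y = "G \<omega>" and B = 1] rb(1)[OF w] Gb(1)[OF w] by simp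
        have "sph_grad (r q) \<omega> = s *\<^sub>R sph_grad (g q) \<omega> - sph_grad G \<omega>"
          unfolding r_eq sph_C2_lincomb(2)[OF sph_C2_holderD[OF Hd] sph_C2_holderD[OF G] w]
          unfolding d_def[abs_def] sph_C2_lincomb(2)[OF Hq H0 w] using sph_C2_vanishing(1)[OF g0 w] by simp
        then show "norm (sph_grad (g q) \<omega>) \<le> C * \<bar>q - p0\<bar>"
          using key[where x = "sph_grad (g q) \<omega>" and y = "sph_grad G \<omega>" and B = 1] rb(2)[OF w] Gb(2)[OF w] by simp
        fix \<xi>
        have "sph_hess (r q) \<omega> \<xi> = s *\<^sub>R sph_hess (g q) \<omega> \<xi> - sph_hess G \<omega> \<xi>"
          unfolding r_eq sph_C2_lincomb(3)[OF sph_C2_holderD[OF Hd] sph_C2_holderD[OF G] w]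
          unfolding d_def[abs_def] sph_C2_lincomb(3)[OF Hq H0 w] using sph_C2_vanishing(2)[OF g0 w] by simp
        then show "norm (sph_hess (g q) \<omega> \<xi>) \<le> C * \<bar>q - p0\<bar> * norm \<xi>"
          using key[where x = "sph_hess (g q) \<omega> \<xi>" and y = "sph_hess G \<omega> \<xi>" and B = "norm \<xi>"] rb(3)[OF w, of \<xi>] Gb(3)[OF w, of \<xi>] by simp
      qed
      then show ?case using q(1) H[OF q(1)] by blast
    qed
  qed
qed

text \<open>Dominated convergence with both the weight and the integrand varying: for positive
  exponents the weight is at most 1 on the unit ball, so the constant C dominates.\<close>

lemma sph_int_tendsto:
  fixes h :: "real \<Rightarrow> 'a::euclidean_space \<Rightarrow> real"
  assumes a: "(a \<longlongrightarrow> b) (at_right p0)" "b > 0"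
    and h: "\<And>\<omega>. norm \<omega> = 1 \<Longrightarrow> ((\<lambda>p. h p \<omega>) \<longlongrightarrow> l \<omega>) (at_right p0)"
    and ev: "\<forall>\<^sub>F p in at_right p0. sph_continuous (h p) \<and> (\<forall>\<omega>. norm \<omega> = 1 \<longrightarrow> \<bar>h p \<omega>\<bar> \<le> C)"
    and l: "sph_continuous l"
  shows "((\<lambda>p. sph_int (a p) (h p)) \<longlongrightarrow> sph_int b l) (at_right p0)"
  unfolding tendsto_at_iff_sequentially comp_def
proof (intro allI impI)
  fix X :: "nat \<Rightarrow> real"
  assume X: "\<forall>i. X i \<in> {p0<..} - {p0}" "X \<longlonglongrightarrow> p0"
  then have fX: "filterlim X (at_right p0) sequentially"
    by (auto simp: filterlim_at intro!: always_eventually)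
  have "\<forall>\<^sub>F p in at_right p0. a p > 0" using order_tendstoD(1)[OF a] .
  with ev have "\<forall>\<^sub>F p in at_right p0. (sph_continuous (h p) \<and> (\<forall>\<omega>. norm \<omega> = 1 \<longrightarrow> \<bar>h p \<omega>\<bar> \<le> C)) \<and> a p > 0"
    by eventually_elim simp
  then have "\<forall>\<^sub>F n in sequentially. (sph_continuous (h (X n)) \<and> (\<forall>\<omega>. norm \<omega> = 1 \<longrightarrow> \<bar>h (X n) \<omega>\<bar> \<le> C)) \<and> a (X n) > 0"
    using fX unfolding filterlim_iff by blast
  then obtain k where k: "\<And>n. n \<ge> k \<Longrightarrow> sph_continuous (h (X n))" "\<And>n \<omega>. n \<ge> k \<Longrightarrow> norm \<omega> = 1 \<Longrightarrow> \<bar>h (X n) \<omega>\<bar> \<le> C"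
    "\<And>n. n \<ge> k \<Longrightarrow> a (X n) > 0"
    unfolding eventually_sequentially by blast
  have aX: "(\<lambda>n. a (X n)) \<longlonglongrightarrow> b" using a(1) fX by (rule filterlim_compose)
  obtain \<omega>0 :: 'a where "\<omega>0 \<in> Basis" using nonempty_Basis by blast
  then have C: "C \<ge> 0" using k(2)[of k \<omega>0] by simp
  \<comment> \<open>The bounds hold only from some index on, so the sequence is shifted by
    k.\<close>
  have "(\<lambda>n. sph_int (a (X (n + k))) (h (X (n + k)))) \<longlonglongrightarrow> sph_int b l"
    unfolding sph_int_def set_lebesgue_integral_def
  proof (rule integral_dominated_convergence[where w = "\<lambda>x. C * indicator (ball 0 1) x"])
    show "integrable lborel (\<lambda>x::'a. C * indicator (ball 0 1) x :: real)"
      by (intro integrable_mult_right) (simp add: integrable_indicator_iff emeasure_bounded_finite[unfolded infinity_ennreal_def])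
    show "(\<lambda>x. indicator (ball 0 1) x *\<^sub>R (norm x powr b * l (sgn x))) \<in> borel_measurable lborel"
      using borel_measurable_sph_continuous[OF l, of b] by (intro borel_measurable_scaleR borel_measurable_indicator) auto
    show "(\<lambda>x. indicator (ball 0 1) x *\<^sub>R (norm x powr a (X (n + k)) * h (X (n + k)) (sgn x))) \<in> borel_measurable lborel" for n
      using borel_measurable_sph_continuous[OF k(1)[of "n + k"], of "a (X (n + k))"]
      by (intro borel_measurable_scaleR borel_measurable_indicator) auto
    have "(\<lambda>n. indicator (ball 0 1) x *\<^sub>R (norm x powr a (X (n + k)) * h (X (n + k)) (sgn x)))
      \<longlonglongrightarrow> indicator (ball 0 1) x *\<^sub>R (norm x powr b * l (sgn x))" for x
    proof (cases "x = 0")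
      case True
      then show ?thesis by simp
    next
      case False
      have "(\<lambda>n. h (X n) (sgn x)) \<longlonglongrightarrow> l (sgn x)"
        by (rule filterlim_compose[OF h fX]) (use False in \<open>simp add: norm_sgn\<close>)
      then have "(\<lambda>n. indicator (ball 0 1) x *\<^sub>R (norm x powr a (X n) * h (X n) (sgn x)))
        \<longlonglongrightarrow> indicator (ball 0 1) x *\<^sub>R (norm x powr b * l (sgn x))"
        using False by (intro tendsto_intros aX) auto
      then show ?thesis by (rule LIMSEQ_ignore_initial_segment)
    qed
    then show "AE x in lborel. (\<lambda>n. indicator (ball 0 1) x *\<^sub>R (norm x powr a (X (n + k)) * h (X (n + k)) (sgn x)))
      \<longlonglongrightarrow> indicator (ball 0 1) x *\<^sub>R (norm x powr b * l (sgn x))" by simp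
    have "norm (indicator (ball 0 1) x *\<^sub>R (norm x powr a (X (n + k)) * h (X (n + k)) (sgn x))) \<le> C * indicator (ball 0 1) x" for n and x :: 'a
    proof (cases "x = 0 \<or> norm x \<ge> 1")
      case True
      then show ?thesis using k(3)[of "n + k"] C by auto
    next
      case False
      have "norm x powr a (X (n + k)) \<le> 1" using powr_mono2[of "a (X (n + k))" "norm x" 1] k(3)[of "n + k"] False by simp
      moreover have "\<bar>h (X (n + k)) (sgn x)\<bar> \<le> C" using k(2)[of "n + k" "sgn x"] False by (simp add: norm_sgn)
      ultimately have "norm x powr a (X (n + k)) * \<bar>h (X (n + k)) (sgn x)\<bar> \<le> 1 * C" by (intro mult_mono) auto
      then show ?thesis using False by (simp add: abs_mult)
    qed
    then show "AE x in lborel. norm (indicator (ball 0 1) x *\<^sub>R (norm x powr a (X (n + k)) * h (X (n + k)) (sgn x))) \<le> C * indicator (ball 0 1) x" for n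
      by simp
  qed
  then show "(\<lambda>n. sph_int (a (X n)) (h (X n))) \<longlonglongrightarrow> sph_int b l" by (rule LIMSEQ_offset)
qed

text \<open>With t = q ln \<bar>x\<bar>, both bounds are the inequality 1 + t \<le> exp t, taken at
  t and at - t.\<close>

lemma powr_quotient_bounds:
  fixes x q :: real
  assumes "q > 0" "x \<noteq> 0"
  shows "ln \<bar>x\<bar> \<le> (\<bar>x\<bar> powr q - 1) / q" "(\<bar>x\<bar> powr q - 1) / q \<le> ln \<bar>x\<bar> * \<bar>x\<bar> powr q"
proof -
  define t where "t = q * ln \<bar>x\<bar>"
  have e: "\<bar>x\<bar> powr q = exp t" using assms(2) by (simp add: powr_def t_def)
  have "t \<le> exp t - 1" using exp_ge_add_one_self[of t] by linarith
  then show "ln \<bar>x\<bar> \<le> (\<bar>x\<bar> powr q - 1) / q" unfolding e using assms(1) by (simp add: t_def pos_le_divide_eq mult.commute)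
  have "1 - t \<le> exp (- t)" using exp_ge_add_one_self[of "- t"] by simp
  then have "(1 - t) * exp t \<le> exp (- t) * exp t" by (intro mult_right_mono) auto
  then have "exp t - 1 \<le> t * exp t" by (simp add: exp_minus algebra_simps)
  then show "(\<bar>x\<bar> powr q - 1) / q \<le> ln \<bar>x\<bar> * \<bar>x\<bar> powr q"
    unfolding e using assms(1) by (simp add: t_def pos_divide_le_eq mult_ac)
qed

text \<open>The bound does not depend on q and tends to 0 with x. It controls the quotient at the
  zeros of v2, where the logarithm is infinite.\<close>

lemma powr_quotient_small:
  fixes x q :: real
  assumes q: "q > 0" and x: "\<bar>x\<bar> \<le> 1"
  shows "\<bar>(\<bar>x\<bar> powr q - 1) / q * x\<bar> \<le> 2 * sqrt \<bar>x\<bar>"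
proof (cases "x = 0")
  case False
  have "ln \<bar>x\<bar> \<le> 0" using x False by simp
  then have "ln \<bar>x\<bar> * \<bar>x\<bar> powr q \<le> 0" by (simp add: mult_nonpos_nonneg)
  then have "\<bar>(\<bar>x\<bar> powr q - 1) / q\<bar> \<le> \<bar>ln \<bar>x\<bar>\<bar>" using powr_quotient_bounds[OF q False] by linarith
  then have "\<bar>(\<bar>x\<bar> powr q - 1) / q\<bar> * \<bar>x\<bar> \<le> \<bar>ln \<bar>x\<bar>\<bar> * \<bar>x\<bar>" by (rule mult_right_mono) simp
  also have "\<dots> = \<bar>x * ln \<bar>x\<bar>\<bar>" by (simp add: abs_mult mult.commute)
  also have "\<dots> \<le> 2 * sqrt \<bar>x\<bar>" by (rule abs_mult_ln_le[OF x])
  finally show ?thesis by (simp only: abs_mult)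
qed simp

text \<open>A bound uniform in q, which serves as the dominating constant when p tends to 2.\<close>

lemma powr_quotient_bounded:
  fixes x q M :: real
  assumes q: "0 < q" "q \<le> 1" and x: "\<bar>x\<bar> \<le> M" and M: "M \<ge> 1"
  shows "\<bar>(\<bar>x\<bar> powr q - 1) / q * x\<bar> \<le> M ^ 3 + 2"
proof (cases "\<bar>x\<bar> \<le> 1")
  case True
  have "sqrt \<bar>x\<bar> \<le> 1" using True by simp
  moreover have "0 \<le> M ^ 3" using M by simp
  ultimately show ?thesis using powr_quotient_small[OF q(1) True] by linarith
next
  case False
  then have x0: "x \<noteq> 0" by auto
  have "ln \<bar>x\<bar> \<ge> 0" using False by simp
  then have 1: "0 \<le> (\<bar>x\<bar> powr q - 1) / q" using powr_quotient_bounds(1)[OF q(1) x0] by linarith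
  have "ln \<bar>x\<bar> \<le> M" using ln_le_minus_one[of "\<bar>x\<bar>"] x0 x by simp
  moreover have "\<bar>x\<bar> powr q \<le> M"
    using powr_mono[of q 1 "\<bar>x\<bar>"] q x False by simp
  ultimately have "ln \<bar>x\<bar> * \<bar>x\<bar> powr q \<le> M * M" using M by (intro mult_mono) auto
  then have "(\<bar>x\<bar> powr q - 1) / q \<le> M * M" using powr_quotient_bounds(2)[OF q(1) x0] by linarith
  then have "\<bar>(\<bar>x\<bar> powr q - 1) / q\<bar> * \<bar>x\<bar> \<le> (M * M) * M" using 1 x M by (intro mult_mono) auto
  then show ?thesis by (simp add: abs_mult power3_eq_cube)
qed

text \<open>The derivative of an exponential in its exponent, with the base moving at the same time.
  Away from y = 0 the quotient is squeezed between two logarithmic expressions; at y = 0 the square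
  root bound takes over.\<close>

lemma powr_quotient_tendsto:
  fixes f :: "real \<Rightarrow> real"
  assumes f: "(f \<longlongrightarrow> y) (at_right p0)"
  shows "((\<lambda>p. (\<bar>f p\<bar> powr (p - p0) - 1) / (p - p0) * f p) \<longlongrightarrow> y * ln \<bar>y\<bar>) (at_right p0)"
proof (cases "y = 0")
  case False
  have q: "((\<lambda>p. p - p0) \<longlongrightarrow> 0) (at_right p0)"
  proof -
    have "((\<lambda>p. p - p0) \<longlongrightarrow> p0 - p0) (at_right p0)" by (intro tendsto_intros)
    then show ?thesis by simp
  qed
  have ev: "\<forall>\<^sub>F p in at_right p0. p > p0 \<and> f p \<noteq> 0"
    using tendsto_imp_eventually_ne[OF f False] eventually_at_right_less[of p0] by eventually_elim simp
  have lnl: "((\<lambda>p. ln \<bar>f p\<bar>) \<longlongrightarrow> ln \<bar>y\<bar>) (at_right p0)"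
    using False by (intro tendsto_intros f) auto
  have "((\<lambda>p. ln \<bar>f p\<bar> * \<bar>f p\<bar> powr (p - p0)) \<longlongrightarrow> ln \<bar>y\<bar> * \<bar>y\<bar> powr 0) (at_right p0)"
    using False by (intro tendsto_intros lnl f q) auto
  then have up: "((\<lambda>p. ln \<bar>f p\<bar> * \<bar>f p\<bar> powr (p - p0)) \<longlongrightarrow> ln \<bar>y\<bar>) (at_right p0)" using False by simp
  have "((\<lambda>p. (\<bar>f p\<bar> powr (p - p0) - 1) / (p - p0)) \<longlongrightarrow> ln \<bar>y\<bar>) (at_right p0)"
    by (rule tendsto_sandwich[OF _ _ lnl up]; use ev in eventually_elim; use powr_quotient_bounds in simp)
  from tendsto_mult[OF this f] show ?thesis by (simp add: mult.commute)
next
  case True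
  have "((\<lambda>p. 2 * sqrt \<bar>f p\<bar>) \<longlongrightarrow> 2 * sqrt \<bar>0\<bar>) (at_right p0)"
    using f True by (intro tendsto_intros) auto
  then have l: "((\<lambda>p. 2 * sqrt \<bar>f p\<bar>) \<longlongrightarrow> 0) (at_right p0)" by simp
  have "\<forall>\<^sub>F p in at_right p0. \<bar>f p\<bar> < 1"
    using tendsto_rabs[OF f] True by (intro order_tendstoD(2)[of _ "\<bar>y\<bar>"]) auto
  then have "\<forall>\<^sub>F p in at_right p0. norm ((\<bar>f p\<bar> powr (p - p0) - 1) / (p - p0) * f p) \<le> 2 * sqrt \<bar>f p\<bar>"
    using eventually_at_right_less[of p0]
  proof eventually_elim
    case (elim p)
    then show ?case using powr_quotient_small[of "p - p0" "f p"] by simp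
  qed
  from Lim_null_comparison[OF this l] show ?thesis using True by simp
qed

section \<open>First-order consequences of the tested equation\<close>

lemma sph_int_identities:
  fixes e :: "'a::euclidean_space" and v :: "'a \<Rightarrow> real"
  assumes e: "norm e = 1" and dim: "DIM('a) \<ge> 3" and v: "sph_C2 v" and a: "a > 0"
    and A: "sph_continuous (sph_A lam v)" and L: "\<And>\<omega>. norm \<omega> = 1 \<Longrightarrow> sph_L p lam v \<omega> = 0"
  defines "c \<equiv> lam * ((p - 1) * lam + real DIM('a) - p)"
  shows "c * sph_int a v + (p - 2) * sph_int a (sph_A lam v) = 0"
    and "(c - 2 * real DIM('a)) * sph_int a (\<lambda>\<omega>. v \<omega> * v2 e \<omega>) + (p - 2) * sph_int a (\<lambda>\<omega>. sph_A lam v \<omega> * v2 e \<omega>) = 0"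
proof -
  have lap: "sph_laplacian v \<omega> = - c * v \<omega> - (p - 2) * sph_A lam v \<omega>" if "norm \<omega> = 1" for \<omega>
    using L[OF that] by (simp add: sph_L_def c_def)
  note one = zonal[of "\<lambda>_. 1" "\<lambda>_. 0" "\<lambda>_. 0", OF _ _ _ e, simplified]
  note v2 = zonal_v2[OF e dim]
  note sv = sph_C2.sph_continuous_v[OF v] and sv2 = sph_continuous_v2[OF e dim]
  have "0 = sph_int a (\<lambda>\<omega>. v \<omega> * sph_laplacian (\<lambda>_. 1) \<omega> - 1 * sph_laplacian v \<omega>)"
    by (rule sph_int_green[OF v one(1) a, symmetric])
  also have "\<dots> = sph_int a (\<lambda>\<omega>. c * v \<omega> + (p - 2) * sph_A lam v \<omega>)"
    by (rule sph_int_cong[OF a]) (simp add: lap one(3))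
  also have "\<dots> = c * sph_int a v + (p - 2) * sph_int a (sph_A lam v)"
    by (rule sph_int_linear[OF sv A a])
  finally show "c * sph_int a v + (p - 2) * sph_int a (sph_A lam v) = 0" by simp
  have "0 = sph_int a (\<lambda>\<omega>. v \<omega> * sph_laplacian (v2 e) \<omega> - v2 e \<omega> * sph_laplacian v \<omega>)"
    by (rule sph_int_green[OF v v2(1) a, symmetric])
  also have "\<dots> = sph_int a (\<lambda>\<omega>. (c - 2 * real DIM('a)) * (v \<omega> * v2 e \<omega>) + (p - 2) * (sph_A lam v \<omega> * v2 e \<omega>))"
    by (rule sph_int_cong[OF a]) (simp add: lap v2(2) algebra_simps)
  also have "\<dots> = (c - 2 * real DIM('a)) * sph_int a (\<lambda>\<omega>. v \<omega> * v2 e \<omega>) + (p - 2) * sph_int a (\<lambda>\<omega>. sph_A lam v \<omega> * v2 e \<omega>)"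
    by (intro sph_int_linear sph_continuous_intros sv sv2 A a)
  finally show "(c - 2 * real DIM('a)) * sph_int a (\<lambda>\<omega>. v \<omega> * v2 e \<omega>) + (p - 2) * sph_int a (\<lambda>\<omega>. sph_A lam v \<omega> * v2 e \<omega>) = 0" by simp
qed

lemma branch_asymptotics:
  fixes e :: "'a::euclidean_space" and g :: "real \<Rightarrow> 'a \<Rightarrow> real"
  assumes e: "norm e = 1" and dim: "DIM('a) \<ge> 3" and \<delta>: "\<delta>\<^sub>0 > 0" and branch: "smooth_branch e \<gamma> \<delta>\<^sub>0 lam g"
  defines "v \<equiv> \<lambda>p \<omega>. v2 e \<omega> + g p \<omega>"
  shows "(lam \<longlongrightarrow> 2) (at_right 2)"
    and "\<forall>\<^sub>F p in at_right 2. lam p < 2 \<and>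
      sph_int (lam p * (p - 1)) (\<lambda>\<omega>. \<bar>v p \<omega>\<bar> powr (p - 2) * v p \<omega>) < 0"
proof -
  define I where "I = {2 - \<delta>\<^sub>0<..<2 + \<delta>\<^sub>0}"
  define d where "d = real DIM('a)"
  have d: "d \<ge> 3" using dim by (simp add: d_def)
  have I: "2 \<in> I" "open I" using \<delta> by (auto simp: I_def)
  from branch have B: "Cinf_on I lam" "smooth_curve_V2 e \<gamma> I g" "lam 2 = 2" "\<And>\<omega>. norm \<omega> = 1 \<Longrightarrow> g 2 \<omega> = 0"
    "\<And>p. p \<in> I \<Longrightarrow> lam p > 0" "\<And>p. p \<in> I \<Longrightarrow> nondegenerate (lam p) (v p)"
    "\<And>p \<omega>. p \<in> I \<Longrightarrow> norm \<omega> = 1 \<Longrightarrow> sph_L p (lam p) (v p) \<omega> = 0"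
    by (auto simp: smooth_branch_def I_def v_def Phi_def)
  have "Ck_on 0 I lam" using B(1) unfolding Cinf_on_def by blast
  then have "isCont lam 2" using I by (simp add: continuous_on_eq_continuous_at)
  then have "(lam \<longlongrightarrow> 2) (at 2)" using B(3) by (simp add: isCont_def)
  then show laml: "(lam \<longlongrightarrow> 2) (at_right 2)" by (rule tendsto_within_subset) simp
  obtain C where C: "C > 0" "\<forall>\<^sub>F p in at 2. p \<in> I \<and> sph_C2_holder \<gamma> (g p) \<and> axially_symmetric e (g p) \<and>
    (\<forall>\<omega>. norm \<omega> = 1 \<longrightarrow> \<bar>g p \<omega>\<bar> \<le> C * \<bar>p - 2\<bar> \<and> norm (sph_grad (g p) \<omega>) \<le> C * \<bar>p - 2\<bar> \<and>
      (\<forall>\<xi>. norm (sph_hess (g p) \<omega> \<xi>) \<le> C * \<bar>p - 2\<bar> * norm \<xi>))"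
    using smooth_curve_V2_linear_bound[OF B(2) I B(4)] by blast
  note zv2 = zonal_v2[OF e dim]
  interpret z: sph_C2 "v2 e" by (rule zv2(1))
  have v_eq: "v p = (\<lambda>\<omega>. 1 * v2 e \<omega> + 1 * g p \<omega>)" for p by (simp add: v_def)
  \<comment> \<open>The bounds p < 3 and lam p < 3 make all estimates below uniform in p: p - 2
    \<le> 1 and (lam p)^2 \<le> 9.\<close>
  define good where "good p \<longleftrightarrow> p \<in> I \<and> 2 < p \<and> p < 3 \<and> lam p < 3 \<and> sph_C2 (g p) \<and>
    (\<forall>\<omega>. norm \<omega> = 1 \<longrightarrow> \<bar>g p \<omega>\<bar> \<le> C * (p - 2) \<and> norm (sph_grad (g p) \<omega>) \<le> C * (p - 2) \<and>
      (\<forall>\<xi>. norm (sph_hess (g p) \<omega> \<xi>) \<le> C * (p - 2) * norm \<xi>))" for p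
  have "\<forall>\<^sub>F p in at_right 2. lam p < 3" by (rule order_tendstoD(2)[OF laml]) simp
  moreover have "\<forall>\<^sub>F p in at_right 2. p < (3::real)" by (auto simp: eventually_at_right_field intro!: exI[of _ 3])
  moreover have "\<forall>\<^sub>F p in at_right 2. p \<in> I \<and> sph_C2_holder \<gamma> (g p) \<and> axially_symmetric e (g p) \<and>
    (\<forall>\<omega>. norm \<omega> = 1 \<longrightarrow> \<bar>g p \<omega>\<bar> \<le> C * \<bar>p - 2\<bar> \<and> norm (sph_grad (g p) \<omega>) \<le> C * \<bar>p - 2\<bar> \<and>
      (\<forall>\<xi>. norm (sph_hess (g p) \<omega> \<xi>) \<le> C * \<bar>p - 2\<bar> * norm \<xi>))"
    using C(2) by (simp add: eventually_at_split)
  ultimately have ev: "eventually good (at_right 2)"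
    using eventually_at_right_less[of 2]
    by eventually_elim (auto simp: good_def intro: sph_C2_holderD)
  have gp: "sph_C2 (v p)" "\<And>\<omega>. norm \<omega> = 1 \<Longrightarrow> sph_grad (v p) \<omega> = sph_grad (v2 e) \<omega> + sph_grad (g p) \<omega>"
    "\<And>\<omega> \<xi>. norm \<omega> = 1 \<Longrightarrow> sph_hess (v p) \<omega> \<xi> = sph_hess (v2 e) \<omega> \<xi> + sph_hess (g p) \<omega> \<xi>" if "good p" for p
  proof -
    have gC: "sph_C2 (g p)" using that by (simp add: good_def)
    show "sph_C2 (v p)" unfolding v_eq by (rule sph_C2_lincomb(1)[OF zv2(1) gC])
    show "\<And>\<omega>. norm \<omega> = 1 \<Longrightarrow> sph_grad (v p) \<omega> = sph_grad (v2 e) \<omega> + sph_grad (g p) \<omega>"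
      unfolding v_eq using sph_C2_lincomb(2)[OF zv2(1) gC, of _ 1 1] by simp
    show "\<And>\<omega> \<xi>. norm \<omega> = 1 \<Longrightarrow> sph_hess (v p) \<omega> \<xi> = sph_hess (v2 e) \<omega> \<xi> + sph_hess (g p) \<omega> \<xi>"
      unfolding v_eq using sph_C2_lincomb(3)[OF zv2(1) gC, of _ 1 1] by simp
  qed
  have den: "(norm (sph_grad (v p) \<omega>))\<^sup>2 + (lam p)\<^sup>2 * (v p \<omega>)\<^sup>2 > 0" if "p \<in> I" "norm \<omega> = 1" for p \<omega>
    using B(6)[OF that(1)] that(2) by (simp add: nondegenerate_def)
  \<comment> \<open>Nondegeneracy of v2 need not be computed: it is the condition on the branch at p
    = 2, where \<open>g 2\<close> vanishes on the sphere.\<close>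
  have den2: "(norm (sph_grad (v2 e) \<omega>))\<^sup>2 + 2\<^sup>2 * (v2 e \<omega>)\<^sup>2 > 0" if w: "norm \<omega> = 1" for \<omega>
  proof -
    have g2: "sph_C2 (g 2)"
      using B(2) I(1) unfolding smooth_curve_V2_def V2_def by (metis (no_types, lifting) mem_Collect_eq sph_C2_holderD)
    have "sph_grad (v 2) \<omega> = sph_grad (v2 e) \<omega>"
      unfolding v_eq using sph_C2_lincomb(2)[OF zv2(1) g2 w, of 1 1] sph_C2_vanishing(1)[OF B(4) w] by simp
    then show ?thesis using den[OF I(1) w] B(3) B(4)[OF w] by (simp add: v_def)
  qed
  obtain M where M: "M > 0" "\<And>\<omega>. norm \<omega> = 1 \<Longrightarrow> \<bar>v2 e \<omega>\<bar> \<le> M" using sph_continuous_bounded[OF z.sph_continuous_v] by blast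
  obtain H where H: "H > 0" "\<And>\<omega> h. norm \<omega> = 1 \<Longrightarrow> norm (sph_hess (v2 e) \<omega> h) \<le> H * norm h" by (rule z.hess_bounded) blast
  have vb: "\<bar>v p \<omega>\<bar> \<le> M + C" if "good p" "norm \<omega> = 1" for p \<omega>
  proof -
    have "C * (p - 2) \<le> C * 1" using C(1) that(1) by (intro mult_left_mono) (auto simp: good_def)
    then show ?thesis using M(2)[OF that(2)] that abs_triangle_ineq[of "v2 e \<omega>" "g p \<omega>"] unfolding good_def v_def by fastforce
  qed
  have Ab: "\<bar>sph_A (lam p) (v p) \<omega>\<bar> \<le> (H + C) + 9 * (M + C)" if "good p" "norm \<omega> = 1" for p \<omega>
  proof -
    have pI: "p \<in> I" using that by (simp add: good_def)
    have "norm (sph_hess (v p) \<omega> \<xi>) \<le> (H + C) * norm \<xi>" for \<xi>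
    proof -
      have "C * (p - 2) * norm \<xi> \<le> C * 1 * norm \<xi>" using C(1) that(1) by (intro mult_right_mono mult_left_mono) (auto simp: good_def)
      moreover have "norm (sph_hess (g p) \<omega> \<xi>) \<le> C * (p - 2) * norm \<xi>" using that by (simp add: good_def)
      ultimately show ?thesis
        unfolding gp(3)[OF that] using H(2)[OF that(2), of \<xi>] norm_triangle_ineq[of "sph_hess (v2 e) \<omega> \<xi>" "sph_hess (g p) \<omega> \<xi>"]
        by (simp add: algebra_simps)
    qed
    then have "\<bar>sph_A (lam p) (v p) \<omega>\<bar> \<le> (H + C) + (lam p)\<^sup>2 * \<bar>v p \<omega>\<bar>"
      using H(1) C(1) by (intro abs_sph_A_le den pI that) auto
    also have "(lam p)\<^sup>2 * \<bar>v p \<omega>\<bar> \<le> 9 * (M + C)"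
    proof (rule mult_mono[OF _ vb[OF that]])
      have "(lam p)\<^sup>2 \<le> 3\<^sup>2" using that(1) B(5)[OF pI] by (intro power_mono) (auto simp: good_def)
      then show "(lam p)\<^sup>2 \<le> 9" by simp
    qed auto
    finally show ?thesis by simp
  qed
  have small: "((\<lambda>p. C * (p - 2) * r) \<longlongrightarrow> 0) (at_right 2)" for r
  proof -
    have "((\<lambda>p. C * (p - 2) * r) \<longlongrightarrow> C * (2 - 2) * r) (at_right 2)" by (intro tendsto_intros)
    then show ?thesis by simp
  qed
  have vl: "((\<lambda>p. v p \<omega>) \<longlongrightarrow> v2 e \<omega>) (at_right 2)" if w: "norm \<omega> = 1" for \<omega>
  proof -
    have "((\<lambda>p. g p \<omega>) \<longlongrightarrow> 0) (at_right 2)"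
    proof (rule Lim_null_comparison[OF _ small[of 1]])
      show "\<forall>\<^sub>F p in at_right 2. norm (g p \<omega>) \<le> C * (p - 2) * 1" using ev by eventually_elim (use w in \<open>simp add: good_def\<close>)
    qed
    from tendsto_add[OF tendsto_const this] show ?thesis by (simp add: v_def)
  qed
  have Gl: "((\<lambda>p. sph_grad (v p) \<omega>) \<longlongrightarrow> sph_grad (v2 e) \<omega>) (at_right 2)" if w: "norm \<omega> = 1" for \<omega>
  proof -
    have "((\<lambda>p. sph_grad (g p) \<omega>) \<longlongrightarrow> 0) (at_right 2)"
    proof (rule Lim_null_comparison[OF _ small[of 1]])
      show "\<forall>\<^sub>F p in at_right 2. norm (sph_grad (g p) \<omega>) \<le> C * (p - 2) * 1" using ev by eventually_elim (use w in \<open>simp add: good_def\<close>)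
    qed
    from tendsto_add[OF tendsto_const[of "sph_grad (v2 e) \<omega>"] this]
    have "((\<lambda>p. sph_grad (v2 e) \<omega> + sph_grad (g p) \<omega>) \<longlongrightarrow> sph_grad (v2 e) \<omega>) (at_right 2)" by simp
    moreover have "\<forall>\<^sub>F p in at_right 2. sph_grad (v2 e) \<omega> + sph_grad (g p) \<omega> = sph_grad (v p) \<omega>"
      using ev by eventually_elim (simp add: gp(2)[OF _ w])
    ultimately show ?thesis by (rule tendsto_cong[THEN iffD1, rotated])
  qed
  have Hl: "((\<lambda>p. sph_hess (v p) \<omega> (sph_grad (v p) \<omega>)) \<longlongrightarrow> sph_hess (v2 e) \<omega> (sph_grad (v2 e) \<omega>)) (at_right 2)" if w: "norm \<omega> = 1" for \<omega>
  proof -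
    have 1: "((\<lambda>p. sph_hess (v2 e) \<omega> (sph_grad (v p) \<omega>)) \<longlongrightarrow> sph_hess (v2 e) \<omega> (sph_grad (v2 e) \<omega>)) (at_right 2)"
      by (rule bounded_linear.tendsto[OF z.bounded_linear_hess[OF w] Gl[OF w]])
    have 2: "((\<lambda>p. sph_hess (g p) \<omega> (sph_grad (v p) \<omega>)) \<longlongrightarrow> 0) (at_right 2)"
    proof (rule Lim_null_comparison)
      show "\<forall>\<^sub>F p in at_right 2. norm (sph_hess (g p) \<omega> (sph_grad (v p) \<omega>)) \<le> C * (p - 2) * 1 * norm (sph_grad (v p) \<omega>)"
        using ev by eventually_elim (use w in \<open>simp add: good_def\<close>)
      show "((\<lambda>p. C * (p - 2) * 1 * norm (sph_grad (v p) \<omega>)) \<longlongrightarrow> 0) (at_right 2)"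
        using tendsto_mult[OF small[of 1] tendsto_norm[OF Gl[OF w]]] by simp
    qed
    from tendsto_add[OF 1 2]
    have "((\<lambda>p. sph_hess (v2 e) \<omega> (sph_grad (v p) \<omega>) + sph_hess (g p) \<omega> (sph_grad (v p) \<omega>)) \<longlongrightarrow> sph_hess (v2 e) \<omega> (sph_grad (v2 e) \<omega>)) (at_right 2)" by simp
    moreover have "\<forall>\<^sub>F p in at_right 2. sph_hess (v2 e) \<omega> (sph_grad (v p) \<omega>) + sph_hess (g p) \<omega> (sph_grad (v p) \<omega>) = sph_hess (v p) \<omega> (sph_grad (v p) \<omega>)"
      using ev by eventually_elim (simp add: gp(3)[OF _ w])
    ultimately show ?thesis by (rule tendsto_cong[THEN iffD1, rotated])
  qed
  have Al: "((\<lambda>p. sph_A (lam p) (v p) \<omega>) \<longlongrightarrow> sph_A 2 (v2 e) \<omega>) (at_right 2)" if w: "norm \<omega> = 1" for \<omega>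
    unfolding sph_A_def using den2[OF w]
    by (intro tendsto_intros Gl[OF w] Hl[OF w] vl[OF w] laml) auto
  have scA: "sph_continuous (sph_A (lam p) (v p))" if "good p" for p
    by (rule sph_C2.sph_continuous_sph_A[OF gp(1)[OF that]]) (use that den in \<open>simp add: good_def\<close>)
  have scA2: "sph_continuous (sph_A 2 (v2 e))"
    by (rule z.sph_continuous_sph_A) (use den2 in simp)
  have scv: "sph_continuous (v p)" if "good p" for p by (rule sph_C2.sph_continuous_v[OF gp(1)[OF that]])
  \<comment> \<open>The degree of |u|^(p-2) u for the function u of the branch. The choice only
    matters for the final integral; the identities hold for every positive weight exponent.\<close>
  define a where "a p = lam p * (p - 1)" for p
  have al: "(a \<longlongrightarrow> 2) (at_right 2)"
  proof -
    have "((\<lambda>p. lam p * (p - 1)) \<longlongrightarrow> 2 * (2 - 1)) (at_right 2)" by (intro tendsto_intros laml)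
    then show ?thesis by (simp add: a_def[abs_def])
  qed
  have ap: "a p > 0" if "good p" for p using that B(5)[of p] by (simp add: a_def good_def)
  let ?S = "sph_int 2 (\<lambda>\<omega>. v2 e \<omega> * v2 e \<omega>)" and ?K = "sph_int 2 (\<lambda>\<omega>. sph_A 2 (v2 e) \<omega> * v2 e \<omega>)"
  have T1: "((\<lambda>p. sph_int (a p) (sph_A (lam p) (v p))) \<longlongrightarrow> sph_int 2 (sph_A 2 (v2 e))) (at_right 2)"
  proof (rule sph_int_tendsto[OF al _ Al])
    show "\<forall>\<^sub>F p in at_right 2. sph_continuous (sph_A (lam p) (v p)) \<and> (\<forall>\<omega>. norm \<omega> = 1 \<longrightarrow> \<bar>sph_A (lam p) (v p) \<omega>\<bar> \<le> (H + C) + 9 * (M + C))"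
      using ev
    proof eventually_elim
      case (elim p)
      show ?case using scA[OF elim] Ab[OF elim] by blast
    qed
  qed (use scA2 in auto)
  have T2: "((\<lambda>p. sph_int (a p) (\<lambda>\<omega>. sph_A (lam p) (v p) \<omega> * v2 e \<omega>)) \<longlongrightarrow> ?K) (at_right 2)"
  proof (rule sph_int_tendsto[OF al _ tendsto_mult[OF Al tendsto_const]])
    show "\<forall>\<^sub>F p in at_right 2. sph_continuous (\<lambda>\<omega>. sph_A (lam p) (v p) \<omega> * v2 e \<omega>) \<and>
      (\<forall>\<omega>. norm \<omega> = 1 \<longrightarrow> \<bar>sph_A (lam p) (v p) \<omega> * v2 e \<omega>\<bar> \<le> ((H + C) + 9 * (M + C)) * M)"
      using ev
    proof eventually_elim
      case (elim p)
      have "\<bar>sph_A (lam p) (v p) \<omega> * v2 e \<omega>\<bar> \<le> ((H + C) + 9 * (M + C)) * M" if "norm \<omega> = 1" for \<omega>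
        unfolding abs_mult using H(1) C(1) M(1) by (intro mult_mono Ab[OF elim that] M(2)[OF that]) auto
      then show ?case using scA[OF elim] z.sph_continuous_v by (auto intro: sph_continuous_intros)
    qed
  qed (use scA2 z.sph_continuous_v in \<open>auto intro: sph_continuous_intros\<close>)
  have T3: "((\<lambda>p. sph_int (a p) (\<lambda>\<omega>. v p \<omega> * v2 e \<omega>)) \<longlongrightarrow> ?S) (at_right 2)"
  proof (rule sph_int_tendsto[OF al _ tendsto_mult[OF vl tendsto_const]])
    show "\<forall>\<^sub>F p in at_right 2. sph_continuous (\<lambda>\<omega>. v p \<omega> * v2 e \<omega>) \<and> (\<forall>\<omega>. norm \<omega> = 1 \<longrightarrow> \<bar>v p \<omega> * v2 e \<omega>\<bar> \<le> (M + C) * M)"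
      using ev
    proof eventually_elim
      case (elim p)
      have "\<bar>v p \<omega> * v2 e \<omega>\<bar> \<le> (M + C) * M" if "norm \<omega> = 1" for \<omega>
        unfolding abs_mult using C(1) M(1) by (intro mult_mono vb[OF elim that] M(2)[OF that]) auto
      then show ?case using scv[OF elim] z.sph_continuous_v by (auto intro: sph_continuous_intros)
    qed
  qed (use z.sph_continuous_v in \<open>auto intro: sph_continuous_intros\<close>)
  \<comment> \<open>The excess of |v|^(p-2) v over v, divided by p - 2; its limit is the entropy
    density v2 ln |v2|.\<close>
  define h where "h p \<omega> = (\<bar>v p \<omega>\<bar> powr (p - 2) - 1) / (p - 2) * v p \<omega>" for p \<omega>
  have sch: "sph_continuous (h p)" if "good p" for p
    unfolding h_def sph_continuous_def
    using that scv[OF that, unfolded sph_continuous_def]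
    by (intro continuous_intros continuous_on_powr') (auto simp: good_def)
  have T4: "((\<lambda>p. sph_int (a p) (h p)) \<longlongrightarrow> sph_int 2 (\<lambda>\<omega>. v2 e \<omega> * ln \<bar>v2 e \<omega>\<bar>)) (at_right 2)"
  proof (rule sph_int_tendsto[OF al])
    show "((\<lambda>p. h p \<omega>) \<longlongrightarrow> v2 e \<omega> * ln \<bar>v2 e \<omega>\<bar>) (at_right 2)" if "norm \<omega> = 1" for \<omega>
      unfolding h_def by (rule powr_quotient_tendsto[OF vl[OF that]])
    show "\<forall>\<^sub>F p in at_right 2. sph_continuous (h p) \<and> (\<forall>\<omega>. norm \<omega> = 1 \<longrightarrow> \<bar>h p \<omega>\<bar> \<le> (M + C + 1) ^ 3 + 2)"
      using ev
    proof eventually_elim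
      case (elim p)
      have "\<bar>h p \<omega>\<bar> \<le> (M + C + 1) ^ 3 + 2" if "norm \<omega> = 1" for \<omega>
        unfolding h_def using elim vb[OF elim that] M(1) C(1)
        by (intro powr_quotient_bounded) (auto simp: good_def)
      then show ?case using sch[OF elim] by blast
    qed
  qed (use sph_int_entropy_bound(2)[OF e dim _ scA2, of 1] in auto)
  define c where "c p = lam p * ((p - 1) * lam p + d - p)" for p
  have cl: "(c \<longlongrightarrow> 2 * d) (at_right 2)"
  proof -
    have "(c \<longlongrightarrow> 2 * ((2 - 1) * 2 + d - 2)) (at_right 2)" unfolding c_def[abs_def] by (intro tendsto_intros laml)
    then show ?thesis by simp
  qed
  have id: "c p * sph_int (a p) (v p) + (p - 2) * sph_int (a p) (sph_A (lam p) (v p)) = 0"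
    "(c p - 2 * d) * sph_int (a p) (\<lambda>\<omega>. v p \<omega> * v2 e \<omega>) + (p - 2) * sph_int (a p) (\<lambda>\<omega>. sph_A (lam p) (v p) \<omega> * v2 e \<omega>) = 0" if "good p" for p
    using sph_int_identities[OF e dim gp(1)[OF that] ap[OF that] scA[OF that], of p] B(7)[of p] that
    by (auto simp: c_def d_def good_def)
  have S: "?S > 0" by (rule sph_int_v2_sq_pos[OF e dim]) simp
  have KS: "?K + 2 * ?S > 0" by (rule sph_int_A_v2_bound[OF e dim _ scA2]) simp
  have "\<forall>\<^sub>F p in at_right 2. sph_int (a p) (\<lambda>\<omega>. v p \<omega> * v2 e \<omega>) > 0" using order_tendstoD(1)[OF T3 S] .
  moreover have "\<forall>\<^sub>F p in at_right 2. sph_int (a p) (\<lambda>\<omega>. sph_A (lam p) (v p) \<omega> * v2 e \<omega>) + 2 * sph_int (a p) (\<lambda>\<omega>. v p \<omega> * v2 e \<omega>) > 0"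
    using order_tendstoD(1)[OF tendsto_add[OF T2 tendsto_mult_left[OF T3, of 2]] KS] .
  ultimately have ev1: "\<forall>\<^sub>F p in at_right 2. lam p < 2"
    using ev
  proof eventually_elim
    case (elim p)
    define s where "s = sph_int (a p) (\<lambda>\<omega>. v p \<omega> * v2 e \<omega>)"
    define k where "k = sph_int (a p) (\<lambda>\<omega>. sph_A (lam p) (v p) \<omega> * v2 e \<omega>)"
    have p: "2 < p" "p < 3" "lam p > 0" using elim(3) B(5) by (auto simp: good_def)
    have sk: "s > 0" "k + 2 * s > 0" "(c p - 2 * d) * s + (p - 2) * k = 0"
      using elim(1,2) id(2)[OF elim(3)] by (auto simp: s_def k_def)
    have "(c p - 2 * d) * s = - ((p - 2) * k)" using sk(3) by simp
    also have "\<dots> < 2 * (p - 2) * s"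
      using mult_strict_left_mono[OF sk(2), of "p - 2"] p by (simp add: algebra_simps)
    finally have "c p - 2 * d < 2 * (p - 2)" using sk(1) by simp
    \<comment> \<open>2d + 2(p-2) is the value that c takes at exponent 2, so the difference has the
      factor lam p - 2; the other factor is positive, as p < 3 \<le> d.\<close>
    moreover have "c p - 2 * d - 2 * (p - 2) = (lam p - 2) * ((p - 1) * (lam p + 2) + d - p)"
      by (simp add: c_def algebra_simps)
    ultimately have neg: "(lam p - 2) * ((p - 1) * (lam p + 2) + d - p) < 0" by linarith
    moreover have "(p - 1) * (lam p + 2) + d - p > 0"
      using p d by (intro add_pos_nonneg[of "(p - 1) * (lam p + 2)" "d - p", simplified add_diff_eq]) auto
    ultimately show ?case using mult_nonneg_nonneg[of "lam p - 2" "(p - 1) * (lam p + 2) + d - p"] by linarith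
  qed
  have ent: "sph_int 2 (\<lambda>\<omega>. v2 e \<omega> * ln \<bar>v2 e \<omega>\<bar>) - sph_int 2 (sph_A 2 (v2 e)) / (2 * d) < 0"
    using sph_int_entropy_bound(1)[OF e dim _ scA2, of 2] by (simp add: d_def)
  \<comment> \<open>The first identity replaces the integral of v by - (p-2) / c times that of
    \<open>sph_A\<close>. This expression is therefore the integral of |v|^(p-2) v divided by p -
    2.\<close>
  have "((\<lambda>p. sph_int (a p) (h p) - sph_int (a p) (sph_A (lam p) (v p)) / c p) \<longlongrightarrow>
      sph_int 2 (\<lambda>\<omega>. v2 e \<omega> * ln \<bar>v2 e \<omega>\<bar>) - sph_int 2 (sph_A 2 (v2 e)) / (2 * d)) (at_right 2)"
    using d by (intro tendsto_diff tendsto_divide T1 T4 cl) simp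
  from order_tendstoD(2)[OF this ent]
  have "\<forall>\<^sub>F p in at_right 2. sph_int (a p) (h p) - sph_int (a p) (sph_A (lam p) (v p)) / c p < 0" .
  moreover have "\<forall>\<^sub>F p in at_right 2. c p > 0" by (rule order_tendstoD(1)[OF cl]) (use d in simp)
  ultimately have ev2: "\<forall>\<^sub>F p in at_right 2. sph_int (a p) (\<lambda>\<omega>. \<bar>v p \<omega>\<bar> powr (p - 2) * v p \<omega>) < 0"
    using ev
  proof eventually_elim
    case (elim p)
    have p: "2 < p" using elim(3) by (auto simp: good_def)
    have "sph_int (a p) (\<lambda>\<omega>. \<bar>v p \<omega>\<bar> powr (p - 2) * v p \<omega>) = sph_int (a p) (\<lambda>\<omega>. (p - 2) * h p \<omega> + 1 * v p \<omega>)"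
    proof (rule sph_int_cong[OF ap[OF elim(3)]])
      fix \<omega>
      have "(p - 2) * h p \<omega> = (\<bar>v p \<omega>\<bar> powr (p - 2) - 1) * v p \<omega>" using p by (simp add: h_def)
      then show "\<bar>v p \<omega>\<bar> powr (p - 2) * v p \<omega> = (p - 2) * h p \<omega> + 1 * v p \<omega>" by (simp add: left_diff_distrib)
    qed
    also have "\<dots> = (p - 2) * sph_int (a p) (h p) + 1 * sph_int (a p) (v p)"
      by (rule sph_int_linear[OF sch[OF elim(3)] scv[OF elim(3)] ap[OF elim(3)]])
    also have "sph_int (a p) (v p) = - (p - 2) * (sph_int (a p) (sph_A (lam p) (v p)) / c p)"
    proof -
      have "sph_int (a p) (v p) * c p = - (p - 2) * sph_int (a p) (sph_A (lam p) (v p))"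
        using id(1)[OF elim(3)] by (simp add: algebra_simps)
      then have "sph_int (a p) (v p) = - (p - 2) * sph_int (a p) (sph_A (lam p) (v p)) / c p"
        using elim(2) by (simp add: eq_divide_eq)
      then show ?thesis by simp
    qed
    also have "(p - 2) * sph_int (a p) (h p) + 1 * (- (p - 2) * (sph_int (a p) (sph_A (lam p) (v p)) / c p))
      = (p - 2) * (sph_int (a p) (h p) - sph_int (a p) (sph_A (lam p) (v p)) / c p)"
    proof -
      have "q * x + 1 * (- q * y) = q * (x - y)" for q x y :: real by (simp add: algebra_simps)
      then show ?thesis .
    qed
    also have "\<dots> < 0" using p elim(1) by (intro mult_pos_neg) auto
    finally show ?case .
  qed
  from ev1 ev2 show "\<forall>\<^sub>F p in at_right 2. lam p < 2 \<and>
      sph_int (lam p * (p - 1)) (\<lambda>\<omega>. \<bar>v p \<omega>\<bar> powr (p - 2) * v p \<omega>) < 0"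
    by eventually_elim (simp add: a_def)
qed

section \<open>Blow-up rate, smoothness off the origin and conclusion\<close>

lemma filterlim_neg_powr_at_bot:
  fixes m b :: real
  assumes "m < 0" "b < 2"
  shows "filterlim (\<lambda>\<epsilon>. \<epsilon> powr b * m / \<epsilon>\<^sup>2) at_bot (at_right 0)"
proof -
  have ev: "\<forall>\<^sub>F \<epsilon> in at_right 0. \<epsilon> > (0::real)" by (rule eventually_at_right_less)
  have "((\<lambda>\<epsilon>::real. \<epsilon> powr (2 - b)) \<longlongrightarrow> 0 powr (2 - b)) (at_right 0)"
    using assms(2) by (intro tendsto_powr' tendsto_intros) (auto intro: eventually_mono[OF ev])
  then have "filterlim (\<lambda>\<epsilon>::real. inverse (\<epsilon> powr (2 - b))) at_top (at_right 0)"
    using assms(2) ev by (intro filterlim_inverse_at_top) (auto elim: eventually_mono)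
  from filterlim_tendsto_neg_mult_at_bot[OF tendsto_const assms(1) this]
  have "filterlim (\<lambda>\<epsilon>. m * inverse (\<epsilon> powr (2 - b))) at_bot (at_right 0)" .
  moreover have "\<forall>\<^sub>F \<epsilon> in at_right 0. m * inverse (\<epsilon> powr (2 - b)) = \<epsilon> powr b * m / \<epsilon>\<^sup>2"
    using ev by eventually_elim (simp add: powr_diff field_simps)
  ultimately show ?thesis by (rule filterlim_cong[THEN iffD1, OF refl refl, rotated])
qed

text \<open>A rotation that fixes e also fixes - e, so the smoothness result applies at both poles;
  the complements of the two antipodal rays cover everything but the origin.\<close>

lemma (in sph_C2) Cinf_radial_mult:
  assumes e: "e \<in> Basis" and ax: "axially_symmetric e v"
    and Z: "\<And>x. x \<noteq> 0 \<Longrightarrow> Z lam x \<noteq> 0" and L: "\<And>\<omega>. norm \<omega> = 1 \<Longrightarrow> sph_L p lam v \<omega> = 0" and p: "p > 1"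
    and dim: "DIM('a) \<ge> 2"
  shows "Cinf_on (- {0}) (\<lambda>x. norm x powr lam * v (sgn x))"
  unfolding Cinf_on_def
proof
  fix k
  \<comment> \<open>Any unit vector orthogonal to e would do as the direction of the meridian; a
    second basis vector exists since the dimension is at least 2.\<close>
  obtain b :: 'a where b: "b \<in> Basis" "b \<noteq> e"
  proof -
    have "card (Basis - {e} :: 'a set) \<noteq> 0" using dim e by simp
    then have "(Basis - {e} :: 'a set) \<noteq> {}" by (metis card.empty)
    then show ?thesis using that by blast
  qed
  have nb: "norm e = 1" "norm (- e) = 1" "norm b = 1" "e \<bullet> b = 0" "- e \<bullet> b = 0"
    using b e by (auto simp: inner_not_same_Basis)
  have ax': "axially_symmetric (- e) v"
    using ax unfolding axially_symmetric_def
  proof (intro allI impI ballI)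
    fix R :: "'a \<Rightarrow> 'a" and \<omega> :: 'a
    assume *: "\<forall>R. orthogonal_transformation R \<and> R e = e \<longrightarrow> (\<forall>\<omega>\<in>sphere 0 1. v (R \<omega>) = v \<omega>)"
      and R: "orthogonal_transformation R \<and> R (- e) = - e" and w: "\<omega> \<in> sphere 0 1"
    have "R (- e) = - R e" using R by (intro linear_neg orthogonal_transformation_linear) simp
    then show "v (R \<omega>) = v \<omega>" using * R w by auto
  qed
  have s1: "Ck_on k {x. x \<noteq> 0 \<and> sgn x \<bullet> e > -1} (\<lambda>x. v (sgn x))"
    by (rule smooth_away_from_antipole[OF nb(1,3,4) ax Z L p dim])
  have s2: "Ck_on k {x. x \<noteq> 0 \<and> sgn x \<bullet> (- e) > -1} (\<lambda>x. v (sgn x))"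
    by (rule smooth_away_from_antipole[OF nb(2,3,5) ax' Z L p dim])
  have op: "open {x. x \<noteq> 0 \<and> sgn x \<bullet> e' > -1}" for e' :: 'a
  proof -
    have "open (- {0} \<inter> (\<lambda>x. sgn x \<bullet> e') -` {-1<..})"
      by (intro continuous_open_preimage continuous_intros) auto
    moreover have "{x. x \<noteq> 0 \<and> sgn x \<bullet> e' > -1} = - {0} \<inter> (\<lambda>x. sgn x \<bullet> e') -` {-1<..}" by auto
    ultimately show ?thesis by simp
  qed
  have "{x. x \<noteq> 0 \<and> sgn x \<bullet> e > -1} \<union> {x. x \<noteq> 0 \<and> sgn x \<bullet> (- e) > -1} = - {0}" by auto
  with Ck_on_Un[OF op op s1 s2] have "Ck_on k (- {0}) (\<lambda>x. v (sgn x))" by simp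
  then show "Ck_on k (- {0}) (\<lambda>x. norm x powr lam * v (sgn x))"
    by (intro Ck_on_mult Ck_on_norm_powr) auto
qed

theorem theorem4p1:
  fixes e :: "'a::euclidean_space"
    and \<gamma> \<delta>\<^sub>0 :: real
    and lam :: "real \<Rightarrow> real"
    and g :: "real \<Rightarrow> 'a \<Rightarrow> real"
    and u :: "real \<Rightarrow> 'a \<Rightarrow> real"
  assumes "DIM('a) \<ge> 3"
    and "e \<in> Basis"
    and "0 < \<gamma>" and "\<gamma> < 1"
    and "\<delta>\<^sub>0 > 0"
    and "smooth_branch e \<gamma> \<delta>\<^sub>0 lam g"
    and "\<And>p. u p = branch_fun e lam g p"
  shows "\<exists>\<delta>>0. \<delta> \<le> \<delta>\<^sub>0 \<and> (\<forall>p. 2 < p \<and> p < 2 + \<delta> \<longrightarrow>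
    p_harmonic_on p UNIV (u p) \<and>
    C1_holder_loc_on \<gamma> UNIV (u p) \<and> Cinf_on (- {0}) (u p) \<and>
    u p 0 = 0 \<and> grad (u p) 0 = 0 \<and>
    filterlim (\<lambda>\<epsilon>. (var_mean p \<epsilon> (u p) 0 - u p 0) / \<epsilon>\<^sup>2) at_bot (at_right 0) \<and>
    filterlim (\<lambda>\<epsilon>. var_mean p \<epsilon> (u p) 0 / \<epsilon>\<^sup>2) at_bot (at_right 0))"
proof -
  note dim = assms(1) and e = assms(2) and \<gamma> = assms(3,4) and \<delta>0 = assms(5) and branch = assms(6)
  have ne: "norm e = 1" using e by simp
  define v where "v p \<omega> = v2 e \<omega> + g p \<omega>" for p \<omega>
  note asym = branch_asymptotics[OF ne dim \<delta>0 branch, folded v_def]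
  \<comment> \<open>The gradient has the exponent lam - 1, which tends to 1 and so exceeds the given
    \<gamma> < 1 for p close to 2.\<close>
  have "\<forall>\<^sub>F p in at_right 2. lam p > 1 + \<gamma>" by (rule order_tendstoD(1)[OF asym(1)]) (use \<gamma> in simp)
  with asym(2) have "\<forall>\<^sub>F p in at_right 2. 1 + \<gamma> < lam p \<and> lam p < 2 \<and>
      sph_int (lam p * (p - 1)) (\<lambda>\<omega>. \<bar>v p \<omega>\<bar> powr (p - 2) * v p \<omega>) < 0"
    by eventually_elim simp
  then obtain b where b: "b > 2" "\<And>p. 2 < p \<Longrightarrow> p < b \<Longrightarrow> 1 + \<gamma> < lam p \<and> lam p < 2 \<and>
      sph_int (lam p * (p - 1)) (\<lambda>\<omega>. \<bar>v p \<omega>\<bar> powr (p - 2) * v p \<omega>) < 0"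
    unfolding eventually_at_right_field by blast
  define \<delta> where "\<delta> = min \<delta>\<^sub>0 (b - 2)"
  show ?thesis
  proof (intro exI[of _ \<delta>] conjI allI impI)
    show "\<delta> > 0" "\<delta> \<le> \<delta>\<^sub>0" using b(1) \<delta>0 by (auto simp: \<delta>_def)
    fix p :: real
    assume p: "2 < p \<and> p < 2 + \<delta>"
    have pI: "p \<in> {2 - \<delta>\<^sub>0<..<2 + \<delta>\<^sub>0}" and pb: "2 < p" "p < b" using p \<delta>0 by (auto simp: \<delta>_def)
    have lam: "1 + \<gamma> < lam p" "lam p < 2" "sph_int (lam p * (p - 1)) (\<lambda>\<omega>. \<bar>v p \<omega>\<bar> powr (p - 2) * v p \<omega>) < 0"
      using b(2)[OF pb] by auto
    have B: "nondegenerate (lam p) (v p)" "\<And>\<omega>. norm \<omega> = 1 \<Longrightarrow> sph_L p (lam p) (v p) \<omega> = 0"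
      using branch pI by (auto simp: smooth_branch_def v_def[abs_def] Phi_def)
    have gV: "sph_C2_holder \<gamma> (g p)" "axially_symmetric e (g p)"
      using branch pI unfolding smooth_branch_def smooth_curve_V2_def V2_def by (metis (no_types, lifting) mem_Collect_eq)+
    have "sph_C2 (\<lambda>\<omega>. 1 * v2 e \<omega> + 1 * g p \<omega>)"
      by (rule sph_C2_lincomb(1)[OF zonal_v2(1)[OF ne dim] sph_C2_holderD[OF gV(1)]])
    then have "sph_C2 (v p)" by (simp add: v_def[abs_def])
    then interpret sph_C2 "v p" .
    have ax: "axially_symmetric e (v p)"
      unfolding axially_symmetric_def
    proof (intro allI impI ballI)
      fix R :: "'a \<Rightarrow> 'a" and \<omega> :: 'a
      assume R: "orthogonal_transformation R \<and> R e = e" and w: "\<omega> \<in> sphere 0 1"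
      then have "R \<omega> \<bullet> e = \<omega> \<bullet> e" unfolding orthogonal_transformation_def by metis
      moreover have "g p (R \<omega>) = g p \<omega>" using gV(2) R w unfolding axially_symmetric_def by blast
      ultimately show "v p (R \<omega>) = v p \<omega>" by (simp add: v_def v2_def)
    qed
    have Z: "Z (lam p) x \<noteq> 0" if "x \<noteq> 0" for x
    proof -
      have w: "norm (sgn x) = 1" using that by (simp add: norm_sgn)
      have "0 < (norm (Z (lam p) x))\<^sup>2"
        using B(1) w unfolding norm_Z[OF that] nondegenerate_def by (simp add: W_def)
      then show ?thesis by auto
    qed
    have u: "u p = (\<lambda>x. norm x powr lam p * v p (sgn x))"
      unfolding assms(7) by (simp add: branch_fun_def[abs_def] v_def)
    have l1: "lam p > 1" using lam(1) \<gamma> by simp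
    show "p_harmonic_on p UNIV (u p)"
      unfolding u by (rule p_harmonic_radial_mult) (use l1 pb dim Z B(2) in auto)
    show "C1_holder_loc_on \<gamma> UNIV (u p)"
      unfolding u by (rule C1_holder_radial_mult) (use lam \<gamma> in auto)
    show "Cinf_on (- {0}) (u p)"
      unfolding u by (rule Cinf_radial_mult[OF e ax Z B(2)]) (use pb dim in auto)
    show u0: "u p 0 = 0" by (simp add: u)
    show "grad (u p) 0 = 0" unfolding u grad_radial_mult_all[OF l1] by simp
    obtain M where M: "M > 0" "\<And>x. x \<noteq> 0 \<Longrightarrow> norm (v p (sgn x)) \<le> M" using bounded_v by blast
    obtain m where m: "m < 0" "\<And>\<epsilon>. \<epsilon> > 0 \<Longrightarrow> var_mean p \<epsilon> (u p) 0 = \<epsilon> powr lam p * m"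
    proof (rule var_mean_homogeneous)
      show "p > 2" by (rule pb(1))
      show "u p \<in> borel_measurable borel"
        unfolding u by (rule borel_measurable_sph_continuous[OF sph_continuous_v])
      show "\<bar>u p x\<bar> \<le> M" if "norm x < 1" for x
      proof (cases "x = 0")
        case False
        have "norm x powr lam p \<le> 1" using powr_mono2[of "lam p" "norm x" 1] that l1 by simp
        then have "norm x powr lam p * \<bar>v p (sgn x)\<bar> \<le> 1 * M" using M(2)[OF False] by (intro mult_mono) auto
        then show ?thesis by (simp add: u abs_mult)
      qed (use M(1) u0 in simp)
      show "u p (c *\<^sub>R x) = c powr lam p * u p x" if "c > 0" for c x
        using that by (simp add: u powr_mult sgn_scaleR_pos)
      \<comment> \<open>Homogeneity identifies the integral over the unit ball with the
        \<open>sph_int\<close> whose sign was found along the branch.\<close>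
      have "\<bar>u p x\<bar> powr (p - 2) * u p x = norm x powr (lam p * (p - 1)) * (\<bar>v p (sgn x)\<bar> powr (p - 2) * v p (sgn x))" for x
      proof (cases "x = 0")
        case False
        have "lam p * (p - 1) = lam p * (p - 2) + lam p" by (simp add: algebra_simps)
        then show ?thesis using False by (simp add: u abs_mult powr_mult powr_powr powr_add)
      qed (simp add: u)
      then show "(LINT x:ball 0 1|lborel. \<bar>u p x\<bar> powr (p - 2) * u p x) < 0"
        using lam(3) by (simp add: sph_int_def)
    qed (rule that)
    have "\<forall>\<^sub>F \<epsilon> in at_right 0. \<epsilon> powr lam p * m / \<epsilon>\<^sup>2 = var_mean p \<epsilon> (u p) 0 / \<epsilon>\<^sup>2"
      using eventually_at_right_less[of "0::real"] by eventually_elim (simp add: m(2))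
    then show lim: "filterlim (\<lambda>\<epsilon>. var_mean p \<epsilon> (u p) 0 / \<epsilon>\<^sup>2) at_bot (at_right 0)"
      using filterlim_neg_powr_at_bot[OF m(1) lam(2)] by (rule filterlim_cong[THEN iffD1, OF refl refl])
    then show "filterlim (\<lambda>\<epsilon>. (var_mean p \<epsilon> (u p) 0 - u p 0) / \<epsilon>\<^sup>2) at_bot (at_right 0)"
      by (simp add: u0)
  qed
qed

end
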